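(* Let $Q$ be a quiver of affine type $\tilde{\mathbb A}$. Then $Q$ satisfies the difference property; that is, for every quasi-simple module $E$ in an exceptional tube and every $\lambda\in\mathbb P^1_0$, $$X_{M_E}=X_{M_\lambda}+X_{\mathrm{q.rad}\,M_E/E}.$$
   Context: Let $k=\mathbb C$. A quiver is of affine type $\tilde{\mathbb A}$ if, for some integers $r,s>0$, its underlying diagram is a cycle with $r+s$ edges, $r$ of whose arrows go clockwise and $s$ anticlockwise (for $r=s=1$ this is the Kronecker quiver). Finite-dimensional left $kQ$-modules are identified with representations of $Q=(Q_0,Q_1)$. $\alpha_i$ is the $i$-th canonical basis vector of $\mathbb Z^{Q_0}$, and $\langle-,-\rangle$ is the Euler form on $\mathbb Z^{Q_0}$ ($\langle\mathbf{dim}\, M,\mathbf{dim}\, N\rangle=\dim\mathrm{Hom}_{kQ}(M,N)-\dim\mathrm{Ext}^1_{kQ}(M,N)$). The regular components of the Auslander-Reiten quiver of $kQ$ form a family of tubes $\mathcal T_\lambda$ indexed by $\lambda\in\mathbb P^1(k)$; a tube is homogeneous if it has rank 1 and exceptional otherwise; $\mathbb P^1_0$ is the set of $\lambda$ with $\mathcal T_\lambda$ homogeneous. An indecomposable regular module is quasi-simple if it has no proper nonzero regular submodule; every indecomposable regular module $M$ has a unique chain $0=M_0\subset M_1\subset\dots\subset M_r=M$ of regular submodules with quasi-simple quotients; $r$ is its quasi-length, $M_1$ its quasi-socle, and $M_{r-1}=\mathrm{q.rad}\,M$ its quasi-radical. For $\lambda\in\mathbb P^1_0$, $M_\lambda$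 is the quasi-simple module of $\mathcal T_\lambda$. For a quasi-simple $E$ in an exceptional tube of rank $p>1$, $M_E$ is the unique indecomposable module with quasi-socle $E$ and quasi-length $p$ (equivalently, with quasi-socle $E$ and dimension vector the minimal positive imaginary root $\delta$). Caldero-Chapoton map of a module $M$: $X_M=\sum_{\mathbf e}\chi(\mathrm{Gr}_{\mathbf e}(M))\prod_{i\in Q_0}u_i^{-\langle\mathbf e,\alpha_i\rangle-\langle\alpha_i,\mathbf{dim}\, M-\mathbf e\rangle}\in\mathbb Z[u_i^{\pm1},i\in Q_0]$, where $\mathrm{Gr}_{\mathbf e}(M)$ is the variety of submodules of dimension vector $\mathbf e$ and $\chi$ is the Euler characteristic; in particular $X_0=1$. *)

theory Defs
  imports
    "HOL-Homology.Homology"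
    "HOL-Library.Poly_Mapping"
    "HOL-Library.Function_Algebras"
begin

section \<open>Quivers of affine type A\<close>

text \<open>Vertices and arrows are the elements of the types \<open>'v\<close> and \<open>'a\<close>; both are
  taken of class \<open>finite\<close> wherever this matters.\<close>

record ('v, 'a) quiver =
  src :: "'a \<Rightarrow> 'v"
  tgt :: "'a \<Rightarrow> 'v"

text \<open>The vertices \<open>v 0, \<dots>, v (r + s - 1)\<close> are listed clockwise around the cycle, and the
  \<open>i\<close>-th edge joins \<open>v i\<close> and its clockwise neighbour. As \<open>r + s \<ge> 2\<close>, these two vertices are
  distinct, so an edge is never both clockwise and anticlockwise.\<close>

definition affine_A :: "('v::finite, 'a::finite) quiver \<Rightarrow> bool" where
  "affine_A Q \<longleftrightarrow> (\<exists>r s. r > 0 \<and> s > 0 \<and>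
     (\<exists>v a. bij_betw v {..<r + s} (UNIV :: 'v set) \<and> bij_betw a {..<r + s} (UNIV :: 'a set) \<and>
       (let clockwise = (\<lambda>i. src Q (a i) = v i \<and> tgt Q (a i) = v (Suc i mod (r + s)));
            anticlockwise = (\<lambda>i. src Q (a i) = v (Suc i mod (r + s)) \<and> tgt Q (a i) = v i)
        in (\<forall>i<r + s. clockwise i \<or> anticlockwise i) \<and>
           card {i. i < r + s \<and> clockwise i} = r \<and>
           card {i. i < r + s \<and> anticlockwise i} = s)))"

text \<open>The Euler form of a quiver. By the standard projective resolution of representations,
  \<open>\<langle>dim M, dim N\<rangle> = dim Hom(M, N) - dim Ext\<^sup>1(M, N)\<close>.\<close>

definition euler_form ::
    "('v::finite, 'a::finite) quiver \<Rightarrow> ('v \<Rightarrow> int) \<Rightarrow> ('v \<Rightarrow> int) \<Rightarrow> int" where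
  "euler_form Q x y = (\<Sum>i\<in>UNIV. x i * y i) - (\<Sum>a\<in>UNIV. x (src Q a) * y (tgt Q a))"

definition basis_vec :: "'v \<Rightarrow> 'v \<Rightarrow> int" where
  "basis_vec i j = of_bool (j = i)"


section \<open>Complex vector spaces\<close>

text \<open>All vector spaces live inside the space of complex sequences. Every finite-dimensional
  space has a copy there, and the product topology of \<^typ>\<open>nat \<Rightarrow> complex\<close> induces the usual
  topology on each finite-dimensional subspace.\<close>

type_synonym cvec = "nat \<Rightarrow> complex"

definition cscale :: "complex \<Rightarrow> cvec \<Rightarrow> cvec" where
  "cscale c x = (\<lambda>n. c * x n)"

global_interpretation cv: vector_space cscale
  by unfold_locales (auto simp: cscale_def fun_eq_iff algebra_simps)

definition fd_space :: "cvec set \<Rightarrow> bool" where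
  "fd_space V \<longleftrightarrow> (\<exists>B. finite B \<and> V = cv.span B)"

definition linear_from_to :: "cvec set \<Rightarrow> cvec set \<Rightarrow> (cvec \<Rightarrow> cvec) \<Rightarrow> bool" where
  "linear_from_to V W f \<longleftrightarrow>
     (\<forall>x\<in>V. f x \<in> W) \<and>
     (\<forall>x\<in>V. \<forall>y\<in>V. f (x + y) = f x + f y) \<and>
     (\<forall>c. \<forall>x\<in>V. f (cscale c x) = cscale c (f x))"


section \<open>Representations\<close>

text \<open>The values of \<open>act M a\<close> outside \<open>spc M (src Q a)\<close> carry no information; likewise for
  morphisms. Representations are therefore only ever compared up to isomorphism.\<close>

record ('v, 'a) quiver_rep =
  spc :: "'v \<Rightarrow> cvec set"
  act :: "'a \<Rightarrow> cvec \<Rightarrow> cvec"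

definition is_rep :: "('v, 'a) quiver \<Rightarrow> ('v, 'a) quiver_rep \<Rightarrow> bool" where
  "is_rep Q M \<longleftrightarrow>
     (\<forall>v. fd_space (spc M v)) \<and>
     (\<forall>a. linear_from_to (spc M (src Q a)) (spc M (tgt Q a)) (act M a))"

definition dim_vec :: "('v, 'a) quiver_rep \<Rightarrow> 'v \<Rightarrow> nat" where
  "dim_vec M v = cv.dim (spc M v)"

definition rep_hom ::
    "('v, 'a) quiver \<Rightarrow> ('v, 'a) quiver_rep \<Rightarrow> ('v, 'a) quiver_rep \<Rightarrow>
     ('v \<Rightarrow> cvec \<Rightarrow> cvec) \<Rightarrow> bool" where
  "rep_hom Q M N f \<longleftrightarrow>
     (\<forall>v. linear_from_to (spc M v) (spc N v) (f v)) \<and>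
     (\<forall>a. \<forall>x\<in>spc M (src Q a). f (tgt Q a) (act M a x) = act N a (f (src Q a) x))"

definition rep_inj :: "('v, 'a) quiver_rep \<Rightarrow> ('v \<Rightarrow> cvec \<Rightarrow> cvec) \<Rightarrow> bool" where
  "rep_inj M f \<longleftrightarrow> (\<forall>v. inj_on (f v) (spc M v))"

definition rep_surj ::
    "('v, 'a) quiver_rep \<Rightarrow> ('v, 'a) quiver_rep \<Rightarrow> ('v \<Rightarrow> cvec \<Rightarrow> cvec) \<Rightarrow> bool" where
  "rep_surj M N f \<longleftrightarrow> (\<forall>v. f v ` spc M v = spc N v)"

definition rep_iso ::
    "('v, 'a) quiver \<Rightarrow> ('v, 'a) quiver_rep \<Rightarrow> ('v, 'a) quiver_rep \<Rightarrow> bool" where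
  "rep_iso Q M N \<longleftrightarrow> (\<exists>f. rep_hom Q M N f \<and> rep_inj M f \<and> rep_surj M N f)"

text \<open>\<open>agree M f g\<close>: the families \<open>f\<close> and \<open>g\<close> define the same map on \<open>M\<close>.\<close>

definition agree ::
    "('v, 'a) quiver_rep \<Rightarrow> ('v \<Rightarrow> cvec \<Rightarrow> cvec) \<Rightarrow> ('v \<Rightarrow> cvec \<Rightarrow> cvec) \<Rightarrow> bool" where
  "agree M f g \<longleftrightarrow> (\<forall>v. \<forall>x\<in>spc M v. f v x = g v x)"

definition comp_fam ::
    "('v \<Rightarrow> cvec \<Rightarrow> cvec) \<Rightarrow> ('v \<Rightarrow> cvec \<Rightarrow> cvec) \<Rightarrow> 'v \<Rightarrow> cvec \<Rightarrow> cvec" where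
  "comp_fam g f = (\<lambda>v. g v \<circ> f v)"

definition submodule ::
    "('v, 'a) quiver \<Rightarrow> ('v, 'a) quiver_rep \<Rightarrow> ('v \<Rightarrow> cvec set) \<Rightarrow> bool" where
  "submodule Q M U \<longleftrightarrow>
     (\<forall>v. cv.subspace (U v) \<and> U v \<subseteq> spc M v) \<and>
     (\<forall>a. act M a ` U (src Q a) \<subseteq> U (tgt Q a))"

definition subrep :: "('v, 'a) quiver_rep \<Rightarrow> ('v \<Rightarrow> cvec set) \<Rightarrow> ('v, 'a) quiver_rep" where
  "subrep M U = M\<lparr>spc := U\<rparr>"

definition zero_fam :: "'v \<Rightarrow> cvec set" where
  "zero_fam v = {0}"

text \<open>\<open>N\<close> is a copy of the quotient \<open>M / U\<close>.\<close>

definition is_quotient ::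
    "('v, 'a) quiver \<Rightarrow> ('v, 'a) quiver_rep \<Rightarrow> ('v \<Rightarrow> cvec set) \<Rightarrow> ('v, 'a) quiver_rep \<Rightarrow> bool"
  where
  "is_quotient Q M U N \<longleftrightarrow> is_rep Q N \<and> submodule Q M U \<and>
     (\<exists>f. rep_hom Q M N f \<and> rep_surj M N f \<and> (\<forall>v. {x \<in> spc M v. f v x = 0} = U v))"

definition complementary ::
    "('v, 'a) quiver_rep \<Rightarrow> ('v \<Rightarrow> cvec set) \<Rightarrow> ('v \<Rightarrow> cvec set) \<Rightarrow> bool" where
  "complementary M U W \<longleftrightarrow>
     (\<forall>v. {x + y | x y. x \<in> U v \<and> y \<in> W v} = spc M v \<and> U v \<inter> W v = {0})"

definition direct_summand ::
    "('v, 'a) quiver \<Rightarrow> ('v, 'a) quiver_rep \<Rightarrow> ('v \<Rightarrow> cvec set) \<Rightarrow> bool" where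
  "direct_summand Q M U \<longleftrightarrow> submodule Q M U \<and> (\<exists>W. submodule Q M W \<and> complementary M U W)"

definition indecomposable :: "('v, 'a) quiver \<Rightarrow> ('v, 'a) quiver_rep \<Rightarrow> bool" where
  "indecomposable Q M \<longleftrightarrow> is_rep Q M \<and> spc M \<noteq> zero_fam \<and>
     (\<forall>U W. submodule Q M U \<and> submodule Q M W \<and> complementary M U W \<longrightarrow>
        U = zero_fam \<or> W = zero_fam)"

definition projective :: "('v, 'a) quiver \<Rightarrow> ('v, 'a) quiver_rep \<Rightarrow> bool" where
  "projective Q P \<longleftrightarrow> is_rep Q P \<and>
     (\<forall>M N f g. is_rep Q M \<and> is_rep Q N \<and> rep_hom Q M N f \<and> rep_surj M N f \<and> rep_hom Q P N g \<longrightarrow>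
        (\<exists>h. rep_hom Q P M h \<and> agree P (comp_fam f h) g))"

definition injective :: "('v, 'a) quiver \<Rightarrow> ('v, 'a) quiver_rep \<Rightarrow> bool" where
  "injective Q I \<longleftrightarrow> is_rep Q I \<and>
     (\<forall>M N f g. is_rep Q M \<and> is_rep Q N \<and> rep_hom Q N M f \<and> rep_inj N f \<and> rep_hom Q N I g \<longrightarrow>
        (\<exists>h. rep_hom Q M I h \<and> agree N (comp_fam h f) g))"


section \<open>The Auslander--Reiten quiver\<close>

definition split_mono ::
    "('v, 'a) quiver \<Rightarrow> ('v, 'a) quiver_rep \<Rightarrow> ('v, 'a) quiver_rep \<Rightarrow>
     ('v \<Rightarrow> cvec \<Rightarrow> cvec) \<Rightarrow> bool" where
  "split_mono Q M N f \<longleftrightarrow> rep_hom Q M N f \<and>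
     (\<exists>g. rep_hom Q N M g \<and> agree M (comp_fam g f) (\<lambda>v. id))"

definition split_epi ::
    "('v, 'a) quiver \<Rightarrow> ('v, 'a) quiver_rep \<Rightarrow> ('v, 'a) quiver_rep \<Rightarrow>
     ('v \<Rightarrow> cvec \<Rightarrow> cvec) \<Rightarrow> bool" where
  "split_epi Q M N f \<longleftrightarrow> rep_hom Q M N f \<and>
     (\<exists>g. rep_hom Q N M g \<and> agree N (comp_fam f g) (\<lambda>v. id))"

definition irreducible_hom ::
    "('v, 'a) quiver \<Rightarrow> ('v, 'a) quiver_rep \<Rightarrow> ('v, 'a) quiver_rep \<Rightarrow>
     ('v \<Rightarrow> cvec \<Rightarrow> cvec) \<Rightarrow> bool" where
  "irreducible_hom Q M N f \<longleftrightarrow>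
     rep_hom Q M N f \<and> \<not> split_mono Q M N f \<and> \<not> split_epi Q M N f \<and>
     (\<forall>Z g h. is_rep Q Z \<and> rep_hom Q M Z h \<and> rep_hom Q Z N g \<and> agree M (comp_fam g h) f \<longrightarrow>
        split_mono Q M Z h \<or> split_epi Q Z N g)"

definition ar_arrow ::
    "('v, 'a) quiver \<Rightarrow> ('v, 'a) quiver_rep \<Rightarrow> ('v, 'a) quiver_rep \<Rightarrow> bool" where
  "ar_arrow Q M N \<longleftrightarrow> indecomposable Q M \<and> indecomposable Q N \<and> (\<exists>f. irreducible_hom Q M N f)"

text \<open>\<open>0 \<longrightarrow> L \<longrightarrow> B \<longrightarrow> N \<longrightarrow> 0\<close> is exact, its first map is left almost split and its second map is
  right almost split.\<close>

definition almost_split_seq ::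
    "('v, 'a) quiver \<Rightarrow> ('v, 'a) quiver_rep \<Rightarrow> ('v, 'a) quiver_rep \<Rightarrow> ('v, 'a) quiver_rep \<Rightarrow>
     ('v \<Rightarrow> cvec \<Rightarrow> cvec) \<Rightarrow> ('v \<Rightarrow> cvec \<Rightarrow> cvec) \<Rightarrow> bool" where
  "almost_split_seq Q L B N f g \<longleftrightarrow>
     is_rep Q L \<and> is_rep Q B \<and> is_rep Q N \<and>
     rep_hom Q L B f \<and> rep_inj L f \<and> rep_hom Q B N g \<and> rep_surj B N g \<and>
     (\<forall>v. f v ` spc L v = {x \<in> spc B v. g v x = 0}) \<and>
     \<not> split_mono Q L B f \<and>
     (\<forall>Y h. is_rep Q Y \<and> rep_hom Q L Y h \<and> \<not> split_mono Q L Y h \<longrightarrow>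
        (\<exists>k. rep_hom Q B Y k \<and> agree L (comp_fam k f) h)) \<and>
     \<not> split_epi Q B N g \<and>
     (\<forall>Y h. is_rep Q Y \<and> rep_hom Q Y N h \<and> \<not> split_epi Q Y N h \<longrightarrow>
        (\<exists>k. rep_hom Q Y B k \<and> agree Y (comp_fam g k) h))"

text \<open>\<open>L\<close> is a copy of the Auslander--Reiten translate \<open>\<tau>N\<close>.\<close>

definition ar_translate ::
    "('v, 'a) quiver \<Rightarrow> ('v, 'a) quiver_rep \<Rightarrow> ('v, 'a) quiver_rep \<Rightarrow> bool" where
  "ar_translate Q N L \<longleftrightarrow> indecomposable Q L \<and> indecomposable Q N \<and>
     (\<exists>B f g. almost_split_seq Q L B N f g)"

text \<open>The vertices of the Auslander--Reiten quiver are isomorphism classes of indecomposables.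
  A component is represented by the set of all indecomposables whose class lies in it.\<close>

definition ar_component ::
    "('v, 'a) quiver \<Rightarrow> ('v, 'a) quiver_rep \<Rightarrow> ('v, 'a) quiver_rep set" where
  "ar_component Q M = {N. (M, N) \<in> {(X, Y). indecomposable Q X \<and> indecomposable Q Y \<and>
     (rep_iso Q X Y \<or> ar_arrow Q X Y \<or> ar_arrow Q Y X)}\<^sup>*}"

definition regular_component ::
    "('v, 'a) quiver \<Rightarrow> ('v, 'a) quiver_rep set \<Rightarrow> bool" where
  "regular_component Q T \<longleftrightarrow>
     (\<exists>M. indecomposable Q M \<and> T = ar_component Q M) \<and>
     (\<forall>N\<in>T. \<not> projective Q N \<and> \<not> injective Q N)"

text \<open>A tube of rank \<open>p\<close> is a regular component isomorphic to \<open>\<int>A\<^sub>\<infinity>/(\<tau>\<^sup>p)\<close> as a translation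
  quiver. The vertices of \<open>\<int>A\<^sub>\<infinity>\<close> are the pairs \<open>(i, j)\<close> with \<open>i \<in> \<int>\<close>, \<open>j \<in> \<nat>\<close>, its arrows are
  \<open>(i, j) \<longrightarrow> (i, j + 1)\<close> and \<open>(i, j + 1) \<longrightarrow> (i + 1, j)\<close>, and \<open>\<tau>(i, j) = (i - 1, j)\<close>.
  Arrows of the Auslander--Reiten quiver are taken without multiplicity.\<close>

definition tube :: "('v, 'a) quiver \<Rightarrow> nat \<Rightarrow> ('v, 'a) quiver_rep set \<Rightarrow> bool" where
  "tube Q p T \<longleftrightarrow> regular_component Q T \<and> p > 0 \<and>
     (\<exists>R :: int \<Rightarrow> nat \<Rightarrow> ('v, 'a) quiver_rep.
        (\<forall>i j. R i j \<in> T) \<and> (\<forall>M\<in>T. \<exists>i j. rep_iso Q M (R i j)) \<and>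
        (\<forall>i j i' j'. rep_iso Q (R i j) (R i' j') \<longleftrightarrow> i mod int p = i' mod int p \<and> j = j') \<and>
        (\<forall>i j i' j'. ar_arrow Q (R i j) (R i' j') \<longleftrightarrow>
           i' mod int p = i mod int p \<and> j' = Suc j \<or>
           i' mod int p = (i + 1) mod int p \<and> j = Suc j') \<and>
        (\<forall>i j. ar_translate Q (R i j) (R (i - 1) j)))"

definition homogeneous_tube :: "('v, 'a) quiver \<Rightarrow> ('v, 'a) quiver_rep set \<Rightarrow> bool" where
  "homogeneous_tube Q T \<longleftrightarrow> tube Q 1 T"


section \<open>Regular modules\<close>

definition regular_module :: "('v, 'a) quiver \<Rightarrow> ('v, 'a) quiver_rep \<Rightarrow> bool" where
  "regular_module Q M \<longleftrightarrow> is_rep Q M \<and>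
     (\<forall>U. direct_summand Q M U \<and> indecomposable Q (subrep M U) \<longrightarrow>
        regular_component Q (ar_component Q (subrep M U)))"

definition regular_submodule ::
    "('v, 'a) quiver \<Rightarrow> ('v, 'a) quiver_rep \<Rightarrow> ('v \<Rightarrow> cvec set) \<Rightarrow> bool" where
  "regular_submodule Q M U \<longleftrightarrow> submodule Q M U \<and> regular_module Q (subrep M U)"

definition quasi_simple :: "('v, 'a) quiver \<Rightarrow> ('v, 'a) quiver_rep \<Rightarrow> bool" where
  "quasi_simple Q M \<longleftrightarrow> indecomposable Q M \<and> regular_module Q M \<and>
     (\<forall>U. regular_submodule Q M U \<longrightarrow> U = zero_fam \<or> U = spc M)"

text \<open>\<open>C 0 \<subset> C 1 \<subset> \<dots> \<subset> C r\<close> is the chain of regular submodules of \<open>M\<close> with quasi-simple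
  quotients. Then \<open>r\<close> is the quasi-length of \<open>M\<close>, \<open>C 1\<close> its quasi-socle and \<open>C (r - 1)\<close> its
  quasi-radical. Only the values \<open>C 0, \<dots>, C r\<close> are relevant.\<close>

definition quasi_chain ::
    "('v, 'a) quiver \<Rightarrow> ('v, 'a) quiver_rep \<Rightarrow> nat \<Rightarrow> (nat \<Rightarrow> 'v \<Rightarrow> cvec set) \<Rightarrow> bool" where
  "quasi_chain Q M r C \<longleftrightarrow>
     C 0 = zero_fam \<and> C r = spc M \<and>
     (\<forall>i\<le>r. regular_submodule Q M (C i)) \<and>
     (\<forall>i<r. C i < C (Suc i) \<and>
        (\<exists>S. is_quotient Q (subrep M (C (Suc i))) (C i) S \<and> quasi_simple Q S))"

text \<open>\<open>M\<close> is a copy of \<open>M\<^sub>E\<close>, for \<open>E\<close> in a tube of rank \<open>p\<close>, and \<open>C\<close> is its chain.\<close>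

definition is_M_E ::
    "('v, 'a) quiver \<Rightarrow> ('v, 'a) quiver_rep \<Rightarrow> nat \<Rightarrow> ('v, 'a) quiver_rep \<Rightarrow>
     (nat \<Rightarrow> 'v \<Rightarrow> cvec set) \<Rightarrow> bool" where
  "is_M_E Q E p M C \<longleftrightarrow> indecomposable Q M \<and> regular_module Q M \<and>
     quasi_chain Q M p C \<and> rep_iso Q (subrep M (C 1)) E"


section \<open>Euler characteristic\<close>

text \<open>The rank of an abelian group, written multiplicatively: the largest number of elements
  that are linearly independent over the integers. It is meaningful only if finite.\<close>

definition group_rank :: "('g, 'b) monoid_scheme \<Rightarrow> nat" where
  "group_rank G = Sup {card B | B. finite B \<and> B \<subseteq> carrier G \<and>
     (\<forall>c :: 'g \<Rightarrow> int. finprod G (\<lambda>b. b [^]\<^bsub>G\<^esub> c b) B = \<one>\<^bsub>G\<^esub> \<longrightarrow> (\<forall>b\<in>B. c b = 0))}"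

definition betti :: "nat \<Rightarrow> 'b topology \<Rightarrow> nat" where
  "betti n X = group_rank (homology_group (int n) X)"

definition euler_char :: "'b topology \<Rightarrow> int" where
  "euler_char X = (\<Sum>n | betti n X \<noteq> 0. (- 1) ^ n * int (betti n X))"


section \<open>Quiver Grassmannians\<close>

text \<open>The space of \<open>n\<close>-frames in \<open>V\<close>, as functions on \<open>{..<n}\<close>, and its quotient, the
  Grassmannian of \<open>n\<close>-dimensional subspaces of \<open>V\<close>, with the analytic topology.\<close>

definition frames :: "nat \<Rightarrow> cvec set \<Rightarrow> (nat \<Rightarrow> cvec) topology" where
  "frames n V = subtopology (product_topology (\<lambda>_. top_of_set V) {..<n})
     {b. cv.dim (b ` {..<n}) = n}"

definition frame_span :: "nat \<Rightarrow> (nat \<Rightarrow> cvec) \<Rightarrow> cvec set" where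
  "frame_span n b = cv.span (b ` {..<n})"

definition grassmannian :: "nat \<Rightarrow> cvec set \<Rightarrow> cvec set topology" where
  "grassmannian n V = topology (\<lambda>W. W \<subseteq> frame_span n ` topspace (frames n V) \<and>
     openin (frames n V) {b \<in> topspace (frames n V). frame_span n b \<in> W})"

lemma openin_grassmannian:
  "openin (grassmannian n V) W \<longleftrightarrow> W \<subseteq> frame_span n ` topspace (frames n V) \<and>
     openin (frames n V) {b \<in> topspace (frames n V). frame_span n b \<in> W}"
proof -
  let ?X = "frames n V" and ?q = "frame_span n"
  let ?pre = "\<lambda>W. {b \<in> topspace ?X. ?q b \<in> W}"
  have "istopology (\<lambda>W. W \<subseteq> ?q ` topspace ?X \<and> openin ?X (?pre W))"
    unfolding istopology_def
  proof (intro conjI allI impI)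
    fix S T
    assume S: "S \<subseteq> ?q ` topspace ?X \<and> openin ?X (?pre S)"
      and T: "T \<subseteq> ?q ` topspace ?X \<and> openin ?X (?pre T)"
    show "S \<inter> T \<subseteq> ?q ` topspace ?X" using S by blast
    have "?pre (S \<inter> T) = ?pre S \<inter> ?pre T" by blast
    then show "openin ?X (?pre (S \<inter> T))" using S T by (simp add: openin_Int)
  next
    fix \<K>
    assume K: "\<forall>K\<in>\<K>. K \<subseteq> ?q ` topspace ?X \<and> openin ?X (?pre K)"
    then show "\<Union> \<K> \<subseteq> ?q ` topspace ?X" by blast
    have "?pre (\<Union> \<K>) = \<Union> (?pre ` \<K>)" by blast
    then show "openin ?X (?pre (\<Union> \<K>))" using K by (metis (no_types, lifting) imageE openin_Union)
  qed
  then show ?thesis by (simp add: grassmannian_def topology_inverse')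
qed

lemma quotient_map_frame_span:
  "quotient_map (frames n V) (grassmannian n V) (frame_span n)"
proof -
  have "{b \<in> topspace (frames n V). frame_span n b \<in> frame_span n ` topspace (frames n V)}
      = topspace (frames n V)" by blast
  then have "openin (grassmannian n V) (frame_span n ` topspace (frames n V))"
    by (simp add: openin_grassmannian)
  then have "topspace (grassmannian n V) = frame_span n ` topspace (frames n V)"
    by (meson openin_grassmannian openin_subset openin_topspace subset_antisym)
  then show ?thesis by (simp add: quotient_map_def openin_grassmannian)
qed

definition quiver_grassmannian ::
    "('v, 'a) quiver \<Rightarrow> ('v \<Rightarrow> nat) \<Rightarrow> ('v, 'a) quiver_rep \<Rightarrow> ('v \<Rightarrow> cvec set) topology" where
  "quiver_grassmannian Q e M =
     subtopology (product_topology (\<lambda>v. grassmannian (e v) (spc M v)) UNIV)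
       {U. submodule Q M U}"


section \<open>The Caldero--Chapoton map\<close>

text \<open>Laurent polynomials in the variables \<open>u\<^sub>i\<close> with integer coefficients form the group ring of
  the group of exponents \<^typ>\<open>'v \<Rightarrow>\<^sub>0 int\<close>, whose product is the convolution of
  \<^typ>\<open>('v \<Rightarrow>\<^sub>0 int) \<Rightarrow>\<^sub>0 int\<close>. The element below is \<open>u\<^sub>i\<^sup>k\<close>.\<close>

type_synonym 'v laurent = "('v \<Rightarrow>\<^sub>0 int) \<Rightarrow>\<^sub>0 int"

definition u_pow :: "'v \<Rightarrow> int \<Rightarrow> 'v laurent" where
  "u_pow i k = Poly_Mapping.single (Poly_Mapping.single i k) 1"

text \<open>The sum ranges over the \<open>e\<close> with \<open>e \<le> dim_vec M\<close>; for all others the Grassmannian is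
  empty.\<close>

definition CC :: "('v::finite, 'a::finite) quiver \<Rightarrow> ('v, 'a) quiver_rep \<Rightarrow> 'v laurent" where
  "CC Q M = (\<Sum>e | \<forall>v. e v \<le> dim_vec M v.
     of_int (euler_char (quiver_grassmannian Q e M)) *
     (\<Prod>i\<in>UNIV. u_pow i
        (- euler_form Q (\<lambda>v. int (e v)) (basis_vec i)
         - euler_form Q (basis_vec i) (\<lambda>v. int (dim_vec M v) - int (e v)))))"


section \<open>The difference property\<close>

text \<open>\<open>E\<close> is a quasi-simple module in the exceptional tube \<open>T\<close> of rank \<open>p\<close>, \<open>M\<close> is \<open>M\<^sub>E\<close>, \<open>N\<close> is
  \<open>q.rad M\<^sub>E / E\<close>, and \<open>L\<close> is the quasi-simple module \<open>M\<^sub>\<lambda>\<close> of the homogeneous tube \<open>H\<close>.\<close>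

definition difference_property :: "('v::finite, 'a::finite) quiver \<Rightarrow> bool" where
  "difference_property Q \<longleftrightarrow>
     (\<forall>T p E M C N H L.
        tube Q p T \<and> p > 1 \<and> E \<in> T \<and> quasi_simple Q E \<and>
        is_M_E Q E p M C \<and> is_quotient Q (subrep M (C (p - 1))) (C 1) N \<and>
        homogeneous_tube Q H \<and> L \<in> H \<and> quasi_simple Q L \<longrightarrow>
        CC Q M = CC Q L + CC Q N)"

end

(* The arrows are read along the universal cover of the cycle, so that a representation comes with
"compatible sequences": families of vectors, indexed by the integers, that are matched by the arrows.
By the duality for Ext, an almost split sequence 0 -> L -> B -> N -> 0 yields maps from L at the target
of an arrow to N at its source, which turn a compatible sequence of finite support in L into one of
smaller support in N. As an almost split sequence starts at every indecomposable that is not injective,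
a representation in a regular component has no nonzero compatible sequence of finite support, and a
member of a tube has no dual one either.

Let M be such an indecomposable and suppose that a clockwise arrow kills a nonzero vector. Take a
longest chain of vectors, matched by the arrows, that ends in a killed vector. Functionals that vanish on
the ends of longer chains give an endomorphism of M with image in the span of the chain. It is not
nilpotent, so it is an isomorphism by Fitting's lemma, and M is a string cut at clockwise arrows. The
members of a tube are therefore strings of this kind, or strings cut at anticlockwise arrows, or
representations all of whose arrows act bijectively; in the last case L and N are isomorphic and the tube
has rank one. The quasi-simple members of a tube of strings are its blocks, the pieces between
consecutive cuts, and the translation permutes them cyclically. It follows that M_E is one-dimensional at
every vertex and that exactly one arrow vanishes on it, that E is the last block of M_E and that
M_E / q.rad M_E is the first one. The module M_lambda is one-dimensional at every vertex, and its
submodules are supported on the sets of vertices that are closed under all arrows.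

The quiver Grassmannians of these representations are points or empty, so X is a sum over the sets of
vertices that are closed under the arrows that do not vanish. For M_E, such a set is closed under all
arrows, or it contains the last block and avoids the first one. Removing the last block matches the
latter sets with those of q.rad M_E / E. The exponents agree because <f, alpha_i> + <alpha_i, f'> = 0 for
the dimension vectors f of the last block and f' of the first one. *)

theory Submission
imports Defs "HOL-Computational_Algebra.Fundamental_Theorem_Algebra"
begin

text \<open>\<open>M_E\<close> and the quotients of its chain are known only to lie in components
  without projectives and injectives, not in tubes, so no almost split sequences come with them;
  they have to be constructed. A non-split extension of \<open>X\<close> by \<open>L\<close> stays
  non-split on a submodule of \<open>X\<close> of bounded dimension, so by the Harada-Sai argument
  it cannot be pulled back along radical maps for ever; where this stops, the class is annihilated
  by the radical. The translation is never computed as a functor. A functional on Ext that does not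
  vanish on a class is a trace form whose matrices satisfy the preprojective relations, a concrete
  form of D Ext(N, L) = Hom(L, tau N). Along the universal cover the relations say that two formulas
  for the same vector agree, and each application loses one position at both ends of the support.
  Reversing the cycle exchanges the two kinds of tubes of strings. The third kind, with bijective
  arrows, is controlled by eigenvectors of the monodromy around the cycle; there the fundamental
  theorem of algebra enters.\<close>

section \<open>Linear algebra\<close>

declare plus_fun_apply [simp del] zero_fun_apply [simp del]

abbreviation clinear :: "(cvec => cvec) => bool" where
 "clinear == Vector_Spaces.linear cscale cscale"

abbreviation cfunctional :: "(cvec => complex) => bool" where
 "cfunctional == Vector_Spaces.linear cscale (*)"

global_interpretation cvp: vector_space_pair cscale cscale
 by unfold_locales

global_interpretation cvf: vector_space_pair cscale "(*) :: complex => complex => complex"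
 by (simp add: vector_space_pair_def vector_space_over_itself.vector_space_axioms cv.vector_space_axioms)

lemma clinear_iff: "clinear f \<longleftrightarrow> (ALL x y. f (x + y) = f x + f y) & (ALL c x. f (cscale c x) = cscale c (f x))"
 using cv.vector_space_axioms unfolding Vector_Spaces.linear_iff by blast

lemma cfunctional_iff: "cfunctional f \<longleftrightarrow> (ALL x y. f (x + y) = f x + f y) & (ALL c x. f (cscale c x) = c * f x)"
 using cv.vector_space_axioms vector_space_over_itself.vector_space_axioms
 unfolding Vector_Spaces.linear_iff by blast

lemma cfunctional_0: "cfunctional f ==> f 0 = 0"
 by (metis cfunctional_iff mult_zero_left cv.scale_zero_left)

lemma cfunctional_diff: "cfunctional f ==> f (x - y) = f x - f y"
 by (metis cfunctional_iff add_diff_cancel diff_add_cancel)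

lemma cfunctional_sum: "cfunctional f ==> f (sum g A) = (SUM i:A. f (g i))"
 by (induction A rule: infinite_finite_induct) (auto simp: cfunctional_0 cfunctional_iff)

lemma clinear_0: "clinear f ==> f 0 = 0"
 by (metis clinear_iff cv.scale_zero_left)

lemma clinear_diff: "clinear f ==> f (x - y) = f x - f y"
 by (metis clinear_iff add_diff_cancel diff_add_cancel)

lemma clinear_comp: "clinear f ==> clinear g ==> clinear (%x. g (f x))"
 by (simp add: clinear_iff)

lemma cfunctional_comp: "clinear f ==> cfunctional g ==> cfunctional (%x. g (f x))"
 by (simp add: clinear_iff cfunctional_iff)

lemma clinear_imp_linear_from_to: "clinear f ==> (!!x. x : V ==> f x : W) ==> linear_from_to V W f"
 by (simp add: linear_from_to_def clinear_iff)

lemma linear_from_toI: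
 "(!!x. x : V ==> f x : W) ==> (!!x y. x : V ==> y : V ==> f (x + y) = f x + f y) ==>
  (!!c x. x : V ==> f (cscale c x) = cscale c (f x)) ==> linear_from_to V W f"
 by (simp add: linear_from_to_def)

lemma
 assumes "linear_from_to V W f"
 shows lft_mem: "x : V ==> f x : W"
  and lft_add: "x : V ==> y : V ==> f (x + y) = f x + f y"
  and lft_scale: "x : V ==> f (cscale c x) = cscale c (f x)"
 using assms by (auto simp: linear_from_to_def)

lemma lft_zero: "linear_from_to V W f ==> cv.subspace V ==> f 0 = 0"
 by (metis cv.scale_zero_left cv.subspace_0 lft_scale)

lemma lft_neg: "linear_from_to V W f ==> x : V ==> f (- x) = - f x"
 using lft_scale[of V W f x "-1"] by simp

lemma lft_diff: "linear_from_to V W f ==> cv.subspace V ==> x : V ==> y : V ==> f (x - y) = f x - f y"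
 using lft_add[of V W f x "- y"] lft_neg[of V W f y] by (simp add: cv.subspace_neg)

lemma lft_sum: "linear_from_to V W f ==> cv.subspace V ==> (!!i. i : A ==> g i : V) ==>
  f (sum g A) = (SUM i:A. f (g i))"
 by (induction A rule: infinite_finite_induct) (auto simp: lft_zero lft_add cv.subspace_sum)

lemma lft_comp: "linear_from_to U V f ==> linear_from_to V W g ==> linear_from_to U W (%x. g (f x))"
 by (simp add: linear_from_to_def)

lemma lft_subset: "linear_from_to V W f ==> U <= V ==> linear_from_to U W f"
 unfolding linear_from_to_def by blast

lemma lft_funpow: "linear_from_to V V f ==> linear_from_to V V (f ^^ k)"
 by (induction k) (auto simp: linear_from_to_def)

lemma lft_image_subspace:
 assumes "linear_from_to V W f" "cv.subspace V"
 shows "cv.subspace (f ` V)"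
proof (rule cv.subspaceI)
 show "0 : f ` V" using lft_zero[OF assms] cv.subspace_0[OF assms(2)] by (metis image_eqI)
 show "x + y : f ` V" if "x : f ` V" "y : f ` V" for x y
  using that lft_add[OF assms(1)] cv.subspace_add[OF assms(2)] by (smt (verit) image_iff)
 show "cscale c x : f ` V" if "x : f ` V" for c x
  using that lft_scale[OF assms(1)] cv.subspace_scale[OF assms(2)] by (smt (verit) image_iff)
qed

lemma lft_kernel_subspace:
 "linear_from_to V W f ==> cv.subspace V ==> cv.subspace U ==> cv.subspace {x : V. f x : U}"
 by (rule cv.subspaceI) (simp_all add: cv.subspace_0 cv.subspace_add cv.subspace_scale lft_zero[of V W f]
   lft_add[of V W f] lft_scale[of V W f])

lemma lft_inj_on_iff:
 assumes f: "linear_from_to V W f" and V: "cv.subspace V"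
 shows "inj_on f V \<longleftrightarrow> (ALL x:V. f x = 0 --> x = 0)"
proof (intro iffI ballI impI inj_onI)
 fix x assume "inj_on f V" "x : V" "f x = 0"
 thus "x = 0" using lft_zero[OF f V] cv.subspace_0[OF V] by (simp add: inj_on_def)
next
 fix x y assume z: "ALL x:V. f x = 0 --> x = 0" and xy: "x : V" "y : V" "f x = f y"
 have "f (x - y) = 0" using lft_diff[OF f V xy(1,2)] xy(3) by simp
 hence "x - y = 0" using z cv.subspace_diff[OF V xy(1,2)] by blast
 thus "x = y" by simp
qed

text \<open>Homomorphisms are constrained only on their domain spaces. A range spanned by the values
  on a basis keeps the extension inside \<open>W\<close>, so sections, retractions and corrections
  may be treated as maps of the whole ambient space.\<close>

lemma linear_extension:
 assumes "linear_from_to V W f" "cv.subspace V" "cv.subspace W"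
 obtains g where "clinear g" "!!x. x : V ==> g x = f x" "!!x. g x : W"
proof -
 obtain B where B: "B <= V" "cv.independent B" "V <= cv.span B"
  using cv.maximal_independent_subset by blast
 obtain g where g: "clinear g" "!!x. x : B ==> g x = f x" "range g = cv.span (f ` B)"
  using cvp.linear_independent_extend_subspace[OF B(2), of f] by blast
 have "g x = f x" if "x : V" for x
 proof -
  have "x : cv.span B" using B that by blast
  hence "g x = f x & x : V"
  proof (induction rule: cv.span_induct_alt)
   case base thus ?case using g lft_zero[OF assms(1,2)] by (simp add: clinear_0[OF g(1)] cv.subspace_0[OF assms(2)])
  next
   case (step c x y)
   hence "x : V" using B by blast
   thus ?case using step assms g unfolding clinear_iff
    by (simp add: lft_add[OF assms(1)] lft_scale[OF assms(1)] cv.subspace_add cv.subspace_scale)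
  qed
  thus ?thesis by blast
 qed
 moreover have "g x : W" for x
 proof -
  have "cv.span (f ` B) <= W"
   using assms B by (intro cv.span_minimal) (auto simp: lft_mem)
  thus ?thesis using g(3) by blast
 qed
 ultimately show ?thesis using g(1) that by blast
qed

lemma projection_exists:
 assumes "cv.subspace U"
 obtains p where "clinear p" "!!x. x : U ==> p x = x" "!!x. p x : U"
proof -
 have "linear_from_to U U (%x. x)" by (simp add: linear_from_to_def)
 thus ?thesis using linear_extension[OF _ assms assms] that by metis
qed

lemma section_exists:
 assumes "linear_from_to V W f" "cv.subspace V" "cv.subspace W" "f ` V = W"
 obtains s where "clinear s" "!!x. s x : V" "!!y. y : W ==> f (s y) = y"
proof -
 obtain f' where f': "clinear f'" "!!x. x : V ==> f' x = f x"
  using linear_extension[OF assms(1-3)] by metis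
 hence "f' ` V = W" using assms(4) by force
 then obtain g where "range g <= V" "clinear g" "ALL v:W. f' (g v) = v"
  using cvp.linear_exists_right_inverse_on[OF f'(1) assms(2)] by auto
 thus ?thesis using that[of g] f'(2) by (metis rangeI subsetD)
qed

lemma retraction_exists:
 assumes "linear_from_to V W f" "cv.subspace V" "cv.subspace W" "inj_on f V"
 obtains s where "clinear s" "!!x. s x : V" "!!x. x : V ==> s (f x) = x"
proof -
 obtain f' where f': "clinear f'" "!!x. x : V ==> f' x = f x"
  using linear_extension[OF assms(1-3)] by metis
 hence "inj_on f' V" using assms(4) by (metis inj_on_cong)
 then obtain g where "range g <= V" "clinear g" "ALL v:V. g (f' v) = v"
  using cvp.linear_exists_left_inverse_on[OF f'(1) assms(2)] by auto
 thus ?thesis using that[of g] f'(2) by (metis rangeI subsetD)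
qed

text \<open>The scaling \<open>s\<close> is arbitrary because two spaces are meant: that of
  sequences, and in \<open>certificate\<close> that of families of maps indexed by the arrows, where
  the lemma produces a functional on Ext.\<close>

lemma separating_functional_general:
 fixes s :: "complex => 'b::ab_group_add => 'b"
 assumes "vector_space s" "module.subspace s S" "x ~: S"
 obtains ph where "Vector_Spaces.linear s (*) ph" "!!y. y : S ==> ph y = 0" "ph x = 1"
proof -
 interpret vector_space s by fact
 interpret p: vector_space_pair s "(*) :: complex => complex => complex"
  by (simp add: vector_space_pair_def vector_space_over_itself.vector_space_axioms assms)
 obtain B where B: "B <= S" "independent B" "S <= span B"
  using maximal_independent_subset by blast
 have S: "span B = S" using B assms(2) span_minimal by blast
 hence i: "independent (insert x B)" using B assms(3) by (simp add: independent_insert)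
 obtain g where g: "Vector_Spaces.linear s (*) g" "ALL y:insert x B. g y = (if y = x then 1 else 0 :: complex)"
  using p.linear_independent_extend[OF i, of "%y. if y = x then 1 else 0"] by blast
 have "g y = 0" if "y : S" for y
 proof -
  have "y : span B" using S that by blast
  thus ?thesis
  proof (induction rule: span_induct_alt)
   case base thus ?case using g(1) by (metis Vector_Spaces.linear_iff mult_zero_left scale_zero_left)
  next
   case (step c a b)
   hence "a ~= x" using B assms(3) by blast
   thus ?case using step g by (simp add: Vector_Spaces.linear_iff)
  qed
 qed
 thus ?thesis using that g by auto
qed

lemma separating_functional:
 assumes "cv.subspace S" "x ~: S"
 obtains ph where "cfunctional ph" "!!y. y : S ==> ph y = 0" "ph x = 1"
 using separating_functional_general[OF cv.vector_space_axioms assms] by metis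

lemma functional_separates:
 assumes "!!ph. cfunctional ph ==> ph x = ph y"
 shows "x = y"
proof (rule ccontr)
 assume "x ~= y"
 hence "x - y ~: {0}" by simp
 then obtain ph where "cfunctional ph" "ph (x - y) = 1"
  using separating_functional[OF cv.subspace_single_0] by metis
 thus False using assms by (metis cfunctional_diff eq_iff_diff_eq_0 zero_neq_one)
qed

lemma fd_basis:
 assumes "fd_space V"
 obtains B where "finite B" "B <= V" "cv.independent B" "cv.span B = V" "card B = cv.dim V"
proof -
 obtain A where A: "finite A" "V = cv.span A" using assms by (auto simp: fd_space_def)
 obtain B where B: "B <= A" "cv.independent B" "A <= cv.span B"
  using cv.maximal_independent_subset by blast
 have "cv.span B = V" using A B by (metis cv.span_mono cv.span_span subset_antisym)
 thus ?thesis using that[of B] A B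
  by (metis cv.dim_span_eq_card_independent cv.span_superset finite_subset)
qed

lemma fd_subspace: "fd_space V ==> cv.subspace V"
 by (auto simp: fd_space_def)

lemma fd_independent_bound:
 assumes "fd_space V" "B <= V" "cv.independent B"
 shows "finite B & card B <= cv.dim V"
proof -
 obtain A where "finite A" "cv.span A = V" "card A = cv.dim V" using fd_basis[OF assms(1)] by metis
 thus ?thesis using cv.independent_span_bound[of A B] assms by auto
qed

lemma fd_sub:
 assumes "fd_space V" "cv.subspace U" "U <= V"
 shows "fd_space U" "cv.dim U <= cv.dim V"
proof -
 obtain B where B: "B <= U" "cv.independent B" "U <= cv.span B" "card B = cv.dim U"
  using cv.basis_exists by blast
 hence f: "finite B & card B <= cv.dim V" using fd_independent_bound assms by blast
 thus "cv.dim U <= cv.dim V" using B by simp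
 have "cv.span B = U" using B assms cv.span_minimal by blast
 thus "fd_space U" using f by (auto simp: fd_space_def)
qed

lemma fd_eq:
 assumes "fd_space V" "cv.subspace U" "U <= V" "cv.dim V <= cv.dim U"
 shows "U = V"
proof -
 obtain B where B: "B <= U" "cv.independent B" "U <= cv.span B" "card B = cv.dim U"
  using cv.basis_exists by blast
 have "x : cv.span B" if "x : V" for x
 proof (rule ccontr)
  assume x: "x ~: cv.span B"
  hence "cv.independent (insert x B)" using B cv.independent_insertI by blast
  hence *: "finite (insert x B) & card (insert x B) <= cv.dim V"
   using fd_independent_bound[OF assms(1), of "insert x B"] B(1) assms(3) that by simp
  moreover have "x ~: B" using x cv.span_base by blast
  ultimately show False using B(4) assms(4) by (auto simp: card_insert_if)
 qed
 moreover have "cv.span B <= U" using B assms cv.span_minimal by blast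
 ultimately show ?thesis using assms by blast
qed

lemma fd_image:
 assumes "fd_space V" "linear_from_to V W f"
 shows "fd_space (f ` V)" "cv.dim (f ` V) <= cv.dim V"
proof -
 obtain B where B: "finite B" "B <= V" "cv.independent B" "cv.span B = V" "card B = cv.dim V"
  using fd_basis[OF assms(1)] .
 have sub: "cv.subspace V" using assms(1) by (rule fd_subspace)
 have "f x : cv.span (f ` B)" if "x : V" for x
 proof -
  have "x : cv.span B" using B that by blast
  hence "f x : cv.span (f ` B) & x : V"
  proof (induction rule: cv.span_induct_alt)
   case base thus ?case by (simp only: lft_zero[OF assms(2) sub] cv.subspace_0[OF sub] cv.span_zero)
  next
   case (step c x y)
   hence "x : V" using B by blast
   thus ?case using step assms(2) sub
    by (simp add: lft_add[OF assms(2)] lft_scale[OF assms(2)] cv.subspace_add cv.subspace_scale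
      cv.span_add cv.span_scale cv.span_base)
  qed
  thus ?thesis by blast
 qed
 moreover have "cv.span (f ` B) <= f ` V"
  using B by (intro cv.span_minimal lft_image_subspace[OF assms(2) sub]) auto
 ultimately have *: "f ` V = cv.span (f ` B)" by blast
 thus "fd_space (f ` V)" using B by (auto simp: fd_space_def)
 have "cv.dim (cv.span (f ` B)) <= card (f ` B)" by (rule cv.dim_le_card[OF order_refl finite_imageI[OF B(1)]])
 also have "... <= card B" by (rule card_image_le[OF B(1)])
 finally show "cv.dim (f ` V) <= cv.dim V" using * B(5) by simp
qed

lemma lft_range: "linear_from_to V W f ==> linear_from_to V (f ` V) f"
 by (auto simp: linear_from_to_def)

lemma fd_image_inj:
 assumes "fd_space V" "linear_from_to V W f" "inj_on f V"
 shows "cv.dim (f ` V) = cv.dim V"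
proof -
 have sub: "cv.subspace V" using assms(1) by (rule fd_subspace)
 obtain s where s: "clinear s" "!!x. s x : V" "!!x. x : V ==> s (f x) = x"
  using retraction_exists[OF lft_range[OF assms(2)] sub lft_image_subspace[OF assms(2) sub] assms(3)] by metis
 have "s ` f ` V = V" using s by (force simp: image_iff)
 moreover have "linear_from_to (f ` V) V s" using s by (simp add: clinear_imp_linear_from_to)
 ultimately show ?thesis using fd_image[OF assms(1,2)] fd_image(2)[of "f ` V" V s] by simp
qed

text \<open>A section \<open>s\<close> of \<open>f\<close> over its image is injective, so by
  dimension its image is all of \<open>V\<close>; on the image of a section \<open>f\<close> is
  injective.\<close>

lemma fd_surj_inj:
 assumes "fd_space V" "linear_from_to V W f" "cv.dim V <= cv.dim (f ` V)"
 shows "inj_on f V"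
proof -
 have sub: "cv.subspace V" using assms(1) by (rule fd_subspace)
 obtain s where s: "clinear s" "!!x. s x : V" "!!y. y : f ` V ==> f (s y) = y"
  using section_exists[OF lft_range[OF assms(2)] sub lft_image_subspace[OF assms(2) sub] refl] by metis
 have l: "linear_from_to (f ` V) V s" using s by (auto intro: clinear_imp_linear_from_to)
 have "inj_on s (f ` V)" using s(3) by (metis inj_on_inverseI)
 hence "cv.dim (s ` f ` V) = cv.dim (f ` V)" using fd_image_inj[OF fd_image(1)[OF assms(1,2)] l] by blast
 hence eq: "s ` f ` V = V"
  using s(2) assms(3)
  by (intro fd_eq[OF assms(1)] lft_image_subspace[OF l] lft_image_subspace[OF assms(2) sub]) auto
 show ?thesis
 proof (rule inj_onI)
  fix x y assume "x : V" "y : V" and *: "f x = f y"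
  then obtain a b where "a : f ` V" "b : f ` V" "x = s a" "y = s b" using eq by (metis imageE)
  thus "x = y" using s(3) * by metis
 qed
qed

lemma dim_zero: "cv.dim {0} = 0"
 using cv.dim_span_eq_card_independent[of "{}"] cv.independent_empty cv.span_empty by simp

lemma fd_dim_0: "fd_space V ==> cv.dim V = 0 \<longleftrightarrow> V = {0}"
 by (metis card_0_eq cv.span_empty fd_basis dim_zero)

lemma dim_1_span:
 assumes "fd_space V" "cv.dim V = 1" "x : V" "x ~= 0" shows "V = cv.span {x}"
proof -
 have i: "cv.independent {x}" using assms(4) by simp
 have "cv.dim (cv.span {x}) = 1" using cv.dim_eq_card_independent[OF i] by simp
 moreover have "cv.span {x} <= V" using cv.span_minimal[OF _ fd_subspace[OF assms(1)], of "{x}"] assms(3) by simp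
 ultimately show ?thesis using fd_eq[OF assms(1) cv.subspace_span, of "{x}"] assms(2) by simp
qed

lemma fd_coordinates:
 assumes "fd_space V"
 obtains B c where "finite B" "B <= V" "!!b. cfunctional (c b)"
  "!!x. x : V ==> x = (SUM b:B. cscale (c b x) b)"
  "!!b b'. b : B ==> b' : B ==> c b b' = of_bool (b = b')"
proof -
 obtain B where B: "finite B" "B <= V" "cv.independent B" "cv.span B = V" "card B = cv.dim V"
  using fd_basis[OF assms(1)] .
 have "EX g. cfunctional g & (ALL x:B. g x = of_bool (b = x))" for b
  using cvf.linear_independent_extend[OF B(3), of "%x. of_bool (b = x)"] by blast
 then obtain c where c: "!!b. cfunctional (c b)" "!!b b'. b' : B ==> c b b' = of_bool (b = b')"
  by metis
 have "x = (SUM b:B. cscale (c b x) b)" if "x : V" for x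
 proof -
  have "x : cv.span B" using B that by blast
  thus ?thesis
  proof (induction rule: cv.span_induct_alt)
   case base thus ?case by (simp add: cfunctional_0[OF c(1)])
  next
   case (step a x y)
   have "(SUM b:B. cscale (c b x) b) = x" using step c B(1)
    by (simp add: if_distrib[of "%u. cscale u _"] of_bool_def cong: if_cong)
   moreover have "cscale (c b (cscale a x + y)) b = cscale a (cscale (c b x) b) + cscale (c b y) b" for b
    using c(1)[of b] by (simp add: cfunctional_iff cv.scale_left_distrib)
   hence "(SUM b:B. cscale (c b (cscale a x + y)) b)
     = cscale a (SUM b:B. cscale (c b x) b) + (SUM b:B. cscale (c b y) b)"
    by (simp only: sum.distrib cv.scale_sum_right)
   ultimately show ?case using step by simp
  qed
 qed
 thus ?thesis using that[of B c] B c by blast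
qed

section \<open>Representations of quivers\<close>

lemma
 assumes "is_rep Q M"
 shows rep_fd: "fd_space (spc M v)"
  and rep_subspace: "cv.subspace (spc M v)"
  and rep_act: "linear_from_to (spc M (src Q a)) (spc M (tgt Q a)) (act M a)"
 using assms by (auto simp: is_rep_def intro: fd_subspace)

lemma rep_act_mem: "is_rep Q M ==> x : spc M (src Q a) ==> act M a x : spc M (tgt Q a)"
 by (meson rep_act lft_mem)

lemma rep_act_diff: "is_rep Q M ==> x : spc M (src Q a) ==> y : spc M (src Q a) ==>
  act M a (x - y) = act M a x - act M a y"
 by (meson rep_act lft_diff rep_subspace)

lemma rep_act_add: "is_rep Q M ==> x : spc M (src Q a) ==> y : spc M (src Q a) ==>
  act M a (x + y) = act M a x + act M a y"
 by (meson rep_act lft_add)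

lemma rep_act_scale: "is_rep Q M ==> x : spc M (src Q a) ==>
  act M a (cscale c x) = cscale c (act M a x)"
 by (meson rep_act lft_scale)

lemma rep_act_0: "is_rep Q M ==> act M a 0 = 0"
 by (meson rep_act lft_zero rep_subspace)

lemma
 assumes "rep_hom Q M N f"
 shows hom_linear: "linear_from_to (spc M v) (spc N v) (f v)"
  and hom_commute: "x : spc M (src Q a) ==> f (tgt Q a) (act M a x) = act N a (f (src Q a) x)"
  and hom_mem: "x : spc M v ==> f v x : spc N v"
  and hom_add: "x : spc M v ==> y : spc M v ==> f v (x + y) = f v x + f v y"
  and hom_scale: "x : spc M v ==> f v (cscale c x) = cscale c (f v x)"
 using assms by (auto simp: rep_hom_def linear_from_to_def)

lemma hom_0: "is_rep Q M ==> rep_hom Q M N f ==> f v 0 = 0"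
 by (meson hom_linear lft_zero rep_subspace)

lemma hom_diff: "is_rep Q M ==> rep_hom Q M N f ==> x : spc M v ==> y : spc M v ==>
  f v (x - y) = f v x - f v y"
 by (meson hom_linear lft_diff rep_subspace)

lemma rep_homI:
 "(!!v. linear_from_to (spc M v) (spc N v) (f v)) ==>
  (!!a x. x : spc M (src Q a) ==> f (tgt Q a) (act M a x) = act N a (f (src Q a) x)) ==> rep_hom Q M N f"
 by (simp add: rep_hom_def)

lemma rep_hom_comp:
 assumes "rep_hom Q L M f" "rep_hom Q M N g"
 shows "rep_hom Q L N (%v x. g v (f v x))"
proof (rule rep_homI)
 show "linear_from_to (spc L v) (spc N v) (%x. g v (f v x))" for v
  by (rule lft_comp[OF hom_linear[OF assms(1)] hom_linear[OF assms(2)]])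
 show "g (tgt Q a) (f (tgt Q a) (act L a x)) = act N a (g (src Q a) (f (src Q a) x))"
  if "x : spc L (src Q a)" for a x
  using that assms by (simp add: hom_commute[OF assms(1)] hom_commute[OF assms(2)] hom_mem[OF assms(1)])
qed

lemma rep_hom_id: "rep_hom Q M M (%v x. x)"
 by (simp add: rep_hom_def linear_from_to_def)

lemma rep_hom_add:
 assumes "is_rep Q N" "rep_hom Q M N f" "rep_hom Q M N g"
 shows "rep_hom Q M N (%v x. f v x + g v x)"
proof (rule rep_homI)
 show "linear_from_to (spc M v) (spc N v) (%x. f v x + g v x)" for v
  by (rule linear_from_toI)
   (simp_all add: hom_mem[OF assms(2)] hom_mem[OF assms(3)] hom_add[OF assms(2)] hom_add[OF assms(3)]
    hom_scale[OF assms(2)] hom_scale[OF assms(3)] cv.subspace_add rep_subspace[OF assms(1)]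
    algebra_simps cv.scale_right_distrib)
 show "f (tgt Q a) (act M a x) + g (tgt Q a) (act M a x) = act N a (f (src Q a) x + g (src Q a) x)"
  if "x : spc M (src Q a)" for a x
  using that by (simp add: hom_commute[OF assms(2)] hom_commute[OF assms(3)] rep_act_add[OF assms(1)]
   hom_mem[OF assms(2)] hom_mem[OF assms(3)])
qed

lemma rep_hom_scale:
 assumes "is_rep Q N" "rep_hom Q M N f"
 shows "rep_hom Q M N (%v x. cscale c (f v x))"
proof (rule rep_homI)
 show "linear_from_to (spc M v) (spc N v) (%x. cscale c (f v x))" for v
  by (rule linear_from_toI)
   (simp_all add: hom_mem[OF assms(2)] hom_add[OF assms(2)]
    hom_scale[OF assms(2)] cv.subspace_scale rep_subspace[OF assms(1)] cv.scale_right_distrib mult.commute)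
 show "cscale c (f (tgt Q a) (act M a x)) = act N a (cscale c (f (src Q a) x))"
  if "x : spc M (src Q a)" for a x
  using that by (simp add: hom_commute[OF assms(2)] rep_act_scale[OF assms(1)] hom_mem[OF assms(2)])
qed

lemma rep_hom_funpow: "rep_hom Q M M u ==> rep_hom Q M M (%v. u v ^^ k)"
proof (induction k)
 case 0 thus ?case using rep_hom_id[of Q M] by (simp add: id_def)
next
 case (Suc k)
 thus ?case using rep_hom_comp[of Q M M "%v. u v ^^ k" M u] by (simp add: comp_def)
qed

lemma rep_inj_iff: "is_rep Q M ==> rep_hom Q M N f ==>
  rep_inj M f \<longleftrightarrow> (ALL v. ALL x:spc M v. f v x = 0 --> x = 0)"
 unfolding rep_inj_def by (meson hom_linear lft_inj_on_iff rep_subspace)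

subsection \<open>Submodules\<close>

lemma
 assumes "submodule Q M U"
 shows submodule_subspace: "cv.subspace (U v)"
  and submodule_subset: "U v <= spc M v"
  and submodule_mem: "x : U v ==> x : spc M v"
  and submodule_act: "x : U (src Q a) ==> act M a x : U (tgt Q a)"
 using assms unfolding submodule_def by blast+

lemma submoduleI:
 "(!!v. cv.subspace (U v)) ==> (!!v x. x : U v ==> x : spc M v) ==>
  (!!a x. x : U (src Q a) ==> act M a x : U (tgt Q a)) ==> submodule Q M U"
 unfolding submodule_def by blast

lemma spc_subrep [simp]: "spc (subrep M U) = U"
 by (simp add: subrep_def)

lemma act_subrep [simp]: "act (subrep M U) = act M"
 by (simp add: subrep_def)

lemma subrep_spc [simp]: "subrep M (spc M) = M"
 by (simp add: subrep_def)

lemma subrep_subrep [simp]: "subrep (subrep M U) W = subrep M W"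
 by (simp add: subrep_def)

lemma is_rep_subrep:
 assumes "is_rep Q M" "submodule Q M U" shows "is_rep Q (subrep M U)"
proof -
 have "linear_from_to (U (src Q a)) (U (tgt Q a)) (act M a)" for a
  using lft_subset[OF rep_act[OF assms(1)] submodule_subset[OF assms(2)]] submodule_act[OF assms(2)]
  by (auto simp: linear_from_to_def)
 moreover have "fd_space (U v)" for v
  using assms by (meson fd_sub(1) rep_fd submodule_subset submodule_subspace)
 ultimately show ?thesis by (simp add: is_rep_def)
qed

lemma submodule_subrep_iff:
 assumes "submodule Q M U"
 shows "submodule Q (subrep M U) W \<longleftrightarrow> submodule Q M W & (ALL v. W v <= U v)"
proof
 assume "submodule Q (subrep M U) W"
 hence W: "cv.subspace (W v)" "W v <= U v" "act M a ` W (src Q a) <= W (tgt Q a)" for v a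
  by (simp_all add: submodule_def)
 moreover have "W v <= spc M v" for v using W(2) submodule_subset[OF assms] by (meson subset_trans)
 ultimately show "submodule Q M W & (ALL v. W v <= U v)" by (simp add: submodule_def)
next
 assume "submodule Q M W & (ALL v. W v <= U v)"
 thus "submodule Q (subrep M U) W" by (simp add: submodule_def)
qed

lemma submodule_zero: "is_rep Q M ==> submodule Q M zero_fam"
 by (rule submoduleI) (auto simp: zero_fam_def rep_act_0 cv.subspace_0[OF rep_subspace])

lemma submodule_full: "is_rep Q M ==> submodule Q M (spc M)"
 by (rule submoduleI) (auto simp: rep_act_mem intro: rep_subspace)

lemma rep_hom_incl: "submodule Q M U ==> rep_hom Q (subrep M U) M (%v x. x)"
 by (auto simp: rep_hom_def linear_from_to_def submodule_mem)

lemma rep_hom_subrep: "submodule Q M U ==> rep_hom Q M N f ==> rep_hom Q (subrep M U) N f"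
 using rep_hom_comp[OF rep_hom_incl] by fastforce

lemma rep_hom_into_subrep:
 "rep_hom Q M N f ==> (!!v x. x : spc M v ==> f v x : U v) ==> rep_hom Q M (subrep N U) f"
 by (auto simp: rep_hom_def linear_from_to_def)

lemma submodule_image:
 assumes "is_rep Q M" "rep_hom Q M N f" "submodule Q M U"
 shows "submodule Q N (%v. f v ` U v)"
proof (rule submoduleI)
 show "cv.subspace (f v ` U v)" for v
  using assms by (meson hom_linear lft_image_subspace lft_subset submodule_subset submodule_subspace)
 show "x : spc N v" if "x : f v ` U v" for v x
  using that by (auto intro: hom_mem[OF assms(2)] submodule_mem[OF assms(3)])
 show "act N a x : f (tgt Q a) ` U (tgt Q a)" if x: "x : f (src Q a) ` U (src Q a)" for a x
 proof -
  obtain y where "y : U (src Q a)" "x = f (src Q a) y" using x by blast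
  thus ?thesis
   using hom_commute[OF assms(2), of y a] submodule_mem[OF assms(3)] submodule_act[OF assms(3)]
   by (metis image_eqI)
 qed
qed

lemma submodule_preimage:
 assumes "is_rep Q M" "rep_hom Q M N f" "submodule Q N W"
 shows "submodule Q M (%v. {x : spc M v. f v x : W v})"
proof (rule submoduleI)
 show "cv.subspace {x : spc M v. f v x : W v}" for v
  by (rule lft_kernel_subspace[OF hom_linear[OF assms(2)] rep_subspace[OF assms(1)] submodule_subspace[OF assms(3)]])
qed (auto simp: hom_commute[OF assms(2)] submodule_act[OF assms(3)] rep_act_mem[OF assms(1)])

lemma submodule_kernel:
 assumes "is_rep Q M" "is_rep Q N" "rep_hom Q M N f"
 shows "submodule Q M (%v. {x : spc M v. f v x = 0})"
 using submodule_preimage[OF assms(1,3) submodule_zero[OF assms(2)]] by (simp add: zero_fam_def)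

subsection \<open>Dimensions\<close>

definition tdim :: "('v::finite, 'a) quiver_rep => nat" where
 "tdim M = (SUM v:UNIV. dim_vec M v)"

lemma tdim_mono:
 assumes "is_rep Q M" "submodule Q M U"
 shows "tdim (subrep M U) <= tdim M"
 unfolding tdim_def dim_vec_def
 by (rule sum_mono) (use assms in \<open>auto intro!: fd_sub(2) simp: submodule_subspace submodule_mem intro: rep_fd\<close>)

lemma sum_eq_pointwise:
 fixes f g :: "'b::finite => nat"
 assumes "!!i. f i <= g i" "sum g UNIV <= sum f UNIV"
 shows "f i = g i"
proof (rule ccontr)
 assume "f i ~= g i"
 hence "f i < g i" using assms(1)[of i] by simp
 hence "sum f UNIV < sum g UNIV" by (intro sum_strict_mono_ex1) (auto simp: assms)
 thus False using assms(2) by simp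
qed

lemma submodule_eq_full:
 assumes "is_rep Q M" "submodule Q M U" "tdim M <= tdim (subrep M U)"
 shows "U = spc M"
proof
 fix v
 have "cv.dim (U v) = cv.dim (spc M v)"
  using sum_eq_pointwise[of "%v. cv.dim (U v)" "%v. cv.dim (spc M v)" v] assms
  by (auto simp: tdim_def dim_vec_def intro!: fd_sub(2) rep_fd submodule_subspace submodule_subset)
 thus "U v = spc M v"
  using assms by (intro fd_eq) (auto intro: rep_fd submodule_subspace submodule_mem)
qed

lemma tdim_image_le:
 assumes "is_rep Q M" "rep_hom Q M N f"
 shows "tdim (subrep N (%v. f v ` spc M v)) <= tdim M"
 unfolding tdim_def dim_vec_def
 by (rule sum_mono) (use assms in \<open>auto intro!: fd_image(2) rep_fd hom_linear\<close>)

lemma tdim_image_inj: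
 assumes "is_rep Q M" "rep_hom Q M N f" "rep_inj M f"
 shows "tdim (subrep N (%v. f v ` spc M v)) = tdim M"
 unfolding tdim_def dim_vec_def
 by (rule sum.cong) (use assms in \<open>auto intro!: fd_image_inj intro: rep_fd hom_linear simp: rep_inj_def\<close>)

lemma rep_inj_of_tdim:
 assumes "is_rep Q M" "rep_hom Q M N f" "tdim M <= tdim (subrep N (%v. f v ` spc M v))"
 shows "rep_inj M f"
 unfolding rep_inj_def
proof
 fix v
 have "cv.dim (f v ` spc M v) = cv.dim (spc M v)"
  using sum_eq_pointwise[of "%v. cv.dim (f v ` spc M v)" "%v. cv.dim (spc M v)" v] assms
  by (auto simp: tdim_def dim_vec_def intro!: fd_image(2) rep_fd hom_linear)
 thus "inj_on (f v) (spc M v)"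
  using assms by (intro fd_surj_inj) (auto intro: rep_fd hom_linear)
qed

lemma rep_surj_iff: "rep_surj M N f \<longleftrightarrow> (%v. f v ` spc M v) = spc N"
 by (auto simp: rep_surj_def fun_eq_iff)

lemma tdim_surj: "is_rep Q M ==> rep_hom Q M N f ==> rep_surj M N f ==> tdim N <= tdim M"
 using tdim_image_le[of Q M N f] by (simp add: rep_surj_iff)

lemma tdim_inj: "is_rep Q M ==> is_rep Q N ==> rep_hom Q M N f ==> rep_inj M f ==> tdim M <= tdim N"
 using tdim_mono[OF _ submodule_image[OF _ _ submodule_full], of Q N M f] tdim_image_inj[of Q M N f]
 by auto

lemma rep_surj_of_tdim:
 assumes "is_rep Q M" "is_rep Q N" "rep_hom Q M N f" "rep_inj M f" "tdim N <= tdim M"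
 shows "rep_surj M N f"
 using submodule_eq_full[OF assms(2) submodule_image[OF assms(1,3) submodule_full[OF assms(1)]]]
  tdim_image_inj[OF assms(1,3,4)] assms(5) by (simp add: rep_surj_iff)

subsection \<open>Isomorphisms\<close>

lemma rep_hom_inverse:
 assumes "is_rep Q M" "rep_hom Q M N f" "rep_inj M f" "rep_surj M N f"
 shows "EX g. rep_hom Q N M g & (ALL v. ALL x:spc M v. g v (f v x) = x) &
  (ALL v. ALL y:spc N v. f v (g v y) = y) & rep_inj N g & rep_surj N M g"
proof -
 define g where "g v = the_inv_into (spc M v) (f v)" for v
 have gf: "g v (f v x) = x" if "x : spc M v" for v x
  using that assms(3) by (simp add: g_def rep_inj_def the_inv_into_f_f)
 have im: "spc N v = f v ` spc M v" for v using assms(4) by (simp add: rep_surj_def)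
 have fg: "f v (g v y) = y" if "y : spc N v" for v y using that im gf by auto
 have mem: "g v y : spc M v" if "y : spc N v" for v y using that im gf by auto
 have "rep_hom Q N M g"
 proof (rule rep_homI)
  show "linear_from_to (spc N v) (spc M v) (g v)" for v
   unfolding im
   by (rule linear_from_toI) (auto simp: gf rep_subspace[OF assms(1)] cv.subspace_add cv.subspace_scale
     simp flip: hom_add[OF assms(2)] hom_scale[OF assms(2)])
  show "g (tgt Q a) (act N a y) = act M a (g (src Q a) y)" if y: "y : spc N (src Q a)" for a y
   using hom_commute[OF assms(2), of "g (src Q a) y" a] mem[OF y] fg[OF y] gf[OF rep_act_mem[OF assms(1) mem[OF y]]]
   by simp
 qed
 moreover have "rep_inj N g" unfolding rep_inj_def using fg by (metis inj_on_inverseI)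
 moreover have "rep_surj N M g"
  unfolding rep_surj_def using mem gf hom_mem[OF assms(2)] by (metis (no_types, lifting) image_eqI image_subsetI subsetI subset_antisym)
 ultimately show ?thesis using gf fg by (intro exI[of _ g]) blast
qed

lemma rep_iso_sym: "is_rep Q M ==> rep_iso Q M N ==> rep_iso Q N M"
 unfolding rep_iso_def using rep_hom_inverse by blast

lemma rep_iso_trans:
 assumes "rep_iso Q L M" "rep_iso Q M N" shows "rep_iso Q L N"
proof -
 obtain f g where fg: "rep_hom Q L M f" "rep_inj L f" "rep_surj L M f" "rep_hom Q M N g" "rep_inj M g" "rep_surj M N g"
  using assms by (auto simp: rep_iso_def)
 have "rep_inj L (%v x. g v (f v x))"
  using fg hom_mem[OF fg(1)] unfolding rep_inj_def inj_on_def by metis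
 moreover have "rep_surj L N (%v x. g v (f v x))"
  using fg unfolding rep_surj_def by (metis image_image)
 ultimately show ?thesis using rep_hom_comp[OF fg(1,4)] unfolding rep_iso_def by blast
qed

lemma rep_iso_tdim: "is_rep Q M ==> is_rep Q N ==> rep_iso Q M N ==> tdim M = tdim N"
 unfolding rep_iso_def by (metis antisym tdim_inj tdim_surj)

subsection \<open>Quotients\<close>

text \<open>The quotient is realised inside \<open>M\<close>: at each vertex it is the image of the
  identity minus a projection onto \<open>U\<close>, and an arrow acts as in \<open>M\<close>,
  followed by this map.\<close>

lemma quotient_exists:
 assumes "is_rep Q M" "submodule Q M U"
 obtains Y p where "is_rep Q Y" "rep_hom Q M Y p" "rep_surj M Y p" "!!v. {x : spc M v. p v x = 0} = U v"
proof -
 have "EX p. clinear p & (ALL x:U v. p x = x) & (ALL x. p x : U v)" for v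
  using projection_exists[OF submodule_subspace[OF assms(2)], of v] by metis
 then obtain r where r: "!!v. clinear (r v)" "!!v x. x : U v ==> r v x = x" "!!v x. r v x : U v"
  by metis
 define p where "p v x = x - r v x" for v x
 have lin: "clinear (p v)" for v
  using r(1)[of v] by (auto simp: clinear_iff p_def cv.scale_right_diff_distrib algebra_simps)
 have rM: "r v x : spc M v" for v x using r(3) submodule_mem[OF assms(2)] by blast
 have pM: "p v x : spc M v" if "x : spc M v" for v x
  using that rM by (simp add: p_def cv.subspace_diff rep_subspace[OF assms(1)])
 have lft: "linear_from_to (spc M v) (spc M v) (p v)" for v
  using lin pM by (auto intro: clinear_imp_linear_from_to)
 have pU: "p v x = 0" if "x : U v" for v x using that r by (simp add: p_def)
 have key: "p (tgt Q a) (act M a (p (src Q a) x)) = p (tgt Q a) (act M a x)" if "x : spc M (src Q a)" for a x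
 proof -
  have "act M a (p (src Q a) x) = act M a x - act M a (r (src Q a) x)"
   using that rM by (simp add: p_def rep_act_diff[OF assms(1)])
  moreover have "p (tgt Q a) (act M a (r (src Q a) x)) = 0"
   using r(3) submodule_act[OF assms(2)] pU by blast
  ultimately show ?thesis by (simp add: clinear_diff[OF lin])
 qed
 define Y where "Y = \<lparr>spc = (%v. p v ` spc M v), act = (%a x. p (tgt Q a) (act M a x))\<rparr>"
 have Yrep: "is_rep Q Y"
  unfolding is_rep_def
 proof (intro conjI allI)
  show "fd_space (spc Y v)" for v
   using fd_image(1)[OF rep_fd[OF assms(1)] lft] by (simp add: Y_def)
  have "linear_from_to (spc M (src Q a)) (p (tgt Q a) ` spc M (tgt Q a)) (%x. p (tgt Q a) (act M a x))" for a
   by (rule lft_comp[OF rep_act[OF assms(1)] lft_range[OF lft]])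
  thus "linear_from_to (spc Y (src Q a)) (spc Y (tgt Q a)) (act Y a)" for a
   unfolding Y_def by (simp) (rule lft_subset, blast, use pM in blast)
 qed
 have "rep_hom Q M Y p"
  by (rule rep_homI) (auto simp: Y_def key intro: lft_range[OF lft])
 moreover have "rep_surj M Y p" by (simp add: rep_surj_def Y_def)
 moreover have "{x : spc M v. p v x = 0} = U v" for v
  using pU submodule_mem[OF assms(2)] r(3) by (auto simp: p_def) (metis eq_iff_diff_eq_0)
 ultimately show ?thesis using that Yrep by blast
qed

subsection \<open>Direct sums\<close>

lemma complementary_projection:
 assumes "is_rep Q M" "submodule Q M U" "submodule Q M W" "complementary M U W"
 obtains p q where "rep_hom Q M (subrep M U) p" "rep_hom Q M (subrep M W) q"
  "!!v x. x : spc M v ==> x = p v x + q v x"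
  "!!v x. x : U v ==> p v x = x" "!!v x. x : W v ==> p v x = 0"
  "!!v x. x : U v ==> q v x = 0" "!!v x. x : W v ==> q v x = x"
proof -
 have ex: "EX y z. y : U v & z : W v & x = y + z" if "x : spc M v" for v x
  using assms(4) that unfolding complementary_def by blast
 have uniq: "y = y' & z = z'" if "y : U v" "z : W v" "y' : U v" "z' : W v" "y + z = y' + z'" for v y z y' z'
 proof -
  have "y - y' = z' - z" using that(5) by (simp add: algebra_simps)
  moreover have "y - y' : U v" "z' - z : W v"
   using that by (simp_all add: cv.subspace_diff submodule_subspace[OF assms(2)] submodule_subspace[OF assms(3)])
  ultimately have "y - y' : U v \<inter> W v" by simp
  hence "y - y' = 0" using assms(4) unfolding complementary_def by blast
  thus ?thesis using that(5) by simp
 qed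
 define r where "r v x = (SOME yz. fst yz : U v & snd yz : W v & fst yz + snd yz = x)" for v x
 define p where "p v x = fst (r v x)" for v x
 define q where "q v x = snd (r v x)" for v x
 have pq: "p v x : U v & q v x : W v & p v x + q v x = x" if x: "x : spc M v" for v x
 proof -
  obtain y z where "y : U v" "z : W v" "x = y + z" using ex[OF x] by blast
  hence "EX yz. fst yz : U v & snd yz : W v & fst yz + snd yz = x"
   by (intro exI[of _ "(y, z)"]) simp
  from someI_ex[OF this] show ?thesis unfolding p_def q_def r_def .
 qed
 have M: "x : spc M v" if "x : U v | x : W v" for v x
  using that submodule_mem[OF assms(2)] submodule_mem[OF assms(3)] by blast
 have U0: "0 : U v" "0 : W v" for v
  by (simp_all add: cv.subspace_0 submodule_subspace[OF assms(2)] submodule_subspace[OF assms(3)])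
 have eqI: "p v x = y & q v x = z" if "y : U v" "z : W v" "x = y + z" for v x y z
 proof -
  have "x : spc M v" using that M by (simp add: cv.subspace_add rep_subspace[OF assms(1)])
  from pq[OF this] show ?thesis using uniq[of "p v x" v "q v x" y z] that by simp
 qed
 have lin: "linear_from_to (spc M v) (U v) (p v) & linear_from_to (spc M v) (W v) (q v)" for v
 proof -
  have "p v (x + y) = p v x + p v y & q v (x + y) = q v x + q v y" if "x : spc M v" "y : spc M v" for x y
  proof (rule eqI)
   show "p v x + p v y : U v" "q v x + q v y : W v"
    using that pq by (simp_all add: cv.subspace_add submodule_subspace[OF assms(2)] submodule_subspace[OF assms(3)])
   have "p v x + p v y + (q v x + q v y) = (p v x + q v x) + (p v y + q v y)" by (simp only: ac_simps)
   thus "x + y = p v x + p v y + (q v x + q v y)" using that pq by simp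
  qed
  moreover have "p v (cscale c x) = cscale c (p v x) & q v (cscale c x) = cscale c (q v x)" if "x : spc M v" for c x
  proof (rule eqI)
   show "cscale c (p v x) : U v" "cscale c (q v x) : W v"
    using that pq by (simp_all add: cv.subspace_scale submodule_subspace[OF assms(2)] submodule_subspace[OF assms(3)])
   show "cscale c x = cscale c (p v x) + cscale c (q v x)"
    using that pq by (simp flip: cv.scale_right_distrib)
  qed
  ultimately show ?thesis using pq by (auto intro!: linear_from_toI)
 qed
 have comm: "p (tgt Q a) (act M a x) = act M a (p (src Q a) x) & q (tgt Q a) (act M a x) = act M a (q (src Q a) x)"
  if "x : spc M (src Q a)" for a x
 proof (rule eqI)
  show "act M a (p (src Q a) x) : U (tgt Q a)" "act M a (q (src Q a) x) : W (tgt Q a)"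
   using pq that assms by (auto intro: submodule_act)
  have "act M a (p (src Q a) x + q (src Q a) x) = act M a (p (src Q a) x) + act M a (q (src Q a) x)"
   using pq[OF that] M by (intro rep_act_add[OF assms(1)]) blast+
  thus "act M a x = act M a (p (src Q a) x) + act M a (q (src Q a) x)"
   using pq[OF that] by simp
 qed
 have "rep_hom Q M (subrep M U) p" "rep_hom Q M (subrep M W) q"
  using lin comm by (auto intro!: rep_homI)
 moreover have "p v x = x & q v x = 0" if "x : U v" for v x using eqI[of x v 0 x] that U0 by simp
 moreover have "p v x = 0 & q v x = x" if "x : W v" for v x using eqI[of 0 v x x] that U0 by simp
 moreover have "x = p v x + q v x" if "x : spc M v" for v x using pq[OF that] by simp
 ultimately show ?thesis using that[of p q] by blast
qed

lemma complementary_image_kernel: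
 assumes "is_rep Q L" "is_rep Q M" "rep_hom Q L M f" "rep_hom Q M L g" "!!v x. x : spc L v ==> g v (f v x) = x"
 shows "complementary M (%v. f v ` spc L v) (%v. {x : spc M v. g v x = 0})"
 unfolding complementary_def
proof (intro allI conjI)
 fix v
 have "x : {x + y |x y. x : f v ` spc L v & y : {x : spc M v. g v x = 0}}" if x: "x : spc M v" for x
 proof -
  have "x = f v (g v x) + (x - f v (g v x))" by simp
  moreover have "x - f v (g v x) : {x : spc M v. g v x = 0}"
   using x assms by (simp add: cv.subspace_diff rep_subspace hom_mem[OF assms(3)] hom_mem[OF assms(4)]
    hom_diff[OF assms(2,4)])
  moreover have "f v (g v x) : f v ` spc L v" using x hom_mem[OF assms(4)] by blast
  ultimately show ?thesis by blast
 qed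
 moreover have "x + y : spc M v" if "x : f v ` spc L v" "y : spc M v" for x y
  using that by (auto intro!: cv.subspace_add rep_subspace[OF assms(2)] hom_mem[OF assms(3)])
 ultimately show "{x + y |x y. x : f v ` spc L v & y : {x : spc M v. g v x = 0}} = spc M v" by blast
 show "f v ` spc L v \<inter> {x : spc M v. g v x = 0} = {0}"
 proof (intro equalityI subsetI)
  fix x assume "x : f v ` spc L v \<inter> {x : spc M v. g v x = 0}"
  then obtain y where "y : spc L v" "x = f v y" "g v x = 0" by blast
  thus "x : {0}" using assms(5) hom_0[OF assms(1,3)] by (metis singletonI)
 next
  fix x :: cvec assume "x : {0}"
  thus "x : f v ` spc L v \<inter> {x : spc M v. g v x = 0}"
   using hom_0[OF assms(1,3), of v] hom_0[OF assms(2,4), of v] cv.subspace_0[OF rep_subspace[OF assms(1)], of v]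
    cv.subspace_0[OF rep_subspace[OF assms(2)], of v] by (auto intro: image_eqI[of _ _ 0])
 qed
qed

lemma indecomposable_rep: "indecomposable Q M ==> is_rep Q M"
 by (simp add: indecomposable_def)

lemma indecomposable_complementary:
 "indecomposable Q M ==> submodule Q M U ==> submodule Q M W ==> complementary M U W ==>
  U = zero_fam | W = zero_fam"
 unfolding indecomposable_def by blast

text \<open>The image of \<open>f\<close> and the kernel of \<open>g\<close> are complementary in
  \<open>M\<close>, and the image is nonzero, so the kernel is zero.\<close>

lemma retract_of_indecomposable:
 assumes "is_rep Q L" "indecomposable Q M" "rep_hom Q L M f" "rep_hom Q M L g"
  "!!v x. x : spc L v ==> g v (f v x) = x" "spc L ~= zero_fam"
 shows "rep_inj L f" "rep_surj L M f" "rep_inj M g" "rep_surj M L g"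
proof -
 have M: "is_rep Q M" using assms(2) by (rule indecomposable_rep)
 have "(%v. f v ` spc L v) = zero_fam | (%v. {x : spc M v. g v x = 0}) = zero_fam"
  by (rule indecomposable_complementary[OF assms(2) submodule_image[OF assms(1,3) submodule_full[OF assms(1)]]
   submodule_kernel[OF M assms(1,4)] complementary_image_kernel[OF assms(1) M assms(3,4,5)]])
 moreover have "(%v. f v ` spc L v) ~= zero_fam"
 proof
  assume z: "(%v. f v ` spc L v) = zero_fam"
  have "x = 0" if "x : spc L v" for v x
  proof -
   have "f v x : zero_fam v" using that unfolding z[symmetric] by (rule imageI)
   thus ?thesis using assms(5)[OF that] hom_0[OF M assms(4)] by (simp add: zero_fam_def)
  qed
  thus False using assms(6) cv.subspace_0[OF rep_subspace[OF assms(1)]] by (auto simp: zero_fam_def fun_eq_iff)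
 qed
 ultimately have ker: "{x : spc M v. g v x = 0} = {0}" for v by (auto simp: zero_fam_def fun_eq_iff)
 thus g: "rep_inj M g" using rep_inj_iff[OF M assms(4)] by blast
 show "rep_inj L f" unfolding rep_inj_def using assms(5) by (metis inj_on_inverseI)
 show "rep_surj M L g" unfolding rep_surj_def
  using assms(5) hom_mem[OF assms(3)] hom_mem[OF assms(4)]
  by (metis (no_types, lifting) image_eqI image_subsetI subsetI subset_antisym)
 have "f v (g v x) = x" if "x : spc M v" for v x
  using g that assms(5) hom_mem[OF assms(3)] hom_mem[OF assms(4)] unfolding rep_inj_def inj_on_def by metis
 thus "rep_surj L M f" unfolding rep_surj_def
  using hom_mem[OF assms(3)] hom_mem[OF assms(4)]
  by (metis (no_types, lifting) image_eqI image_subsetI subsetI subset_antisym)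
qed

lemma fitting:
 assumes "indecomposable Q (M :: ('v::finite,'a) quiver_rep)" "rep_hom Q M M u"
 shows "rep_inj M u & rep_surj M M u | (EX k. ALL v. ALL x:spc M v. (u v ^^ k) x = 0)"
proof -
 have M: "is_rep Q M" using assms(1) by (rule indecomposable_rep)
 have u: "rep_hom Q M M (%v. u v ^^ k)" for k using assms(2) by (rule rep_hom_funpow)
 have mem: "(u v ^^ k) x : spc M v" if "x : spc M v" for v x k using hom_mem[OF u] that by blast
 define I where "I k = (%v. (u v ^^ k) ` spc M v)" for k
 define d where "d k = tdim (subrep M (I k))" for k
 have sub: "submodule Q M (I k)" for k
  unfolding I_def by (rule submodule_image[OF M u submodule_full[OF M]])
 have rep: "is_rep Q (subrep M (I k))" for k by (rule is_rep_subrep[OF M sub])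
 \<comment> \<open>An exponent with the smallest image. Every power of \<open>u\<close> is then
   injective on \<open>I k\<close>, whence \<open>I k\<close> and the kernel of the
   \<open>k\<close>-th power are complementary.\<close>
 define k where "k = (ARG_MIN d k. True)"
 have min: "d k <= d j" for j unfolding k_def by (rule arg_min_nat_le) simp
 have shift: "(%v. (u v ^^ j) ` I i v) = I (j + i)" for i j
  by (simp add: I_def image_image funpow_add)
 have uk: "rep_hom Q (subrep M (I i)) M (%v. u v ^^ j)" for i j by (rule rep_hom_subrep[OF sub u])
 have inj: "rep_inj (subrep M (I k)) (%v. u v ^^ j)" for j
  using rep_inj_of_tdim[OF rep uk, of k j] min[of "j + k"] by (simp add: shift d_def)
 have "I (k + k) = I k"
 proof -
  have "submodule Q (subrep M (I k)) (I (k + k))"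
   unfolding submodule_subrep_iff[OF sub]
  proof (intro conjI allI sub)
   show "I (k + k) v <= I k v" for v unfolding I_def funpow_add using mem by auto
  qed
  thus ?thesis using submodule_eq_full[OF rep, of k "I (k + k)"] min[of "k + k"] by (simp add: d_def)
 qed
 let ?K = "%v. {x : spc M v. (u v ^^ k) x = 0}"
 have K: "submodule Q M ?K" by (rule submodule_kernel[OF M M u])
 have "complementary M (I k) ?K"
  unfolding complementary_def
 proof (intro allI conjI)
  fix v
  have "x : {x + y |x y. x : I k v & y : ?K v}" if x: "x : spc M v" for x
  proof -
   have "(u v ^^ k) x : I (k + k) v" using \<open>I (k + k) = I k\<close> x unfolding I_def by (metis image_eqI)
   then obtain y where y: "y : spc M v" "(u v ^^ k) x = (u v ^^ k) ((u v ^^ k) y)"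
    unfolding I_def funpow_add by auto
   have "x - (u v ^^ k) y : ?K v"
    using x y mem by (simp add: cv.subspace_diff rep_subspace[OF M] hom_diff[OF M u])
   moreover have "(u v ^^ k) y : I k v" using y by (simp add: I_def)
   moreover have "x = (u v ^^ k) y + (x - (u v ^^ k) y)" by simp
   ultimately show ?thesis by blast
  qed
  moreover have "x + y : spc M v" if "x : I k v" "y : ?K v" for x y
   using that submodule_mem[OF sub] by (auto intro!: cv.subspace_add rep_subspace[OF M])
  ultimately show "{x + y |x y. x : I k v & y : ?K v} = spc M v" by blast
  have "0 : I k v" "0 : ?K v" using submodule_subspace[OF sub] submodule_subspace[OF K] cv.subspace_0 by blast+
  moreover have "x = 0" if "x : I k v" "x : ?K v" for x
   using inj[of k] that rep_inj_iff[OF rep uk, of k k] by simp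
  ultimately show "I k v \<inter> ?K v = {0}" by blast
 qed
 then consider "I k = zero_fam" | "?K = zero_fam"
  using indecomposable_complementary[OF assms(1) sub K] by blast
 thus ?thesis
 proof cases
  case 1
  hence "(u v ^^ k) x = 0" if "x : spc M v" for v x
  proof -
   have "(u v ^^ k) x : I k v" using that by (simp add: I_def)
   thus ?thesis using 1 by (simp add: zero_fam_def)
  qed
  thus ?thesis by blast
 next
  case 2
  have "x = 0" if "x : spc M v" "u v x = 0" for v x
  proof -
   have "(u v ^^ k) x : {0} | k = 0"
    using that(2) hom_0[OF M u] by (cases k) (simp_all add: funpow_swap1[symmetric] funpow_Suc_right del: funpow.simps)
   hence "k = 0 | x : ?K v" using that(1) by blast
   moreover have "?K v = {0}" using 2 by (simp add: zero_fam_def fun_eq_iff)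
   ultimately consider "k = 0" | "x = 0" by blast
   thus ?thesis
   proof cases
    case 1
    \<comment> \<open>For \<open>k = 0\<close> the kernel of the \<open>k\<close>-th power says
      nothing about \<open>u\<close>; but then \<open>I k\<close> is all of \<open>M\<close> and
      \<open>inj\<close> applies with exponent 1.\<close>
    hence "inj_on (u v) (spc M v)" using inj[of 1] by (simp add: rep_inj_def I_def)
    thus ?thesis using that lft_inj_on_iff[OF hom_linear[OF assms(2)] rep_subspace[OF M]] by blast
   qed
  qed
  hence i: "rep_inj M u" using rep_inj_iff[OF M assms(2)] by blast
  thus ?thesis using rep_surj_of_tdim[OF M M assms(2) i] by simp
 qed
qed

section \<open>Almost split sequences\<close>

lemma skolem2:
 assumes "!!v y. P v y ==> EX x. R v y x"
 shows "EX s. ALL v y. P v y --> R v y (s v y)"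
proof (intro exI allI impI)
 show "R v y ((%v y. SOME x. R v y x) v y)" if "P v y" for v y
  using someI_ex[OF assms[OF that]] by simp
qed

lemma rep_surjD: "rep_surj M N f ==> y : spc N v ==> EX x. x : spc M v & y = f v x"
 unfolding rep_surj_def by (metis imageE)

lemma factor_through_surj:
 assumes "is_rep Q M" "rep_hom Q M N g" "rep_surj M N g" "rep_hom Q M Z h"
  "!!v x. x : spc M v ==> g v x = 0 ==> h v x = 0"
 shows "EX k. rep_hom Q N Z k & (ALL v. ALL x:spc M v. k v (g v x) = h v x)"
proof -
 have "EX x. x : spc M v & g v x = y" if "y : spc N v" for v y
 proof -
  have "y : g v ` spc M v" using assms(3) that by (simp add: rep_surj_def)
  thus ?thesis by blast
 qed
 then obtain s where s: "ALL v. ALL y:spc N v. s v y : spc M v & g v (s v y) = y"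
  using skolem2[of "%v y. y : spc N v" "%v y x. x : spc M v & g v x = y"] by (auto simp: Ball_def)
 note s = s[rule_format]
 have eq: "h v x = h v y" if "x : spc M v" "y : spc M v" "g v x = g v y" for v x y
 proof -
  have "h v (x - y) = 0"
   using assms(5)[of "x - y" v] that
   by (simp add: cv.subspace_diff rep_subspace[OF assms(1)] hom_diff[OF assms(1,2)])
  thus ?thesis using that by (simp add: hom_diff[OF assms(1,4)])
 qed
 define k where "k v y = h v (s v y)" for v y
 have k: "k v (g v x) = h v x" if "x : spc M v" for v x
  unfolding k_def using that s[OF hom_mem[OF assms(2) that]] by (intro eq) auto
 have im: "spc N v = g v ` spc M v" for v using assms(3) by (simp add: rep_surj_def)
 have "rep_hom Q N Z k"
 proof (rule rep_homI)
  show "linear_from_to (spc N v) (spc Z v) (k v)" for v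
   unfolding im
   by (rule linear_from_toI) (auto simp: k rep_subspace[OF assms(1)] cv.subspace_add cv.subspace_scale
     hom_mem[OF assms(4)] hom_add[OF assms(4)] hom_scale[OF assms(4)]
     simp flip: hom_add[OF assms(2)] hom_scale[OF assms(2)])
  show "k (tgt Q a) (act N a y) = act Z a (k (src Q a) y)" if "y : spc N (src Q a)" for a y
  proof -
   have "y : g (src Q a) ` spc M (src Q a)" using that im[of "src Q a"] by simp
   then obtain x where x: "x : spc M (src Q a)" "y = g (src Q a) x" by (rule imageE)
   have "k (tgt Q a) (act N a y) = k (tgt Q a) (g (tgt Q a) (act M a x))"
    by (simp only: x(2) hom_commute[OF assms(2) x(1)])
   also have "... = act Z a (h (src Q a) x)"
    by (simp only: k[OF rep_act_mem[OF assms(1) x(1)]] hom_commute[OF assms(4) x(1)])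
   finally show ?thesis by (simp only: x(2) k[OF x(1)])
  qed
 qed
 thus ?thesis using k by (intro exI[of _ k]) blast
qed

lemma factor_through_inj:
 assumes "is_rep Q L" "is_rep Q Y" "rep_hom Q L B f" "rep_inj L f" "rep_hom Q Y B h"
  "!!v y. y : spc Y v ==> h v y : f v ` spc L v"
 shows "EX k. rep_hom Q Y L k & (ALL v. ALL y:spc Y v. f v (k v y) = h v y)"
proof -
 let ?I = "subrep B (%v. f v ` spc L v)"
 have f: "rep_hom Q L ?I f" using assms(3) by (rule rep_hom_into_subrep) blast
 have s: "rep_surj L ?I f" by (simp add: rep_surj_def)
 obtain k where k: "rep_hom Q ?I L k" "ALL v. ALL y:spc ?I v. f v (k v y) = y"
  using rep_hom_inverse[OF assms(1) f assms(4) s] by blast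
 note k = k[rule_format]
 have h: "rep_hom Q Y ?I h" using assms(5,6) by (rule rep_hom_into_subrep)
 show ?thesis
  by (rule exI[of _ "%v x. k v (h v x)"])
   (use rep_hom_comp[OF h k(1)] k(2) assms(6) in auto)
qed

lemma split_monoI:
 "rep_hom Q M N f ==> rep_hom Q N M g ==> (!!v x. x : spc M v ==> g v (f v x) = x) ==> split_mono Q M N f"
 unfolding split_mono_def agree_def comp_fam_def by (auto intro!: exI[of _ g])

lemma split_epiI:
 "rep_hom Q M N f ==> rep_hom Q N M g ==> (!!v x. x : spc N v ==> f v (g v x) = x) ==> split_epi Q M N f"
 unfolding split_epi_def agree_def comp_fam_def by (auto intro!: exI[of _ g])

lemma split_mono_iff: "split_mono Q M N f \<longleftrightarrow> rep_hom Q M N f &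
  (EX g. rep_hom Q N M g & (ALL v. ALL x:spc M v. g v (f v x) = x))"
 by (simp add: split_mono_def agree_def comp_fam_def)

lemma split_epi_iff: "split_epi Q M N f \<longleftrightarrow> rep_hom Q M N f &
  (EX g. rep_hom Q N M g & (ALL v. ALL x:spc N v. f v (g v x) = x))"
 by (simp add: split_epi_def agree_def comp_fam_def)

lemma bij_split_mono:
 assumes "is_rep Q M" "rep_hom Q M N f" "rep_inj M f" "rep_surj M N f"
 shows "split_mono Q M N f" "split_epi Q M N f"
proof -
 obtain g where g: "rep_hom Q N M g" "ALL v. ALL x:spc M v. g v (f v x) = x"
  "ALL v. ALL y:spc N v. f v (g v y) = y"
  using rep_hom_inverse[OF assms] by blast
 note g = g[rule_format]
 show "split_mono Q M N f" using split_monoI[OF assms(2) g(1)] g(2) by blast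
 show "split_epi Q M N f" using split_epiI[OF assms(2) g(1)] g(3) by blast
qed

lemma split_mono_inj:
 assumes "split_mono Q M N f" shows "rep_inj M f"
proof -
 obtain g where "ALL v. ALL x:spc M v. g v (f v x) = x" using assms unfolding split_mono_iff by blast
 hence "inj_on (f v) (spc M v)" for v by (intro inj_on_inverseI[of _ "g v"]) simp
 thus ?thesis by (simp add: rep_inj_def)
qed

lemma split_epi_surj:
 assumes "split_epi Q M N f" shows "rep_surj M N f"
proof -
 obtain g where g: "rep_hom Q M N f" "rep_hom Q N M g" "ALL v. ALL x:spc N v. f v (g v x) = x"
  using assms unfolding split_epi_iff by blast
 note g = g[rule_format]
 have "f v ` spc M v = spc N v" for v
 proof
  show "f v ` spc M v <= spc N v" using hom_mem[OF g(1)] by blast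
  show "spc N v <= f v ` spc M v"
  proof
   fix y assume y: "y : spc N v"
   hence "y = f v (g v y)" using g(3) by simp
   thus "y : f v ` spc M v" using hom_mem[OF g(2) y] by (rule image_eqI)
  qed
 qed
 thus ?thesis by (simp add: rep_surj_def)
qed

text \<open>Irreducibility is applied to the factorisation of \<open>f\<close> through its image: a
  split mono onto the image makes \<open>f\<close> injective, a split epi from the image makes it
  surjective.\<close>

lemma irreducible_inj_or_surj:
 assumes "is_rep Q M" "is_rep Q N" "irreducible_hom Q M N f"
 shows "rep_inj M f | rep_surj M N f"
proof -
 let ?U = "%v. f v ` spc M v"
 have f: "rep_hom Q M N f" using assms(3) by (simp add: irreducible_hom_def)
 have U: "submodule Q N ?U" by (rule submodule_image[OF assms(1) f submodule_full[OF assms(1)]])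
 have h: "rep_hom Q M (subrep N ?U) f" by (rule rep_hom_into_subrep[OF f]) blast
 have i: "rep_hom Q (subrep N ?U) N (%v x. x)" by (rule rep_hom_incl[OF U])
 have "agree M (comp_fam (%v x. x) f) f" by (simp add: agree_def comp_fam_def)
 hence "split_mono Q M (subrep N ?U) f | split_epi Q (subrep N ?U) N (%v x. x)"
  using assms(3) is_rep_subrep[OF assms(2) U] h i unfolding irreducible_hom_def by blast
 thus ?thesis
 proof
  assume "split_mono Q M (subrep N ?U) f" thus ?thesis using split_mono_inj by blast
 next
  assume "split_epi Q (subrep N ?U) N (%v x. x)"
  thus ?thesis using split_epi_surj by (fastforce simp: rep_surj_def)
 qed
qed

lemma irreducible_not_bij:
 "is_rep Q M ==> irreducible_hom Q M N f ==> ~ (rep_inj M f & rep_surj M N f)"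
 using bij_split_mono(1)[of Q M N f] by (auto simp: irreducible_hom_def)

text \<open>Kept apart from \<open>almost_split\<close> because \<open>endo_over\<close> is applied
  to an extension before it is known to be almost split.\<close>

locale nonsplit_exact =
 fixes Q :: "('v::finite, 'a::finite) quiver" and L B N f g
 assumes L: "is_rep Q L" and B: "is_rep Q B" and N: "is_rep Q N"
  and f: "rep_hom Q L B f" and f_inj: "rep_inj L f"
  and g: "rep_hom Q B N g" and g_surj: "rep_surj B N g"
  and exact: "!!v. f v ` spc L v = {x : spc B v. g v x = 0}"
  and not_split_mono: "~ split_mono Q L B f" and not_split_epi: "~ split_epi Q B N g"
begin

lemma exactD: "x : spc B v ==> g v x = 0 ==> EX l. l : spc L v & x = f v l"
 using exact[of v] by (metis (mono_tags, lifting) imageE mem_Collect_eq)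

lemma gf [simp]: "x : spc L v ==> g v (f v x) = 0"
 using exact by blast

text \<open>Fitting's lemma is applied to the restriction \<open>u\<close> of \<open>tt\<close> to
  \<open>L\<close>. If \<open>u\<close> is nilpotent, a power of \<open>tt\<close> kills the image
  of \<open>f\<close> and descends along \<open>g\<close> to a section of \<open>g\<close>, which
  does not exist. If \<open>u\<close> is injective, so is \<open>tt\<close>.\<close>

lemma endo_over:
 assumes "indecomposable Q L" "rep_hom Q B B tt" "!!v x. x : spc B v ==> g v (tt v x) = g v x"
 shows "rep_inj B tt & rep_surj B B tt"
proof -
 have im: "tt v (f v x) : f v ` spc L v" if "x : spc L v" for v x
  unfolding exact using that hom_mem[OF f] hom_mem[OF assms(2)] assms(3) by simp
 obtain u where u: "rep_hom Q L L u" "ALL v. ALL x:spc L v. f v (u v x) = tt v (f v x)"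
  using factor_through_inj[OF L L f f_inj rep_hom_comp[OF f assms(2)] im] by blast
 note u = u[rule_format]
 have uk: "f v ((u v ^^ k) x) = (tt v ^^ k) (f v x)" if "x : spc L v" for v x k
  using u(2) hom_mem[OF rep_hom_funpow[OF u(1)]] that by (induction k) simp_all
 have gk: "g v ((tt v ^^ k) x) = g v x" if "x : spc B v" for v x k
  using assms(3) hom_mem[OF rep_hom_funpow[OF assms(2)]] that by (induction k) simp_all
 from fitting[OF assms(1) u(1)] show ?thesis
 proof
  assume "rep_inj L u & rep_surj L L u"
  hence ui: "rep_inj L u" by blast
  have "x = 0" if x: "x : spc B v" "tt v x = 0" for v x
  proof -
   have "g v x = 0" using assms(3)[OF x(1)] x(2) hom_0[OF B g] by simp
   then obtain l where l: "l : spc L v" "x = f v l" using exactD[OF x(1)] by blast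
   have "f v (u v l) = 0" using u(2)[OF l(1)] l(2) x(2) by simp
   hence "u v l = 0" using f_inj rep_inj_iff[OF L f] hom_mem[OF u(1) l(1)] by blast
   hence "l = 0" using ui rep_inj_iff[OF L u(1)] l(1) by blast
   thus ?thesis using l(2) hom_0[OF L f] by simp
  qed
  hence "rep_inj B tt" using rep_inj_iff[OF B assms(2)] by blast
  thus ?thesis using rep_surj_of_tdim[OF B B assms(2)] by blast
 next
  assume "EX k. ALL v. ALL x:spc L v. (u v ^^ k) x = 0"
  then obtain k where k: "ALL v. ALL x:spc L v. (u v ^^ k) x = 0" by blast
  note k = k[rule_format]
  have ker: "(tt v ^^ k) x = 0" if x: "x : spc B v" "g v x = 0" for v x
  proof -
   obtain l where "l : spc L v" "x = f v l" using exactD x by blast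
   thus ?thesis using uk[of l v k] k hom_0[OF L f] by simp
  qed
  obtain s where s: "rep_hom Q N B s" "ALL v. ALL x:spc B v. s v (g v x) = (tt v ^^ k) x"
   using factor_through_surj[OF B g g_surj rep_hom_funpow[OF assms(2), of k] ker] by blast
  note s = s[rule_format]
  have "g v (s v y) = y" if y: "y : spc N v" for v y
  proof -
   obtain x where "x : spc B v" "y = g v x" using rep_surjD[OF g_surj y] by blast
   thus ?thesis using s(2) gk by simp
  qed
  thus ?thesis using split_epiI[OF g s(1)] not_split_epi by blast
 qed
qed

text \<open>Dual to \<open>endo_over\<close>: if the induced endomorphism of \<open>N\<close> were
  nilpotent, a power of \<open>tt\<close> would have its image in \<open>L\<close> and give a
  retraction of \<open>f\<close>.\<close>

lemma endo_under:
 assumes "indecomposable Q N" "rep_hom Q B B tt" "ALL v. ALL x:spc L v. tt v (f v x) = f v x"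
 shows "rep_inj B tt & rep_surj B B tt"
proof -
 have fk: "(tt v ^^ k) (f v x) = f v x" if "x : spc L v" for v x k
  using that assms(3) by (induction k) simp_all
 have ker: "g v (tt v x) = 0" if x: "x : spc B v" "g v x = 0" for v x
 proof -
  obtain l where "l : spc L v" "x = f v l" using exactD x by blast
  thus ?thesis using assms(3) by simp
 qed
 obtain u where u: "rep_hom Q N N u" "ALL v. ALL x:spc B v. u v (g v x) = g v (tt v x)"
  using factor_through_surj[OF B g g_surj rep_hom_comp[OF assms(2) g] ker] by blast
 note u = u[rule_format]
 have uk: "(u v ^^ k) (g v x) = g v ((tt v ^^ k) x)" if "x : spc B v" for v x k
  using u(2) hom_mem[OF rep_hom_funpow[OF assms(2)]] that by (induction k) simp_all
 from fitting[OF assms(1) u(1)] show ?thesis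
 proof
  assume "rep_inj N u & rep_surj N N u"
  hence ui: "rep_inj N u" by blast
  have "x = 0" if x: "x : spc B v" "tt v x = 0" for v x
  proof -
   have "u v (g v x) = 0" using u(2)[OF x(1)] x(2) hom_0[OF B g] by simp
   hence "g v x = 0" using ui rep_inj_iff[OF N u(1)] hom_mem[OF g x(1)] by blast
   then obtain l where "l : spc L v" "x = f v l" using exactD[OF x(1)] by blast
   thus ?thesis using assms(3) x(2) by simp
  qed
  hence "rep_inj B tt" using rep_inj_iff[OF B assms(2)] by blast
  thus ?thesis using rep_surj_of_tdim[OF B B assms(2)] by blast
 next
  assume "EX k. ALL v. ALL x:spc N v. (u v ^^ k) x = 0"
  then obtain k where k: "ALL v. ALL x:spc N v. (u v ^^ k) x = 0" by blast
  note k = k[rule_format]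
  have im: "(tt v ^^ k) x : f v ` spc L v" if x: "x : spc B v" for v x
   unfolding exact using x uk[OF x, of k] k hom_mem[OF g x] hom_mem[OF rep_hom_funpow[OF assms(2)] x] by simp
  obtain r where r: "rep_hom Q B L r" "ALL v. ALL x:spc B v. f v (r v x) = (tt v ^^ k) x"
   using factor_through_inj[OF L B f f_inj rep_hom_funpow[OF assms(2), of k] im] by blast
  note r = r[rule_format]
  have "r v (f v x) = x" if "x : spc L v" for v x
  proof -
   have "f v (r v (f v x)) = f v x" using r(2)[OF hom_mem[OF f that]] fk[OF that] by simp
   thus ?thesis using f_inj that hom_mem[OF r(1) hom_mem[OF f that]]
    unfolding rep_inj_def inj_on_def by blast
  qed
  thus ?thesis using split_monoI[OF f r(1)] not_split_mono by blast
 qed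
qed

end

locale almost_split =
 fixes Q :: "('v::finite, 'a::finite) quiver" and L B N f g
 assumes seq: "almost_split_seq Q L B N f g"

sublocale almost_split \<subseteq> nonsplit_exact
 using seq by unfold_locales (auto simp: almost_split_seq_def)

context almost_split
begin

lemma extend:
 assumes "is_rep Q Y" "rep_hom Q L Y h" "~ split_mono Q L Y h"
 shows "EX k. rep_hom Q B Y k & (ALL v. ALL x:spc L v. k v (f v x) = h v x)"
proof -
 have "EX k. rep_hom Q B Y k & agree L (comp_fam k f) h"
  using seq assms unfolding almost_split_seq_def by blast
 thus ?thesis by (simp add: agree_def comp_fam_def)
qed

lemma lift:
 assumes "is_rep Q Y" "rep_hom Q Y N h" "~ split_epi Q Y N h"
 shows "EX k. rep_hom Q Y B k & (ALL v. ALL x:spc Y v. g v (k v x) = h v x)"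
proof -
 have "EX k. rep_hom Q Y B k & agree Y (comp_fam g k) h"
  using seq assms unfolding almost_split_seq_def by blast
 thus ?thesis by (simp add: agree_def comp_fam_def)
qed

text \<open>Given a factorisation through \<open>Z\<close>, the extension or lifting property yields
  an endomorphism of \<open>B\<close> under \<open>L\<close> or over \<open>N\<close>. It is
  bijective by \<open>endo_under\<close> or \<open>endo_over\<close>, and its inverse, cut down to
  \<open>U\<close>, splits the factor in question.\<close>

lemma summand_irreducible:
 assumes "indecomposable Q L" "indecomposable Q N"
  "submodule Q B U" "submodule Q B W" "complementary B U W" "indecomposable Q (subrep B U)"
  "rep_hom Q B (subrep B U) p" "rep_hom Q B (subrep B W) q" "!!v x. x : spc B v ==> x = p v x + q v x"
  "!!v x. x : U v ==> p v x = x" "!!v x. x : W v ==> p v x = 0"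
  "!!v x. x : U v ==> q v x = 0" "!!v x. x : W v ==> q v x = x"
 shows "irreducible_hom Q L (subrep B U) (%v x. p v (f v x))"
  and "irreducible_hom Q (subrep B U) N g"
proof -
 let ?X = "subrep B U"
 have X: "is_rep Q ?X" using assms(6) by (rule indecomposable_rep)
 have Xne: "spc ?X ~= zero_fam" using assms(6) by (simp add: indecomposable_def)
 have UB: "x : spc B v" if "x : U v" for v x using that submodule_mem[OF assms(3)] by blast
 have WB: "x : spc B v" if "x : W v" for v x using that submodule_mem[OF assms(4)] by blast
 have pU: "p v x : U v" if "x : spc B v" for v x using hom_mem[OF assms(7) that] by simp
 have qW: "q v x : W v" if "x : spc B v" for v x using hom_mem[OF assms(8) that] by simp
 have UW: "x = 0" if "x : U v" "x : W v" for v x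
  using assms(5) that unfolding complementary_def by blast
 have incl: "rep_hom Q ?X B (%v x. x)" by (rule rep_hom_incl[OF assms(3)])
 have qB: "rep_hom Q B B q" using rep_hom_comp[OF assms(8) rep_hom_incl[OF assms(4)]] by simp
 have pf: "rep_hom Q L ?X (%v x. p v (f v x))" by (rule rep_hom_comp[OF f assms(7)])
 have gX: "rep_hom Q ?X N g" by (rule rep_hom_subrep[OF assms(3) g])
 show "irreducible_hom Q L ?X (%v x. p v (f v x))"
  unfolding irreducible_hom_def
 proof (intro conjI pf allI impI)
  show nm: "~ split_mono Q L ?X (%v x. p v (f v x))"
  proof
   assume "split_mono Q L ?X (%v x. p v (f v x))"
   then obtain r where "rep_hom Q ?X L r" "ALL v. ALL x:spc L v. r v (p v (f v x)) = x"
    unfolding split_mono_iff by blast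
   hence "split_mono Q L B f" using split_monoI[OF f rep_hom_comp[OF assms(7)]] by blast
   thus False using not_split_mono by blast
  qed
  show "~ split_epi Q L ?X (%v x. p v (f v x))"
  proof
   assume "split_epi Q L ?X (%v x. p v (f v x))"
   then obtain s where s: "rep_hom Q ?X L s" "ALL v. ALL x:spc ?X v. p v (f v (s v x)) = x"
    unfolding split_epi_iff by blast
   note s = s[rule_format]
   show False
    using retract_of_indecomposable(3,4)[OF X assms(1) s(1) pf s(2) Xne] bij_split_mono(1)[OF L pf] nm by blast
  qed
  fix Z g' h'
  assume "is_rep Q Z & rep_hom Q L Z h' & rep_hom Q Z ?X g' & agree L (comp_fam g' h') (%v x. p v (f v x))"
  hence Z: "is_rep Q Z" and h': "rep_hom Q L Z h'" and g': "rep_hom Q Z ?X g'"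
   and gh: "!!v x. x : spc L v ==> g' v (h' v x) = p v (f v x)"
   by (auto simp: agree_def comp_fam_def)
  show "split_mono Q L Z h' | split_epi Q Z ?X g'"
  proof (cases "split_mono Q L Z h'")
   case nsm: False
   obtain k where k: "rep_hom Q B Z k" "ALL v. ALL x:spc L v. k v (f v x) = h' v x"
    using extend[OF Z h' nsm] by blast
   note k = k[rule_format]
   \<comment> \<open>On \<open>f l\<close> the first summand is \<open>p (f l)\<close>, because
     \<open>k\<close> extends \<open>h'\<close> and \<open>g'\<close> after \<open>h'\<close> is
     \<open>p\<close> after \<open>f\<close>. So the sum fixes the image of
     \<open>L\<close>.\<close>
   let ?tt = "%v x. g' v (k v x) + q v x"
   have gk: "rep_hom Q B B (%v x. g' v (k v x))"
    using rep_hom_comp[OF rep_hom_comp[OF k(1) g'] incl] by simp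
   have tt: "rep_hom Q B B ?tt" by (rule rep_hom_add[OF B gk qB])
   have "g' v (k v (f v x)) + q v (f v x) = f v x" if "x : spc L v" for v x
    using k(2)[OF that] gh[OF that] assms(9)[OF hom_mem[OF f that]] by simp
   hence bij: "rep_inj B ?tt" "rep_surj B B ?tt" using endo_under[OF assms(2) tt] by blast+
   obtain t where t: "rep_hom Q B B t" "ALL v. ALL x:spc B v. t v (g' v (k v x) + q v x) = x"
    "ALL v. ALL y:spc B v. g' v (k v (t v y)) + q v (t v y) = y" "rep_inj B t" "rep_surj B B t"
    using rep_hom_inverse[OF B tt bij] by blast
   note t = t[rule_format]
   have "g' v (k v (t v x)) = x" if x: "x : U v" for v x
   proof -
    have tB: "t v x : spc B v" using hom_mem[OF t(1) UB[OF x]] .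
    have gU: "g' v (k v (t v x)) : U v" using hom_mem[OF g' hom_mem[OF k(1) tB]] by simp
    have "q v (t v x) = x - g' v (k v (t v x))" using t(3)[OF UB[OF x]] by (simp add: algebra_simps)
    also have "... : U v" using x gU by (simp add: cv.subspace_diff submodule_subspace[OF assms(3)])
    finally have "q v (t v x) = 0" using qW[OF tB] UW by blast
    thus ?thesis using t(3)[OF UB[OF x]] by simp
   qed
   hence "split_epi Q Z ?X g'"
    using split_epiI[OF g' rep_hom_comp[OF incl rep_hom_comp[OF t(1) k(1)]]] by simp
   thus ?thesis ..
  qed simp
 qed
 show "irreducible_hom Q ?X N g"
  unfolding irreducible_hom_def
 proof (intro conjI gX allI impI)
  show ne: "~ split_epi Q ?X N g"
  proof
   assume "split_epi Q ?X N g"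
   then obtain s where "rep_hom Q N ?X s" "ALL v. ALL x:spc N v. g v (s v x) = x"
    unfolding split_epi_iff by blast
   hence "split_epi Q B N g" using split_epiI[OF g rep_hom_comp[OF _ incl]] by blast
   thus False using not_split_epi by blast
  qed
  show "~ split_mono Q ?X N g"
  proof
   assume "split_mono Q ?X N g"
   then obtain r where r: "rep_hom Q N ?X r" "ALL v. ALL x:spc ?X v. r v (g v x) = x"
    unfolding split_mono_iff by blast
   note r = r[rule_format]
   show False
    using retract_of_indecomposable(1,2)[OF X assms(2) gX r(1) r(2) Xne] bij_split_mono(2)[OF X gX] ne by blast
  qed
  fix Z g' h'
  assume "is_rep Q Z & rep_hom Q ?X Z h' & rep_hom Q Z N g' & agree ?X (comp_fam g' h') g"
  hence Z: "is_rep Q Z" and h': "rep_hom Q ?X Z h'" and g': "rep_hom Q Z N g'"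
   and gh: "!!v x. x : U v ==> g' v (h' v x) = g v x"
   by (auto simp: agree_def comp_fam_def)
  show "split_mono Q ?X Z h' | split_epi Q Z N g'"
  proof (rule disjCI)
   assume nse: "~ split_epi Q Z N g'"
   obtain k where k: "rep_hom Q Z B k" "ALL v. ALL x:spc Z v. g v (k v x) = g' v x"
    using lift[OF Z g' nse] by blast
   note k = k[rule_format]
   \<comment> \<open>Under \<open>g\<close> the first summand becomes \<open>g (p x)\<close>,
     because \<open>k\<close> lifts \<open>g'\<close> and \<open>g'\<close> after \<open>h'\<close>
     is \<open>g\<close> on \<open>U\<close>. So the sum lies over the identity of
     \<open>N\<close>.\<close>
   let ?tt = "%v x. k v (h' v (p v x)) + q v x"
   have kh: "rep_hom Q B B (%v x. k v (h' v (p v x)))"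
    using rep_hom_comp[OF rep_hom_comp[OF assms(7) h'] k(1)] by simp
   have tt: "rep_hom Q B B ?tt" by (rule rep_hom_add[OF B kh qB])
   have "g v (k v (h' v (p v x)) + q v x) = g v x" if x: "x : spc B v" for v x
   proof -
    have "h' v (p v x) : spc Z v" using hom_mem[OF h'] pU[OF x] by simp
    hence "g v (k v (h' v (p v x))) = g v (p v x)" using k(2) gh[OF pU[OF x]] by simp
    hence "g v (k v (h' v (p v x)) + q v x) = g v (p v x) + g v (q v x)"
     using hom_add[OF g hom_mem[OF kh x] hom_mem[OF qB x]] by simp
    also have "... = g v (p v x + q v x)" using hom_add[OF g UB[OF pU[OF x]] hom_mem[OF qB x]] by simp
    finally show ?thesis using assms(9)[OF x] by simp
   qed
   hence bij: "rep_inj B ?tt" "rep_surj B B ?tt" using endo_over[OF assms(1) tt] by blast+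
   obtain t where t: "rep_hom Q B B t" "ALL v. ALL x:spc B v. t v (k v (h' v (p v x)) + q v x) = x"
    "ALL v. ALL y:spc B v. k v (h' v (p v (t v y))) + q v (t v y) = y" "rep_inj B t" "rep_surj B B t"
    using rep_hom_inverse[OF B tt bij] by blast
   note t = t[rule_format]
   have "p v (t v (k v (h' v x))) = x" if x: "x : U v" for v x
    using t(2)[OF UB[OF x]] assms(10)[OF x] assms(12)[OF x] by simp
   thus "split_mono Q ?X Z h'"
    using split_monoI[OF h' rep_hom_comp[OF k(1) rep_hom_comp[OF t(1) assms(7)]]] by simp
  qed
 qed
qed

end

declare minus_apply [simp del] uminus_apply [simp del]

section \<open>Extensions and the connection map of an almost split sequence\<close>

text \<open>\<open>et\<close> describes the extension of \<open>X\<close> by \<open>L\<close> on \<open>L \<oplus> X\<close> in which the arrow \<open>a\<close> acts by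
 \<open>(l, x) \<mapsto> (a l + et a x, a x)\<close>; it splits iff \<open>et\<close> is a coboundary.\<close>

definition cocycle ::
  "('v, 'a) quiver => ('v, 'a) quiver_rep => ('v, 'a) quiver_rep => ('a => cvec => cvec) => bool" where
 "cocycle Q X L et \<longleftrightarrow> (ALL a. linear_from_to (spc X (src Q a)) (spc L (tgt Q a)) (et a))"

definition coboundary ::
  "('v, 'a) quiver => ('v, 'a) quiver_rep => ('v, 'a) quiver_rep => ('a => cvec => cvec) => bool" where
 "coboundary Q X L et \<longleftrightarrow> (EX ps. (ALL v. linear_from_to (spc X v) (spc L v) (ps v)) &
   (ALL a. ALL x:spc X (src Q a). et a x = act L a (ps (src Q a) x) - ps (tgt Q a) (act X a x)))"

lemma diff_swap: "a - b = c - d ==> b - d = a - (c :: 'b :: ab_group_add)"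
 by (simp add: algebra_simps)

lemma lft_plus: "cv.subspace W ==> linear_from_to V W f ==> linear_from_to V W g ==>
  linear_from_to V W (%x. f x + g x)"
 unfolding linear_from_to_def by (simp add: cv.subspace_add cv.scale_right_distrib algebra_simps)

lemma lft_minus: "cv.subspace W ==> linear_from_to V W f ==> linear_from_to V W g ==>
  linear_from_to V W (%x. f x - g x)"
 unfolding linear_from_to_def by (simp add: cv.subspace_diff cv.scale_right_diff_distrib algebra_simps)

lemma lft_scaled: "cv.subspace W ==> linear_from_to V W f ==> linear_from_to V W (%x. cscale c (f x))"
 unfolding linear_from_to_def by (simp add: cv.subspace_scale cv.scale_right_distrib mult.commute)

lemma lft_0: "cv.subspace W ==> linear_from_to V W (%x. 0)"
 unfolding linear_from_to_def by (simp add: cv.subspace_0)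

lemma coboundary_zero:
 assumes "is_rep Q X" "is_rep Q L" "!!a x. x : spc X (src Q a) ==> tt a x = 0"
 shows "coboundary Q X L tt"
 unfolding coboundary_def
 by (rule exI[of _ "%v x. 0"]) (simp add: assms lft_0 rep_subspace[OF assms(2)] rep_act_0[OF assms(2)])

lemma coboundary_add:
 assumes L: "is_rep Q L" and "coboundary Q X L tt" "coboundary Q X L tt'"
 shows "coboundary Q X L (%a x. tt a x + tt' a x)"
proof -
 obtain ps where ps: "ALL v. linear_from_to (spc X v) (spc L v) (ps v)"
  "ALL a. ALL x:spc X (src Q a). tt a x = act L a (ps (src Q a) x) - ps (tgt Q a) (act X a x)"
  using assms(2) unfolding coboundary_def by blast
 obtain ps' where ps': "ALL v. linear_from_to (spc X v) (spc L v) (ps' v)"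
  "ALL a. ALL x:spc X (src Q a). tt' a x = act L a (ps' (src Q a) x) - ps' (tgt Q a) (act X a x)"
  using assms(3) unfolding coboundary_def by blast
 show ?thesis
  unfolding coboundary_def
 proof (intro exI[of _ "%v x. ps v x + ps' v x"] conjI allI ballI)
  show "linear_from_to (spc X v) (spc L v) (%x. ps v x + ps' v x)" for v
   using ps(1) ps'(1) by (intro lft_plus rep_subspace[OF L]) auto
  show "tt a x + tt' a x = act L a (ps (src Q a) x + ps' (src Q a) x) -
    (ps (tgt Q a) (act X a x) + ps' (tgt Q a) (act X a x))" if x: "x : spc X (src Q a)" for a x
   using ps(2) ps'(2) x rep_act_add[OF L lft_mem[OF ps(1)[rule_format] x] lft_mem[OF ps'(1)[rule_format] x]]
   by simp
 qed
qed

lemma coboundary_scale: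
 assumes L: "is_rep Q L" and "coboundary Q X L tt"
 shows "coboundary Q X L (%a x. cscale c (tt a x))"
proof -
 obtain ps where ps: "ALL v. linear_from_to (spc X v) (spc L v) (ps v)"
  "ALL a. ALL x:spc X (src Q a). tt a x = act L a (ps (src Q a) x) - ps (tgt Q a) (act X a x)"
  using assms(2) unfolding coboundary_def by blast
 show ?thesis
  unfolding coboundary_def
 proof (intro exI[of _ "%v x. cscale c (ps v x)"] conjI allI ballI)
  show "linear_from_to (spc X v) (spc L v) (%x. cscale c (ps v x))" for v
   using ps(1) by (intro lft_scaled rep_subspace[OF L]) auto
  show "cscale c (tt a x) = act L a (cscale c (ps (src Q a) x)) - cscale c (ps (tgt Q a) (act X a x))"
   if x: "x : spc X (src Q a)" for a x
   using ps(2) x rep_act_scale[OF L lft_mem[OF ps(1)[rule_format] x]]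
   by (simp add: cv.scale_right_diff_distrib)
 qed
qed

definition dual_basis :: "cvec set => cvec set => (cvec => cvec => complex) => bool" where
 "dual_basis V B c \<longleftrightarrow> finite B & B <= V & (ALL b. cfunctional (c b)) &
   (ALL x:V. (SUM b:B. cscale (c b x) b) = x)"

lemma dual_basis_exists:
 assumes "fd_space V" shows "EX B c. dual_basis V B c"
proof (rule fd_coordinates[OF assms])
 fix B c
 assume "finite B" "B <= V" "!!b. cfunctional (c b)" "!!x. x : V ==> x = (SUM b:B. cscale (c b x) b)"
 hence "dual_basis V B c" unfolding dual_basis_def by metis
 thus ?thesis by blast
qed

text \<open>\<open>Ph\<close> is an element of the dual of Ext^1(X, L). It is given on all families
  of functions, linear or not; a family that is zero on \<open>X\<close> is a coboundary, so
  \<open>Ph\<close> depends only on values on \<open>X\<close> (\<open>Ph_cong\<close>). The dual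
  bases serve to write it as a trace.\<close>

locale cocycle_functional =
 fixes Q :: "('v::finite, 'a::finite) quiver" and X L :: "('v, 'a) quiver_rep"
  and Ph :: "('a => cvec => cvec) => complex"
  and BX BL :: "'v => cvec set" and cX cL :: "'v => cvec => cvec => complex"
 assumes X: "is_rep Q X" and L: "is_rep Q L"
  and Ph_add: "!!tt tt'. Ph (%a x. tt a x + tt' a x) = Ph tt + Ph tt'"
  and Ph_scale: "!!c tt. Ph (%a x. cscale c (tt a x)) = c * Ph tt"
  and Ph_coboundary: "!!tt. coboundary Q X L tt ==> Ph tt = 0"
  and BX: "!!v. dual_basis (spc X v) (BX v) (cX v)" and BL: "!!v. dual_basis (spc L v) (BL v) (cL v)"
begin

lemma Ph_diff: "Ph (%a x. tt a x - tt' a x) = Ph tt - Ph tt'"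
 using Ph_add[of tt "%a x. cscale (-1) (tt' a x)"] Ph_scale[of "-1" tt'] by simp

lemma Ph_cong:
 assumes "!!a x. x : spc X (src Q a) ==> tt a x = tt' a x" shows "Ph tt = Ph tt'"
proof -
 have "coboundary Q X L (%a x. tt a x - tt' a x)"
  by (rule coboundary_zero[OF X L]) (simp add: assms)
 thus ?thesis using Ph_coboundary Ph_diff[of tt tt'] by simp
qed

lemma Ph_zero: "Ph (%a x. 0) = 0"
 by (rule Ph_coboundary[OF coboundary_zero[OF X L]]) simp

lemma Ph_sum: "Ph (%a x. SUM i:A. tt i a x) = (SUM i:A. Ph (tt i))"
 by (induction A rule: infinite_finite_induct) (simp_all add: Ph_zero Ph_add)

definition rk :: "'a => (cvec => complex) => cvec => 'a => cvec => cvec" where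
 "rk a ph l b x = (if b = a then cscale (ph x) l else 0)"

text \<open>The matrices that represent \<open>Ph\<close> under the trace pairing: the value of
  \<open>Ph\<close> on the rank-one map \<open>ph\<close> times \<open>l\<close> at the arrow
  \<open>a\<close> is \<open>ph (h a l)\<close>, see \<open>Ph_rk'\<close>.\<close>

definition h :: "'a => cvec => cvec" where
 "h a l = (SUM b:BX (src Q a). cscale (Ph (rk a (cX (src Q a) b) l)) b)"

lemma BX_mem: "b : BX v ==> b : spc X v"
 using BX[of v] by (auto simp: dual_basis_def)

lemma BX_expand: "x : spc X v ==> (SUM b:BX v. cscale (cX v b x) b) = x"
 using BX[of v] by (simp add: dual_basis_def)

lemma BL_mem: "b : BL v ==> b : spc L v"
 using BL[of v] by (auto simp: dual_basis_def)

lemma BL_expand: "x : spc L v ==> (SUM b:BL v. cscale (cL v b x) b) = x"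
 using BL[of v] by (simp add: dual_basis_def)

lemma cX_functional: "cfunctional (cX v b)" and cL_functional: "cfunctional (cL v b)"
 using BX[of v] BL[of v] by (simp_all add: dual_basis_def)

lemma h_mem: "h a l : spc X (src Q a)"
 unfolding h_def
 by (intro cv.subspace_sum cv.subspace_scale rep_subspace[OF X] BX_mem)

lemma rk_add: "Ph (rk a ph (l + l')) = Ph (rk a ph l) + Ph (rk a ph l')"
proof -
 have "rk a ph (l + l') = (%b x. rk a ph l b x + rk a ph l' b x)"
  by (auto simp: rk_def fun_eq_iff cv.scale_right_distrib)
 thus ?thesis by (simp only: Ph_add)
qed

lemma rk_scale: "Ph (rk a ph (cscale c l)) = c * Ph (rk a ph l)"
proof -
 have "rk a ph (cscale c l) = (%b x. cscale c (rk a ph l b x))"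
  by (intro ext) (simp add: rk_def mult.commute)
 thus ?thesis by (simp only: Ph_scale)
qed

lemma h_linear: "linear_from_to V (spc X (src Q a)) (h a)"
proof (rule linear_from_toI)
 show "h a (l + l') = h a l + h a l'" for l l'
  by (simp add: h_def rk_add cv.scale_left_distrib sum.distrib)
 show "h a (cscale c l) = cscale c (h a l)" for c l
  by (simp add: h_def rk_scale cv.scale_sum_right)
qed (rule h_mem)

lemma Ph_rk:
 assumes f: "linear_from_to (spc X (src Q a)) W f" and d: "cfunctional d"
 shows "Ph (rk a (%x. d (f x)) l) = d (f (h a l))"
proof -
 let ?B = "BX (src Q a)" and ?c = "cX (src Q a)"
 have sum: "d (f (SUM b:?B. cscale (u b) b)) = (SUM b:?B. u b * d (f b))" for u
 proof -
  have "f (SUM b:?B. cscale (u b) b) = (SUM b:?B. f (cscale (u b) b))"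
   by (rule lft_sum[OF f rep_subspace[OF X]]) (intro cv.subspace_scale rep_subspace[OF X] BX_mem)
  also have "... = (SUM b:?B. cscale (u b) (f b))"
   by (intro sum.cong refl lft_scale[OF f] BX_mem)
  finally show ?thesis using d by (simp add: cfunctional_sum cfunctional_iff)
 qed
 have "Ph (rk a (%x. d (f x)) l) = Ph (%a' x. SUM b:?B. cscale (d (f b)) (rk a (?c b) l a' x))"
 proof (rule Ph_cong)
  fix a' x assume x: "x : spc X (src Q a')"
  show "rk a (%x. d (f x)) l a' x = (SUM b:?B. cscale (d (f b)) (rk a (?c b) l a' x))"
  proof (cases "a' = a")
   case True
   hence "d (f x) = (SUM b:?B. d (f b) * ?c b x)"
    using sum[of "%b. ?c b x"] BX_expand[of x "src Q a"] x by (simp add: mult.commute)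
   thus ?thesis using True by (simp add: rk_def cv.scale_sum_left)
  qed (simp add: rk_def)
 qed
 also have "... = (SUM b:?B. d (f b) * Ph (rk a (?c b) l))"
  by (simp add: Ph_sum Ph_scale)
 also have "... = d (f (h a l))" by (simp add: h_def sum mult.commute)
 finally show ?thesis .
qed

lemma Ph_rk': "cfunctional d ==> Ph (rk a d l) = d (h a l)"
 using Ph_rk[of a UNIV "%x. x" d l] by (simp add: linear_from_to_def)

text \<open>Evaluate \<open>Ph\<close> on the coboundary of the rank-one map \<open>ph\<close> times
  \<open>l\<close> at the vertex \<open>v\<close>. The result is the preprojective relation at
  \<open>v\<close>, tested with \<open>ph\<close>.\<close>

lemma h_closed:
 assumes l: "l : spc L v"
 shows "(SUM a | src Q a = v. h a (act L a l)) = (SUM a | tgt Q a = v. act X a (h a l))"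
proof (rule functional_separates)
 fix ph assume ph: "cfunctional ph"
 define ps where "ps u x = (if u = v then cscale (ph x) l else 0)" for u x
 let ?d = "%a x. act L a (ps (src Q a) x) - ps (tgt Q a) (act X a x)"
 have "linear_from_to (spc X u) (spc L u) (ps u)" for u
  unfolding ps_def using ph l
  by (auto simp: linear_from_to_def cfunctional_iff cv.scale_left_distrib
    intro: cv.subspace_scale[OF rep_subspace[OF L]] cv.subspace_0[OF rep_subspace[OF L]])
 hence "coboundary Q X L ?d" unfolding coboundary_def by (intro exI[of _ ps]) simp
 hence "0 = Ph ?d" using Ph_coboundary by simp
 also have "... = Ph (%a x. (SUM b | src Q b = v. rk b ph (act L b l) a x) -
   (SUM b | tgt Q b = v. rk b (%x. ph (act X b x)) l a x))"
 proof (rule Ph_cong)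
  fix a x assume "x : spc X (src Q a)"
  have "(SUM b | src Q b = v. rk b ph (act L b l) a x) = (if src Q a = v then cscale (ph x) (act L a l) else 0)"
   unfolding rk_def by (subst sum.delta') auto
  moreover have "(SUM b | tgt Q b = v. rk b (%x. ph (act X b x)) l a x) =
    (if tgt Q a = v then cscale (ph (act X a x)) l else 0)"
   unfolding rk_def by (subst sum.delta') auto
  ultimately show "?d a x = (SUM b | src Q b = v. rk b ph (act L b l) a x) -
    (SUM b | tgt Q b = v. rk b (%x. ph (act X b x)) l a x)"
   using l by (auto simp: ps_def rep_act_0[OF L] rep_act_scale[OF L])
 qed
 also have "... = (SUM b | src Q b = v. ph (h b (act L b l))) - (SUM b | tgt Q b = v. ph (act X b (h b l)))"
  by (simp only: Ph_diff Ph_sum Ph_rk'[OF ph] Ph_rk[OF rep_act[OF X] ph])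
 finally show "ph (SUM a | src Q a = v. h a (act L a l)) = ph (SUM a | tgt Q a = v. act X a (h a l))"
  by (simp add: cfunctional_sum[OF ph])
qed

text \<open>The traces of \<open>tt a\<close> after \<open>h a\<close>, taken on \<open>L\<close>;
  \<open>Ph_trace2\<close> takes the composites in the other order, on \<open>X\<close>. Each of the
  two forms shows that one of the composites is nonzero.\<close>

lemma Ph_trace1:
 assumes "cocycle Q X L tt"
 shows "Ph tt = (SUM a:UNIV. SUM j:BL (tgt Q a). cL (tgt Q a) j (tt a (h a j)))"
proof -
 have tt: "linear_from_to (spc X (src Q a)) (spc L (tgt Q a)) (tt a)" for a
  using assms by (simp add: cocycle_def)
 have "Ph tt = Ph (%a x. SUM b:UNIV. SUM j:BL (tgt Q b). rk b (%x. cL (tgt Q b) j (tt b x)) j a x)"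
 proof (rule Ph_cong)
  fix a x assume x: "x : spc X (src Q a)"
  have "(SUM b:UNIV. SUM j:BL (tgt Q b). rk b (%x. cL (tgt Q b) j (tt b x)) j a x)
    = (SUM b:UNIV. if a = b then (SUM j:BL (tgt Q b). cscale (cL (tgt Q b) j (tt b x)) j) else 0)"
   by (intro sum.cong) (auto simp: rk_def)
  also have "... = tt a x" using BL_expand[OF lft_mem[OF tt x]] by simp
  finally show "tt a x = (SUM b:UNIV. SUM j:BL (tgt Q b). rk b (%x. cL (tgt Q b) j (tt b x)) j a x)" by simp
 qed
 thus ?thesis by (simp only: Ph_sum Ph_rk[OF tt cL_functional])
qed

lemma Ph_trace2:
 assumes "cocycle Q X L tt"
 shows "Ph tt = (SUM a:UNIV. SUM b:BX (src Q a). cX (src Q a) b (h a (tt a b)))"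
proof -
 have tt: "linear_from_to (spc X (src Q a)) (spc L (tgt Q a)) (tt a)" for a
  using assms by (simp add: cocycle_def)
 have "Ph tt = Ph (%a x. SUM a':UNIV. SUM b:BX (src Q a'). rk a' (cX (src Q a') b) (tt a' b) a x)"
 proof (rule Ph_cong)
  fix a x assume x: "x : spc X (src Q a)"
  have "(SUM a':UNIV. SUM b:BX (src Q a'). rk a' (cX (src Q a') b) (tt a' b) a x)
    = (SUM a':UNIV. if a = a' then (SUM b:BX (src Q a'). cscale (cX (src Q a') b x) (tt a' b)) else 0)"
   by (intro sum.cong) (auto simp: rk_def)
  also have "... = (SUM b:BX (src Q a). cscale (cX (src Q a) b x) (tt a b))" by simp
  also have "... = (SUM b:BX (src Q a). tt a (cscale (cX (src Q a) b x) b))"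
   by (intro sum.cong refl lft_scale[OF tt, symmetric] BX_mem)
  also have "... = tt a (SUM b:BX (src Q a). cscale (cX (src Q a) b x) b)"
   by (rule lft_sum[OF tt rep_subspace[OF X], symmetric]) (intro cv.subspace_scale rep_subspace[OF X] BX_mem)
  finally show "tt a x = (SUM a':UNIV. SUM b:BX (src Q a'). rk a' (cX (src Q a') b) (tt a' b) a x)"
   using BX_expand[OF x] by simp
 qed
 thus ?thesis by (simp only: Ph_sum Ph_rk'[OF cX_functional])
qed

end

text \<open>The functional is 1 on \<open>et\<close>, hence on every cohomologous cocycle. As a sum
  of traces it would vanish if the composite with \<open>h\<close> on either side were zero. So a
  single \<open>h\<close> testifies for the whole class.\<close>

lemma certificate:
 fixes Q :: "('v::finite, 'a::finite) quiver"
 assumes X: "is_rep Q X" and L: "is_rep Q L" and et: "~ coboundary Q X L et"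
 shows "EX h. (ALL a. linear_from_to (spc L (tgt Q a)) (spc X (src Q a)) (h a)) &
  (ALL v. ALL l:spc L v. (SUM a | src Q a = v. h a (act L a l)) = (SUM a | tgt Q a = v. act X a (h a l))) &
  (ALL tt. cocycle Q X L tt & coboundary Q X L (%a x. et a x - tt a x) -->
   (EX a. EX l:spc L (tgt Q a). tt a (h a l) ~= 0) & (EX a. EX x:spc X (src Q a). h a (tt a x) ~= 0))"
proof -
 let ?s = "%c (tt :: 'a => cvec => cvec). %a x. cscale c (tt a x)"
 have vs: "vector_space ?s"
  by unfold_locales (auto simp: fun_eq_iff plus_fun_apply cscale_def algebra_simps)
 interpret F: vector_space ?s by (rule vs)
 have "F.subspace {tt. coboundary Q X L tt}"
 proof (rule F.subspaceI)
  show "0 : {tt. coboundary Q X L tt}" using coboundary_zero[OF X L] by (simp add: zero_fun_apply)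
  show "x + y : {tt. coboundary Q X L tt}"
   if "x : {tt. coboundary Q X L tt}" "y : {tt. coboundary Q X L tt}" for x y
   using coboundary_add[OF L, of X x y] that by (simp add: plus_fun_def)
  show "?s c x : {tt. coboundary Q X L tt}" if "x : {tt. coboundary Q X L tt}" for c x
   using coboundary_scale[OF L, of X x c] that by simp
 qed
 moreover have "et ~: {tt. coboundary Q X L tt}" using et by simp
 ultimately have "EX Ph. Vector_Spaces.linear ?s (*) Ph & (ALL tt. coboundary Q X L tt --> Ph tt = 0) & Ph et = 1"
  using separating_functional_general[OF vs, of "{tt. coboundary Q X L tt}" et] by auto
 then obtain Ph where Ph: "Vector_Spaces.linear ?s (*) Ph" "ALL tt. coboundary Q X L tt --> Ph tt = 0" "Ph et = 1"
  by blast
 have add: "Ph (%a x. tt a x + tt' a x) = Ph tt + Ph tt'" for tt tt'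
 proof -
  have "(%a x. tt a x + tt' a x) = tt + tt'" by (simp add: plus_fun_def)
  thus ?thesis using Ph(1) unfolding Vector_Spaces.linear_iff by simp
 qed
 have scale: "Ph (%a x. cscale c (tt a x)) = c * Ph tt" for c tt
  using Ph(1) unfolding Vector_Spaces.linear_iff by simp
 obtain BX cX where BX: "!!v. dual_basis (spc X v) (BX v) (cX v)"
  using dual_basis_exists[OF rep_fd[OF X]] by metis
 obtain BL cL where BL: "!!v. dual_basis (spc L v) (BL v) (cL v)"
  using dual_basis_exists[OF rep_fd[OF L]] by metis
 interpret cocycle_functional Q X L Ph BX BL cX cL
  by unfold_locales (use X L add scale Ph(2) BX BL in auto)
 have one: "Ph tt = 1" if "coboundary Q X L (%a x. et a x - tt a x)" for tt
  using Ph_coboundary[OF that] Ph_diff[of et tt] Ph(3) by simp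
 show ?thesis
 proof (intro exI[of _ h] conjI allI ballI impI)
  show "linear_from_to (spc L (tgt Q a)) (spc X (src Q a)) (h a)" for a by (rule h_linear)
  show "(SUM a | src Q a = v. h a (act L a l)) = (SUM a | tgt Q a = v. act X a (h a l))" if "l : spc L v" for v l
   using that by (rule h_closed)
  fix tt assume *: "cocycle Q X L tt & coboundary Q X L (%a x. et a x - tt a x)"
  show "EX a. EX l:spc L (tgt Q a). tt a (h a l) ~= 0"
  proof (rule ccontr)
   assume "~ ?thesis"
   hence "tt a (h a j) = 0" if "j : BL (tgt Q a)" for a j using BL_mem[OF that] by blast
   hence "Ph tt = 0" using Ph_trace1[of tt] * by (simp add: cfunctional_0[OF cL_functional])
   thus False using one[of tt] * by simp
  qed
  show "EX a. EX x:spc X (src Q a). h a (tt a x) ~= 0"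
  proof (rule ccontr)
   assume "~ ?thesis"
   hence "h a (tt a b) = 0" if "b : BX (src Q a)" for a b using BX_mem[OF that] by blast
   hence "Ph tt = 0" using Ph_trace2[of tt] * by (simp add: cfunctional_0[OF cX_functional])
   thus False using one[of tt] * by simp
  qed
 qed
qed

text \<open>What is kept of the relation between \<open>L\<close> and its inverse translate
  \<open>N\<close>: the preprojective relations, and two conditions that stand for injectivity of
  the map from \<open>L\<close> to tau \<open>N\<close> encoded by \<open>h\<close> and surjectivity
  of its adjoint.\<close>

definition connection ::
  "('v::finite, 'a::finite) quiver => ('v, 'a) quiver_rep => ('v, 'a) quiver_rep => ('a => cvec => cvec) => bool" where
 "connection Q L N h \<longleftrightarrow> (ALL a. linear_from_to (spc L (tgt Q a)) (spc N (src Q a)) (h a)) &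
  (ALL v. ALL l:spc L v. (SUM a | src Q a = v. h a (act L a l)) = (SUM a | tgt Q a = v. act N a (h a l))) &
  (ALL K. submodule Q L K & (ALL a. ALL l:K (tgt Q a). h a l = 0) --> K = zero_fam) &
  (ALL W. submodule Q N W & (ALL a. ALL l:spc L (tgt Q a). h a l : W (src Q a)) --> W = spc N)"

context almost_split
begin

lemma connection_exists: "EX h. connection Q L N h"
proof -
 have "EX s. clinear s & (ALL x. s x : spc B v) & (ALL y:spc N v. g v (s y) = y)" for v
  using section_exists[OF hom_linear[OF g] rep_subspace[OF B] rep_subspace[OF N]] g_surj
  unfolding rep_surj_def by metis
 then obtain si where si: "!!v. clinear (si v)" "!!v x. si v x : spc B v" "!!v y. y : spc N v ==> g v (si v y) = y"
  by metis
 have "EX r. clinear r & (ALL x. r x : spc L v) & (ALL x:spc L v. r (f v x) = x)" for v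
  using retraction_exists[OF hom_linear[OF f] rep_subspace[OF L] rep_subspace[OF B]] f_inj
  unfolding rep_inj_def by metis
 then obtain r where r: "!!v. clinear (r v)" "!!v x. r v x : spc L v" "!!v x. x : spc L v ==> r v (f v x) = x"
  by metis
 have fr: "f v (r v b) = b" if "b : spc B v" "g v b = 0" for v b
  using exactD[OF that] r(3) by auto
 \<comment> \<open>The cocycle of the sequence: the failure of the sections \<open>si\<close> to
   commute with the arrows, read in \<open>L\<close>.\<close>
 define ep where "ep a x = r (tgt Q a) (act B a (si (src Q a) x) - si (tgt Q a) (act N a x))" for a x
 have dB: "act B a (si (src Q a) x) - si (tgt Q a) (act N a x) : spc B (tgt Q a)" for a x
  using si(2) by (simp add: cv.subspace_diff rep_subspace[OF B] rep_act_mem[OF B])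
 have fep: "f (tgt Q a) (ep a x) = act B a (si (src Q a) x) - si (tgt Q a) (act N a x)"
  if x: "x : spc N (src Q a)" for a x
 proof -
  have "g (tgt Q a) (act B a (si (src Q a) x) - si (tgt Q a) (act N a x)) = 0"
   using x si by (simp add: hom_diff[OF B g] rep_act_mem[OF B] rep_act_mem[OF N] hom_commute[OF g])
  thus ?thesis unfolding ep_def by (rule fr[OF dB])
 qed
 have ep_lin: "linear_from_to (spc N (src Q a)) (spc L (tgt Q a)) (ep a)" for a
 proof -
  have 1: "linear_from_to (spc N (src Q a)) (spc B (tgt Q a)) (%x. act B a (si (src Q a) x))"
   by (rule lft_comp[OF clinear_imp_linear_from_to[OF si(1) si(2)] rep_act[OF B]])
  have 2: "linear_from_to (spc N (src Q a)) (spc B (tgt Q a)) (%x. si (tgt Q a) (act N a x))"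
   by (rule lft_comp[OF rep_act[OF N] clinear_imp_linear_from_to[OF si(1) si(2)]])
  show ?thesis unfolding ep_def
   by (rule lft_comp[OF lft_minus[OF rep_subspace[OF B] 1 2] clinear_imp_linear_from_to[OF r(1) r(2)]])
 qed
 have nc: "~ coboundary Q N L ep"
 proof
  assume "coboundary Q N L ep"
  then obtain ps where ps: "ALL v. linear_from_to (spc N v) (spc L v) (ps v)"
   "ALL a. ALL x:spc N (src Q a). ep a x = act L a (ps (src Q a) x) - ps (tgt Q a) (act N a x)"
   unfolding coboundary_def by blast
  have psm: "ps v x : spc L v" if "x : spc N v" for v x using lft_mem[OF ps(1)[rule_format] that] .
  have "rep_hom Q N B (%v x. si v x - f v (ps v x))"
  proof (rule rep_homI)
   show "linear_from_to (spc N v) (spc B v) (%x. si v x - f v (ps v x))" for v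
    by (intro lft_minus rep_subspace[OF B] clinear_imp_linear_from_to si lft_comp[OF _ hom_linear[OF f]] ps(1)[rule_format])
   fix a x assume x: "x : spc N (src Q a)"
   have "act B a (si (src Q a) x) - si (tgt Q a) (act N a x)
     = f (tgt Q a) (act L a (ps (src Q a) x)) - f (tgt Q a) (ps (tgt Q a) (act N a x))"
    using fep[OF x] ps(2) x psm[OF x] psm[OF rep_act_mem[OF N x]]
    by (simp add: hom_diff[OF L f] rep_act_mem[OF L])
   also have "f (tgt Q a) (act L a (ps (src Q a) x)) = act B a (f (src Q a) (ps (src Q a) x))"
    by (rule hom_commute[OF f psm[OF x]])
   finally show "si (tgt Q a) (act N a x) - f (tgt Q a) (ps (tgt Q a) (act N a x)) =
     act B a (si (src Q a) x - f (src Q a) (ps (src Q a) x))"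
    unfolding rep_act_diff[OF B si(2) hom_mem[OF f psm[OF x]]]
    by (rule diff_swap)
  qed
  moreover have "g v (si v x - f v (ps v x)) = x" if "x : spc N v" for v x
   using that si psm hom_mem[OF f psm[OF that]] by (simp add: hom_diff[OF B g])
  ultimately show False using split_epiI[OF g] not_split_epi by blast
 qed
 obtain h where h: "ALL a. linear_from_to (spc L (tgt Q a)) (spc N (src Q a)) (h a)"
  "ALL v. ALL l:spc L v. (SUM a | src Q a = v. h a (act L a l)) = (SUM a | tgt Q a = v. act N a (h a l))"
  "ALL tt. cocycle Q N L tt & coboundary Q N L (%a x. ep a x - tt a x) -->
   (EX a. EX l:spc L (tgt Q a). tt a (h a l) ~= 0) & (EX a. EX x:spc N (src Q a). h a (tt a x) ~= 0)"
  using certificate[OF N L nc] by blast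
 have shift: "cocycle Q N L (%a x. ep a x - (act L a (ps (src Q a) x) - ps (tgt Q a) (act N a x))) &
   coboundary Q N L (%a x. ep a x - (ep a x - (act L a (ps (src Q a) x) - ps (tgt Q a) (act N a x))))"
  if ps: "!!v. linear_from_to (spc N v) (spc L v) (ps v)" for ps
 proof
  show "cocycle Q N L (%a x. ep a x - (act L a (ps (src Q a) x) - ps (tgt Q a) (act N a x)))"
   unfolding cocycle_def
   by (intro allI lft_minus rep_subspace[OF L] ep_lin lft_comp[OF ps rep_act[OF L]] lft_comp[OF rep_act[OF N] ps])
  show "coboundary Q N L (%a x. ep a x - (ep a x - (act L a (ps (src Q a) x) - ps (tgt Q a) (act N a x))))"
   unfolding coboundary_def by (intro exI[of _ ps]) (use ps in auto)
 qed
 \<comment> \<open>If \<open>h\<close> kills \<open>K\<close>, extend the projection of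
   \<open>L\<close> to \<open>L / K\<close> to the middle term. The extension moves
   \<open>ep\<close> within its class to a cocycle with values in \<open>K\<close>, on which
   \<open>h\<close> vanishes; this contradicts the certificate.\<close>
 have K0: "K = zero_fam" if K: "submodule Q L K" and hK: "ALL a. ALL l:K (tgt Q a). h a l = 0" for K
 proof (rule ccontr)
  assume Kne: "K ~= zero_fam"
  obtain Y p where Y: "is_rep Q Y" and p: "rep_hom Q L Y p" "rep_surj L Y p" and ker: "!!v. {x : spc L v. p v x = 0} = K v"
   by (rule quotient_exists[OF L K]) blast
  have "~ split_mono Q L Y p"
  proof
   assume "split_mono Q L Y p"
   hence "rep_inj L p" by (rule split_mono_inj)
   hence "K v = {0}" for v
    using ker[of v] rep_inj_iff[OF L p(1)] submodule_mem[OF K] cv.subspace_0[OF submodule_subspace[OF K]] by blast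
   thus False using Kne by (auto simp: zero_fam_def fun_eq_iff)
  qed
  then obtain k where k: "rep_hom Q B Y k" "ALL v. ALL x:spc L v. k v (f v x) = p v x"
   using extend[OF Y p(1)] by blast
  have "EX s. clinear s & (ALL x. s x : spc L v) & (ALL y:spc Y v. p v (s y) = y)" for v
   using section_exists[OF hom_linear[OF p(1)] rep_subspace[OF L] rep_subspace[OF Y]] p(2)
   unfolding rep_surj_def by metis
  then obtain s where s: "!!v. clinear (s v)" "!!v x. s v x : spc L v" "!!v y. y : spc Y v ==> p v (s v y) = y"
   by metis
  define ps where "ps v x = s v (k v (si v x))" for v x
  have ps: "linear_from_to (spc N v) (spc L v) (ps v)" for v
   unfolding ps_def
   by (rule lft_comp[OF lft_comp[OF clinear_imp_linear_from_to[OF si(1) si(2)] hom_linear[OF k(1)]]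
    clinear_imp_linear_from_to[OF s(1) s(2)]])
  define tt where "tt a x = ep a x - (act L a (ps (src Q a) x) - ps (tgt Q a) (act N a x))" for a x
  have "tt a x : K (tgt Q a)" if x: "x : spc N (src Q a)" for a x
  proof -
   have epL: "ep a x : spc L (tgt Q a)" using lft_mem[OF ep_lin x] .
   have psL: "ps v y : spc L v" for v y unfolding ps_def by (rule s(2))
   have pps: "p v (ps v y) = k v (si v y)" for v y unfolding ps_def by (intro s(3) hom_mem[OF k(1)] si(2))
   have "p (tgt Q a) (ep a x) = k (tgt Q a) (act B a (si (src Q a) x) - si (tgt Q a) (act N a x))"
    using k(2) epL fep[OF x] by metis
   also have "... = act Y a (k (src Q a) (si (src Q a) x)) - k (tgt Q a) (si (tgt Q a) (act N a x))"
    using si(2) by (simp add: hom_diff[OF B k(1)] rep_act_mem[OF B] hom_commute[OF k(1)])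
   also have "... = p (tgt Q a) (act L a (ps (src Q a) x)) - p (tgt Q a) (ps (tgt Q a) (act N a x))"
    by (simp only: hom_commute[OF p(1) psL] pps)
   finally have "p (tgt Q a) (tt a x) = 0"
    unfolding tt_def using epL psL by (simp add: hom_diff[OF L p(1)] rep_act_mem[OF L] cv.subspace_diff rep_subspace[OF L])
   moreover have "tt a x : spc L (tgt Q a)"
    unfolding tt_def using epL psL by (simp add: rep_act_mem[OF L] cv.subspace_diff rep_subspace[OF L])
   ultimately show ?thesis using ker by blast
  qed
  hence "h a (tt a x) = 0" if "x : spc N (src Q a)" for a x using hK that by blast
  thus False using h(3)[rule_format, OF shift[OF ps]] unfolding tt_def by blast
 qed
 \<comment> \<open>Dually, a lift of the inclusion of \<open>W\<close> to the middle term moves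
   \<open>ep\<close> to a cocycle that vanishes on \<open>W\<close>, hence on all values of
   \<open>h\<close>.\<close>
 have W1: "W = spc N" if W: "submodule Q N W" and hW: "ALL a. ALL l:spc L (tgt Q a). h a l : W (src Q a)" for W
 proof (rule ccontr)
  assume Wne: "W ~= spc N"
  have incl: "rep_hom Q (subrep N W) N (%v x. x)" by (rule rep_hom_incl[OF W])
  have "~ split_epi Q (subrep N W) N (%v x. x)"
   using split_epi_surj[of Q "subrep N W" N "%v x. x"] Wne by (auto simp: rep_surj_def fun_eq_iff)
  then obtain k where k: "rep_hom Q (subrep N W) B k" "ALL v. ALL x:spc (subrep N W) v. g v (k v x) = x"
   using lift[OF is_rep_subrep[OF N W] incl] by blast
  have WN: "x : spc N v" if "x : W v" for v x using submodule_mem[OF W that] .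
  have kB: "k v x : spc B v" if "x : W v" for v x using hom_mem[OF k(1)] that by simp
  have "EX ps. clinear ps & (ALL x:W v. ps x = r v (si v x - k v x)) & (ALL x. ps x : spc L v)" for v
  proof -
   have 1: "linear_from_to (W v) (spc B v) (si v)" by (rule clinear_imp_linear_from_to[OF si(1) si(2)])
   have 2: "linear_from_to (W v) (spc B v) (k v)" using hom_linear[OF k(1), of v] by simp
   have "linear_from_to (W v) (spc L v) (%x. r v (si v x - k v x))"
    by (rule lft_comp[OF lft_minus[OF rep_subspace[OF B] 1 2] clinear_imp_linear_from_to[OF r(1) r(2)]])
   from linear_extension[OF this submodule_subspace[OF W] rep_subspace[OF L]] show ?thesis by metis
  qed
  then obtain ps where ps: "!!v. clinear (ps v)" "!!v x. x : W v ==> ps v x = r v (si v x - k v x)"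
   "!!v x. ps v x : spc L v" by metis
  have psl: "linear_from_to (spc N v) (spc L v) (ps v)" for v
   by (rule clinear_imp_linear_from_to[OF ps(1) ps(3)])
  have fps: "f v (ps v x) = si v x - k v x" if x: "x : W v" for v x
  proof -
   have "g v (si v x - k v x) = 0"
    using x k(2) si WN[OF x] kB[OF x] by (simp add: hom_diff[OF B g])
   thus ?thesis
    unfolding ps(2)[OF x] using si(2) kB[OF x] by (intro fr) (simp_all add: cv.subspace_diff rep_subspace[OF B])
  qed
  have zero: "ep a x - (act L a (ps (src Q a) x) - ps (tgt Q a) (act N a x)) = 0" if x: "x : W (src Q a)" for a x
  proof -
   have ax: "act N a x : W (tgt Q a)" by (rule submodule_act[OF W x])
   have eL: "ep a x : spc L (tgt Q a)" using lft_mem[OF ep_lin WN[OF x]] .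
   let ?z = "ep a x - (act L a (ps (src Q a) x) - ps (tgt Q a) (act N a x))"
   have zL: "?z : spc L (tgt Q a)" using eL ps(3) by (simp add: cv.subspace_diff rep_subspace[OF L] rep_act_mem[OF L])
   have "f (tgt Q a) ?z = f (tgt Q a) (ep a x) - (act B a (f (src Q a) (ps (src Q a) x)) - f (tgt Q a) (ps (tgt Q a) (act N a x)))"
    using eL ps(3) by (simp add: hom_diff[OF L f] rep_act_mem[OF L] cv.subspace_diff rep_subspace[OF L] hom_commute[OF f])
   also have "... = act B a (si (src Q a) x) - si (tgt Q a) (act N a x) -
     (act B a (si (src Q a) x) - act B a (k (src Q a) x) - (si (tgt Q a) (act N a x) - k (tgt Q a) (act N a x)))"
    by (simp only: fep[OF WN[OF x]] fps[OF x] fps[OF ax] rep_act_diff[OF B si(2) kB[OF x]])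
   also have "... = 0" using hom_commute[OF k(1), of x a] x by simp
   finally show ?thesis using f_inj rep_inj_iff[OF L f] zL by blast
  qed
  show False using h(3)[rule_format, OF shift[OF psl]] hW zero by blast
 qed
 show ?thesis
  unfolding connection_def using h(1,2) K0 W1 by (intro exI[of _ h]) blast
qed

end

section \<open>Existence of almost split sequences\<close>

subsection \<open>The representation defined by a cocycle\<close>

text \<open>All spaces consist of sequences, so a direct sum is encoded by interleaving two
  sequences.\<close>

definition cpair :: "cvec => cvec => cvec" where
 "cpair x y = (%n. if even n then x (n div 2) else y (n div 2))"

definition cfst :: "cvec => cvec" where "cfst z = (%n. z (2 * n))"

definition csnd :: "cvec => cvec" where "csnd z = (%n. z (Suc (2 * n)))"

lemma cfst_cpair [simp]: "cfst (cpair x y) = x" and csnd_cpair [simp]: "csnd (cpair x y) = y"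
 by (simp_all add: cpair_def cfst_def csnd_def fun_eq_iff)

lemma cpair_add: "cpair x y + cpair x' y' = cpair (x + x') (y + y')"
 by (auto simp: cpair_def plus_fun_apply fun_eq_iff)

lemma cpair_scale: "cscale c (cpair x y) = cpair (cscale c x) (cscale c y)"
 by (auto simp: cpair_def cscale_def fun_eq_iff)

lemma cfst_add: "cfst (x + y) = cfst x + cfst y"
 by (simp add: cfst_def plus_fun_apply fun_eq_iff)

lemma cfst_scale: "cfst (cscale c x) = cscale c (cfst x)"
 by (simp add: cfst_def cscale_def fun_eq_iff)

lemma cpair_0: "cpair 0 0 = 0"
 by (auto simp: cpair_def zero_fun_apply fun_eq_iff)

lemma cpair_eq_iff [simp]: "cpair x y = cpair x' y' \<longleftrightarrow> x = x' & y = y'"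
 by (metis cfst_cpair csnd_cpair)

lemma cpair_eq_0 [simp]: "cpair x y = 0 \<longleftrightarrow> x = 0 & y = 0"
 by (metis cpair_0 cpair_eq_iff)

lemma fd_cpair:
 assumes "fd_space V" "fd_space W" shows "fd_space {cpair x y |x y. x : V & y : W}"
proof -
 have "linear_from_to V UNIV (%x. cpair x 0)" "linear_from_to W UNIV (%y. cpair 0 y)"
  by (auto simp: linear_from_to_def cpair_add cpair_scale)
 hence "fd_space ((%x. cpair x 0) ` V)" "fd_space ((%y. cpair 0 y) ` W)"
  using assms by (auto intro: fd_image(1))
 then obtain A A' where A: "finite A" "(%x. cpair x 0) ` V = cv.span A" "finite A'" "(%y. cpair 0 y) ` W = cv.span A'"
  by (auto simp: fd_space_def)
 have "{cpair x y |x y. x : V & y : W} = {u + w |u w. u : (%x. cpair x 0) ` V & w : (%y. cpair 0 y) ` W}"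
  by (auto simp: cpair_add) (metis add.right_neutral add.left_neutral cpair_add image_eqI)
 also have "... = cv.span (A \<union> A')" by (simp only: cv.span_Un A)
 finally show ?thesis using A by (auto simp: fd_space_def)
qed

definition ext_rep :: "('v, 'a) quiver_rep => ('v, 'a) quiver_rep => ('a => cvec => cvec) => ('v, 'a) quiver_rep" where
 "ext_rep L X et = \<lparr>spc = (%v. {cpair l x |l x. l : spc L v & x : spc X v}),
   act = (%a z. cpair (act L a (cfst z) + et a (csnd z)) (act X a (csnd z)))\<rparr>"

lemma spc_ext_rep: "spc (ext_rep L X et) v = {cpair l x |l x. l : spc L v & x : spc X v}"
 by (simp add: ext_rep_def)

lemma act_ext_rep [simp]: "act (ext_rep L X et) a (cpair l x) = cpair (act L a l + et a x) (act X a x)"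
 by (simp add: ext_rep_def)

context
 fixes Q :: "('v::finite, 'a::finite) quiver" and L X et
 assumes L: "is_rep Q L" and X: "is_rep Q X" and et: "cocycle Q X L et"
begin

private lemma et_lin: "linear_from_to (spc X (src Q a)) (spc L (tgt Q a)) (et a)"
 using et by (simp add: cocycle_def)

lemma is_rep_ext_rep: "is_rep Q (ext_rep L X et)"
 unfolding is_rep_def
proof (intro conjI allI)
 show "fd_space (spc (ext_rep L X et) v)" for v
  by (simp add: spc_ext_rep fd_cpair rep_fd[OF L] rep_fd[OF X])
 show "linear_from_to (spc (ext_rep L X et) (src Q a)) (spc (ext_rep L X et) (tgt Q a)) (act (ext_rep L X et) a)" for a
  by (rule linear_from_toI)
   (auto simp: spc_ext_rep cpair_add cpair_scale rep_act_mem[OF X] rep_act_mem[OF L] lft_mem[OF et_lin]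
    rep_act_add[OF L] rep_act_add[OF X] rep_act_scale[OF L] rep_act_scale[OF X] lft_add[OF et_lin]
    lft_scale[OF et_lin] cv.scale_right_distrib algebra_simps cv.subspace_add[OF rep_subspace[OF L]])
qed

lemma ext_rep_incl: "rep_hom Q L (ext_rep L X et) (%v l. cpair l 0)"
proof (rule rep_homI)
 show "linear_from_to (spc L v) (spc (ext_rep L X et) v) (%l. cpair l 0)" for v
  by (rule linear_from_toI) (auto simp: spc_ext_rep cpair_add cpair_scale cv.subspace_0[OF rep_subspace[OF X]])
qed (simp add: rep_act_0[OF X] lft_zero[OF et_lin rep_subspace[OF X]])

lemma ext_rep_proj: "rep_hom Q (ext_rep L X et) X (%v. csnd)"
 by (rule rep_homI; (rule linear_from_toI)?) (auto simp: spc_ext_rep cpair_add cpair_scale)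

lemma coboundary_if_split_epi:
 assumes "split_epi Q (ext_rep L X et) X (%v. csnd)" shows "coboundary Q X L et"
proof -
 obtain s where s: "rep_hom Q X (ext_rep L X et) s" "ALL v. ALL x:spc X v. csnd (s v x) = x"
  using assms unfolding split_epi_iff by blast
 have sx: "s v x = cpair (cfst (s v x)) x & cfst (s v x) : spc L v" if "x : spc X v" for v x
  using hom_mem[OF s(1) that] s(2)[rule_format, OF that] by (auto simp: spc_ext_rep)
 define ps where "ps v x = - cfst (s v x)" for v x
 have "linear_from_to (spc X v) (spc L v) (ps v)" for v
 proof (rule linear_from_toI)
  show "ps v x : spc L v" if "x : spc X v" for x
   unfolding ps_def using sx[OF that] by (simp add: cv.subspace_neg rep_subspace[OF L])
  show "ps v (x + y) = ps v x + ps v y" if "x : spc X v" "y : spc X v" for x y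
   using hom_add[OF s(1) that] by (simp add: ps_def cfst_add)
  show "ps v (cscale c x) = cscale c (ps v x)" if "x : spc X v" for c x
   using hom_scale[OF s(1) that, of c] by (simp add: ps_def cfst_scale)
 qed
 moreover have "et a x = act L a (ps (src Q a) x) - ps (tgt Q a) (act X a x)" if x: "x : spc X (src Q a)" for a x
 proof -
  have "s (tgt Q a) (act X a x) = act (ext_rep L X et) a (cpair (cfst (s (src Q a) x)) x)"
   using hom_commute[OF s(1) x] sx[OF x] by simp
  hence "cfst (s (tgt Q a) (act X a x)) = act L a (cfst (s (src Q a) x)) + et a x" by simp
  moreover have "act L a (- cfst (s (src Q a) x)) = - act L a (cfst (s (src Q a) x))"
   using lft_neg[OF rep_act[OF L]] sx[OF x] by blast
  ultimately show ?thesis by (simp add: ps_def)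
 qed
 ultimately show ?thesis unfolding coboundary_def by blast
qed

lemma coboundary_if_split_mono:
 assumes "split_mono Q L (ext_rep L X et) (%v l. cpair l 0)" shows "coboundary Q X L et"
proof -
 obtain r where r: "rep_hom Q (ext_rep L X et) L r" "ALL v. ALL l:spc L v. r v (cpair l 0) = l"
  using assms unfolding split_mono_iff by blast
 have m: "cpair 0 x : spc (ext_rep L X et) v" if "x : spc X v" for v x
  using that cv.subspace_0[OF rep_subspace[OF L]] by (auto simp: spc_ext_rep)
 have m': "cpair l 0 : spc (ext_rep L X et) v" if "l : spc L v" for v l
  using that cv.subspace_0[OF rep_subspace[OF X]] by (auto simp: spc_ext_rep)
 define ps where "ps v x = r v (cpair 0 x)" for v x
 have ps: "linear_from_to (spc X v) (spc L v) (ps v)" for v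
 proof (rule linear_from_toI)
  show "ps v x : spc L v" if "x : spc X v" for x
   unfolding ps_def by (rule hom_mem[OF r(1) m[OF that]])
  show "ps v (x + y) = ps v x + ps v y" if "x : spc X v" "y : spc X v" for x y
   using hom_add[OF r(1) m[OF that(1)] m[OF that(2)]] by (simp add: ps_def cpair_add)
  show "ps v (cscale c x) = cscale c (ps v x)" if "x : spc X v" for c x
   using hom_scale[OF r(1) m[OF that], of c] by (simp add: ps_def cpair_scale)
 qed
 moreover have "et a x = act L a (ps (src Q a) x) - ps (tgt Q a) (act X a x)" if x: "x : spc X (src Q a)" for a x
 proof -
  have e: "et a x : spc L (tgt Q a)" and ax: "act X a x : spc X (tgt Q a)"
   using lft_mem[OF et_lin x] rep_act_mem[OF X x] by auto
  have "r (tgt Q a) (cpair (et a x) (act X a x)) = act L a (r (src Q a) (cpair 0 x))"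
   using hom_commute[OF r(1) m[OF x]] by (simp add: rep_act_0[OF L])
  moreover have "cpair (et a x) (act X a x) = cpair (et a x) 0 + cpair 0 (act X a x)" by (simp add: cpair_add)
  ultimately show ?thesis using hom_add[OF r(1) m'[OF e] m[OF ax]] r(2) e by (simp add: ps_def eq_diff_eq)
 qed
 ultimately show ?thesis unfolding coboundary_def by blast
qed

lemma nonsplit_exact_ext_rep:
 assumes "~ coboundary Q X L et"
 shows "nonsplit_exact Q L (ext_rep L X et) X (%v l. cpair l 0) (%v. csnd)"
proof unfold_locales
 show "rep_inj L (%v l. cpair l 0)" by (simp add: rep_inj_def inj_on_def)
 show "rep_surj (ext_rep L X et) X (%v. csnd)"
  using cv.subspace_0[OF rep_subspace[OF L]] unfolding rep_surj_def spc_ext_rep by force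
 show "(%l. cpair l 0) ` spc L v = {x : spc (ext_rep L X et) v. csnd x = 0}" for v
  using cv.subspace_0[OF rep_subspace[OF X]] unfolding spc_ext_rep by force
qed (use assms L X is_rep_ext_rep ext_rep_incl ext_rep_proj coboundary_if_split_mono coboundary_if_split_epi in auto)

end

subsection \<open>Almost split sequences from cocycles annihilated by the radical\<close>

definition pull :: "('v, 'a) quiver => ('v => cvec => cvec) => ('a => cvec => cvec) => 'a => cvec => cvec" where
 "pull Q f et = (%a x. et a (f (src Q a) x))"

lemma cocycle_pull: "rep_hom Q Y X f ==> cocycle Q X L et ==> cocycle Q Y L (pull Q f et)"
 unfolding cocycle_def pull_def by (intro allI lft_comp[OF hom_linear[of Q Y X f]]) auto

text \<open>\<open>rad\<close> says that the class dies along every non-split map into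
  \<open>X\<close>, which is the lifting property. The extension property then follows from it and
  the indecomposability of \<open>L\<close>.\<close>

lemma almost_split_seq_ext_rep:
 fixes Q :: "('v::finite, 'a::finite) quiver"
 assumes Lind: "indecomposable Q L" and X: "is_rep Q X" and et: "cocycle Q X L et" "~ coboundary Q X L et"
  and rad: "!!Y h. is_rep Q Y ==> rep_hom Q Y X h ==> ~ split_epi Q Y X h ==> coboundary Q Y L (pull Q h et)"
 shows "almost_split_seq Q L (ext_rep L X et) X (%v l. cpair l 0) (%v. csnd)"
proof -
 let ?B = "ext_rep L X et"
 have Lr: "is_rep Q L" using Lind by (rule indecomposable_rep)
 interpret nonsplit_exact Q L ?B X "%v l. cpair l 0" "%v. csnd"
  by (rule nonsplit_exact_ext_rep[OF Lr X et])
 have lift: "EX k. rep_hom Q Y ?B k & (ALL v. ALL y:spc Y v. csnd (k v y) = h v y)"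
  if Y: "is_rep Q Y" and h: "rep_hom Q Y X h" and ns: "~ split_epi Q Y X h" for Y h
 proof -
  obtain ps where ps: "ALL v. linear_from_to (spc Y v) (spc L v) (ps v)"
   "ALL a. ALL y:spc Y (src Q a). et a (h (src Q a) y) = act L a (ps (src Q a) y) - ps (tgt Q a) (act Y a y)"
   using rad[OF Y h ns] unfolding coboundary_def pull_def by blast
  note psl = ps(1)[rule_format]
  have neg: "- ps v y : spc L v" if "y : spc Y v" for v y
   using lft_mem[OF psl that] by (simp add: cv.subspace_neg rep_subspace[OF Lr])
  have "rep_hom Q Y ?B (%v y. cpair (- ps v y) (h v y))"
  proof (rule rep_homI)
   show "linear_from_to (spc Y v) (spc ?B v) (%y. cpair (- ps v y) (h v y))" for v
    by (rule linear_from_toI)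
     (use neg in \<open>auto simp: spc_ext_rep cpair_add cpair_scale hom_mem[OF h] hom_add[OF h] hom_scale[OF h]
      lft_add[OF psl] lft_scale[OF psl] algebra_simps\<close>)
   show "cpair (- ps (tgt Q a) (act Y a y)) (h (tgt Q a) (act Y a y)) = act ?B a (cpair (- ps (src Q a) y) (h (src Q a) y))"
    if y: "y : spc Y (src Q a)" for a y
    using ps(2) y lft_neg[OF rep_act[OF Lr] lft_mem[OF psl y]] by (simp add: hom_commute[OF h y])
  qed
  thus ?thesis by (intro exI[of _ "%v y. cpair (- ps v y) (h v y)"]) simp
 qed
 have extend: "EX k. rep_hom Q ?B Y k & (ALL v. ALL l:spc L v. k v (cpair l 0) = h v l)"
  if Y: "is_rep Q Y" and h: "rep_hom Q L Y h" and ns: "~ split_mono Q L Y h" for Y h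
 proof -
  let ?tt = "%a x. h (tgt Q a) (et a x)"
  have etm: "linear_from_to (spc X (src Q a)) (spc L (tgt Q a)) (et a)" for a
   using et(1) by (simp add: cocycle_def)
  have tt: "cocycle Q X Y ?tt"
   unfolding cocycle_def using lft_comp[OF etm hom_linear[OF h]] by blast
  \<comment> \<open>The pushout along \<open>h\<close>. If it does not split, its projection lifts
    to \<open>?B\<close>, and the composite \<open>?B\<close> to \<open>?B'\<close> to
    \<open>?B\<close> lies over the identity of \<open>X\<close>, so it is bijective. On
    \<open>L\<close> this makes \<open>h\<close> a split mono.\<close>
  let ?B' = "ext_rep Y X ?tt"
  have B': "is_rep Q ?B'" by (rule is_rep_ext_rep[OF Y X tt])
  have g': "rep_hom Q ?B' X (%v. csnd)" by (rule ext_rep_proj[OF Y X tt])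
  have "coboundary Q X Y ?tt"
  proof (rule ccontr)
   assume "~ coboundary Q X Y ?tt"
   hence "~ split_epi Q ?B' X (%v. csnd)" using coboundary_if_split_epi[OF Y X tt] by blast
   then obtain k where k: "rep_hom Q ?B' ?B k" "ALL v. ALL y:spc ?B' v. csnd (k v y) = csnd y"
    using lift[OF B' g'] by blast
   let ?j = "%v z. cpair (h v (cfst z)) (csnd z)"
   have jm: "?j v z : spc ?B' v" if "z : spc ?B v" for v z
    using that by (auto simp: spc_ext_rep hom_mem[OF h])
   have j: "rep_hom Q ?B ?B' ?j"
   proof (rule rep_homI)
    show "linear_from_to (spc ?B v) (spc ?B' v) (?j v)" for v
     by (rule linear_from_toI)
      (auto simp: spc_ext_rep cpair_add cpair_scale hom_mem[OF h] hom_add[OF h] hom_scale[OF h])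
    show "?j (tgt Q a) (act ?B a z) = act ?B' a (?j (src Q a) z)" if z: "z : spc ?B (src Q a)" for a z
     using z lft_mem[OF etm]
     by (auto simp: spc_ext_rep hom_commute[OF h] hom_add[OF h] rep_act_mem[OF Lr])
   qed
   let ?ka = "%v z. k v (?j v z)"
   have ka: "rep_hom Q ?B ?B ?ka" by (rule rep_hom_comp[OF j k(1)])
   have kag: "csnd (?ka v z) = csnd z" if "z : spc ?B v" for v z using k(2) jm[OF that] by simp
   have bij: "rep_inj ?B ?ka" "rep_surj ?B ?B ?ka" using endo_over[OF Lind ka kag] by blast+
   obtain t where t: "rep_hom Q ?B ?B t" "ALL v. ALL z:spc ?B v. t v (?ka v z) = z" "ALL v. ALL z:spc ?B v. ?ka v (t v z) = z"
    using rep_hom_inverse[OF B ka bij] by blast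
   have tg: "csnd (t v z) = csnd z" if z: "z : spc ?B v" for v z
    using kag[OF hom_mem[OF t(1) z]] t(3) z by simp
   have iY: "rep_hom Q Y ?B' (%v y. cpair y 0)" by (rule ext_rep_incl[OF Y X tt])
   let ?u = "%v y. t v (k v (cpair y 0))"
   have u: "rep_hom Q Y ?B ?u" by (rule rep_hom_comp[OF rep_hom_comp[OF iY k(1)] t(1)])
   have "?u v y : (%l. cpair l 0) ` spc L v" if y: "y : spc Y v" for v y
    unfolding exact using hom_mem[OF u y] tg[OF hom_mem[OF k(1) hom_mem[OF iY y]]] k(2) hom_mem[OF iY y] by simp
   then obtain s where s: "rep_hom Q Y L s" "ALL v. ALL y:spc Y v. cpair (s v y) 0 = ?u v y"
    using factor_through_inj[OF Lr Y f f_inj u] by blast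
   have "s v (h v l) = l" if l: "l : spc L v" for v l
   proof -
    have "cpair (s v (h v l)) 0 = t v (?ka v (cpair l 0))" using s(2) hom_mem[OF h l] by simp
    also have "... = cpair l 0" using t(2) hom_mem[OF f l] by blast
    finally show ?thesis by simp
   qed
   thus False using split_monoI[OF h s(1)] ns by blast
  qed
  then obtain ps where ps: "ALL v. linear_from_to (spc X v) (spc Y v) (ps v)"
   "ALL a. ALL x:spc X (src Q a). h (tgt Q a) (et a x) = act Y a (ps (src Q a) x) - ps (tgt Q a) (act X a x)"
   unfolding coboundary_def by blast
  note psl = ps(1)[rule_format]
  have "rep_hom Q ?B Y (%v z. h v (cfst z) + ps v (csnd z))"
  proof (rule rep_homI)
   show "linear_from_to (spc ?B v) (spc Y v) (%z. h v (cfst z) + ps v (csnd z))" for v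
    by (rule linear_from_toI)
     (auto simp: spc_ext_rep cpair_add cpair_scale hom_mem[OF h] hom_add[OF h] hom_scale[OF h]
      lft_add[OF psl] lft_scale[OF psl] lft_mem[OF psl] cv.scale_right_distrib algebra_simps
      intro: cv.subspace_add[OF rep_subspace[OF Y]])
   show "h (tgt Q a) (cfst (act ?B a z)) + ps (tgt Q a) (csnd (act ?B a z)) = act Y a (h (src Q a) (cfst z) + ps (src Q a) (csnd z))"
    if z: "z : spc ?B (src Q a)" for a z
    using z ps(2) lft_mem[OF etm] lft_mem[OF psl]
    by (auto simp: spc_ext_rep hom_commute[OF h] hom_add[OF h] rep_act_mem[OF Lr] rep_act_add[OF Y] hom_mem[OF h])
  qed
  moreover have "ps v 0 = 0" for v by (rule lft_zero[OF psl rep_subspace[OF X]])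
  ultimately show ?thesis by (intro exI[of _ "%v z. h v (cfst z) + ps v (csnd z)"]) simp
 qed
 show ?thesis
  unfolding almost_split_seq_def agree_def comp_fam_def comp_apply
  using Lr B X f f_inj g g_surj exact not_split_mono not_split_epi lift extend by blast
qed

subsection \<open>Submodules generated by few elements\<close>

text \<open>Finite-dimensionality of the path algebra, in the form needed here: the bound depends on
  the number of generators and not on the representation.\<close>

definition fg_bounded :: "('v::finite, 'a::finite) quiver => bool" where
 "fg_bounded Q \<longleftrightarrow> (ALL D. EX K. ALL X G. is_rep Q (X :: ('v, 'a) quiver_rep) &
   (ALL v. finite (G v) & card (G v) <= D & G v <= spc X v) -->
   (EX U. submodule Q X U & (ALL v. G v <= U v) & tdim (subrep X U) <= K))"

lemma lft_span_image:
 assumes "linear_from_to V W f" "cv.subspace V" "cv.subspace W" "F <= V"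
 shows "f ` cv.span F = cv.span (f ` F)"
proof -
 obtain g where g: "clinear g" "!!x. x : V ==> g x = f x" "!!x. g x : W"
  using linear_extension[OF assms(1-3)] by metis
 have s: "cv.span F <= V" using assms by (intro cv.span_minimal)
 have "f ` cv.span F = g ` cv.span F" using s g(2) by (intro image_cong) auto
 also have "... = cv.span (g ` F)" using cvp.linear_span_image[OF g(1)] by simp
 also have "g ` F = f ` F" using assms(4) g(2) by (intro image_cong) auto
 finally show ?thesis .
qed

fun gen_sub :: "('v, 'a) quiver => ('v, 'a) quiver_rep => ('v => cvec set) => nat => 'v => cvec set" where
 "gen_sub Q X G 0 v = cv.span (G v)"
| "gen_sub Q X G (Suc k) v = cv.span (G v \<union> (UN a:{a. tgt Q a = v}. act X a ` gen_sub Q X G k (src Q a)))"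

lemma acyclic_fg_bounded:
 fixes Q :: "('v::finite, 'a::finite) quiver" and rank :: "'v => nat"
 assumes "!!a. rank (src Q a) < rank (tgt Q a)"
 shows "fg_bounded Q"
 unfolding fg_bounded_def
proof
 fix D :: nat
 \<comment> \<open>\<open>b k\<close> bounds the number of vectors that span \<open>gen_sub\<close>
   at depth \<open>k\<close>: the generators at the vertex and, for each arrow, the vectors of the
   previous depth.\<close>
 define b where "b = rec_nat D (%_ m. D + card (UNIV :: 'a set) * m)"
 have b0: "b 0 = D" and bS: "b (Suc k) = D + card (UNIV :: 'a set) * b k" for k by (simp_all add: b_def)
 define R where "R = Max (range rank)"
 have R: "rank v <= R" for v unfolding R_def by (intro Max_ge) auto
 show "EX K. ALL X G. is_rep Q (X :: ('v, 'a) quiver_rep) &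
   (ALL v. finite (G v) & card (G v) <= D & G v <= spc X v) -->
   (EX U. submodule Q X U & (ALL v. G v <= U v) & tdim (subrep X U) <= K)"
 proof (intro exI[of _ "card (UNIV :: 'v set) * b R"] allI impI)
  fix X :: "('v, 'a) quiver_rep" and G
  assume "is_rep Q X & (ALL v. finite (G v) & card (G v) <= D & G v <= spc X v)"
  hence X: "is_rep Q X" and G: "!!v. finite (G v)" "!!v. card (G v) <= D" "!!v. G v <= spc X v" by auto
  let ?U = "gen_sub Q X G"
  have sub: "cv.subspace (?U k v)" for k v by (cases k) simp_all
  have GU: "G v <= ?U k v" for k v by (cases k) (auto intro: cv.span_base)
  have UX: "?U k v <= spc X v" for k v
  proof (induction k arbitrary: v)
   case 0 thus ?case using cv.span_minimal[OF G(3) rep_subspace[OF X]] by simp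
  next
   case (Suc k)
   have "G v \<union> (UN a:{a. tgt Q a = v}. act X a ` ?U k (src Q a)) <= spc X v"
    using G(3) Suc rep_act_mem[OF X] by blast
   thus ?case using cv.span_minimal[OF _ rep_subspace[OF X]] by simp
  qed
  have stable: "?U (Suc k) v = ?U k v" if "rank v <= k" for k v
   using that
  proof (induction k arbitrary: v)
   case 0
   hence no: "{a. tgt Q a = v} = {}" using assms by (metis (mono_tags, lifting) Collect_empty_eq less_le_trans not_less_zero)
   show ?case unfolding gen_sub.simps no by simp
  next
   case (Suc k)
   have "?U (Suc k) (src Q a) = ?U k (src Q a)" if "tgt Q a = v" for a
    using Suc.IH[of "src Q a"] Suc.prems assms[of a] that by simp
   hence eq: "(UN a:{a. tgt Q a = v}. act X a ` ?U (Suc k) (src Q a)) = (UN a:{a. tgt Q a = v}. act X a ` ?U k (src Q a))"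
    by (intro SUP_cong) auto
   have "?U (Suc (Suc k)) v = cv.span (G v \<union> (UN a:{a. tgt Q a = v}. act X a ` ?U (Suc k) (src Q a)))"
    by (rule gen_sub.simps(2))
   also have "... = ?U (Suc k) v" unfolding eq by (rule gen_sub.simps(2)[symmetric])
   finally show ?case .
  qed
  have fin: "EX F. finite F & card F <= b k & ?U k v = cv.span F" for k v
  proof (induction k arbitrary: v)
   case 0 thus ?case using G b0 by auto
  next
   case (Suc k)
   then obtain F where F: "!!v. finite (F v)" "!!v. card (F v) <= b k" "!!v. ?U k v = cv.span (F v)" by metis
   let ?F = "G v \<union> (UN a:{a. tgt Q a = v}. act X a ` F (src Q a))"
   have FX: "F v <= spc X v" for v using UX[of k v] F(3)[of v] cv.span_superset[of "F v"] by blast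
   have im: "act X a ` ?U k (src Q a) = cv.span (act X a ` F (src Q a))" for a
    unfolding F(3) by (rule lft_span_image[OF rep_act[OF X] rep_subspace[OF X] rep_subspace[OF X] FX])
   have "cv.span (G v \<union> (UN a:{a. tgt Q a = v}. cv.span (act X a ` F (src Q a)))) = cv.span ?F"
   proof (rule subset_antisym)
    show "cv.span (G v \<union> (UN a:{a. tgt Q a = v}. cv.span (act X a ` F (src Q a)))) <= cv.span ?F"
    proof (rule cv.span_minimal[OF _ cv.subspace_span])
     have "cv.span (act X a ` F (src Q a)) <= cv.span ?F" if "tgt Q a = v" for a
      using that by (intro cv.span_mono) blast
     thus "G v \<union> (UN a:{a. tgt Q a = v}. cv.span (act X a ` F (src Q a))) <= cv.span ?F"
      using cv.span_superset[of ?F] by blast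
    qed
    show "cv.span ?F <= cv.span (G v \<union> (UN a:{a. tgt Q a = v}. cv.span (act X a ` F (src Q a))))"
     by (intro cv.span_mono Un_mono subset_refl UN_mono cv.span_superset)
   qed
   hence "?U (Suc k) v = cv.span ?F" by (simp add: im)
   moreover have "finite ?F" using F(1) G(1) by simp
   moreover have "card ?F <= b (Suc k)"
   proof -
    have "card (UN a:{a. tgt Q a = v}. act X a ` F (src Q a)) <= (SUM a | tgt Q a = v. card (act X a ` F (src Q a)))"
     by (rule card_UN_le) simp
    also have "... <= (SUM a | tgt Q a = v. b k)"
     by (intro sum_mono) (meson F card_image_le le_trans)
    also have "... <= card (UNIV :: 'a set) * b k" by (simp add: card_mono)
    finally show ?thesis using card_Un_le[of "G v" "UN a:{a. tgt Q a = v}. act X a ` F (src Q a)"] G(2)[of v] bS[of k] by linarith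
   qed
   ultimately show ?case by blast
  qed
  have "submodule Q X (?U R)"
  proof (rule submoduleI)
   show "x : spc X v" if "x : ?U R v" for v x using UX that by blast
   show "act X a x : ?U R (tgt Q a)" if "x : ?U R (src Q a)" for a x
   proof -
    have "act X a x : ?U (Suc R) (tgt Q a)" using that by (auto intro!: cv.span_base)
    thus ?thesis using stable[OF R] by simp
   qed
  qed (rule sub)
  moreover have "tdim (subrep X (?U R)) <= card (UNIV :: 'v set) * b R"
  proof -
   have "cv.dim (?U R v) <= b R" for v
    using fin[of R v] by (metis cv.dim_le_card cv.dim_span cv.span_superset le_trans)
   hence "(SUM v:UNIV. cv.dim (?U R v)) <= (SUM v:(UNIV :: 'v set). b R)" by (intro sum_mono)
   thus ?thesis by (simp add: tdim_def dim_vec_def)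
  qed
  ultimately show "EX U. submodule Q X U & (ALL v. G v <= U v) & tdim (subrep X U) <= card (UNIV :: 'v set) * b R"
   using GU by blast
 qed
qed

text \<open>The submodule is generated by the values of the certificate \<open>h\<close> on bases of
  the spaces of \<open>L\<close>, so its size is bounded in terms of \<open>Q\<close> and
  \<open>L\<close>. If the class split on it, a cohomologous cocycle would vanish on all values of
  \<open>h\<close>.\<close>

lemma nonsplit_restriction_bounded:
 fixes Q :: "('v::finite, 'a::finite) quiver"
 assumes bd: "fg_bounded Q" and L: "is_rep Q L"
 shows "EX K. ALL X et. is_rep Q X & cocycle Q X L et & ~ coboundary Q X L et -->
  (EX U. submodule Q X U & tdim (subrep X U) <= K & ~ coboundary Q (subrep X U) L et)"
proof -
 obtain BL cL where BL: "!!v. dual_basis (spc L v) (BL v) (cL v)"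
  using dual_basis_exists[OF rep_fd[OF L]] by metis
 define D where "D = (SUM a:UNIV. card (BL (tgt Q a)))"
 obtain K where K': "ALL X G. is_rep Q (X :: ('v, 'a) quiver_rep) &
   (ALL v. finite (G v) & card (G v) <= D & G v <= spc X v) -->
   (EX U. submodule Q X U & (ALL v. G v <= U v) & tdim (subrep X U) <= K)"
  using spec[OF bd[unfolded fg_bounded_def], of D] by (rule exE)
 have K: "EX U. submodule Q X U & (ALL v. G v <= U v) & tdim (subrep X U) <= K"
  if "is_rep Q (X :: ('v, 'a) quiver_rep)" "!!v. finite (G v) & card (G v) <= D & G v <= spc X v" for X G
  using K'[rule_format, of X G] that by simp
 show ?thesis
 proof (intro exI[of _ K] allI impI, elim conjE)
  fix X et assume X: "is_rep Q X" and et: "cocycle Q X L et" "~ coboundary Q X L et"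
  obtain h where h: "ALL a. linear_from_to (spc L (tgt Q a)) (spc X (src Q a)) (h a)"
   "ALL tt. cocycle Q X L tt & coboundary Q X L (%a x. et a x - tt a x) -->
    (EX a. EX l:spc L (tgt Q a). tt a (h a l) ~= 0) & (EX a. EX x:spc X (src Q a). h a (tt a x) ~= 0)"
   using certificate[OF X L et(2)] by blast
  define G where "G v = (UN a:{a. src Q a = v}. h a ` BL (tgt Q a))" for v
  have fB: "finite (BL v)" "BL v <= spc L v" "!!x. x : spc L v ==> (SUM b:BL v. cscale (cL v b x) b) = x" for v
   using BL[of v] by (auto simp: dual_basis_def)
  have "finite (G v) & card (G v) <= D & G v <= spc X v" for v
  proof (intro conjI)
   show "finite (G v)" using fB by (simp add: G_def)
   have "card (G v) <= (SUM a | src Q a = v. card (h a ` BL (tgt Q a)))"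
    unfolding G_def by (rule card_UN_le) simp
   also have "... <= (SUM a | src Q a = v. card (BL (tgt Q a)))" by (intro sum_mono card_image_le fB)
   also have "... <= D" unfolding D_def by (intro sum_mono2) auto
   finally show "card (G v) <= D" .
   show "G v <= spc X v" unfolding G_def using h(1) fB(2) by (auto dest: lft_mem)
  qed
  then obtain U where U: "submodule Q X U" "!!v. G v <= U v" "tdim (subrep X U) <= K" using K[OF X, of G] by blast
  have hU: "h a l : U (src Q a)" if l: "l : spc L (tgt Q a)" for a l
  proof -
   have "h a l = h a (SUM b:BL (tgt Q a). cscale (cL (tgt Q a) b l) b)" using fB(3)[OF l] by simp
   also have "... = (SUM b:BL (tgt Q a). h a (cscale (cL (tgt Q a) b l) b))"
    using fB(2) by (intro lft_sum[OF h(1)[rule_format] rep_subspace[OF L]] cv.subspace_scale rep_subspace[OF L]) blast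
   also have "... = (SUM b:BL (tgt Q a). cscale (cL (tgt Q a) b l) (h a b))"
    using fB(2) by (intro sum.cong refl lft_scale[OF h(1)[rule_format]]) blast
   also have "... : U (src Q a)"
    using U(2)[of "src Q a"] by (intro cv.subspace_sum cv.subspace_scale submodule_subspace[OF U(1)]) (auto simp: G_def)
   finally show ?thesis .
  qed
  have "~ coboundary Q (subrep X U) L et"
  proof
   assume "coboundary Q (subrep X U) L et"
   then obtain ps0 where ps0: "ALL v. linear_from_to (U v) (spc L v) (ps0 v)"
    "ALL a. ALL x:U (src Q a). et a x = act L a (ps0 (src Q a) x) - ps0 (tgt Q a) (act X a x)"
    unfolding coboundary_def by auto
   have "EX ps. clinear ps & (ALL x:U v. ps x = ps0 v x) & (ALL x. ps x : spc L v)" for v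
    using linear_extension[OF ps0(1)[rule_format] submodule_subspace[OF U(1)] rep_subspace[OF L]] by metis
   then obtain ps where ps: "!!v. clinear (ps v)" "!!v x. x : U v ==> ps v x = ps0 v x" "!!v x. ps v x : spc L v"
    by metis
   have psl: "linear_from_to (spc X v) (spc L v) (ps v)" for v
    by (rule clinear_imp_linear_from_to[OF ps(1) ps(3)])
   define tt where "tt = (%a x. et a x - (act L a (ps (src Q a) x) - ps (tgt Q a) (act X a x)))"
   have etl: "linear_from_to (spc X (src Q a)) (spc L (tgt Q a)) (et a)" for a using et(1) by (simp add: cocycle_def)
   have "cocycle Q X L tt"
    unfolding cocycle_def tt_def
    by (intro allI lft_minus rep_subspace[OF L] etl lft_comp[OF psl rep_act[OF L]] lft_comp[OF rep_act[OF X] psl])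
   moreover have "coboundary Q X L (%a x. et a x - tt a x)"
    unfolding coboundary_def tt_def by (intro exI[of _ ps]) (use psl in auto)
   ultimately obtain a l where al: "l : spc L (tgt Q a)" "tt a (h a l) ~= 0" using h(2) by blast
   have x: "h a l : U (src Q a)" by (rule hU[OF al(1)])
   have "tt a (h a l) = 0"
    unfolding tt_def ps(2)[OF x] ps(2)[OF submodule_act[OF U(1) x]] using ps0(2) x by simp
   thus False using al by simp
  qed
  thus "EX U. submodule Q X U & tdim (subrep X U) <= K & ~ coboundary Q (subrep X U) L et" using U by blast
 qed
qed

subsection \<open>Composites of radical maps\<close>

lemma coboundary_complementary:
 assumes X: "is_rep Q X" and L: "is_rep Q L" and et: "cocycle Q X L et"
  and UW: "submodule Q X U" "submodule Q X W" "complementary X U W"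
  and c: "coboundary Q (subrep X U) L et" "coboundary Q (subrep X W) L et"
 shows "coboundary Q X L et"
proof -
 obtain p q where p: "rep_hom Q X (subrep X U) p" and q: "rep_hom Q X (subrep X W) q"
  and pq: "!!v x. x : spc X v ==> x = p v x + q v x"
  by (rule complementary_projection[OF X UW]) blast
 obtain ps1 where 1: "ALL v. linear_from_to (U v) (spc L v) (ps1 v)"
  "ALL a. ALL x:U (src Q a). et a x = act L a (ps1 (src Q a) x) - ps1 (tgt Q a) (act X a x)"
  using c(1) unfolding coboundary_def by auto
 obtain ps2 where 2: "ALL v. linear_from_to (W v) (spc L v) (ps2 v)"
  "ALL a. ALL x:W (src Q a). et a x = act L a (ps2 (src Q a) x) - ps2 (tgt Q a) (act X a x)"
  using c(2) unfolding coboundary_def by auto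
 have pl: "linear_from_to (spc X v) (U v) (p v)" and ql: "linear_from_to (spc X v) (W v) (q v)" for v
  using hom_linear[OF p, of v] hom_linear[OF q, of v] by simp_all
 have etl: "linear_from_to (spc X (src Q a)) (spc L (tgt Q a)) (et a)" for a using et by (simp add: cocycle_def)
 show ?thesis
  unfolding coboundary_def
 proof (intro exI[of _ "%v x. ps1 v (p v x) + ps2 v (q v x)"] conjI allI ballI)
  show "linear_from_to (spc X v) (spc L v) (%x. ps1 v (p v x) + ps2 v (q v x))" for v
   by (intro lft_plus rep_subspace[OF L] lft_comp[OF pl 1(1)[rule_format]] lft_comp[OF ql 2(1)[rule_format]])
  fix a x assume x: "x : spc X (src Q a)"
  have m: "p (src Q a) x : U (src Q a)" "q (src Q a) x : W (src Q a)" using lft_mem[OF pl x] lft_mem[OF ql x] .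
  have "et a x = et a (p (src Q a) x + q (src Q a) x)" using pq[OF x] by simp
  also have "... = et a (p (src Q a) x) + et a (q (src Q a) x)"
   by (rule lft_add[OF etl]) (use m submodule_mem[OF UW(1)] submodule_mem[OF UW(2)] in auto)
  also have "... = act L a (ps1 (src Q a) (p (src Q a) x)) - ps1 (tgt Q a) (p (tgt Q a) (act X a x)) +
    (act L a (ps2 (src Q a) (q (src Q a) x)) - ps2 (tgt Q a) (q (tgt Q a) (act X a x)))"
   using 1(2) 2(2) m hom_commute[OF p x] hom_commute[OF q x] by simp
  finally show "et a x = act L a (ps1 (src Q a) (p (src Q a) x) + ps2 (src Q a) (q (src Q a) x)) -
    (ps1 (tgt Q a) (p (tgt Q a) (act X a x)) + ps2 (tgt Q a) (q (tgt Q a) (act X a x)))"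
   using rep_act_add[OF L lft_mem[OF 1(1)[rule_format] m(1)] lft_mem[OF 2(1)[rule_format] m(2)]] by simp
 qed
qed

text \<open>A submodule of least dimension on which the class does not split cannot decompose, since
  a class that splits on two complementary submodules splits on their sum.\<close>

lemma nonsplit_indecomposable:
 fixes Q :: "('v::finite, 'a::finite) quiver"
 assumes X: "is_rep Q X" and L: "is_rep Q L" and et: "cocycle Q X L et" "~ coboundary Q X L et"
 shows "EX U. submodule Q X U & indecomposable Q (subrep X U) & ~ coboundary Q (subrep X U) L et"
proof -
 let ?P = "%U. submodule Q X U & ~ coboundary Q (subrep X U) L et"
 have "?P (spc X)" using submodule_full[OF X] et(2) by simp
 define U where "U = (ARG_MIN (%U. tdim (subrep X U)) U. ?P U)"
 have PU: "?P U" unfolding U_def using \<open>?P (spc X)\<close> by (rule arg_min_natI[where P = ?P])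
 have min: "tdim (subrep X U) <= tdim (subrep X W)" if "?P W" for W
  unfolding U_def using that by (rule arg_min_nat_le[where P = ?P])
 have U: "submodule Q X U" using PU by blast
 have Ur: "is_rep Q (subrep X U)" by (rule is_rep_subrep[OF X U])
 have etU: "cocycle Q (subrep X U) L et"
  using cocycle_pull[OF rep_hom_incl[OF U] et(1)] by (simp add: pull_def)
 have "A = zero_fam | B = zero_fam"
  if A: "submodule Q (subrep X U) A" and B: "submodule Q (subrep X U) B" and AB: "complementary (subrep X U) A B" for A B
 proof -
  have full: "C = U" if C: "submodule Q (subrep X U) C" "~ coboundary Q (subrep X C) L et" for C
  proof -
   have "?P C" using C submodule_subrep_iff[OF U, of C] by blast
   thus ?thesis using submodule_eq_full[OF Ur C(1)] min by simp
  qed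
  have zero: "D = zero_fam" if "!!v. C v \<inter> D v = {0}" "C = U" "submodule Q (subrep X U) D" for C D
  proof
   fix v
   have "D v <= U v" using submodule_subset[OF that(3), of v] by simp
   thus "D v = zero_fam v" using that(1)[of v] that(2) by (auto simp: zero_fam_def)
  qed
  have "~ coboundary Q (subrep X A) L et | ~ coboundary Q (subrep X B) L et"
   using coboundary_complementary[OF Ur L etU A B AB] PU by simp blast
  then consider "A = U" | "B = U" using full[OF A] full[OF B] by blast
  thus ?thesis
  proof cases
   case 1 thus ?thesis using zero[of A B] AB B by (auto simp: complementary_def)
  next
   case 2 thus ?thesis using zero[of B A] AB A by (auto simp: complementary_def Int_commute)
  qed
 qed
 moreover have "spc (subrep X U) ~= zero_fam"
 proof
  assume z: "spc (subrep X U) = zero_fam"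
  have "et a 0 = 0" for a using et(1) rep_subspace[OF X] unfolding cocycle_def by (meson lft_zero)
  hence "coboundary Q (subrep X U) L et" using z by (intro coboundary_zero[OF Ur L]) (simp add: zero_fam_def)
  thus False using PU by blast
 qed
 ultimately have "indecomposable Q (subrep X U)" using Ur unfolding indecomposable_def by blast
 thus ?thesis using PU by blast
qed

text \<open>\<open>F\<close> meets the kernel of \<open>h\<close> in zero and has the same image as
  \<open>Z\<close>, so it is a complement of the kernel.\<close>

lemma indecomposable_iso_on_summand:
 fixes Q :: "('v::finite, 'a::finite) quiver"
 assumes Z: "indecomposable Q Z" and X: "is_rep Q X" and h: "rep_hom Q Z X h" and F: "submodule Q Z F" "F ~= zero_fam"
  and inj: "rep_inj (subrep Z F) h" and im: "!!v. h v ` F v = h v ` spc Z v"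
 shows "F = spc Z" "rep_inj Z h"
proof -
 have Zr: "is_rep Q Z" using Z by (rule indecomposable_rep)
 have Fr: "is_rep Q (subrep Z F)" by (rule is_rep_subrep[OF Zr F(1)])
 let ?K = "%v. {x : spc Z v. h v x = 0}"
 have K: "submodule Q Z ?K" by (rule submodule_kernel[OF Zr X h])
 have i: "x = 0" if "x : F v" "h v x = 0" for v x
  using inj rep_inj_iff[OF Fr rep_hom_subrep[OF F(1) h]] that by simp
 have c: "complementary Z F ?K"
  unfolding complementary_def
 proof (intro allI conjI)
  fix v
  have "x : {x + y |x y. x : F v & y : ?K v}" if x: "x : spc Z v" for x
  proof -
   have "h v x : h v ` F v" using im x by blast
   then obtain y where y: "y : F v" "h v x = h v y" by blast
   have "x - y : ?K v" using x y submodule_mem[OF F(1) y(1)]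
    by (simp add: cv.subspace_diff rep_subspace[OF Zr] hom_diff[OF Zr h])
   moreover have "x = y + (x - y)" by simp
   ultimately show ?thesis using y(1) by blast
  qed
  thus "{x + y |x y. x : F v & y : ?K v} = spc Z v"
   using submodule_mem[OF F(1)] cv.subspace_add[OF rep_subspace[OF Zr]] by blast
  show "F v \<inter> ?K v = {0}"
   using i cv.subspace_0[OF submodule_subspace[OF F(1)]] cv.subspace_0[OF submodule_subspace[OF K]] by blast
 qed
 hence K0: "?K = zero_fam" using indecomposable_complementary[OF Z F(1) K] F(2) by blast
 have Kv: "?K v = {0}" for v using fun_cong[OF K0, of v] by (simp add: zero_fam_def)
 hence k: "x = 0" if "x : spc Z v" "h v x = 0" for v x using that by blast
 thus "rep_inj Z h" using rep_inj_iff[OF Zr h] by blast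
 show "F = spc Z"
 proof
  fix v
  have "{x + y |x y. x : F v & y : ?K v} = spc Z v" using c unfolding complementary_def by blast
  thus "F v = spc Z v" unfolding Kv by auto
 qed
qed

definition rank_hom :: "('v::finite, 'a) quiver_rep => ('v, 'a) quiver_rep => ('v => cvec => cvec) => nat" where
 "rank_hom M N f = (SUM v:UNIV. cv.dim (f v ` spc M v))"

lemma tdim_image: "tdim (subrep N (%v. f v ` spc M v)) = rank_hom M N f"
 by (simp add: rank_hom_def tdim_def dim_vec_def)

text \<open>If the rank did not drop, the image of \<open>f\<close> would map isomorphically onto
  the image of \<open>h\<close>. Then \<open>indecomposable_iso_on_summand\<close>, used once in
  \<open>Z'\<close> and once in \<open>Z\<close>, shows that \<open>g\<close> is injective and
  surjective.\<close>

lemma harada_sai_step: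
 fixes Q :: "('v::finite, 'a::finite) quiver"
 assumes Y: "is_rep Q Y" and Z': "indecomposable Q Z'" and Z: "indecomposable Q Z" and X: "is_rep Q X"
  and f: "rep_hom Q Y Z' f" and g: "rep_hom Q Z' Z g" and h: "rep_hom Q Z X h"
  and gns: "~ (rep_inj Z' g & rep_surj Z' Z g)"
  and rf: "rank_hom Y Z' f <= d" and rh: "rank_hom Z X h <= d"
  and ne: "~ (ALL v. ALL y:spc Y v. h v (g v (f v y)) = 0)"
 shows "rank_hom Y X (%v y. h v (g v (f v y))) < d"
proof (rule ccontr)
 assume "~ ?thesis"
 hence d: "d <= rank_hom Y X (%v y. h v (g v (f v y)))" by simp
 have Zr: "is_rep Q Z" and Z'r: "is_rep Q Z'" using Z Z' by (simp_all add: indecomposable_rep)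
 let ?F = "%v. f v ` spc Y v" and ?G = "%v. (%y. g v (f v y)) ` spc Y v"
 have gf: "rep_hom Q Y Z (%v y. g v (f v y))" by (rule rep_hom_comp[OF f g])
 have hg: "rep_hom Q Z' X (%v z. h v (g v z))" by (rule rep_hom_comp[OF g h])
 have F: "submodule Q Z' ?F" by (rule submodule_image[OF Y f submodule_full[OF Y]])
 have G: "submodule Q Z ?G" by (rule submodule_image[OF Y gf submodule_full[OF Y]])
 have Fr: "is_rep Q (subrep Z' ?F)" and Gr: "is_rep Q (subrep Z ?G)"
  by (rule is_rep_subrep[OF Z'r F], rule is_rep_subrep[OF Zr G])
 have imF: "(%v. (%z. h v (g v z)) ` ?F v) = (%v. (%y. h v (g v (f v y))) ` spc Y v)" by (simp add: image_image)
 have imG: "(%v. h v ` ?G v) = (%v. (%y. h v (g v (f v y))) ` spc Y v)" by (simp add: image_image)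
 have T: "is_rep Q (subrep X (%v. h v ` spc Z v))"
  by (rule is_rep_subrep[OF X submodule_image[OF Zr h submodule_full[OF Zr]]])
 have sub: "submodule Q X (%v. (%y. h v (g v (f v y))) ` spc Y v)"
  by (rule submodule_image[OF Y rep_hom_comp[OF gf h] submodule_full[OF Y]])
 have "submodule Q (subrep X (%v. h v ` spc Z v)) (%v. (%y. h v (g v (f v y))) ` spc Y v)"
  unfolding submodule_subrep_iff[OF submodule_image[OF Zr h submodule_full[OF Zr]]]
  using sub hom_mem[OF gf] by auto
 hence full: "(%v. (%y. h v (g v (f v y))) ` spc Y v) = (%v. h v ` spc Z v)"
  using submodule_eq_full[OF T, of "%v. (%y. h v (g v (f v y))) ` spc Y v"] d rh by (simp add: tdim_image)
 have Fne: "?F ~= zero_fam"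
 proof
  assume z: "?F = zero_fam"
  have "h v (g v (f v y)) = 0" if "y : spc Y v" for v y
  proof -
   have "f v y : ?F v" using that by blast
   hence "f v y : zero_fam v" using fun_cong[OF z, of v] by simp
   thus ?thesis using hom_0[OF Z'r hg] by (simp add: zero_fam_def)
  qed
  thus False using ne by blast
 qed
 have Gne: "?G ~= zero_fam"
 proof
  assume z: "?G = zero_fam"
  have "h v (g v (f v y)) = 0" if "y : spc Y v" for v y
  proof -
   have "g v (f v y) : ?G v" using that by blast
   hence "g v (f v y) : zero_fam v" using fun_cong[OF z, of v] by simp
   thus ?thesis using hom_0[OF Zr h] by (simp add: zero_fam_def)
  qed
  thus False using ne by blast
 qed
 have iF: "rep_inj (subrep Z' ?F) (%v z. h v (g v z))"
  by (rule rep_inj_of_tdim[OF Fr rep_hom_subrep[OF F hg]]) (use d rf in \<open>simp add: imF tdim_image image_image rank_hom_def tdim_def dim_vec_def\<close>)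
 have "(%z. h v (g v z)) ` ?F v = (%z. h v (g v z)) ` spc Z' v" for v
 proof
  show "(%z. h v (g v z)) ` ?F v <= (%z. h v (g v z)) ` spc Z' v" using hom_mem[OF f] by blast
  have "(%z. h v (g v z)) ` spc Z' v <= h v ` spc Z v" using hom_mem[OF g] by blast
  also have "... = (%z. h v (g v z)) ` ?F v" using fun_cong[OF full, of v] by (simp add: image_image)
  finally show "(%z. h v (g v z)) ` spc Z' v <= (%z. h v (g v z)) ` ?F v" .
 qed
 hence "rep_inj Z' (%v z. h v (g v z))"
  using indecomposable_iso_on_summand(2)[OF Z' X hg F Fne iF] by blast
 hence "z = 0" if "z : spc Z' v" "g v z = 0" for v z
  using rep_inj_iff[OF Z'r hg] that hom_0[OF Zr h, of v] by simp
 hence "rep_inj Z' g" using rep_inj_iff[OF Z'r g] by blast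
 have rG: "tdim (subrep Z ?G) <= d"
  using tdim_image_le[OF Fr rep_hom_subrep[OF F g]] rf
  by (simp add: image_image rank_hom_def tdim_def dim_vec_def)
 have iG: "rep_inj (subrep Z ?G) h"
  by (rule rep_inj_of_tdim[OF Gr rep_hom_subrep[OF G h]]) (use d rG in \<open>simp add: imG tdim_image image_image rank_hom_def tdim_def dim_vec_def\<close>)
 have "h v ` ?G v = h v ` spc Z v" for v using fun_cong[OF full, of v] by (simp add: image_image)
 hence "?G = spc Z" using indecomposable_iso_on_summand(1)[OF Z X h G Gne iG] by blast
 hence G': "(%v. (%y. g v (f v y)) ` spc Y v) = spc Z" .
 have "rep_surj Z' Z g"
  unfolding rep_surj_def
 proof (intro allI subset_antisym subsetI)
  fix v x
  show "x : spc Z v" if "x : g v ` spc Z' v" using that hom_mem[OF g] by blast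
  show "x : g v ` spc Z' v" if x: "x : spc Z v"
  proof -
   have "x : (%y. g v (f v y)) ` spc Y v" using fun_cong[OF G', of v] x by simp
   thus ?thesis using hom_mem[OF f] by blast
  qed
 qed
 thus False using gns \<open>rep_inj Z' g\<close> by blast
qed

text \<open>Otherwise a non-split class on an indecomposable of dimension at most \<open>K\<close>
  can always be pulled back, along a non-isomorphism from another such indecomposable, to a
  non-split class. All composites of these maps are nonzero, but their ranks can be forced below any
  bound.\<close>

lemma radical_annihilated_cocycle:
 fixes Q :: "('v::finite, 'a::finite) quiver"
 assumes bd: "fg_bounded Q" and L: "is_rep Q L"
  and X0: "is_rep Q X0" "cocycle Q X0 L et0" "~ coboundary Q X0 L et0"
 shows "EX X et. indecomposable Q X & cocycle Q X L et & ~ coboundary Q X L et &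
  (ALL Y h. is_rep Q Y & rep_hom Q Y X h & ~ split_epi Q Y X h --> coboundary Q Y L (pull Q h et))"
proof (rule ccontr)
 assume contra: "~ ?thesis"
 obtain K where K: "!!X et. is_rep Q X ==> cocycle Q X L et ==> ~ coboundary Q X L et ==>
   EX U. submodule Q X U & tdim (subrep X U) <= K & ~ coboundary Q (subrep X U) L et"
  using nonsplit_restriction_bounded[OF bd L] by blast
 define good where "good X et \<longleftrightarrow> indecomposable Q X & tdim X <= K & cocycle Q X L et & ~ coboundary Q X L et" for X et
 have sub: "EX U. submodule Q X U & good (subrep X U) et"
  if X: "is_rep Q X" "cocycle Q X L et" "~ coboundary Q X L et" for X et
 proof -
  obtain U where U: "submodule Q X U" "tdim (subrep X U) <= K" "~ coboundary Q (subrep X U) L et"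
   using K[OF X] by blast
  have Ur: "is_rep Q (subrep X U)" by (rule is_rep_subrep[OF X(1) U(1)])
  have Uc: "cocycle Q (subrep X U) L et" using cocycle_pull[OF rep_hom_incl[OF U(1)] X(2)] by (simp add: pull_def)
  obtain W where W: "submodule Q (subrep X U) W" "indecomposable Q (subrep X W)" "~ coboundary Q (subrep X W) L et"
   using nonsplit_indecomposable[OF Ur L Uc U(3)] by auto
  have WX: "submodule Q X W" using W(1) submodule_subrep_iff[OF U(1)] by blast
  have "tdim (subrep X W) <= K" using tdim_mono[OF Ur W(1)] U(2) by simp
  moreover have "cocycle Q (subrep X W) L et" using cocycle_pull[OF rep_hom_incl[OF WX] X(2)] by (simp add: pull_def)
  ultimately show ?thesis using W WX unfolding good_def by blast
 qed
 have succ: "EX Y g. good Y (pull Q g et) & rep_hom Q Y X g & ~ (rep_inj Y g & rep_surj Y X g)" if "good X et" for X et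
 proof -
  have X: "indecomposable Q X" "cocycle Q X L et" "~ coboundary Q X L et" using that by (auto simp: good_def)
  then obtain Y h where Y: "is_rep Q Y" "rep_hom Q Y X h" "~ split_epi Q Y X h" "~ coboundary Q Y L (pull Q h et)"
   using contra by blast
  obtain U where U: "submodule Q Y U" "good (subrep Y U) (pull Q h et)"
   using sub[OF Y(1) cocycle_pull[OF Y(2) X(2)] Y(4)] by blast
  have hU: "rep_hom Q (subrep Y U) X h" by (rule rep_hom_subrep[OF U(1) Y(2)])
  have "~ (rep_inj (subrep Y U) h & rep_surj (subrep Y U) X h)"
  proof
   assume b: "rep_inj (subrep Y U) h & rep_surj (subrep Y U) X h"
   then obtain s where s: "rep_hom Q X (subrep Y U) s" "ALL v. ALL x:spc X v. h v (s v x) = x"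
    using rep_hom_inverse[OF is_rep_subrep[OF Y(1) U(1)] hU] by blast
   have "rep_hom Q X Y s" using rep_hom_comp[OF s(1) rep_hom_incl[OF U(1)]] .
   thus False using split_epiI[OF Y(2)] s(2) Y(3) by blast
  qed
  thus ?thesis using U(2) hU by blast
 qed
 \<comment> \<open>Two composites of rank at most \<open>K - m\<close>, joined by a non-isomorphism,
   form one of rank at most \<open>K - m - 1\<close>; so the composite that belongs to
   \<open>m\<close> has 2^m - 1 factors. At \<open>m = K + 1\<close> the inequality is
   absurd.\<close>
 have chain: "EX Y f. good Y (pull Q f et) & rep_hom Q Y X f & rank_hom Y X f + m <= K" if "good X et" for m X et
  using that
 proof (induction m arbitrary: X et)
  case 0
  thus ?case
   by (intro exI[of _ X] exI[of _ "%v x. x"]) (simp add: pull_def good_def rep_hom_id rank_hom_def tdim_def dim_vec_def)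
 next
  case (Suc m)
  obtain Z h where Z: "good Z (pull Q h et)" "rep_hom Q Z X h" "rank_hom Z X h + m <= K"
   using Suc.IH[OF Suc.prems] by blast
  obtain Z' g where Z': "good Z' (pull Q g (pull Q h et))" "rep_hom Q Z' Z g" "~ (rep_inj Z' g & rep_surj Z' Z g)"
   using succ[OF Z(1)] by blast
  obtain Y f where Y: "good Y (pull Q f (pull Q g (pull Q h et)))" "rep_hom Q Y Z' f" "rank_hom Y Z' f + m <= K"
   using Suc.IH[OF Z'(1)] by blast
  let ?c = "%v y. h v (g v (f v y))"
  have c: "rep_hom Q Y X ?c" by (rule rep_hom_comp[OF rep_hom_comp[OF Y(2) Z'(2)] Z(2)])
  have p: "pull Q ?c et = pull Q f (pull Q g (pull Q h et))" by (simp add: pull_def)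
  have Yr: "is_rep Q Y" and Xr: "is_rep Q X" using Y(1) Suc.prems by (auto simp: good_def indecomposable_rep)
  have ne: "~ (ALL v. ALL y:spc Y v. ?c v y = 0)"
  proof
   assume z: "ALL v. ALL y:spc Y v. ?c v y = 0"
   have "et a 0 = 0" for a
    using Suc.prems rep_subspace[OF Xr] unfolding good_def cocycle_def by (meson lft_zero)
   hence "coboundary Q Y L (pull Q ?c et)"
    using z by (intro coboundary_zero[OF Yr L]) (simp add: pull_def)
   thus False using Y(1) p by (simp add: good_def)
  qed
  have "rank_hom Y X ?c < K - m"
   by (rule harada_sai_step[OF Yr _ _ Xr Y(2) Z'(2) Z(2) Z'(3) _ _ ne])
    (use Z Z' Y in \<open>auto simp: good_def\<close>)
  hence "rank_hom Y X ?c + Suc m <= K" by simp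
  thus ?case using c Y(1) p by (intro exI[of _ Y] exI[of _ ?c]) simp
 qed
 obtain U where "good (subrep X0 U) et0" using sub[OF X0] by blast
 from chain[OF this, of "Suc K"] show False by auto
qed

text \<open>Suppose that all cocycles with values in \<open>L\<close> split. A map from
  \<open>N\<close> to \<open>L\<close> is extended along \<open>f\<close> at each vertex separately;
  the failure to commute with the arrows vanishes on \<open>N\<close>, descends to a cocycle on the
  quotient, and a splitting of it corrects the extension.\<close>

lemma not_injective_nonsplit:
 assumes L: "is_rep Q L" and "~ injective Q L"
 shows "EX X et. is_rep Q X & cocycle Q X L et & ~ coboundary Q X L et"
proof (rule ccontr)
 assume none: "~ ?thesis"
 have "EX h. rep_hom Q M L h & agree N (comp_fam h f) g"
  if M: "is_rep Q M" and N: "is_rep Q N" and f: "rep_hom Q N M f" "rep_inj N f" and g: "rep_hom Q N L g" for M N f g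
 proof -
  let ?I = "%v. f v ` spc N v"
  have I: "submodule Q M ?I" by (rule submodule_image[OF N f(1) submodule_full[OF N]])
  obtain X p where X: "is_rep Q X" and p: "rep_hom Q M X p" "rep_surj M X p" and ker: "!!v. {x : spc M v. p v x = 0} = ?I v"
   by (rule quotient_exists[OF M I]) blast
  have "EX r. clinear r & (ALL x. r x : spc N v) & (ALL x:spc N v. r (f v x) = x)" for v
   using retraction_exists[OF hom_linear[OF f(1)] rep_subspace[OF N] rep_subspace[OF M]] f(2)
   unfolding rep_inj_def by metis
  then obtain r where r: "!!v. clinear (r v)" "!!v x. r v x : spc N v" "!!v x. x : spc N v ==> r v (f v x) = x"
   by metis
  have "EX s. clinear s & (ALL x. s x : spc M v) & (ALL y:spc X v. p v (s y) = y)" for v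
   using section_exists[OF hom_linear[OF p(1)] rep_subspace[OF M] rep_subspace[OF X]] p(2)
   unfolding rep_surj_def by metis
  then obtain s where s: "!!v. clinear (s v)" "!!v x. s v x : spc M v" "!!v y. y : spc X v ==> p v (s v y) = y"
   by metis
  define ro where "ro v x = g v (r v x)" for v x
  have ro: "linear_from_to (spc M v) (spc L v) (ro v)" for v
   unfolding ro_def by (rule lft_comp[OF clinear_imp_linear_from_to[OF r(1) r(2)] hom_linear[OF g]])
  define d where "d a m = act L a (ro (src Q a) m) - ro (tgt Q a) (act M a m)" for a m
  have d: "linear_from_to (spc M (src Q a)) (spc L (tgt Q a)) (d a)" for a
   unfolding d_def by (intro lft_minus rep_subspace[OF L] lft_comp[OF ro rep_act[OF L]] lft_comp[OF rep_act[OF M] ro])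
  have d0: "d a m = 0" if "m : ?I (src Q a)" for a m
  proof -
   obtain x where x: "x : spc N (src Q a)" "m = f (src Q a) x" using \<open>m : ?I (src Q a)\<close> by blast
   have "ro (tgt Q a) (act M a m) = ro (tgt Q a) (f (tgt Q a) (act N a x))"
    using hom_commute[OF f(1) x(1)] x(2) by simp
   thus ?thesis
    unfolding d_def using x r(3)[OF x(1)] r(3)[OF rep_act_mem[OF N x(1)]] hom_commute[OF g x(1)] by (simp add: ro_def)
  qed
  define et where "et a y = d a (s (src Q a) y)" for a y
  have "cocycle Q X L et"
   unfolding cocycle_def et_def by (intro allI lft_comp[OF clinear_imp_linear_from_to[OF s(1) s(2)] d])
  hence "coboundary Q X L et" using none X by blast
  then obtain ps where ps: "ALL v. linear_from_to (spc X v) (spc L v) (ps v)"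
   "ALL a. ALL x:spc X (src Q a). et a x = act L a (ps (src Q a) x) - ps (tgt Q a) (act X a x)"
   unfolding coboundary_def by blast
  have etp: "et a (p (src Q a) m) = d a m" if m: "m : spc M (src Q a)" for a m
  proof -
   have "m - s (src Q a) (p (src Q a) m) : {x : spc M (src Q a). p (src Q a) x = 0}"
    using m s hom_mem[OF p(1) m] by (simp add: cv.subspace_diff rep_subspace[OF M] hom_diff[OF M p(1)])
   hence "d a (m - s (src Q a) (p (src Q a) m)) = 0" using ker d0 by blast
   thus ?thesis using lft_diff[OF d rep_subspace[OF M] m s(2)] by (simp add: et_def)
  qed
  have psm: "ps v (p v m) : spc L v" if "m : spc M v" for v m
   using lft_mem[OF ps(1)[rule_format] hom_mem[OF p(1) that]] .
  have "rep_hom Q M L (%v m. ro v m - ps v (p v m))"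
  proof (rule rep_homI)
   show "linear_from_to (spc M v) (spc L v) (%m. ro v m - ps v (p v m))" for v
    by (intro lft_minus rep_subspace[OF L] ro lft_comp[OF hom_linear[OF p(1)] ps(1)[rule_format]])
   fix a m assume m: "m : spc M (src Q a)"
   have "d a m = act L a (ps (src Q a) (p (src Q a) m)) - ps (tgt Q a) (p (tgt Q a) (act M a m))"
    using etp[OF m] ps(2) hom_mem[OF p(1) m] hom_commute[OF p(1) m] by simp
   thus "ro (tgt Q a) (act M a m) - ps (tgt Q a) (p (tgt Q a) (act M a m)) = act L a (ro (src Q a) m - ps (src Q a) (p (src Q a) m))"
    unfolding d_def rep_act_diff[OF L lft_mem[OF ro m] psm[OF m]] by (rule diff_swap)
  qed
  moreover have "ro v (f v x) - ps v (p v (f v x)) = g v x" if x: "x : spc N v" for v x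
  proof -
   have "p v (f v x) = 0" using ker[of v] x by blast
   moreover have "ps v 0 = 0" by (rule lft_zero[OF ps(1)[rule_format] rep_subspace[OF X]])
   ultimately show ?thesis using r(3)[OF x] by (simp add: ro_def)
  qed
  ultimately show ?thesis
   by (intro exI[of _ "%v m. ro v m - ps v (p v m)"]) (simp add: agree_def comp_fam_def)
 qed
 hence "injective Q L" unfolding injective_def using L by blast
 thus False using assms(2) by blast
qed

theorem almost_split_exists:
 fixes Q :: "('v::finite, 'a::finite) quiver"
 assumes "fg_bounded Q" "indecomposable Q L" "~ injective Q L"
 shows "EX B N f g. almost_split_seq Q L B N f g & indecomposable Q N"
proof -
 have L: "is_rep Q L" using assms(2) by (rule indecomposable_rep)
 obtain X0 et0 where "is_rep Q X0" "cocycle Q X0 L et0" "~ coboundary Q X0 L et0"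
  using not_injective_nonsplit[OF L assms(3)] by blast
 from radical_annihilated_cocycle[OF assms(1) L this] obtain X et where
  X: "indecomposable Q X" "cocycle Q X L et" "~ coboundary Q X L et"
  "ALL Y h. is_rep Q Y & rep_hom Q Y X h & ~ split_epi Q Y X h --> coboundary Q Y L (pull Q h et)"
  by blast
 have "almost_split_seq Q L (ext_rep L X et) X (%v l. cpair l 0) (%v. csnd)"
  using almost_split_seq_ext_rep[OF assms(2) indecomposable_rep[OF X(1)] X(2,3)] X(4) by blast
 thus ?thesis using X(1) by blast
qed

subsection \<open>Components of the Auslander--Reiten quiver\<close>

lemma idempotent_summand:
 assumes B: "is_rep Q B" and e: "rep_hom Q B B p" and idem: "!!v x. x : spc B v ==> p v (p v x) = p v x"
 defines "U == %v. p v ` spc B v" and "W == %v. {x : spc B v. p v x = 0}"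
 shows "submodule Q B U" "submodule Q B W" "complementary B U W"
  "rep_hom Q B (subrep B U) p" "rep_hom Q B (subrep B W) (%v x. x - p v x)"
proof -
 show U: "submodule Q B U" unfolding U_def by (rule submodule_image[OF B e submodule_full[OF B]])
 show W: "submodule Q B W" unfolding W_def by (rule submodule_kernel[OF B B e])
 show pU: "rep_hom Q B (subrep B U) p" by (rule rep_hom_into_subrep[OF e]) (simp add: U_def)
 have "p v x = x" if "x : spc (subrep B U) v" for v x using that idem by (auto simp: U_def)
 hence "complementary B (%v. (%x. x) ` spc (subrep B U) v) (%v. {x : spc B v. p v x = 0})"
  by (rule complementary_image_kernel[OF is_rep_subrep[OF B U] B rep_hom_incl[OF U] pU])
 thus "complementary B U W" by (simp add: W_def)
 have "rep_hom Q B B (%v x. x + cscale (-1) (p v x))"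
  by (rule rep_hom_add[OF B rep_hom_id rep_hom_scale[OF B e]])
 hence q: "rep_hom Q B B (%v x. x - p v x)" by simp
 show "rep_hom Q B (subrep B W) (%v x. x - p v x)"
  by (rule rep_hom_into_subrep[OF q])
   (simp add: W_def hom_diff[OF B e] hom_mem[OF e] idem cv.subspace_diff rep_subspace[OF B])
qed

text \<open>Take an idempotent \<open>p\<close> of least rank for which the composite of
  \<open>F\<close>, \<open>p\<close> and \<open>k\<close> is nonzero. If its image decomposed
  properly, one of the two parts would still detect the composite, with smaller rank.\<close>

lemma detecting_summand:
 fixes Q :: "('v::finite, 'a::finite) quiver"
 assumes B: "is_rep Q B" and F: "rep_hom Q Y B F" and k: "rep_hom Q B Z k"
  and ne: "EX v. EX y:spc Y v. k v (F v y) ~= 0"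
 shows "EX p. rep_hom Q B B p & (ALL v. ALL x:spc B v. p v (p v x) = p v x) &
  indecomposable Q (subrep B (%v. p v ` spc B v)) & (EX v. EX y:spc Y v. k v (p v (F v y)) ~= 0)"
proof -
 let ?P = "%p. rep_hom Q B B p & (ALL v. ALL x:spc B v. p v (p v x) = p v x) & (EX v. EX y:spc Y v. k v (p v (F v y)) ~= 0)"
 have P0: "?P (%v x. x)" using ne rep_hom_id by blast
 define p where "p = (ARG_MIN (%p. rank_hom B B p) p. ?P p)"
 have Pp: "?P p" unfolding p_def using P0 by (rule arg_min_natI[where P = ?P])
 have min: "rank_hom B B p <= rank_hom B B r" if "?P r" for r
  unfolding p_def using that by (rule arg_min_nat_le[where P = ?P])
 have p: "rep_hom Q B B p" and idem: "!!v x. x : spc B v ==> p v (p v x) = p v x" using Pp by blast+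
 obtain v0 y0 where y0: "y0 : spc Y v0" "k v0 (p v0 (F v0 y0)) ~= 0" using Pp by blast
 define U where "U v = p v ` spc B v" for v
 have Ueq: "U = (%v. p v ` spc B v)" by (simp add: U_def fun_eq_iff)
 have U: "submodule Q B U" unfolding Ueq by (rule idempotent_summand(1)[OF B p idem])
 have Ur: "is_rep Q (subrep B U)" by (rule is_rep_subrep[OF B U])
 have pU: "p v x : U v" if "x : spc B v" for v x using that by (simp add: U_def)
 have pfix: "p v x = x" if "x : U v" for v x using that idem by (auto simp: U_def)
 have pB: "rep_hom Q B (subrep B U) p" using p pU by (rule rep_hom_into_subrep)
 have half: "A = U" if A: "submodule Q (subrep B U) A" and r: "rep_hom Q (subrep B U) (subrep (subrep B U) A) r"
   and rA: "!!v x. x : A v ==> r v x = x" and nz: "k v0 (r v0 (p v0 (F v0 y0))) ~= 0" for A r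
 proof -
  have AU: "x : U v" if "x : A v" for v x using submodule_mem[OF A that] by simp
  have rm: "r v x : A v" if "x : U v" for v x using hom_mem[OF r, of x v] that by simp
  have AB: "submodule Q B A" using A submodule_subrep_iff[OF U] by blast
  have "rep_hom Q B (subrep B A) (%v x. r v (p v x))" using rep_hom_comp[OF pB r] by simp
  hence rp: "rep_hom Q B B (%v x. r v (p v x))" using rep_hom_comp[OF _ rep_hom_incl[OF AB]] by blast
  have "r v (p v (r v (p v x))) = r v (p v x)" if "x : spc B v" for v x
   using pfix[OF AU[OF rm[OF pU[OF that]]]] rA[OF rm[OF pU[OF that]]] by simp
  hence "?P (%v x. r v (p v x))" using rp nz y0(1) by blast
  hence le: "rank_hom B B p <= rank_hom B B (%v x. r v (p v x))" by (rule min)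
  have imA: "(%v. (%x. r v (p v x)) ` spc B v) = A"
  proof
   fix v
   have "a : (%x. r v (p v x)) ` spc B v" if a: "a : A v" for a
    using pfix[OF AU[OF a]] rA[OF a] submodule_mem[OF U AU[OF a]] by (metis image_eqI)
   thus "(%x. r v (p v x)) ` spc B v = A v" using rm pU by blast
  qed
  have "tdim (subrep B U) <= tdim (subrep (subrep B U) A)"
   using le tdim_image[of B "%v x. r v (p v x)" B] tdim_image[of B p B] imA Ueq by simp
  thus ?thesis using submodule_eq_full[OF Ur A] by simp
 qed
 have "A = zero_fam | C = zero_fam"
  if A: "submodule Q (subrep B U) A" and C: "submodule Q (subrep B U) C" and AC: "complementary (subrep B U) A C" for A C
 proof -
  obtain r s where r: "rep_hom Q (subrep B U) (subrep (subrep B U) A) r" and s: "rep_hom Q (subrep B U) (subrep (subrep B U) C) s"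
   and rs: "!!v x. x : spc (subrep B U) v ==> x = r v x + s v x"
   and rA: "!!v x. x : A v ==> r v x = x" and sC: "!!v x. x : C v ==> s v x = x"
   by (rule complementary_projection[OF Ur A C AC]) blast
  have zero: "D = zero_fam" if "!!v. E v \<inter> D v = {0}" "E = U" "submodule Q (subrep B U) D" for E D
  proof
   fix v
   have "D v <= U v" using submodule_subset[OF that(3), of v] by simp
   thus "D v = zero_fam v" using that(1)[of v] that(2) by (auto simp: zero_fam_def)
  qed
  let ?z = "p v0 (F v0 y0)"
  have z: "?z : U v0" using pU hom_mem[OF F y0(1)] by blast
  have zA: "r v0 ?z : spc B v0" "s v0 ?z : spc B v0"
   using hom_mem[OF r, of ?z v0] hom_mem[OF s, of ?z v0] z submodule_mem[OF U] submodule_mem[OF A] submodule_mem[OF C] by auto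
  have "k v0 ?z = k v0 (r v0 ?z) + k v0 (s v0 ?z)"
   using rs[of ?z v0] z hom_add[OF k zA] by simp
  then consider "k v0 (r v0 ?z) ~= 0" | "k v0 (s v0 ?z) ~= 0" using y0(2) by fastforce
  thus ?thesis
  proof cases
   case 1
   have "A = U" by (rule half[OF A r rA 1])
   thus ?thesis using zero[of A C] AC C by (auto simp: complementary_def)
  next
   case 2
   have "C = U" by (rule half[OF C s sC 2])
   thus ?thesis using zero[of C A] AC A by (auto simp: complementary_def Int_commute)
  qed
 qed
 moreover have "spc (subrep B U) ~= zero_fam"
 proof
  assume z: "spc (subrep B U) = zero_fam"
  have "p v0 (F v0 y0) = 0" using pU[OF hom_mem[OF F y0(1)]] z by (simp add: zero_fam_def)
  thus False using y0(2) hom_0[OF B k] by simp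
 qed
 ultimately have "indecomposable Q (subrep B U)" using Ur unfolding indecomposable_def by blast
 thus ?thesis using Pp unfolding Ueq by blast
qed

lemma (in almost_split) middle_summand:
 assumes ind: "indecomposable Q L" "indecomposable Q N" and F: "rep_hom Q Y B F" and k: "rep_hom Q B Z k"
  and ne: "EX v. EX y:spc Y v. k v (F v y) ~= 0"
 shows "EX U p. submodule Q B U & indecomposable Q (subrep B U) & rep_hom Q B (subrep B U) p &
  irreducible_hom Q L (subrep B U) (%v x. p v (f v x)) & irreducible_hom Q (subrep B U) N g &
  (EX v. EX y:spc Y v. k v (p v (F v y)) ~= 0)"
proof -
 obtain p where p: "rep_hom Q B B p" "ALL v. ALL x:spc B v. p v (p v x) = p v x"
  "indecomposable Q (subrep B (%v. p v ` spc B v))" "EX v. EX y:spc Y v. k v (p v (F v y)) ~= 0"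
  using detecting_summand[OF B F k ne] by blast
 let ?U = "%v. p v ` spc B v" and ?W = "%v. {x : spc B v. p v x = 0}"
 have idem: "p v (p v x) = p v x" if "x : spc B v" for v x using p(2) that by blast
 note s = idempotent_summand[OF B p(1), OF idem]
 have "irreducible_hom Q L (subrep B ?U) (%v x. p v (f v x)) & irreducible_hom Q (subrep B ?U) N g"
  by (rule conjI; rule summand_irreducible[OF ind s(1-3) p(3) s(4,5)]) (auto simp: idem)
 thus ?thesis using s(1,4) p(3,4) by blast
qed

lemma ar_arrowI: "indecomposable Q M ==> indecomposable Q N ==> irreducible_hom Q M N f ==> ar_arrow Q M N"
 by (auto simp: ar_arrow_def)

definition ar_rel :: "('v, 'a) quiver => (('v, 'a) quiver_rep \<times> ('v, 'a) quiver_rep) set" where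
 "ar_rel Q = {(X, Y). indecomposable Q X & indecomposable Q Y &
   (rep_iso Q X Y | ar_arrow Q X Y | ar_arrow Q Y X)}"

lemma ar_component_eq: "ar_component Q M = {N. (M, N) : (ar_rel Q)\<^sup>*}"
 by (simp add: ar_component_def ar_rel_def)

lemma sym_ar_rel: "sym (ar_rel Q)"
 unfolding sym_def ar_rel_def using rep_iso_sym indecomposable_rep by blast

lemma ar_component_cong:
 assumes "N : ar_component Q M" shows "ar_component Q N = ar_component Q M"
proof -
 have "(M, N) : (ar_rel Q)\<^sup>*" using assms by (simp add: ar_component_eq)
 moreover have "(N, M) : (ar_rel Q)\<^sup>*" using sym_rtrancl[OF sym_ar_rel] calculation by (meson symD)
 ultimately show ?thesis unfolding ar_component_eq by (auto intro: rtrancl_trans)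
qed

lemma ar_component_self: "M : ar_component Q M"
 by (simp add: ar_component_eq)

lemma ar_component_step: "N : ar_component Q M ==> (N, X) : ar_rel Q ==> X : ar_component Q M"
 by (auto simp: ar_component_eq)

lemma ar_component_iso:
 "N : ar_component Q M ==> indecomposable Q N ==> indecomposable Q X ==> rep_iso Q N X ==> X : ar_component Q M"
 by (rule ar_component_step) (auto simp: ar_rel_def)

lemma ar_component_indecomposable:
 assumes "N : ar_component Q M" "indecomposable Q M" shows "indecomposable Q N"
proof -
 have "(M, N) : (ar_rel Q)\<^sup>*" using assms by (simp add: ar_component_eq)
 thus ?thesis using assms(2) by (induction rule: rtrancl_induct) (auto simp: ar_rel_def)
qed

text \<open>An indecomposable summand of the middle term, found by \<open>middle_summand\<close>
  with identity maps, is joined by irreducible maps to both ends.\<close>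

lemma (in almost_split) ar_component_end:
 assumes "indecomposable Q L" "indecomposable Q N" "L : ar_component Q M"
 shows "N : ar_component Q M"
proof -
 obtain v x where x: "x : spc L v" "x ~= 0"
  using assms(1) cv.subspace_0[OF rep_subspace[OF L]] by (auto simp: indecomposable_def zero_fam_def fun_eq_iff)
 have "f v x ~= 0" using x rep_inj_iff[OF L f] f_inj by blast
 hence "EX v. EX y:spc B v. (%v x. x) v ((%v x. x) v y) ~= (0 :: cvec)" using hom_mem[OF f x(1)] by blast
 then obtain U p where U: "indecomposable Q (subrep B U)" "irreducible_hom Q L (subrep B U) (%v x. p v (f v x))"
   "irreducible_hom Q (subrep B U) N g"
  using middle_summand[OF assms(1,2) rep_hom_id rep_hom_id] by blast
 have "(L, subrep B U) : ar_rel Q" "(subrep B U, N) : ar_rel Q"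
  using U assms ar_arrowI by (auto simp: ar_rel_def)
 thus ?thesis using assms(3) ar_component_step by blast
qed

section \<open>Cyclic quivers and compatible sequences\<close>

text \<open>The vertices and arrows of the cycle are indexed \<open>n\<close>-periodically by the integers: the
 arrow \<open>e q\<close> joins \<open>w q\<close> and \<open>w (q + 1)\<close>, and it is clockwise iff \<open>cw q\<close>.\<close>

locale cyclic_quiver =
 fixes Q :: "('v::finite, 'a::finite) quiver" and n :: nat and w :: "int => 'v" and e :: "int => 'a"
  and cw :: "int => bool"
 assumes n2: "n >= 2" and w_eq: "!!q q'. w q = w q' \<longleftrightarrow> q mod int n = q' mod int n"
  and e_eq: "!!q q'. e q = e q' \<longleftrightarrow> q mod int n = q' mod int n"
  and w_surj: "!!v. EX q. v = w q" and e_surj: "!!a. EX q. a = e q"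
  and cw_cong: "!!q q'. q mod int n = q' mod int n ==> cw q = cw q'"
  and src_e: "!!q. src Q (e q) = (if cw q then w q else w (q + 1))"
  and tgt_e: "!!q. tgt Q (e q) = (if cw q then w (q + 1) else w q)"
  and ex_cw: "EX q. cw q" and ex_acw: "EX q. ~ cw q"
begin

lemma e_neq: "e q ~= e (q - 1)"
proof
 assume "e q = e (q - 1)"
 hence "int n dvd q - (q - 1)" using e_eq mod_eq_dvd_iff by blast
 thus False using n2 by auto
qed

lemma mod_add1: "q mod int n = q' mod int n ==> (q + k) mod int n = (q' + k) mod int n"
 by (metis mod_add_left_eq)

lemma mod_add1_iff: "(q + 1) mod int n = q' mod int n \<longleftrightarrow> q mod int n = (q' - 1) mod int n"
 using mod_add1[of "q + 1" q' "-1"] mod_add1[of q "q' - 1" 1] by auto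

lemma arrows_from: "{a. src Q a = w q} = (if cw q then {e q} else {}) \<union> (if cw (q - 1) then {} else {e (q - 1)})"
proof -
 have "src Q (e q') = w q \<longleftrightarrow> e q' : (if cw q then {e q} else {}) \<union> (if cw (q - 1) then {} else {e (q - 1)})" for q'
  using cw_cong[of q' q] cw_cong[of q' "q - 1"] by (auto simp: src_e w_eq e_eq mod_add1_iff)
 note * = this
 show ?thesis
 proof (rule Set.set_eqI)
  fix a
  obtain q' where "a = e q'" using e_surj by blast
  thus "a : {a. src Q a = w q} \<longleftrightarrow> a : (if cw q then {e q} else {}) \<union> (if cw (q - 1) then {} else {e (q - 1)})" using *[of q'] by simp
 qed
qed

lemma arrows_to: "{a. tgt Q a = w q} = (if cw q then {} else {e q}) \<union> (if cw (q - 1) then {e (q - 1)} else {})"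
proof -
 have "tgt Q (e q') = w q \<longleftrightarrow> e q' : (if cw q then {} else {e q}) \<union> (if cw (q - 1) then {e (q - 1)} else {})" for q'
  using cw_cong[of q' q] cw_cong[of q' "q - 1"] by (auto simp: tgt_e w_eq e_eq mod_add1_iff)
 note * = this
 show ?thesis
 proof (rule Set.set_eqI)
  fix a
  obtain q' where "a = e q'" using e_surj by blast
  thus "a : {a. tgt Q a = w q} \<longleftrightarrow> a : (if cw q then {} else {e q}) \<union> (if cw (q - 1) then {e (q - 1)} else {})" using *[of q'] by simp
 qed
qed

lemma sum_arrows_from: "(SUM a | src Q a = w q. F a) = (if cw q then F (e q) else 0) + (if cw (q - 1) then 0 else F (e (q - 1)))"
 for F :: "'a => 'b::comm_monoid_add"
 unfolding arrows_from using e_neq[of q] by (auto simp: add.commute)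

lemma sum_arrows_to: "(SUM a | tgt Q a = w q. F a) = (if cw q then 0 else F (e q)) + (if cw (q - 1) then F (e (q - 1)) else 0)"
 for F :: "'a => 'b::comm_monoid_add"
 unfolding arrows_to using e_neq[of q] by (auto simp: add.commute)

lemma cw_shift: "cw (q + int n * k) = cw q"
 by (rule cw_cong) simp

text \<open>The rank of a vertex is the length of a longest path that ends there: \<open>lft\<close>
  counts the clockwise arrows arriving in a row from the left, \<open>rgt\<close> the anticlockwise
  ones arriving from the right. Both are finite because both kinds of arrows occur.\<close>

lemma cyclic_fg_bounded: "fg_bounded Q"
proof -
 define lft rgt where "lft q = (LEAST k::nat. ~ cw (q - 1 - int k))" and "rgt q = (LEAST k::nat. cw (q + int k))" for q
 have exl: "EX k::nat. ~ cw (q - 1 - int k)" for q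
 proof -
  obtain q0 where q0: "~ cw q0" using ex_acw by blast
  have "~ cw (q - 1 - int (nat ((q - 1 - q0) mod int n)))"
  proof -
   have "(q - 1 - (q - 1 - q0) mod int n) mod int n = q0 mod int n" by (simp add: mod_diff_right_eq)
   thus ?thesis using q0 cw_cong n2 by (metis (no_types, lifting) int_nat_eq nat_0_le pos_mod_sign of_nat_0_less_iff
      zero_less_numeral less_le_trans)
  qed
  thus ?thesis by blast
 qed
 have exr: "EX k::nat. cw (q + int k)" for q
 proof -
  obtain q0 where q0: "cw q0" using ex_cw by blast
  have "cw (q + int (nat ((q0 - q) mod int n)))"
  proof -
   have "(q + (q0 - q) mod int n) mod int n = q0 mod int n" by (simp add: mod_add_right_eq)
   thus ?thesis using q0 cw_cong n2 by (metis (no_types, lifting) int_nat_eq nat_0_le pos_mod_sign of_nat_0_less_iff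
      zero_less_numeral less_le_trans)
  qed
  thus ?thesis by blast
 qed
 have lS: "lft (q + 1) = Suc (lft q)" if "cw q" for q
 proof -
  obtain k where "~ cw (q + 1 - 1 - int k)" using exl[of "q + 1"] by blast
  hence "lft (q + 1) = Suc (LEAST k. ~ cw (q + 1 - 1 - int (Suc k)))"
   unfolding lft_def by (rule Least_Suc) (use that in simp)
  also have "(%k. ~ cw (q + 1 - 1 - int (Suc k))) = (%k. ~ cw (q - 1 - int k))" by (simp add: algebra_simps)
  finally show ?thesis by (simp add: lft_def)
 qed
 have l0: "lft (q + 1) = 0" if "~ cw q" for q using that by (simp add: lft_def)
 have rS: "rgt q = Suc (rgt (q + 1))" if "~ cw q" for q
 proof -
  obtain k where "cw (q + int k)" using exr[of q] by blast
  hence "rgt q = Suc (LEAST k. cw (q + int (Suc k)))"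
   unfolding rgt_def by (rule Least_Suc) (use that in simp)
  also have "(%k. cw (q + int (Suc k))) = (%k. cw (q + 1 + int k))" by (simp add: algebra_simps)
  finally show ?thesis by (simp add: rgt_def)
 qed
 have r0: "rgt q = 0" if "cw q" for q using that by (simp add: rgt_def)
 have cong: "lft q = lft q'" "rgt q = rgt q'" if "q mod int n = q' mod int n" for q q'
 proof -
  have "cw (q - 1 - int k) = cw (q' - 1 - int k)" "cw (q + int k) = cw (q' + int k)" for k
   using cw_cong[OF mod_add1[OF that, of "- 1 - int k"]] cw_cong[OF mod_add1[OF that, of "int k"]]
   by (simp_all add: algebra_simps)
  thus "lft q = lft q'" "rgt q = rgt q'" by (simp_all add: lft_def rgt_def)
 qed
 define rank where "rank v = (let q = (SOME q. v = w q) in max (lft q) (rgt q))" for v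
 have rank: "rank (w q) = max (lft q) (rgt q)" for q
 proof -
  have "w q = w (SOME q'. w q = w q')" by (rule someI_ex) blast
  hence "q mod int n = (SOME q'. w q = w q') mod int n" by (simp only: w_eq)
  from cong[OF this] show ?thesis by (simp add: rank_def Let_def)
 qed
 have "rank (src Q a) < rank (tgt Q a)" for a
 proof -
  obtain q where q: "a = e q" using e_surj by blast
  show ?thesis
  proof (cases "cw q")
   case True thus ?thesis by (simp add: q src_e tgt_e rank r0 lS)
  next
   case False thus ?thesis by (simp add: q src_e tgt_e rank rS l0)
  qed
 qed
 thus ?thesis by (rule acyclic_fg_bounded)
qed

section \<open>Sequences on the universal cover of the cycle\<close>

definition step :: "('v, 'a) quiver_rep => int => cvec => cvec => bool" where
 "step M q x y \<longleftrightarrow> (if cw q then act M (e q) x = y else act M (e q) y = x)"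

definition compat :: "('v, 'a) quiver_rep => (int => cvec) => bool" where
 "compat M xi \<longleftrightarrow> (ALL q. xi q : spc M (w q) & step M q (xi q) (xi (q + 1)))"

text \<open>The length \<open>k\<close> of the window is explicit for the sake of an induction in
  which it changes by two at each almost split sequence.\<close>

definition no_compat :: "('v, 'a) quiver_rep => nat => bool" where
 "no_compat M k \<longleftrightarrow> (ALL xi l. compat M xi & (ALL q. q < l | q >= l + int k --> xi q = 0) --> (ALL q. xi q = 0))"

definition tpos :: "int => int" where
 "tpos q = (if cw q then q + 1 else q)"

definition spos :: "int => int" where
 "spos q = (if cw q then q else q + 1)"

lemma src_spos: "src Q (e q) = w (spos q)" and tgt_tpos: "tgt Q (e q) = w (tpos q)"
 by (simp_all add: src_e tgt_e spos_def tpos_def)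

lemma e_position_src: "src Q (e q) = w q' ==> EX q0. e q0 = e q & spos q0 = q'"
proof -
 assume "src Q (e q) = w q'"
 hence m: "(q + (q' - spos q)) mod int n = q mod int n"
  by (metis src_spos w_eq add.commute diff_add_cancel mod_add1 add_diff_cancel_left' add_diff_eq)
 hence "cw (q + (q' - spos q)) = cw q" by (rule cw_cong)
 thus ?thesis using m e_eq[of "q + (q' - spos q)" q] by (intro exI[of _ "q + (q' - spos q)"]) (simp add: spos_def)
qed

lemma e_position_tgt: "tgt Q (e q) = w q' ==> EX q0. e q0 = e q & tpos q0 = q'"
proof -
 assume "tgt Q (e q) = w q'"
 hence m: "(q + (q' - tpos q)) mod int n = q mod int n"
  by (metis tgt_tpos w_eq add.commute diff_add_cancel mod_add1 add_diff_cancel_left' add_diff_eq)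
 hence "cw (q + (q' - tpos q)) = cw q" by (rule cw_cong)
 thus ?thesis using m e_eq[of "q + (q' - tpos q)" q] by (intro exI[of _ "q + (q' - tpos q)"]) (simp add: tpos_def)
qed

lemma act_mem_cw: "is_rep Q M ==> cw q ==> x : spc M (w q) ==> act M (e q) x : spc M (w (q + 1))"
 using rep_act_mem[of Q M x "e q"] by (simp add: src_e tgt_e)

lemma act_mem_acw: "is_rep Q M ==> ~ cw q ==> x : spc M (w (q + 1)) ==> act M (e q) x : spc M (w q)"
 using rep_act_mem[of Q M x "e q"] by (simp add: src_e tgt_e)

lemma compat_mem: "compat M xi ==> xi q : spc M (w q)"
 and compat_cw: "compat M xi ==> cw q ==> act M (e q) (xi q) = xi (q + 1)"
 and compat_acw: "compat M xi ==> ~ cw q ==> act M (e q) (xi (q + 1)) = xi q"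
 by (auto simp: compat_def step_def)

lemma compat_act: "compat M xi ==> act M (e q) (xi (spos q)) = xi (tpos q)"
 by (simp add: spos_def tpos_def compat_cw compat_acw)

lemma compat_values: "compat M xi ==> {xi q |q. w q = v} <= spc M v"
 using compat_mem by force

lemma span_compat_submodule:
 assumes "is_rep Q M" "compat M xi"
 shows "submodule Q M (%v. cv.span {xi q |q. w q = v})"
proof (rule submoduleI)
 have sub: "{xi q |q. w q = v} <= spc M v" for v by (rule compat_values[OF assms(2)])
 show "x : spc M v" if "x : cv.span {xi q |q. w q = v}" for v x
  using cv.span_minimal[OF sub rep_subspace[OF assms(1)]] that by blast
 show "act M a x : cv.span {xi q |q. w q = tgt Q a}" if x: "x : cv.span {xi q |q. w q = src Q a}" for a x
 proof -
  have "act M a ` cv.span {xi q |q. w q = src Q a} = cv.span (act M a ` {xi q |q. w q = src Q a})"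
   by (rule lft_span_image[OF rep_act[OF assms(1)] rep_subspace[OF assms(1)] rep_subspace[OF assms(1)] sub])
  moreover have "act M a ` {xi q |q. w q = src Q a} <= {xi q |q. w q = tgt Q a}"
  proof
   fix y assume "y : act M a ` {xi q |q. w q = src Q a}"
   then obtain q where q: "w q = src Q a" "y = act M a (xi q)" by blast
   obtain q1 where q1: "a = e q1" using e_surj by blast
   obtain q0 where "e q0 = e q1" "spos q0 = q" using e_position_src[of q1 q] q q1 by auto
   hence q0: "e q0 = a" "spos q0 = q" using q1 by simp_all
   have "y = xi (tpos q0)" using q(2) compat_act[OF assms(2), of q0] q0 by simp
   moreover have "w (tpos q0) = tgt Q a" using tgt_tpos[of q0] q0 by simp
   ultimately show "y : {xi q |q. w q = tgt Q a}" by blast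
  qed
  ultimately show ?thesis using x cv.span_mono by blast
 qed
qed simp

lemma
 assumes "connection Q L N h"
 shows connection_lin: "linear_from_to (spc L (tgt Q a)) (spc N (src Q a)) (h a)"
  and connection_mem: "l : spc L (w (tpos q)) ==> h (e q) l : spc N (w (spos q))"
  and connection_faithful: "submodule Q L K ==> (!!a l. l : K (tgt Q a) ==> h a l = 0) ==> K = zero_fam"
  and connection_generates: "submodule Q N W ==> (!!a l. l : spc L (tgt Q a) ==> h a l : W (src Q a)) ==> W = spc N"
proof -
 show *: "linear_from_to (spc L (tgt Q a)) (spc N (src Q a)) (h a)" for a
  using assms by (simp add: connection_def)
 show "l : spc L (w (tpos q)) ==> h (e q) l : spc N (w (spos q))"
  using lft_mem[OF *, of l "e q"] by (simp add: src_spos tgt_tpos)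
qed (use assms in \<open>unfold connection_def, blast+\<close>)

lemma connection_0: "is_rep Q L ==> connection Q L N h ==> h a 0 = 0"
 by (rule lft_zero[OF connection_lin rep_subspace])

lemma connection_closed:
 assumes "connection Q L N h" "l : spc L (w q)"
 shows "(if cw q then h (e q) (act L (e q) l) else 0) + (if cw (q - 1) then 0 else h (e (q - 1)) (act L (e (q - 1)) l))
  = (if cw q then 0 else act N (e q) (h (e q) l)) + (if cw (q - 1) then act N (e (q - 1)) (h (e (q - 1)) l) else 0)"
proof -
 have "(SUM a | src Q a = w q. h a (act L a l)) = (SUM a | tgt Q a = w q. act N a (h a l))"
  using assms unfolding connection_def by blast
 thus ?thesis unfolding sum_arrows_from sum_arrows_to .
qed

text \<open>A sequence in \<open>L\<close> gives a vector of \<open>N\<close> at each position,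
  computed from the edge on the right (\<open>lam\<close>) or from the edge on the left
  (\<open>rho\<close>, indexed by that edge). The signs turn the preprojective relation at
  \<open>w q\<close> into the equality of \<open>lam\<close> at \<open>q\<close> and
  \<open>rho\<close> at \<open>q - 1\<close>.\<close>

definition lam :: "('v, 'a) quiver_rep => ('a => cvec => cvec) => (int => cvec) => int => cvec" where
 "lam N h xi q = (if cw q then h (e q) (xi (q + 1)) else - act N (e q) (h (e q) (xi q)))"

definition rho :: "('v, 'a) quiver_rep => ('a => cvec => cvec) => (int => cvec) => int => cvec" where
 "rho N h xi q = (if cw q then act N (e q) (h (e q) (xi (q + 1))) else - h (e q) (xi q))"

lemma lam_eq_rho:
 assumes "connection Q L N h" "xi q : spc L (w q)" "cw q ==> act L (e q) (xi q) = xi (q + 1)"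
  "~ cw (q - 1) ==> act L (e (q - 1)) (xi q) = xi (q - 1)"
 shows "lam N h xi q = rho N h xi (q - 1)"
 using connection_closed[OF assms(1,2)] assms(3,4)
 by (cases "cw q"; cases "cw (q - 1)") (simp_all add: lam_def rho_def eq_neg_iff_add_eq_0 neg_eq_iff_add_eq_0 add.commute)

lemma lam_mem:
 assumes "is_rep Q N" "connection Q L N h" "xi (tpos q) : spc L (w (tpos q))"
 shows "lam N h xi q : spc N (w q)"
 using connection_mem[OF assms(2,3)] act_mem_acw[OF assms(1), of q]
 by (auto simp: lam_def spos_def tpos_def cv.subspace_neg[OF rep_subspace[OF assms(1)]] split: if_splits)

lemma lam_step:
 assumes "is_rep Q N" "connection Q L N h" "xi (tpos q) : spc L (w (tpos q))" "lam N h xi (q + 1) = rho N h xi q"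
 shows "step N q (lam N h xi q) (lam N h xi (q + 1))"
proof (cases "cw q")
 case True thus ?thesis using assms(4) by (simp add: step_def lam_def rho_def)
next
 case False
 have "h (e q) (xi q) : spc N (src Q (e q))"
  using connection_mem[OF assms(2,3)] False by (simp add: src_e spos_def tpos_def)
 from lft_neg[OF rep_act[OF assms(1)] this] show ?thesis
  unfolding step_def assms(4) using False by (simp add: lam_def rho_def)
qed

lemma lam_compat:
 assumes "is_rep Q N" "connection Q L N h" "compat L xi"
 shows "lam N h xi (q + 1) = rho N h xi q" "compat N (lam N h xi)"
proof -
 have m: "xi p : spc L (w p)" for p using compat_mem[OF assms(3)] .
 have *: "lam N h xi (p + 1) = rho N h xi p" for p
  using lam_eq_rho[where q = "p + 1" and xi = xi, OF assms(2) m[of "p + 1"]] compat_cw[OF assms(3), of "p + 1"]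
   compat_acw[OF assms(3), of p] by simp
 thus "lam N h xi (q + 1) = rho N h xi q" .
 have "lam N h xi p : spc N (w p)" for p by (rule lam_mem[where xi = xi, OF assms(1,2) m])
 moreover have "step N p (lam N h xi p) (lam N h xi (p + 1))" for p
  by (rule lam_step[where xi = xi, OF assms(1,2) m *])
 ultimately show "compat N (lam N h xi)" by (simp add: compat_def)
qed

text \<open>If \<open>lam\<close> vanishes, so does \<open>rho\<close>, and thus \<open>h\<close> is
  zero on all entries of the sequence. The entries span a submodule of \<open>L\<close>, which is
  zero because the connection is faithful.\<close>

lemma lam_zero:
 assumes "is_rep Q L" "is_rep Q N" "connection Q L N h" "compat L xi" "!!q. lam N h xi q = 0"
 shows "xi q = 0"
proof -
 let ?K = "%v. cv.span {xi q |q. w q = v}"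
 have hz: "h (e q) (xi (tpos q)) = 0" for q
  using assms(5)[of q] assms(5)[of "q + 1"] lam_compat(1)[OF assms(2,3,4), of q]
  by (cases "cw q") (auto simp: tpos_def lam_def rho_def)
 have K: "submodule Q L ?K" by (rule span_compat_submodule[OF assms(1,4)])
 have "h a l = 0" if l: "l : ?K (tgt Q a)" for a l
 proof -
  have sub: "{xi q |q. w q = tgt Q a} <= spc L (tgt Q a)" by (rule compat_values[OF assms(4)])
  have "h a ` ?K (tgt Q a) = cv.span (h a ` {xi q |q. w q = tgt Q a})"
   by (rule lft_span_image[OF connection_lin[OF assms(3)] rep_subspace[OF assms(1)] rep_subspace[OF assms(2)] sub])
  moreover have im0: "h a ` {xi q |q. w q = tgt Q a} <= {0}"
  proof
   fix y assume "y : h a ` {xi q |q. w q = tgt Q a}"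
   then obtain q where q: "w q = tgt Q a" "y = h a (xi q)" by blast
   obtain q1 where q1: "a = e q1" using e_surj by blast
   obtain q0 where "e q0 = e q1" "tpos q0 = q" using e_position_tgt[of q1 q] q q1 by auto
   hence "e q0 = a" "tpos q0 = q" using q1 by simp_all
   thus "y : {0}" using q(2) hz[of q0] by simp
  qed
  ultimately have "h a ` ?K (tgt Q a) <= cv.span {0}" using cv.span_mono[OF im0] by simp
  hence "h a l : cv.span {0}" using l by blast
  thus ?thesis by simp
 qed
 hence "?K = zero_fam" by (rule connection_faithful[OF assms(3) K])
 from fun_cong[OF this, of "w q"] have "?K (w q) = {0}" by (simp add: zero_fam_def)
 moreover have "xi q : ?K (w q)" by (rule cv.span_base) blast
 ultimately show ?thesis by blast
qed

lemma no_compat_mono: "no_compat M k ==> j <= k ==> no_compat M j"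
 unfolding no_compat_def by (meson le_trans add_left_mono of_nat_mono order_trans)

text \<open>\<open>lam\<close> loses one position at each end: on the left it is computed as
  \<open>rho\<close> from the preceding edge, on the right from the following edge, and a zero entry
  outside the window forces the entry it is mapped to to vanish.\<close>

lemma no_compat_step:
 assumes L: "is_rep Q L" and N: "is_rep Q N" and h: "connection Q L N h" and k: "no_compat N k"
 shows "no_compat L (k + 2)"
 unfolding no_compat_def
proof (intro allI impI, elim conjE)
 fix xi l q assume xi: "compat L xi" and supp: "ALL q. q < l | q >= l + int (k + 2) --> xi q = 0"
 have h0: "h a 0 = 0" for a by (rule connection_0[OF L h])
 have "lam N h xi q = 0" if q: "q < l + 1 | q >= l + 1 + int k" for q
  using q
 proof
  assume q: "q < l + 1"
  have "xi (tpos (q - 1)) = 0"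
  proof (cases "cw (q - 1)")
   case True
   have "xi (q - 1) = 0" using supp q by simp
   hence "xi q = 0" using compat_cw[OF xi True] rep_act_0[OF L] by simp
   thus ?thesis using True by (simp add: tpos_def)
  next
   case False thus ?thesis using supp q by (simp add: tpos_def)
  qed
  hence "rho N h xi (q - 1) = 0" by (cases "cw (q - 1)") (simp_all add: rho_def tpos_def h0 rep_act_0[OF N])
  thus ?thesis using lam_compat(1)[OF N h xi, of "q - 1"] by simp
 next
  assume q: "q >= l + 1 + int k"
  have "xi (tpos q) = 0"
  proof (cases "cw q")
   case True thus ?thesis using supp q by (simp add: tpos_def)
  next
   case False
   have "xi (q + 1) = 0" using supp q by simp
   hence "xi q = 0" using compat_acw[OF xi False] rep_act_0[OF L] by simp
   thus ?thesis using False by (simp add: tpos_def)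
  qed
  thus ?thesis by (cases "cw q") (simp_all add: lam_def tpos_def h0 rep_act_0[OF N])
 qed
 hence "lam N h xi q = 0" for q
  using k lam_compat(2)[OF N h xi] unfolding no_compat_def by blast
 thus "xi q = 0" by (rule lam_zero[OF L N h xi])
qed

lemma no_compat_0: "no_compat M 0"
 unfolding no_compat_def by (auto simp: not_less)

text \<open>No member of the component is injective, so each one starts an almost split sequence
  whose end is again a member. Starting from empty windows, every step gains two positions for all
  members at once.\<close>

theorem regular_no_compat:
 assumes "indecomposable Q M" "regular_component Q (ar_component Q M)"
 shows "no_compat M k"
proof -
 have "ALL X : ar_component Q M. no_compat X (2 * m)" for m
 proof (induction m)
  case 0 thus ?case using no_compat_0 by simp
 next
  case (Suc m)
  show ?case
  proof
   fix X assume X: "X : ar_component Q M"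
   have Xi: "indecomposable Q X" by (rule ar_component_indecomposable[OF X assms(1)])
   have "~ injective Q X" using assms(2) X by (simp add: regular_component_def)
   then obtain B N f g where s: "almost_split_seq Q X B N f g" "indecomposable Q N"
    using almost_split_exists[OF cyclic_fg_bounded Xi] by blast
   interpret almost_split Q X B N f g by unfold_locales (rule s(1))
   have "N : ar_component Q M" by (rule ar_component_end[OF Xi s(2) X])
   hence Nk: "no_compat N (2 * m)" using Suc by blast
   obtain h where "connection Q X N h" using connection_exists by blast
   from no_compat_step[OF L N this Nk] show "no_compat X (2 * Suc m)" by simp
  qed
 qed
 hence "no_compat M (2 * k)" using ar_component_self by blast
 thus ?thesis by (rule no_compat_mono) simp
qed

subsection \<open>The dual statement\<close>

definition flin :: "cvec set => (cvec => complex) => bool" where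
 "flin V ph \<longleftrightarrow> (ALL x:V. ALL y:V. ph (x + y) = ph x + ph y) & (ALL c. ALL x:V. ph (cscale c x) = c * ph x)"

definition dcompat :: "('v, 'a) quiver_rep => (int => cvec => complex) => bool" where
 "dcompat M ph \<longleftrightarrow> (ALL q. flin (spc M (w q)) (ph q) &
   (if cw q then ALL x:spc M (w q). ph q x = ph (q + 1) (act M (e q) x)
   else ALL x:spc M (w (q + 1)). ph (q + 1) x = ph q (act M (e q) x)))"

definition no_dcompat :: "('v, 'a) quiver_rep => nat => bool" where
 "no_dcompat M k \<longleftrightarrow> (ALL ph l. dcompat M ph & (ALL q. q < l | q >= l + int k --> (ALL x:spc M (w q). ph q x = 0)) -->
   (ALL q. ALL x:spc M (w q). ph q x = 0))"

lemma flin_0: "flin V ph ==> 0 : V ==> ph 0 = 0"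
 unfolding flin_def by (metis cv.scale_zero_left mult_zero_left)

lemma dcompat_flin: "dcompat M ph ==> flin (spc M (w q)) (ph q)"
 and dcompat_cw: "dcompat M ph ==> cw q ==> x : spc M (w q) ==> ph (q + 1) (act M (e q) x) = ph q x"
 and dcompat_acw: "dcompat M ph ==> ~ cw q ==> x : spc M (w (q + 1)) ==> ph q (act M (e q) x) = ph (q + 1) x"
 unfolding dcompat_def by metis+

text \<open>The adjoint of \<open>lam\<close>. It carries sequences of functionals from
  \<open>N\<close> to \<open>L\<close>, so the induction runs against the one above and needs almost
  split sequences that end at a given module; these are part of the structure of a tube.\<close>

definition dlam :: "('v, 'a) quiver_rep => ('a => cvec => cvec) => (int => cvec => complex) => int => cvec => complex" where
 "dlam L h ph q x = (if cw q then ph q (h (e q) (act L (e q) x)) else - ph (q + 1) (h (e q) x))"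

definition drho :: "('v, 'a) quiver_rep => ('a => cvec => cvec) => (int => cvec => complex) => int => cvec => complex" where
 "drho L h ph q x = (if cw q then ph q (h (e q) x) else - ph (q + 1) (h (e q) (act L (e q) x)))"

context
 fixes L N h ph
 assumes L: "is_rep Q L" and N: "is_rep Q N" and h: "connection Q L N h" and ph: "dcompat N ph"
begin

private lemma h_cw: "cw q ==> l : spc L (w (q + 1)) ==> h (e q) l : spc N (w q)"
 using connection_mem[OF h, of l q] by (simp add: tpos_def spos_def)

private lemma h_acw: "~ cw q ==> l : spc L (w q) ==> h (e q) l : spc N (w (q + 1))"
 using connection_mem[OF h, of l q] by (simp add: tpos_def spos_def)

lemma dlam_eq_drho:
 assumes x: "x : spc L (w q)" shows "dlam L h ph q x = drho L h ph (q - 1) x"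
proof -
 have add: "ph q (y + z) = ph q y + ph q z" if "y : spc N (w q)" "z : spc N (w q)" for y z
  using dcompat_flin[OF ph, of q] that by (simp add: flin_def)
 have z: "ph q 0 = 0" by (rule flin_0[OF dcompat_flin[OF ph] cv.subspace_0[OF rep_subspace[OF N]]])
 note c = arg_cong[OF connection_closed[OF h x], of "ph q"]
 show ?thesis
 proof (cases "cw q")
  case 1: True
  have m1: "h (e q) (act L (e q) x) : spc N (w q)" by (rule h_cw[OF 1 act_mem_cw[OF L 1 x]])
  show ?thesis
  proof (cases "cw (q - 1)")
   case 2: True
   have m2: "h (e (q - 1)) x : spc N (w (q - 1))" using h_cw[OF 2] x by simp
   show ?thesis using c 1 2 dcompat_cw[OF ph 2 m2] by (simp add: dlam_def drho_def)
  next
   case 2: False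
   have "act L (e (q - 1)) x : spc L (w (q - 1))" using act_mem_acw[OF L 2] x by simp
   from h_acw[OF 2 this] have m2: "h (e (q - 1)) (act L (e (q - 1)) x) : spc N (w q)" by simp
   show ?thesis using c 1 2 add[OF m1 m2] z by (simp add: dlam_def drho_def eq_neg_iff_add_eq_0)
  qed
 next
  case 1: False
  have m1: "h (e q) x : spc N (w (q + 1))" by (rule h_acw[OF 1 x])
  note a1 = act_mem_acw[OF N 1 m1]
  show ?thesis
  proof (cases "cw (q - 1)")
   case 2: True
   have m2: "h (e (q - 1)) x : spc N (w (q - 1))" using h_cw[OF 2] x by simp
   have a2: "act N (e (q - 1)) (h (e (q - 1)) x) : spc N (w q)" using act_mem_cw[OF N 2 m2] by simp
   show ?thesis using c 1 2 add[OF a1 a2] z dcompat_cw[OF ph 2 m2] dcompat_acw[OF ph 1 m1]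
    by (simp add: dlam_def drho_def neg_eq_iff_add_eq_0)
  next
   case 2: False
   show ?thesis using c 1 2 dcompat_acw[OF ph 1 m1] by (simp add: dlam_def drho_def)
  qed
 qed
qed

lemma dlam_dcompat: "dcompat L (dlam L h ph)"
 unfolding dcompat_def
proof (intro allI conjI)
 fix q
 show "flin (spc L (w q)) (dlam L h ph q)"
 proof (cases "cw q")
  case True
  have l: "linear_from_to (spc L (w q)) (spc N (w q)) (%x. h (e q) (act L (e q) x))"
   using lft_comp[OF rep_act[OF L, of "e q"] connection_lin[OF h, of "e q"]] True by (simp add: src_e)
  thus ?thesis using dcompat_flin[OF ph, of q] True
   by (simp add: flin_def dlam_def lft_add[OF l] lft_scale[OF l] lft_mem[OF l])
 next
  case False
  have l: "linear_from_to (spc L (w q)) (spc N (w (q + 1))) (h (e q))"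
   using connection_lin[OF h, of "e q"] False by (simp add: src_e tgt_e)
  thus ?thesis using dcompat_flin[OF ph, of "q + 1"] False
   by (simp add: flin_def dlam_def lft_add[OF l] lft_scale[OF l] lft_mem[OF l])
 qed
 show "if cw q then ALL x:spc L (w q). dlam L h ph q x = dlam L h ph (q + 1) (act L (e q) x)
   else ALL x:spc L (w (q + 1)). dlam L h ph (q + 1) x = dlam L h ph q (act L (e q) x)"
 proof (cases "cw q")
  case True
  thus ?thesis using dlam_eq_drho[OF act_mem_cw[OF L True]] by (simp add: dlam_def[of L h ph q] drho_def)
 next
  case False
  thus ?thesis using dlam_eq_drho[of _ "q + 1"] by (simp add: dlam_def[of L h ph q] drho_def)
 qed
qed

text \<open>The vectors on which all functionals of the sequence vanish form a submodule of
  \<open>N\<close> that contains the values of \<open>h\<close>, hence all of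
  \<open>N\<close>.\<close>

lemma dlam_zero:
 assumes z: "!!q x. x : spc L (w q) ==> dlam L h ph q x = 0"
 shows "ALL x:spc N (w q). ph q x = 0"
proof -
 have hz: "ph (spos q) (h (e q) l) = 0" if l: "l : spc L (w (tpos q))" for q l
 proof (cases "cw q")
  case True
  hence l': "l : spc L (w (q + 1))" using l by (simp add: tpos_def)
  have "drho L h ph q l = 0" using dlam_eq_drho[OF l'] z[OF l'] by simp
  thus ?thesis using True by (simp add: drho_def spos_def)
 next
  case False
  thus ?thesis using z[of l q] l by (simp add: dlam_def spos_def tpos_def)
 qed
 let ?W = "%v. {x : spc N v. ALL q. w q = v --> ph q x = 0}"
 have f: "ph q (x + y) = ph q x + ph q y" "ph q (cscale c x) = c * ph q x" if "x : spc N (w q)" "y : spc N (w q)" for q x y c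
  using dcompat_flin[OF ph, of q] that by (auto simp: flin_def)
 have f0: "ph q 0 = 0" for q by (rule flin_0[OF dcompat_flin[OF ph] cv.subspace_0[OF rep_subspace[OF N]]])
 have W: "submodule Q N ?W"
 proof (rule submoduleI)
  show "cv.subspace (?W v)" for v
   by (rule cv.subspaceI)
    (auto simp: f f0 cv.subspace_add[OF rep_subspace[OF N]] cv.subspace_scale[OF rep_subspace[OF N]] cv.subspace_0[OF rep_subspace[OF N]])
  show "act N a x : ?W (tgt Q a)" if x: "x : ?W (src Q a)" for a x
  proof -
   have "ph q (act N a x) = 0" if q: "w q = tgt Q a" for q
   proof -
    obtain q1 where q1: "a = e q1" using e_surj by blast
    obtain q0 where "e q0 = e q1" "tpos q0 = q" using e_position_tgt[of q1 q] q q1 by auto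
    hence q0: "a = e q0" "tpos q0 = q" using q1 by simp_all
    have x': "x : spc N (w (spos q0))" "ph (spos q0) x = 0" using x q0 by (auto simp: src_spos)
    show ?thesis
     using x' q0 dcompat_cw[OF ph, of q0 x] dcompat_acw[OF ph, of q0 x]
     by (cases "cw q0") (auto simp: spos_def tpos_def)
   qed
   thus ?thesis using x rep_act_mem[OF N] by simp
  qed
 qed simp
 have "?W = spc N"
 proof (rule connection_generates[OF h W])
  fix a l assume l: "l : spc L (tgt Q a)"
  have "ph q (h a l) = 0" if q: "w q = src Q a" for q
  proof -
   obtain q1 where q1: "a = e q1" using e_surj by blast
   obtain q0 where "e q0 = e q1" "spos q0 = q" using e_position_src[of q1 q] q q1 by auto
   hence q0: "a = e q0" "spos q0 = q" using q1 by simp_all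
   thus ?thesis using hz[of l q0] l by (simp add: tgt_tpos)
  qed
  thus "h a l : ?W (src Q a)" using lft_mem[OF connection_lin[OF h] l] by simp
 qed
 from fun_cong[OF this, of "w q"] show ?thesis by blast
qed

end

lemma no_dcompat_step:
 assumes L: "is_rep Q L" and N: "is_rep Q N" and h: "connection Q L N h" and k: "no_dcompat L k"
 shows "no_dcompat N (k + 2)"
 unfolding no_dcompat_def
proof (intro allI impI, elim conjE)
 fix ph l q assume ph: "dcompat N ph" and supp: "ALL q. q < l | q >= l + int (k + 2) --> (ALL x:spc N (w q). ph q x = 0)"
 have src0: "dlam L h ph q x = 0" if "!!y. y : spc N (w (spos q)) ==> ph (spos q) y = 0" "x : spc L (w q)" for q x
 proof (cases "cw q")
  case True
  thus ?thesis using that(1)[of "h (e q) (act L (e q) x)"] connection_mem[OF h, of "act L (e q) x" q]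
   act_mem_cw[OF L True that(2)] by (simp add: dlam_def spos_def tpos_def)
 next
  case False
  thus ?thesis using that(1)[of "h (e q) x"] connection_mem[OF h, of x q] that(2)
   by (simp add: dlam_def spos_def tpos_def)
 qed
 have src0': "drho L h ph q x = 0" if "!!y. y : spc N (w (spos q)) ==> ph (spos q) y = 0" "x : spc L (w (q + 1))" for q x
 proof (cases "cw q")
  case True
  thus ?thesis using that(1)[of "h (e q) x"] connection_mem[OF h, of x q] that(2)
   by (simp add: drho_def spos_def tpos_def)
 next
  case False
  thus ?thesis using that(1)[of "h (e q) (act L (e q) x)"] connection_mem[OF h, of "act L (e q) x" q]
   act_mem_acw[OF L False that(2)] by (simp add: drho_def spos_def tpos_def)
 qed
 have "dlam L h ph q x = 0" if q: "q < l + 1 | q >= l + 1 + int k" and x: "x : spc L (w q)" for q x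
  using q
 proof
  assume q: "q < l + 1"
  have "ph (spos (q - 1)) y = 0" if y: "y : spc N (w (spos (q - 1)))" for y
  proof (cases "cw (q - 1)")
   case True thus ?thesis using supp q y by (simp add: spos_def)
  next
   case False
   hence y': "y : spc N (w (q - 1 + 1))" using y by (simp add: spos_def)
   have "ph (q - 1) (act N (e (q - 1)) y) = 0" using supp q act_mem_acw[OF N False y'] by simp
   thus ?thesis using dcompat_acw[OF ph False y'] False by (simp add: spos_def)
  qed
  hence "drho L h ph (q - 1) x = 0" using x by (intro src0') simp_all
  thus ?thesis using dlam_eq_drho[OF L N h ph x] by simp
 next
  assume q: "q >= l + 1 + int k"
  have "ph (spos q) y = 0" if y: "y : spc N (w (spos q))" for y
  proof (cases "cw q")
   case True
   hence y': "y : spc N (w q)" using y by (simp add: spos_def)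
   have "ph (q + 1) (act N (e q) y) = 0" using supp q act_mem_cw[OF N True y'] by simp
   thus ?thesis using dcompat_cw[OF ph True y'] True by (simp add: spos_def)
  next
   case False thus ?thesis using supp q y by (simp add: spos_def)
  qed
  thus ?thesis using x by (intro src0)
 qed
 hence "dlam L h ph q x = 0" if "x : spc L (w q)" for q x
  using k dlam_dcompat[OF L N h ph] that unfolding no_dcompat_def by blast
 thus "ALL x:spc N (w q). ph q x = 0" by (rule dlam_zero[OF L N h ph])
qed

lemma no_dcompat_0: "no_dcompat M 0"
 unfolding no_dcompat_def by (auto simp: not_less)

lemma no_dcompat_mono: "no_dcompat M k ==> j <= k ==> no_dcompat M j"
 unfolding no_dcompat_def by (meson le_trans add_left_mono of_nat_mono order_trans)

lemma step_cong: "q mod int n = q' mod int n ==> step M q = step M q'"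
 using cw_cong[of q q'] e_eq[of q q'] by (simp add: step_def fun_eq_iff)

lemma step_0: "is_rep Q M ==> step M q 0 0"
 by (simp add: step_def rep_act_0)

lemma step_add:
 assumes "is_rep Q M" "x : spc M (w q)" "x' : spc M (w q)" "y : spc M (w (q + 1))" "y' : spc M (w (q + 1))"
  "step M q x y" "step M q x' y'"
 shows "step M q (x + x') (y + y')"
 using assms rep_act_add[OF assms(1), of x "e q" x'] rep_act_add[OF assms(1), of y "e q" y']
 by (auto simp: step_def src_e split: if_splits)

lemma step_scale:
 assumes "is_rep Q M" "x : spc M (w q)" "y : spc M (w (q + 1))" "step M q x y"
 shows "step M q (cscale c x) (cscale c y)"
 using assms rep_act_scale[OF assms(1), of x "e q" c] rep_act_scale[OF assms(1), of y "e q" c]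
 by (auto simp: step_def src_e split: if_splits)

section \<open>Representations with bijective anticlockwise arrows\<close>

definition acwbij :: "('v, 'a) quiver_rep => bool" where
 "acwbij M \<longleftrightarrow> is_rep Q M & (ALL q. ~ cw q --> bij_betw (act M (e q)) (spc M (w (q + 1))) (spc M (w q)))"

definition sg :: "('v, 'a) quiver_rep => int => cvec => cvec" where
 "sg M q = (if cw q then act M (e q) else the_inv_into (spc M (w (q + 1))) (act M (e q)))"

fun sgp :: "('v, 'a) quiver_rep => int => nat => cvec => cvec" where
 "sgp M q 0 x = x"
| "sgp M q (Suc j) x = sg M (q + int j) (sgp M q j x)"

lemma acwbij_rep: "acwbij M ==> is_rep Q M"
 by (simp add: acwbij_def)

lemma w_add: "w q = w q' ==> w (q + k) = w (q' + k)"
 using mod_add1[of q q' k] by (simp add: w_eq)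

lemma sg_cong: "w q = w q' ==> sg M q = sg M q'"
 using cw_cong[of q q'] e_eq[of q q'] w_add[of q q' 1] by (simp add: sg_def w_eq[of q])

lemma w_add_iff: "w (q + k) = w (q' + k) \<longleftrightarrow> w q = w q'"
 using w_add[of "q + k" "q' + k" "- k"] w_add[of q q' k] by auto

lemma sgp_cong: "w q = w q' ==> sgp M q j x = sgp M q' j x"
proof (induction j)
 case (Suc j)
 have "sg M (q + int j) = sg M (q' + int j)" by (rule sg_cong[OF w_add[OF Suc.prems]])
 thus ?case using Suc by simp
qed simp

lemma
 assumes "acwbij M" "x : spc M (w q)"
 shows sg_mem: "sg M q x : spc M (w (q + 1))" and sg_step: "step M q x (sg M q x)"
proof -
 have "sg M q x : spc M (w (q + 1)) & step M q x (sg M q x)"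
 proof (cases "cw q")
  case True thus ?thesis using act_mem_cw[OF acwbij_rep[OF assms(1)] True assms(2)] by (simp add: sg_def step_def)
 next
  case False
  hence b: "bij_betw (act M (e q)) (spc M (w (q + 1))) (spc M (w q))" using assms(1) by (simp add: acwbij_def)
  show ?thesis
   using the_inv_into_into[OF bij_betw_imp_inj_on[OF b], of x] f_the_inv_into_f[OF bij_betw_imp_inj_on[OF b], of x]
    assms(2) bij_betw_imp_surj_on[OF b] False by (simp add: sg_def step_def)
 qed
 thus "sg M q x : spc M (w (q + 1))" "step M q x (sg M q x)" by blast+
qed

lemma step_sg:
 assumes "acwbij M" "x : spc M (w q)" "y : spc M (w (q + 1))" "step M q x y"
 shows "y = sg M q x"
proof (cases "cw q")
 case True thus ?thesis using assms(4) by (simp add: sg_def step_def)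
next
 case False
 hence "bij_betw (act M (e q)) (spc M (w (q + 1))) (spc M (w q))" using assms(1) by (simp add: acwbij_def)
 from the_inv_into_f_f[OF bij_betw_imp_inj_on[OF this] assms(3)] show ?thesis
  using assms(4) False by (simp add: sg_def step_def)
qed

lemma sg_lin: assumes "acwbij M" shows "linear_from_to (spc M (w q)) (spc M (w (q + 1))) (sg M q)"
proof (rule linear_from_toI)
 note M = acwbij_rep[OF assms]
 show "sg M q x : spc M (w (q + 1))" if "x : spc M (w q)" for x by (rule sg_mem[OF assms that])
 show "sg M q (x + y) = sg M q x + sg M q y" if xy: "x : spc M (w q)" "y : spc M (w q)" for x y
  by (rule step_sg[OF assms, symmetric])
   (auto intro!: step_add[OF M] sg_mem[OF assms] sg_step[OF assms] cv.subspace_add[OF rep_subspace[OF M]] simp: xy)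
 show "sg M q (cscale c x) = cscale c (sg M q x)" if x: "x : spc M (w q)" for c x
  by (rule step_sg[OF assms, symmetric])
   (auto intro!: step_scale[OF M] sg_mem[OF assms] sg_step[OF assms] cv.subspace_scale[OF rep_subspace[OF M]] simp: x)
qed

lemma sgp_lin: assumes "acwbij M" shows "linear_from_to (spc M (w q)) (spc M (w (q + int j))) (sgp M q j)"
proof (induction j)
 case 0 show ?case by (simp add: linear_from_to_def)
next
 case (Suc j)
 have "w (q + int (Suc j)) = w (q + int j + 1)" by (simp add: algebra_simps)
 moreover have "sgp M q (Suc j) = (%x. sg M (q + int j) (sgp M q j x))" by (simp add: fun_eq_iff)
 ultimately show ?case using lft_comp[OF Suc sg_lin[OF assms]] by simp
qed

lemma sgp_mem: "acwbij M ==> x : spc M (w q) ==> sgp M q j x : spc M (w (q + int j))"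
 by (rule lft_mem[OF sgp_lin])

lemma sgp_0: "acwbij M ==> sgp M q j 0 = 0"
 by (rule lft_zero[OF sgp_lin rep_subspace[OF acwbij_rep]])

lemma sgp_add: "sgp M q (i + j) x = sgp M (q + int i) j (sgp M q i x)"
 by (induction j) (simp_all add: algebra_simps)

lemma sgp_zero_mono: "acwbij M ==> sgp M q i x = 0 ==> i <= j ==> sgp M q j x = 0"
 using sgp_add[of M q i "j - i" x] sgp_0[of M] by simp

lemma hom_sg:
 assumes M: "acwbij M" and N: "acwbij N" and f: "rep_hom Q M N f" and x: "x : spc M (w q)"
 shows "f (w (q + 1)) (sg M q x) = sg N q (f (w q) x)"
proof (rule step_sg[OF N hom_mem[OF f x] hom_mem[OF f sg_mem[OF M x]]])
 show "step N q (f (w q) x) (f (w (q + 1)) (sg M q x))"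
  using sg_step[OF M x] hom_commute[OF f, of x "e q"] hom_commute[OF f, of "sg M q x" "e q"] x sg_mem[OF M x]
  by (auto simp: step_def src_e tgt_e split: if_splits)
qed

lemma hom_sgp:
 assumes M: "acwbij M" and N: "acwbij N" and f: "rep_hom Q M N f" and x: "x : spc M (w q)"
 shows "f (w (q + int j)) (sgp M q j x) = sgp N q j (f (w q) x)"
proof (induction j)
 case (Suc j)
 thus ?case using hom_sg[OF M N f sgp_mem[OF M x, of j]] by (simp add: algebra_simps)
qed simp

end

text \<open>Counts indices rather than vectors, because the chains and strings below are families
  and their distinctness is part of what has to be shown.\<close>

lemma dim_span_family:
 fixes b :: "'i => cvec"
 assumes I: "finite I" and ind: "!!c. (SUM i:I. cscale (c i) (b i)) = 0 ==> ALL i:I. c i = 0"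
 shows "cv.dim (cv.span (b ` I)) = card I"
proof -
 have inj: "inj_on b I"
 proof (rule inj_onI)
  fix i j assume ij: "i : I" "j : I" "b i = b j"
  show "i = j"
  proof (rule ccontr)
   assume ne: "i ~= j"
   define c where "c k = (if k = i then 1 else if k = j then - 1 else 0 :: complex)" for k
   have "(SUM k:I. cscale (c k) (b k)) = (SUM k:{i, j}. cscale (c k) (b k))"
    by (rule sum.mono_neutral_right) (use I ij c_def in auto)
   also have "... = 0" using ne ij(3) by (simp add: c_def)
   finally show False using ind[of c] ij(1) by (auto simp: c_def)
  qed
 qed
 have "cv.independent (b ` I)"
 proof (rule cv.independent_if_scalars_zero)
  show "finite (b ` I)" using I by simp
  fix f x assume s: "(SUM x:b ` I. cscale (f x) x) = 0" and x: "x : b ` I"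
  have "(SUM i:I. cscale (f (b i)) (b i)) = 0" using s by (simp add: sum.reindex[OF inj])
  from ind[OF this] show "f x = 0" using x by auto
 qed
 thus ?thesis by (simp add: cv.dim_eq_card_independent card_image[OF inj])
qed
lemma complementary_split: "complementary M U W ==> x : spc M v ==> EX u z. u : U v & z : W v & x = u + z"
proof -
 assume a: "complementary M U W" "x : spc M v"
 hence "{x + y |x y. x : U v & y : W v} = spc M v" by (simp add: complementary_def)
 hence "x : {x + y |x y. x : U v & y : W v}" using a(2) by simp
 thus ?thesis by blast
qed

lemma indecomposable_if_no_idempotents:
 assumes X: "is_rep Q X" and ne: "spc X ~= zero_fam"
  and idem: "!!p q. rep_hom Q X X p ==> rep_hom Q X X q ==> (!!v x. x : spc X v ==> x = p v x + q v x) ==>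
   (!!v x. x : spc X v ==> p v (p v x) = p v x) ==>
   (ALL v. ALL x:spc X v. p v x = 0) | (ALL v. ALL x:spc X v. q v x = 0)"
 shows "indecomposable Q X"
 unfolding indecomposable_def
proof (intro conjI allI impI X ne)
 fix U W assume "submodule Q X U & submodule Q X W & complementary X U W"
 hence U: "submodule Q X U" and W: "submodule Q X W" and c: "complementary X U W" by blast+
 obtain p q where p: "rep_hom Q X (subrep X U) p" and q: "rep_hom Q X (subrep X W) q"
  and pq: "!!v x. x : spc X v ==> x = p v x + q v x" "!!v x. x : U v ==> p v x = x" "!!v x. x : W v ==> q v x = x"
  by (rule complementary_projection[OF X U W c]) blast
 have "p v (p v x) = p v x" if "x : spc X v" for v x using pq(2) hom_mem[OF p that] by simp
 from idem[OF rep_hom_comp[OF p rep_hom_incl[OF U]] rep_hom_comp[OF q rep_hom_incl[OF W]] pq(1) this]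
 consider "!!v x. x : spc X v ==> p v x = 0" | "!!v x. x : spc X v ==> q v x = 0" by blast
 hence "(ALL v. U v <= {0}) | (ALL v. W v <= {0})"
  using pq(2,3) submodule_mem[OF U] submodule_mem[OF W] by cases (metis singletonI subsetI)+
 thus "U = zero_fam | W = zero_fam"
  using cv.subspace_0[OF submodule_subspace[OF U]] cv.subspace_0[OF submodule_subspace[OF W]]
  by (auto simp: zero_fam_def fun_eq_iff)
qed

context cyclic_quiver
begin

section \<open>Indecomposable nilpotent representations\<close>

text \<open>The vectors at position \<open>q\<close> that end a matched chain of \<open>k\<close>
  edges coming from the left: iterated images under clockwise and preimages under anticlockwise
  arrows, as in the functorial filtrations of string modules.\<close>

fun lc :: "('v, 'a) quiver_rep => nat => int => cvec set" where
 "lc M 0 q = spc M (w q)"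
| "lc M (Suc k) q = {x : spc M (w q). EX y:lc M k (q - 1). step M (q - 1) y x}"

lemma lc_sub: "lc M k q <= spc M (w q)"
 by (cases k) auto

lemma lc_antimono: "lc M (Suc k) q <= lc M k q"
proof (induction k arbitrary: q)
 case 0 show ?case by auto
next
 case (Suc k)
 show ?case unfolding lc.simps(2)[of M "Suc k" q] lc.simps(2)[of M k q] using Suc[of "q - 1"] by blast
qed

lemma lc_cong: "w q = w q' ==> lc M k q = lc M k q'"
proof (induction k arbitrary: q q')
 case (Suc k)
 have w1: "w (q - 1) = w (q' - 1)" using w_add[OF Suc.prems, of "- 1"] by simp
 hence "step M (q - 1) = step M (q' - 1)" using step_cong[of "q - 1" "q' - 1" M] by (simp add: w_eq)
 thus ?case using Suc.prems Suc.IH[OF w1] by simp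
qed simp

lemma lc_Suc_cw: "is_rep Q M ==> cw (q - 1) ==> lc M (Suc k) q = act M (e (q - 1)) ` lc M k (q - 1)"
 using act_mem_cw[of M "q - 1"] lc_sub[of M k "q - 1"] by (auto simp: step_def)

lemma lc_Suc_acw: "~ cw (q - 1) ==> lc M (Suc k) q = {x : spc M (w q). act M (e (q - 1)) x : lc M k (q - 1)}"
 by (auto simp: step_def)

lemma lc_subspace: assumes "is_rep Q M" shows "cv.subspace (lc M k q)"
proof (induction k arbitrary: q)
 case 0 show ?case using rep_subspace[OF assms] by simp
next
 case (Suc k)
 show ?case
 proof (cases "cw (q - 1)")
  case True
  have "linear_from_to (lc M k (q - 1)) (spc M (w q)) (act M (e (q - 1)))"
   using lft_subset[OF rep_act[OF assms, of "e (q - 1)"]] lc_sub[of M k "q - 1"] True by (simp add: src_e tgt_e)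
  thus ?thesis unfolding lc_Suc_cw[OF assms True] by (rule lft_image_subspace[OF _ Suc])
 next
  case False
  have "linear_from_to (spc M (w q)) (spc M (w (q - 1))) (act M (e (q - 1)))"
   using rep_act[OF assms, of "e (q - 1)"] False by (simp add: src_e tgt_e)
  thus ?thesis unfolding lc_Suc_acw[OF False] by (rule lft_kernel_subspace[OF _ rep_subspace[OF assms] Suc])
 qed
qed

definition drel :: "('v, 'a) quiver_rep => int => (cvec => complex) => (cvec => complex) => bool" where
 "drel M q ps ph \<longleftrightarrow> (if cw q then ALL x:spc M (w q). ps x = ph (act M (e q) x)
   else ALL x:spc M (w (q + 1)). ph x = ps (act M (e q) x))"

text \<open>Dual to prolonging a chain by one edge. Across a clockwise arrow the functional is
  pulled back. Across an anticlockwise one it is factored through the quotient by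
  \<open>lc M k (q - 1)\<close>; this is possible because it kills the preimage of that
  space.\<close>

lemma extend_left:
 assumes M: "is_rep Q M" and ph: "cfunctional ph" "!!x. x : lc M (Suc k) q ==> ph x = 0"
 shows "EX ps. cfunctional ps & (ALL x:lc M k (q - 1). ps x = 0) & drel M (q - 1) ps ph"
proof (cases "cw (q - 1)")
 case True
 have l: "linear_from_to (spc M (w (q - 1))) (spc M (w q)) (act M (e (q - 1)))"
  using rep_act[OF M, of "e (q - 1)"] True by (simp add: src_e tgt_e)
 obtain g where g: "clinear g" "!!x. x : spc M (w (q - 1)) ==> g x = act M (e (q - 1)) x"
  using linear_extension[OF l rep_subspace[OF M] rep_subspace[OF M]] by metis
 have "ph (g x) = 0" if "x : lc M k (q - 1)" for x
  using ph(2)[of "g x"] lc_Suc_cw[OF M True, of k] that g(2)[of x] lc_sub[of M k "q - 1"] by blast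
 thus ?thesis
  using cfunctional_comp[OF g(1) ph(1)] g(2) True by (intro exI[of _ "%x. ph (g x)"]) (simp add: drel_def)
next
 case False
 let ?a = "act M (e (q - 1))" let ?S = "lc M k (q - 1)"
 have l: "linear_from_to (spc M (w q)) (spc M (w (q - 1))) ?a"
  using rep_act[OF M, of "e (q - 1)"] False by (simp add: src_e tgt_e)
 obtain p where p: "clinear p" "!!x. x : ?S ==> p x = x" "!!x. p x : ?S"
  using projection_exists[OF lc_subspace[OF M], of k "q - 1"] by metis
 have c: "clinear (%x. x - p x)" using p(1) by (simp add: clinear_iff cv.scale_right_diff_distrib)
 have pM: "p x : spc M (w (q - 1))" for x using p(3) lc_sub by blast
 let ?l = "%x. ?a x - p (?a x)"
 have l2: "linear_from_to (spc M (w q)) (spc M (w (q - 1))) ?l"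
  by (rule lft_comp[OF l clinear_imp_linear_from_to[OF c]]) (simp add: cv.subspace_diff[OF rep_subspace[OF M]] pM)
 let ?I = "?l ` spc M (w q)"
 have I: "cv.subspace ?I" by (rule lft_image_subspace[OF l2 rep_subspace[OF M]])
 obtain s where s: "clinear s" "!!x. s x : spc M (w q)" "!!y. y : ?I ==> ?l (s y) = y"
  by (rule section_exists[OF lft_range[OF l2] rep_subspace[OF M] I refl], rule that)
 obtain r where r: "clinear r" "!!x. x : ?I ==> r x = x" "!!x. r x : ?I"
  by (rule projection_exists[OF I], rule that)
 let ?ps = "%z. ph (s (r (z - p z)))"
 have "cfunctional ?ps" by (rule cfunctional_comp[OF clinear_comp[OF clinear_comp[OF c r(1)] s(1)] ph(1)])
 moreover have "?ps z = 0" if "z : ?S" for z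
  using p(2)[OF that] clinear_0[OF r(1)] clinear_0[OF s(1)] cfunctional_0[OF ph(1)] by simp
 moreover have "ph x = ?ps (?a x)" if x: "x : spc M (w q)" for x
 proof -
  have xI: "?l x : ?I" using x by blast
  let ?y = "s (?l x)"
  have "?l (x - ?y) = ?l x - ?l ?y" by (rule lft_diff[OF l2 rep_subspace[OF M] x s(2)])
  hence "?a (x - ?y) = p (?a (x - ?y))" using s(3)[OF xI] by simp
  hence "?a (x - ?y) : ?S" using p(3) by metis
  moreover have "x - ?y : spc M (w q)" by (rule cv.subspace_diff[OF rep_subspace[OF M] x s(2)])
  ultimately have "ph (x - ?y) = 0" unfolding lc_Suc_acw[OF False, of M k, symmetric]
   using ph(2) lc_Suc_acw[OF False, of M k] by blast
  thus ?thesis using r(2)[OF xI] cfunctional_diff[OF ph(1)] by simp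
 qed
 ultimately show ?thesis using False by (intro exI[of _ ?ps]) (simp add: drel_def)
qed

text \<open>After \<open>k\<close> steps the functional kills \<open>lc\<close> at depth 0, the
  whole space, and is continued by zero.\<close>

lemma extend_all_left:
 assumes M: "is_rep Q M"
 shows "cfunctional ph ==> (ALL x:lc M k q. ph x = 0) ==>
  EX Ph. Ph q = ph & (ALL i<=q. cfunctional (Ph i)) & (ALL i<q. drel M i (Ph i) (Ph (i + 1))) &
   (ALL i<=q - int k. ALL x:spc M (w i). Ph i x = 0)"
proof (induction k arbitrary: q ph)
 case 0
 have c0: "cfunctional (%x. 0)" by (simp add: cfunctional_iff)
 define Ph where "Ph i = (if i = q then ph else (%x. 0))" for i
 have "drel M i (Ph i) (Ph (i + 1))" if "i < q" for i
  using 0(2) that act_mem_cw[OF M, of i] by (auto simp: drel_def Ph_def)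
 thus ?case using 0 c0 by (intro exI[of _ Ph]) (auto simp: Ph_def)
next
 case (Suc k)
 obtain ps where ps: "cfunctional ps" "ALL x:lc M k (q - 1). ps x = 0" "drel M (q - 1) ps ph"
  using extend_left[OF M Suc.prems(1), of k q] Suc.prems(2) by blast
 obtain Ph where Ph: "Ph (q - 1) = ps" "ALL i<=q - 1. cfunctional (Ph i)" "ALL i<q - 1. drel M i (Ph i) (Ph (i + 1))"
  "ALL i<=q - 1 - int k. ALL x:spc M (w i). Ph i x = 0"
  using Suc.IH[OF ps(1,2)] by blast
 have "drel M i ((Ph(q := ph)) i) ((Ph(q := ph)) (i + 1))" if "i < q" for i
  using that Ph(1,3) ps(3) by (cases "i = q - 1") auto
 thus ?case using Ph Suc.prems(1) by (intro exI[of _ "Ph(q := ph)"]) auto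
qed

lemma lc_chain:
 "z : lc M k q ==> EX xi. xi q = z & (ALL i. q - int k <= i & i <= q --> xi i : spc M (w i)) &
  (ALL i. q - int k <= i & i < q --> step M i (xi i) (xi (i + 1)))"
proof (induction k arbitrary: q z)
 case 0 thus ?case by (intro exI[of _ "%_. z"]) auto
next
 case (Suc k)
 obtain y where y: "z : spc M (w q)" "y : lc M k (q - 1)" "step M (q - 1) y z" using Suc.prems by auto
 obtain xi where xi: "xi (q - 1) = y" "ALL i. q - 1 - int k <= i & i <= q - 1 --> xi i : spc M (w i)"
  "ALL i. q - 1 - int k <= i & i < q - 1 --> step M i (xi i) (xi (i + 1))" using Suc.IH[OF y(2)] by blast
 have "step M i ((xi(q := z)) i) ((xi(q := z)) (i + 1))" if "q - int (Suc k) <= i" "i < q" for i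
  using xi(1,3) y(3) that by (cases "i = q - 1") auto
 thus ?case using xi(2) y(1) by (intro exI[of _ "xi(q := z)"]) auto
qed

lemma step_sum:
 assumes "is_rep Q M" "!!i. i : A ==> x i : spc M (w q) & y i : spc M (w (q + 1)) & step M q (x i) (y i)"
 shows "step M q (SUM i:A. cscale (c i) (x i)) (SUM i:A. cscale (c i) (y i))"
 using assms(2)
proof (induction A rule: infinite_finite_induct)
 case (insert a A)
 thus ?case
  by (simp, intro step_add[OF assms(1)] step_scale[OF assms(1)] cv.subspace_scale cv.subspace_sum)
   (auto intro: cv.subspace_scale simp: rep_subspace[OF assms(1)])
qed (simp_all add: step_0[OF assms(1)])

definition null_chain :: "('v, 'a) quiver_rep => int => int => (int => cvec) => bool" where
 "null_chain M q0 q1 xi \<longleftrightarrow> q0 <= q1 & xi q1 ~= 0 & (ALL i. xi i : spc M (w i)) &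
   (ALL i>=q0. step M i (xi i) (xi (i + 1))) & (ALL i>q1. xi i = 0)"

text \<open>Shift the parts of the chain that begin at the positions in \<open>A\<close> so that
  they all begin at \<open>q\<close>, and add them with the coefficients \<open>c\<close>. By
  \<open>s\<close> the sum continues by zero to the left, and all parts end, so it is a matched
  sequence of finite support. Its last entry is due to the smallest index with nonzero coefficient
  alone.\<close>

lemma null_chain_independent:
 assumes M: "is_rep Q M" and S: "!!k. no_compat M k" and ch: "null_chain M q0 q1 xi"
  and A: "A <= {i. q0 <= i & i <= q1 & w i = w q}" and s: "step M (q - 1) 0 (SUM i:A. cscale (c i) (xi i))"
  and i: "i : A"
 shows "c i = 0"
proof (rule ccontr)
 assume ci: "c i ~= 0"
 have xi: "xi j : spc M (w j)" "j >= q0 ==> step M j (xi j) (xi (j + 1))" "j > q1 ==> xi j = 0" for j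
  using ch by (auto simp: null_chain_def)
 have fin: "finite A" by (rule finite_subset[OF A]) (rule finite_subset[of _ "{q0..q1}"], auto)
 define i0 where "i0 = Min {i : A. c i ~= 0}"
 have "i0 : {i : A. c i ~= 0}" unfolding i0_def using fin i ci by (intro Min_in) auto
 hence i0: "i0 : A" "c i0 ~= 0" by auto
 have i0min: "i0 <= j" if "j : A" "c j ~= 0" for j unfolding i0_def using fin that by (intro Min_le) auto
 have wj: "w (j + (t - q)) = w t" if "j : A" for j t using w_add[of j q "t - q"] A that by auto
 define et where "et t = (if t < q then 0 else SUM j:A. cscale (c j) (xi (j + (t - q))))" for t
 have mem: "et t : spc M (w t)" for t
  unfolding et_def using xi(1) wj
  by (auto intro!: cv.subspace_sum cv.subspace_scale simp: rep_subspace[OF M] cv.subspace_0) (metis)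
 have "step M t (et t) (et (t + 1))" for t
 proof -
  consider "t < q - 1" | "t = q - 1" | "t >= q" by linarith
  thus ?thesis
  proof cases
   case 1 thus ?thesis by (simp add: et_def step_0[OF M])
  next
   case 2 thus ?thesis using s by (simp add: et_def)
  next
   case 3
   have "xi (j + (t - q)) : spc M (w t) & xi (j + (t + 1 - q)) : spc M (w (t + 1)) & step M t (xi (j + (t - q))) (xi (j + (t + 1 - q)))"
    if j: "j : A" for j
   proof -
    have "q0 <= j + (t - q)" using A j 3 by auto
    from xi(2)[OF this] have "step M t (xi (j + (t - q))) (xi (j + (t + 1 - q)))"
     using step_cong[of "j + (t - q)" t M] wj[OF j, of t] by (simp add: w_eq algebra_simps)
    thus ?thesis using xi(1)[of "j + (t - q)"] xi(1)[of "j + (t + 1 - q)"] wj[OF j] by simp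
   qed
   from step_sum[OF M this] show ?thesis using 3 by (simp add: et_def)
  qed
 qed
 hence c: "compat M et" using mem by (simp add: compat_def)
 have "et t = 0" if "t < q | t >= q + int (nat (q1 - q0 + 1))" for t
 proof (cases "t < q")
  case False
  have "xi (j + (t - q)) = 0" if "j : A" for j using False \<open>t < q | _\<close> A that by (intro xi(3)) auto
  thus ?thesis by (simp add: et_def)
 qed (simp add: et_def)
 hence "et (q + (q1 - i0)) = 0" using S[of "nat (q1 - q0 + 1)"] c unfolding no_compat_def by blast
 moreover have "et (q + (q1 - i0)) = (SUM j:A. if j = i0 then cscale (c i0) (xi q1) else 0)"
 proof -
  have "cscale (c j) (xi (j + (q1 - i0))) = (if j = i0 then cscale (c i0) (xi q1) else 0)" if "j : A" for j
   using i0min[OF that] xi(3)[of "j + (q1 - i0)"] by (cases "c j = 0") (use i0(2) in auto)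
  moreover have "~ q + (q1 - i0) < q" using A i0(1) by auto
  ultimately show ?thesis by (simp add: et_def)
 qed
 ultimately show False using i0 fin ch by (simp add: null_chain_def)
qed

text \<open>A chain that passes over the vertex \<open>w q0\<close> more often than the dimension
  there would give too many independent vectors.\<close>

lemma null_chain_bounded:
 assumes M: "is_rep Q M" and S: "!!k. no_compat M k" and ch: "null_chain M q0 q1 xi"
 shows "q1 - q0 < int (n * Suc (tdim M))"
proof (rule ccontr)
 assume a: "~ ?thesis"
 define D where "D = cv.dim (spc M (w q0))"
 have "D <= tdim M" unfolding D_def tdim_def dim_vec_def by (rule member_le_sum) auto
 hence nD: "n * D <= n * Suc (tdim M)" by (meson le_SucI mult_le_mono2)
 have b: "q0 + int n * int j <= q1" if "j <= D" for j
 proof -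
  have "n * j <= n * Suc (tdim M)" using mult_le_mono2[OF that, of n] nD by (rule order_trans)
  hence "int n * int j <= int (n * Suc (tdim M))" by (metis of_nat_le_iff of_nat_mult)
  thus ?thesis using a by linarith
 qed
 let ?b = "%j. xi (q0 + int n * int j)"
 have wj: "w (q0 + int n * int j) = w q0" for j by (simp add: w_eq)
 have inj: "inj_on (%j. q0 + int n * int j) {..D}" using n2 by (auto simp: inj_on_def)
 have "cv.dim (cv.span (?b ` {..D})) = card {..D}"
 proof (rule dim_span_family)
  fix c assume z: "(SUM j:{..D}. cscale (c j) (?b j)) = 0"
  let ?A = "(%j. q0 + int n * int j) ` {..D}"
  define c' where "c' i = c (nat ((i - q0) div int n))" for i
  have cc: "c' (q0 + int n * int j) = c j" for j using n2 by (simp add: c'_def)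
  have "(SUM i:?A. cscale (c' i) (xi i)) = 0" unfolding sum.reindex[OF inj] by (simp add: cc z)
  hence st: "step M (q0 - 1) 0 (SUM i:?A. cscale (c' i) (xi i))" by (simp add: step_0[OF M])
  have "c' (q0 + int n * int j) = 0" if "j <= D" for j
   by (rule null_chain_independent[OF M S ch _ st]) (use b wj that in auto)
  thus "ALL j:{..D}. c j = 0" by (simp add: cc)
 qed simp
 moreover have "?b j : spc M (w q0)" for j using ch wj[of j] unfolding null_chain_def by metis
 hence "cv.span (?b ` {..D}) <= spc M (w q0)" by (intro cv.span_minimal rep_subspace[OF M]) auto
 hence "cv.dim (cv.span (?b ` {..D})) <= D" unfolding D_def by (rule fd_sub(2)[OF rep_fd[OF M] cv.subspace_span])
 ultimately show False by simp
qed

text \<open>Only generation is demanded; the independence of the string follows from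
  \<open>null_chain_independent\<close>.\<close>

definition string_basis :: "('v, 'a) quiver_rep => int => int => (int => cvec) => bool" where
 "string_basis M q0 q1 xi \<longleftrightarrow> null_chain M q0 q1 xi & cw (q0 - 1) & cw q1 &
   (ALL q. ALL y:spc M (w q). EX c. y = (SUM i | q0 <= i & i <= q1 & w i = w q. cscale (c i) (xi i)))"

theorem string_basis_exists:
 assumes ind: "indecomposable Q M" and S: "!!k. no_compat M k"
  and x: "cw k" "x : spc M (w k)" "act M (e k) x = 0" "x ~= 0"
 shows "EX q0 q1 xi. string_basis M q0 q1 xi"
proof -
 have M: "is_rep Q M" using ind by (rule indecomposable_rep)
 have M0: "0 : spc M v" for v by (rule cv.subspace_0[OF rep_subspace[OF M]])
 let ?P = "%h. EX q z. cw q & z : lc M h q & z ~= 0 & act M (e q) z = 0"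
 have chain: "EX xi. null_chain M (q - int h) q xi & xi q = z"
  if z: "cw q" "z : lc M h q" "z ~= 0" "act M (e q) z = 0" for q z h
 proof -
  obtain et where et: "et q = z" "ALL i. q - int h <= i & i <= q --> et i : spc M (w i)"
   "ALL i. q - int h <= i & i < q --> step M i (et i) (et (i + 1))" using lc_chain[OF z(2)] by blast
  define xi where "xi i = (if q - int h <= i & i <= q then et i else 0)" for i
  have "step M i (xi i) (xi (i + 1))" if "i >= q - int h" for i
  proof -
   consider "i < q" | "i = q" | "i > q" by linarith
   thus ?thesis using et that z by cases (auto simp: xi_def step_0[OF M], auto simp: step_def)
  qed
  thus ?thesis using et(1,2) z(3) M0 by (intro exI[of _ xi]) (auto simp: xi_def null_chain_def)
 qed
 have P0: "?P 0" using x by auto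
 have bd: "h <= n * Suc (tdim M)" if h: "?P h" for h
 proof -
  obtain q z where "cw q" "z : lc M h q" "z ~= 0" "act M (e q) z = 0" using h by blast
  from chain[OF this] obtain xi where "null_chain M (q - int h) q xi" by blast
  from null_chain_bounded[OF M S this] show ?thesis by linarith
 qed
 define h where "h = (GREATEST h. ?P h)"
 have h: "?P h" unfolding h_def by (rule GreatestI_nat[where P = ?P, OF P0 bd])
 have hmax: "h' <= h" if "?P h'" for h' unfolding h_def by (rule Greatest_le_nat[where P = ?P, OF that bd])
 obtain q1 z where z: "cw q1" "z : lc M h q1" "z ~= 0" "act M (e q1) z = 0" using h by blast
 obtain xi where ch: "null_chain M (q1 - int h) q1 xi" and xiz: "xi q1 = z" using chain[OF z] by blast
 define q0 where "q0 = q1 - int h"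
 have xi: "xi j : spc M (w j)" "j >= q0 ==> step M j (xi j) (xi (j + 1))" "j > q1 ==> xi j = 0" for j
  using ch by (auto simp: null_chain_def q0_def)
 have q01: "q0 <= q1" by (simp add: q0_def)
 have "z ~: lc M (Suc h) q1" using hmax[of "Suc h"] z(1,3,4) by (metis not_less_eq_eq order_refl)
 then obtain ph where ph: "cfunctional ph" "!!y. y : lc M (Suc h) q1 ==> ph y = 0" "ph z = 1"
  using separating_functional[OF lc_subspace[OF M]] by metis
 obtain Ph where Ph: "Ph q1 = ph" "!!i. i <= q1 ==> cfunctional (Ph i)" "!!i. i < q1 ==> drel M i (Ph i) (Ph (i + 1))"
  "!!i x. i < q0 ==> x : spc M (w i) ==> Ph i x = 0"
  using extend_all_left[OF M ph(1), of "Suc h" q1] ph(2) by (auto simp: q0_def)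
 have pair: "Ph (q1 - int j) (xi (q1 - int j)) = 1" if "j <= h" for j
  using that
 proof (induction j)
  case 0 thus ?case using Ph(1) xiz ph(3) by simp
 next
  case (Suc j)
  let ?i = "q1 - int (Suc j)"
  have i: "?i + 1 = q1 - int j" by simp
  have "?i >= q0" using Suc.prems by (simp add: q0_def)
  from xi(2)[OF this] have "Ph ?i (xi ?i) = Ph (?i + 1) (xi (?i + 1))"
   using Ph(3)[of ?i] xi(1)[of ?i] xi(1)[of "?i + 1"] unfolding drel_def step_def by (auto split: if_splits)
  thus ?case using Suc unfolding i by simp
 qed
 \<comment> \<open>Across an anticlockwise edge in front of \<open>q0\<close> the functional
   \<open>Ph q0\<close> would be the pullback of \<open>Ph (q0 - 1)\<close>, which is zero, although
   it is 1 on \<open>xi q0\<close>.\<close>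
 have cw0: "cw (q0 - 1)"
 proof (rule ccontr)
  assume "~ cw (q0 - 1)"
  hence "Ph q0 (xi q0) = Ph (q0 - 1) (act M (e (q0 - 1)) (xi q0))"
   using Ph(3)[of "q0 - 1"] xi(1)[of q0] q01 by (simp add: drel_def)
  thus False using Ph(4)[of "q0 - 1" "act M (e (q0 - 1)) (xi q0)"] act_mem_acw[OF M, of "q0 - 1" "xi q0"]
   \<open>~ cw (q0 - 1)\<close> xi(1)[of q0] pair[of h] by (simp add: q0_def)
 qed
 define Ps where "Ps i = (if i < q0 | i > q1 then (%x. 0) else Ph i)" for i
 \<comment> \<open>The sum of the rank-one maps \<open>xi i\<close> times \<open>Ps i\<close>. It
   commutes with the arrows since vectors and functionals are both matched, and at the two ends one
   of the factors vanishes.\<close>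
 define P where "P v y = (SUM i | q0 <= i & i <= q1 & w i = v. cscale (Ps i y) (xi i))" for v y
 have Psf: "cfunctional (Ps i)" for i using Ph(2)[of i] by (auto simp: Ps_def cfunctional_iff)
 \<comment> \<open>Indexed by edges from \<open>q0 - 1\<close> to \<open>q1\<close>, so that the
   values of \<open>P\<close> at the two ends of an arrow become sums over the same set; the surplus
   terms are zero.\<close>
 let ?E = "%q. {j. q0 - 1 <= j & j <= q1 & w j = w q}"
 have finE: "finite (?E q)" for q by (rule finite_subset[of _ "{q0 - 1..q1}"]) auto
 have Pq: "P (w q) y = (SUM j:?E q. cscale (Ps j y) (xi j))" for q y
  unfolding P_def by (rule sum.mono_neutral_left[OF finE]) (auto simp: Ps_def)
 have Pq1: "P (w (q + 1)) y = (SUM j:?E q. cscale (Ps (j + 1) y) (xi (j + 1)))" for q y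
 proof -
  have "P (w (q + 1)) y = (SUM i:(%j. j + 1) ` ?E q. cscale (Ps i y) (xi i))"
   unfolding P_def
  proof (rule sum.mono_neutral_left)
   show "{i. q0 <= i & i <= q1 & w i = w (q + 1)} <= (%j. j + 1) ` ?E q"
   proof
    fix i assume "i : {i. q0 <= i & i <= q1 & w i = w (q + 1)}"
    thus "i : (%j. j + 1) ` ?E q" using w_add_iff[of "i - 1" 1 q] by (intro image_eqI[of _ _ "i - 1"]) auto
   qed
   show "ALL i:(%j. j + 1) ` ?E q - {i. q0 <= i & i <= q1 & w i = w (q + 1)}. cscale (Ps i y) (xi i) = 0"
   proof
    fix i assume "i : (%j. j + 1) ` ?E q - {i. q0 <= i & i <= q1 & w i = w (q + 1)}"
    then obtain j where "i = j + 1" "w j = w q" "~ (q0 <= i & i <= q1 & w i = w (q + 1))" by auto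
    thus "cscale (Ps i y) (xi i) = 0" using w_add[of j q 1] by (auto simp: Ps_def)
   qed
  qed (simp add: finE)
  thus ?thesis by (simp add: sum.reindex)
 qed
 have xim: "cscale c (xi i) : spc M v" if "w i = v" for c i v using xi(1)[of i] that cv.subspace_scale[OF rep_subspace[OF M]] by blast
 have lin: "linear_from_to (spc M v) (spc M v) (P v)" for v
 proof (rule clinear_imp_linear_from_to)
  show "clinear (P v)" using Psf by (simp add: clinear_iff P_def cfunctional_iff cv.scale_left_distrib sum.distrib cv.scale_sum_right)
  show "P v x : spc M v" for x unfolding P_def by (rule cv.subspace_sum[OF rep_subspace[OF M]]) (simp add: xim)
 qed
 have hom: "rep_hom Q M M P"
 proof (rule rep_homI[OF lin])
  fix a x assume x: "x : spc M (src Q a)"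
  obtain q where q: "a = e q" using e_surj by blast
  have wq1: "w (j + 1) = w (q + 1)" and eq: "e j = e q" "cw j = cw q" if "j : ?E q" for j
   using that w_add[of j q 1] cw_cong[of j q] by (auto simp: w_eq e_eq)
  show "P (tgt Q a) (act M a x) = act M a (P (src Q a) x)"
  proof (cases "cw q")
   case True
   have xq: "x : spc M (w q)" using x True by (simp add: q src_e)
   have l: "linear_from_to (spc M (w q)) (spc M (w (q + 1))) (act M (e q))"
    using rep_act[OF M, of "e q"] True by (simp add: src_e tgt_e)
   have "act M (e q) (P (w q) x) = (SUM j:?E q. act M (e q) (cscale (Ps j x) (xi j)))"
    unfolding Pq by (rule lft_sum[OF l rep_subspace[OF M] xim]) simp
   also have "... = P (w (q + 1)) (act M (e q) x)"
    unfolding Pq1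
   proof (rule sum.cong[OF refl])
    fix j assume j: "j : ?E q"
    have s: "act M (e q) (cscale (Ps j x) (xi j)) = cscale (Ps j x) (act M (e q) (xi j))"
     by (rule lft_scale[OF l]) (use j xi(1)[of j] in simp)
    consider "j = q0 - 1" | "q0 <= j" "j < q1" | "j = q1" using j by fastforce
    thus "act M (e q) (cscale (Ps j x) (xi j)) = cscale (Ps (j + 1) (act M (e q) x)) (xi (j + 1))"
    proof cases
     case 1
     hence "Ph q0 (act M (e q) x) = 0" using Ph(3)[of j] Ph(4)[of j x] q01 xq j eq[OF j] True by (simp add: drel_def)
     thus ?thesis unfolding s using 1 q01 by (simp add: Ps_def)
    next
     case 2
     hence "Ph (j + 1) (act M (e q) x) = Ph j x" using Ph(3)[of j] xq j eq[OF j] True by (simp add: drel_def)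
     moreover have "act M (e q) (xi j) = xi (j + 1)" using xi(2)[of j] 2 eq[OF j] True by (simp add: step_def)
     ultimately show ?thesis unfolding s using 2 by (simp add: Ps_def)
    next
     case 3
     hence "act M (e q) (xi j) = 0" using z(4) xiz eq[OF j] by simp
     thus ?thesis unfolding s using 3 by (simp add: Ps_def)
    qed
   qed
   finally show ?thesis using True by (simp add: q src_e tgt_e)
  next
   case False
   have xq: "x : spc M (w (q + 1))" using x False by (simp add: q src_e)
   have l: "linear_from_to (spc M (w (q + 1))) (spc M (w q)) (act M (e q))"
    using rep_act[OF M, of "e q"] False by (simp add: src_e tgt_e)
   have "act M (e q) (P (w (q + 1)) x) = (SUM j:?E q. act M (e q) (cscale (Ps (j + 1) x) (xi (j + 1))))"
    unfolding Pq1 by (rule lft_sum[OF l rep_subspace[OF M] xim]) (rule wq1)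
   also have "... = P (w q) (act M (e q) x)"
    unfolding Pq
   proof (rule sum.cong[OF refl])
    fix j assume j: "j : ?E q"
    have s: "act M (e q) (cscale (Ps (j + 1) x) (xi (j + 1))) = cscale (Ps (j + 1) x) (act M (e q) (xi (j + 1)))"
     by (rule lft_scale[OF l]) (use wq1[OF j] xi(1)[of "j + 1"] in simp)
    have "j ~= q0 - 1" "j ~= q1" using eq(2)[OF j] False cw0 z(1) by auto
    hence j': "q0 <= j" "j < q1" using j by auto
    hence "Ph (j + 1) x = Ph j (act M (e q) x)" using Ph(3)[of j] xq wq1[OF j] eq[OF j] False by (simp add: drel_def)
    moreover have "act M (e q) (xi (j + 1)) = xi j" using xi(2)[of j] j' eq[OF j] False by (simp add: step_def)
    ultimately show "act M (e q) (cscale (Ps (j + 1) x) (xi (j + 1))) = cscale (Ps j (act M (e q) x)) (xi j)"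
     unfolding s using j' by (simp add: Ps_def)
   qed
   finally show ?thesis using False by (simp add: q src_e tgt_e)
  qed
 qed
 have zm: "z : spc M (w q1)" using xi(1)[of q1] xiz by simp
 \<comment> \<open>\<open>P\<close> fixes \<open>z\<close>: at an earlier position over the same
   vertex the functional factors through the arrow that kills \<open>z\<close>.\<close>
 have "P (w q1) z = (SUM i | q0 <= i & i <= q1 & w i = w q1. if i = q1 then z else 0)"
  unfolding P_def
 proof (rule sum.cong[OF refl])
  fix i assume i: "i : {i. q0 <= i & i <= q1 & w i = w q1}"
  show "cscale (Ps i z) (xi i) = (if i = q1 then z else 0)"
  proof (cases "i = q1")
   case True thus ?thesis using Ph(1) ph(3) xiz q01 by (simp add: Ps_def)
  next
   case False
   hence i': "i < q1" "cw i" "e i = e q1" using i z(1) cw_cong[of i q1] by (auto simp: w_eq e_eq)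
   have "Ph i z = Ph (i + 1) (act M (e i) z)" using Ph(3)[OF i'(1)] i'(2) zm i by (simp add: drel_def)
   also have "... = 0" using z(4) i'(1,3) cfunctional_0[OF Ph(2)[of "i + 1"]] by simp
   finally show ?thesis using False i by (simp add: Ps_def)
  qed
 qed
 also have "... = z"
 proof -
  have "finite {i. q0 <= i & i <= q1 & w i = w q1}" by (rule finite_subset[of _ "{q0..q1}"]) auto
  thus ?thesis using q01 by simp
 qed
 finally have Pz: "P (w q1) z = z" .
 have "(P (w q1) ^^ k) z = z" for k by (induction k) (simp_all add: Pz)
 hence "rep_surj M M P" using fitting[OF ind hom] zm z(3) by metis
 hence "EX c. y = (SUM i | q0 <= i & i <= q1 & w i = w q. cscale (c i) (xi i))" if "y : spc M (w q)" for y q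
 proof -
  have "y : P (w q) ` spc M (w q)" using that \<open>rep_surj M M P\<close> by (simp add: rep_surj_def)
  then obtain x where "y = P (w q) x" by (rule imageE)
  thus ?thesis by (intro exI[of _ "%i. Ps i x"]) (simp add: P_def)
 qed
 thus ?thesis using ch cw0 z(1) unfolding string_basis_def q0_def by blast
qed

context
 fixes M q0 q1 xi
 assumes M: "is_rep Q M" and S: "!!k. no_compat M k" and sb: "string_basis M q0 q1 xi"
begin

private lemma xi: "xi j : spc M (w j)" "j >= q0 ==> step M j (xi j) (xi (j + 1))" "j > q1 ==> xi j = 0" "xi q1 ~= 0" "q0 <= q1"
  and chain: "null_chain M q0 q1 xi" and cw01: "cw (q0 - 1)" "cw q1"
  and expand: "y : spc M (w q) ==> EX c. y = (SUM i | q0 <= i & i <= q1 & w i = w q. cscale (c i) (xi i))"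
 using sb by (auto simp: string_basis_def null_chain_def)

private lemma fin: "finite {i. q0 <= i & i <= q1 & w i = w q}"
 by (rule finite_subset[of _ "{q0..q1}"]) auto

text \<open>Injectivity is the independence of the string. For surjectivity, the string ends at a
  clockwise edge, so over an anticlockwise edge \<open>xi i\<close> is always the image of
  \<open>xi (i + 1)\<close>.\<close>

lemma string_acwbij: "acwbij M"
 unfolding acwbij_def
proof (intro conjI allI impI M)
 fix q assume q: "~ cw q"
 have l: "linear_from_to (spc M (w (q + 1))) (spc M (w q)) (act M (e q))"
  using rep_act[OF M, of "e q"] q by (simp add: src_e tgt_e)
 have "y = 0" if y: "y : spc M (w (q + 1))" "act M (e q) y = 0" for y
 proof -
  obtain c where c: "y = (SUM i | q0 <= i & i <= q1 & w i = w (q + 1). cscale (c i) (xi i))" using expand[OF y(1)] by blast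
  have "step M (q + 1 - 1) 0 y" using y(2) q by (simp add: step_def)
  from null_chain_independent[OF M S chain order_refl this[unfolded c]]
  show ?thesis unfolding c by (intro sum.neutral) simp
 qed
 hence "inj_on (act M (e q)) (spc M (w (q + 1)))" using lft_inj_on_iff[OF l rep_subspace[OF M]] by blast
 moreover have "y : act M (e q) ` spc M (w (q + 1))" if y: "y : spc M (w q)" for y
 proof -
  let ?I = "{i. q0 <= i & i <= q1 & w i = w q}"
  obtain c where c: "y = (SUM i:?I. cscale (c i) (xi i))" using expand[OF y] by blast
  have m: "cscale (c i) (xi (i + 1)) : spc M (w (q + 1))" if "i : ?I" for i
   using xi(1)[of "i + 1"] w_add[of i q 1] that cv.subspace_scale[OF rep_subspace[OF M]] by auto
  have "act M (e q) (SUM i:?I. cscale (c i) (xi (i + 1))) = (SUM i:?I. act M (e q) (cscale (c i) (xi (i + 1))))"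
   by (rule lft_sum[OF l rep_subspace[OF M] m])
  also have "... = y"
   unfolding c
  proof (rule sum.cong[OF refl])
   fix i assume i: "i : ?I"
   have "e i = e q" "~ cw i" "w (i + 1) = w (q + 1)" using i q cw_cong[of i q] w_add[of i q 1] by (auto simp: w_eq e_eq)
   thus "act M (e q) (cscale (c i) (xi (i + 1))) = cscale (c i) (xi i)"
    using xi(2)[of i] xi(1)[of "i + 1"] i lft_scale[OF l, of "xi (i + 1)" "c i"] by (simp add: step_def)
  qed
  finally have eq: "act M (e q) (SUM i:?I. cscale (c i) (xi (i + 1))) = y" .
  show ?thesis by (rule image_eqI[of _ "act M (e q)", OF eq[symmetric]], rule cv.subspace_sum[OF rep_subspace[OF M]], rule m)
 qed
 ultimately show "bij_betw (act M (e q)) (spc M (w (q + 1))) (spc M (w q))"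
  unfolding bij_betw_def using lft_mem[OF l] by blast
qed

lemma string_sgp: "q0 <= i ==> sgp M i j (xi i) = xi (i + int j)"
proof (induction j)
 case (Suc j)
 have "xi (i + int j + 1) = sg M (i + int j) (xi (i + int j))"
  by (rule step_sg[OF string_acwbij]) (use xi(1)[of "i + int j + 1"] xi(1,2) Suc.prems in auto)
 thus ?case using Suc by (simp add: algebra_simps)
qed simp

lemma string_nilpotent: "y : spc M (w q) ==> sgp M q (nat (q1 - q0 + 1)) y = 0"
proof -
 let ?j = "nat (q1 - q0 + 1)" and ?I = "{i. q0 <= i & i <= q1 & w i = w q}"
 assume "y : spc M (w q)"
 then obtain c where c: "y = (SUM i:?I. cscale (c i) (xi i))" using expand by blast
 have "sgp M q ?j (cscale (c i) (xi i)) = 0" if "i : ?I" for i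
  using that lft_scale[OF sgp_lin[OF string_acwbij], of "xi i" q ?j "c i"] xi(1)[of i]
   sgp_cong[of q i M ?j "xi i"] string_sgp[of i ?j] xi(3)[of "i + int ?j"] by simp
 moreover have "sgp M q ?j y = (SUM i:?I. sgp M q ?j (cscale (c i) (xi i)))"
  unfolding c
 proof (rule lft_sum[OF sgp_lin[OF string_acwbij] rep_subspace[OF M]])
  show "cscale (c i) (xi i) : spc M (w q)" if "i : ?I" for i
   using xi(1)[of i] that cv.subspace_scale[OF rep_subspace[OF M]] by auto
 qed
 ultimately show ?thesis by simp
qed

text \<open>A clockwise arrow moves each vector of the string one place on, and the images are again
  independent except for that of the last vector, which is zero.\<close>

lemma string_kernel:
 assumes y: "y : spc M (w q)" "cw q" "act M (e q) y = 0" "y ~= 0"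
 shows "w q = w q1 & (EX c. y = cscale c (xi q1))"
proof -
 let ?I = "{i. q0 <= i & i <= q1 & w i = w q}"
 obtain c where c: "y = (SUM i:?I. cscale (c i) (xi i))" using expand[OF y(1)] by blast
 let ?A = "(%i. i + 1) ` (?I - {q1})"
 have s0: "act M (e q) (cscale (c i) (xi i)) = cscale (c i) (xi (i + 1))" if "i : ?I" for i
 proof -
  have "e i = e q" "cw i" using that y(2) cw_cong[of i q] by (auto simp: w_eq e_eq)
  thus ?thesis using xi(1,2)[of i] that y(2) rep_act_scale[OF M, of "xi i" "e q" "c i"] by (simp add: step_def src_e)
 qed
 have l: "linear_from_to (spc M (w q)) (spc M (w (q + 1))) (act M (e q))"
  using rep_act[OF M, of "e q"] y(2) by (simp add: src_e tgt_e)
 have m: "cscale (c i) (xi i) : spc M (w q)" if "i : ?I" for i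
  using xi(1)[of i] that cv.subspace_scale[OF rep_subspace[OF M]] by auto
 have "0 = (SUM i:?I. act M (e q) (cscale (c i) (xi i)))"
  using y(3) unfolding c by (simp only: lft_sum[OF l rep_subspace[OF M] m])
 also have "... = (SUM i:?I. cscale (c i) (xi (i + 1)))" by (rule sum.cong[OF refl s0])
 also have "... = (SUM i:?I - {q1}. cscale (c i) (xi (i + 1)))"
  by (rule sum.mono_neutral_right) (auto simp: fin xi(3))
 also have "... = (SUM i:?A. cscale (c (i - 1)) (xi i))" by (simp add: sum.reindex)
 finally have st: "step M (q + 1 - 1) 0 (SUM i:?A. cscale (c (i - 1)) (xi i))" using step_0[OF M, of q] by simp
 have A: "?A <= {i. q0 <= i & i <= q1 & w i = w (q + 1)}"
 proof
  fix t assume "t : ?A"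
  then obtain i where "t = i + 1" "i : ?I" "i ~= q1" by auto
  thus "t : {i. q0 <= i & i <= q1 & w i = w (q + 1)}" using w_add[of i q 1] by auto
 qed
 have c0: "c i = 0" if "i : ?I" "i ~= q1" for i
  using null_chain_independent[OF M S chain A st, of "i + 1"] that by auto
 have "w q = w q1"
 proof (rule ccontr)
  assume "w q ~= w q1"
  have "y = 0"
   unfolding c
  proof (rule sum.neutral, rule ballI)
   fix i assume i: "i : ?I"
   hence "i ~= q1" using \<open>w q ~= w q1\<close> by auto
   thus "cscale (c i) (xi i) = 0" using c0[OF i] by simp
  qed
  thus False using y(4) by simp
 qed
 moreover have "y = (SUM i:?I. if i = q1 then cscale (c q1) (xi q1) else 0)" unfolding c using c0 by (intro sum.cong) auto
 hence "y = cscale (c q1) (xi q1)" using \<open>w q = w q1\<close> xi(5) fin by simp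
 ultimately show ?thesis by blast
qed

lemma string_dim: "cv.dim (spc M (w q)) = card {i. q0 <= i & i <= q1 & w i = w q}"
proof -
 let ?I = "{i. q0 <= i & i <= q1 & w i = w q}"
 have "cv.dim (cv.span (xi ` ?I)) = card ?I"
 proof (rule dim_span_family[OF fin])
  fix c assume "(SUM i:?I. cscale (c i) (xi i)) = 0"
  hence "step M (q - 1) 0 (SUM i:?I. cscale (c i) (xi i))" by (simp add: step_0[OF M])
  from null_chain_independent[OF M S chain order_refl this] show "ALL i:?I. c i = 0" by blast
 qed
 moreover have "cv.span (xi ` ?I) = spc M (w q)"
 proof
  show "cv.span (xi ` ?I) <= spc M (w q)" using xi(1) by (intro cv.span_minimal rep_subspace[OF M]) (metis (mono_tags, lifting) image_subsetI mem_Collect_eq)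
  show "spc M (w q) <= cv.span (xi ` ?I)"
  proof
   fix y assume "y : spc M (w q)"
   then obtain c where c: "y = (SUM i:?I. cscale (c i) (xi i))" using expand by blast
   show "y : cv.span (xi ` ?I)" unfolding c by (intro cv.span_sum cv.span_scale cv.span_base imageI)
  qed
 qed
 ultimately show ?thesis by simp
qed

end

section \<open>Blocks\<close>

lemma next_cw: "EX j::nat. cw (q + int j) & (ALL i<j. ~ cw (q + int i))"
proof -
 obtain q0 where q0: "cw q0" using ex_cw by blast
 have n0: "int n > 0" using n2 by simp
 have "(q + (q0 - q) mod int n) mod int n = q0 mod int n" by (simp add: mod_add_right_eq)
 hence "cw (q + (q0 - q) mod int n)" using q0 cw_cong by blast
 hence ex: "EX j::nat. cw (q + int j)" using pos_mod_sign[OF n0, of "q0 - q"] by (intro exI[of _ "nat ((q0 - q) mod int n)"]) simp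
 show ?thesis using LeastI_ex[OF ex] not_less_Least by blast
qed

text \<open>Runs backwards through a maximal run of anticlockwise edges, from the clockwise position
  at its end. Where the anticlockwise arrows are bijective, it reduces statements to the clockwise
  positions.\<close>

lemma acw_induct:
 assumes "!!q. cw q ==> P q" "!!q. ~ cw q ==> P (q + 1) ==> P q" shows "P q"
proof -
 have main: "P (q' - int j)" if q': "cw q'" and a: "ALL i<j. ~ cw (q' - int (Suc i))" for q' j
  using a
 proof (induction j)
  case 0 thus ?case using assms(1)[OF q'] by simp
 next
  case (Suc j)
  have "q' - int (Suc j) + 1 = q' - int j" by simp
  thus ?case using assms(2)[of "q' - int (Suc j)"] Suc by simp
 qed
 obtain j where j: "cw (q + int j)" "ALL i<j. ~ cw (q + int i)" using next_cw by blast
 have "ALL i<j. ~ cw (q + int j - int (Suc i))"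
 proof (intro allI impI)
  fix i assume i: "i < j"
  have "q + int j - int (Suc i) = q + int (j - Suc i)" using i by simp
  thus "~ cw (q + int j - int (Suc i))" using j(2)[rule_format, of "j - Suc i"] i by (simp only:) simp
 qed
 from main[OF j(1) this] show ?thesis by simp
qed

lemma hom_bij_of_cw:
 assumes X: "acwbij X" and Y: "acwbij Y" and f: "rep_hom Q X Y f"
  and b: "!!q. cw q ==> bij_betw (f (w q)) (spc X (w q)) (spc Y (w q))"
 shows "rep_inj X f" "rep_surj X Y f"
proof -
 have *: "bij_betw (f (w q)) (spc X (w q)) (spc Y (w q))" for q
 proof (induction q rule: acw_induct)
  case (1 q) thus ?case by (rule b)
 next
  case (2 q)
  have bX: "bij_betw (act X (e q)) (spc X (w (q + 1))) (spc X (w q))" and bY: "bij_betw (act Y (e q)) (spc Y (w (q + 1))) (spc Y (w q))"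
   using X Y 2(1) by (simp_all add: acwbij_def)
  have c: "f (w q) (act X (e q) x) = act Y (e q) (f (w (q + 1)) x)" if "x : spc X (w (q + 1))" for x
   using hom_commute[OF f, of x "e q"] that 2(1) by (simp add: src_e tgt_e)
  have "bij_betw (act Y (e q) \<circ> f (w (q + 1))) (spc X (w (q + 1))) (spc Y (w q))" by (rule bij_betw_trans[OF 2(2) bY])
  hence "bij_betw (f (w q) \<circ> act X (e q)) (spc X (w (q + 1))) (spc Y (w q))"
   by (rule bij_betw_cong[THEN iffD1, rotated]) (simp add: c)
  thus ?case using bij_betw_comp_iff[OF bX] by blast
 qed
 show "rep_inj X f" unfolding rep_inj_def
 proof
  fix v obtain q where "v = w q" using w_surj by blast
  thus "inj_on (f v) (spc X v)" using bij_betw_imp_inj_on[OF *] by simp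
 qed
 show "rep_surj X Y f" unfolding rep_surj_def
 proof
  fix v obtain q where "v = w q" using w_surj by blast
  thus "f v ` spc X v = spc Y v" using bij_betw_imp_surj_on[OF *] by simp
 qed
qed

text \<open>A block is one-dimensional on a maximal run of anticlockwise edges, the run that ends at the position
 \<open>k\<close>, and zero elsewhere.\<close>

definition blk :: "int => ('v, 'a) quiver_rep => bool" where
 "blk k X \<longleftrightarrow> acwbij X & cw k & (ALL q. cw q --> (ALL x:spc X (w q). act X (e q) x = 0)) &
   (ALL q. cw q --> cv.dim (spc X (w q)) = of_bool (w q = w k))"

lemma blk_acwbij: "blk k X ==> acwbij X" and blk_rep: "blk k X ==> is_rep Q X"
 and blk_cw: "blk k X ==> cw k" and blk_act: "blk k X ==> cw q ==> x : spc X (w q) ==> act X (e q) x = 0"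
 and blk_dim: "blk k X ==> cw q ==> cv.dim (spc X (w q)) = of_bool (w q = w k)"
 using acwbij_rep by (auto simp: blk_def)

lemma blk_zero: "blk k X ==> cw q ==> w q ~= w k ==> spc X (w q) = {0}"
 using blk_dim[of k X q] fd_dim_0[OF rep_fd[OF blk_rep]] by simp

lemma blk_element:
 assumes "blk k X" shows "EX x. x : spc X (w k) & x ~= 0 & spc X (w k) = cv.span {x}"
proof -
 have d: "cv.dim (spc X (w k)) = 1" using blk_dim[OF assms blk_cw[OF assms]] by simp
 hence "spc X (w k) ~= {0}" by (rule contrapos_pn) (simp add: dim_zero)
 then obtain x where "x : spc X (w k)" "x ~= 0" using cv.subspace_0[OF rep_subspace[OF blk_rep[OF assms]]] by fast
 thus ?thesis using dim_1_span[OF rep_fd[OF blk_rep[OF assms]] d] by blast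
qed

lemma blk_hom_iso:
 assumes X: "blk k X" and Y: "blk k Y" and f: "rep_hom Q X Y f" and x: "x : spc X (w k)" "f (w k) x ~= 0"
 shows "rep_inj X f" "rep_surj X Y f"
proof -
 have "bij_betw (f (w q)) (spc X (w q)) (spc Y (w q))" if q: "cw q" for q
 proof (cases "w q = w k")
  case True
  have dX: "cv.dim (spc X (w k)) = 1" and dY: "cv.dim (spc Y (w k)) = 1"
   using blk_dim[OF X blk_cw[OF X]] blk_dim[OF Y blk_cw[OF X]] by simp_all
  have x0: "x ~= 0" using x(2) hom_0[OF blk_rep[OF X] f] by metis
  have sX: "spc X (w k) = cv.span {x}" by (rule dim_1_span[OF rep_fd[OF blk_rep[OF X]] dX x(1) x0])
  have sY: "spc Y (w k) = cv.span {f (w k) x}" by (rule dim_1_span[OF rep_fd[OF blk_rep[OF Y]] dY hom_mem[OF f x(1)] x(2)])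
  have im: "f (w k) ` spc X (w k) = spc Y (w k)"
   using lft_span_image[OF hom_linear[OF f] rep_subspace[OF blk_rep[OF X]] rep_subspace[OF blk_rep[OF Y]], of "{x}" "w k"] x(1) sX sY by simp
  moreover have "inj_on (f (w k)) (spc X (w k))"
   by (rule fd_surj_inj[OF rep_fd[OF blk_rep[OF X]] hom_linear[OF f]]) (simp add: im dX dY)
  ultimately show ?thesis using True by (simp add: bij_betw_def)
 next
  case False
  thus ?thesis using blk_zero[OF X q] blk_zero[OF Y q] hom_0[OF blk_rep[OF X] f] by (simp add: bij_betw_def)
 qed
 from hom_bij_of_cw[OF blk_acwbij[OF X] blk_acwbij[OF Y] f this] show "rep_inj X f" "rep_surj X Y f" by blast+
qed

lemma blk_hom_zero:
 assumes S: "blk k S" and Y: "is_rep Q Y" and F: "rep_hom Q S Y F" and x: "x : spc S (w k)" "x ~= 0" "F (w k) x = 0"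
 shows "ALL y:spc S (w q). F (w q) y = 0"
proof (induction q rule: acw_induct)
 case (1 q)
 show ?case
 proof (cases "w q = w k")
  case True
  have "spc S (w k) = cv.span {x}"
   using dim_1_span[OF rep_fd[OF blk_rep[OF S]] _ x(1,2)] blk_dim[OF S blk_cw[OF S]] by simp
  thus ?thesis using True hom_scale[OF F x(1)] x(3) by (auto simp: cv.span_singleton)
 next
  case False thus ?thesis using blk_zero[OF S 1] hom_0[OF blk_rep[OF S] F] by simp
 qed
next
 case (2 q)
 show ?case
 proof
  fix y assume "y : spc S (w q)"
  then obtain z where "z : spc S (w (q + 1))" "y = act S (e q) z"
   using blk_acwbij[OF S] 2(1) unfolding acwbij_def bij_betw_def by blast
  thus "F (w q) y = 0" using hom_commute[OF F, of z "e q"] 2 rep_act_0[OF Y] by (simp add: src_e tgt_e)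
 qed
qed

lemma blk_indecomposable:
 assumes X: "blk k X" shows "indecomposable Q X"
proof (rule indecomposable_if_no_idempotents)
 show Xr: "is_rep Q X" by (rule blk_rep[OF X])
 obtain x where x: "x : spc X (w k)" "x ~= 0" using blk_element[OF X] by blast
 thus "spc X ~= zero_fam" by (auto simp: zero_fam_def)
 fix p q assume p: "rep_hom Q X X p" and q: "rep_hom Q X X q"
  and pq: "!!v x. x : spc X v ==> x = p v x + q v x" "!!v x. x : spc X v ==> p v (p v x) = p v x"
 have all: "ALL v. ALL y:spc X v. f v y = 0" if "rep_hom Q X X f" "y : spc X (w k)" "y ~= 0" "f (w k) y = 0" for f y
  using blk_hom_zero[OF X Xr that] w_surj by metis
 show "(ALL v. ALL x:spc X v. p v x = 0) | (ALL v. ALL x:spc X v. q v x = 0)"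
 proof (cases "p (w k) x = 0")
  case True thus ?thesis using all[OF p x] by blast
 next
  case False
  let ?y = "p (w k) x"
  have y: "?y : spc X (w k)" by (rule hom_mem[OF p x(1)])
  have "q (w k) ?y = 0" using pq(1)[OF y] pq(2)[OF x(1)] by simp
  thus ?thesis using all[OF q y False] by blast
 qed
qed

text \<open>Entry \<open>j\<close> belongs to position \<open>k - j\<close>. The entries are zero
  from the first clockwise edge on, so that \<open>j\<close> needs no bound.\<close>

fun zt :: "('v, 'a) quiver_rep => int => cvec => nat => cvec" where
 "zt M k y 0 = y"
| "zt M k y (Suc j) = (if cw (k - 1 - int j) then 0 else act M (e (k - 1 - int j)) (zt M k y j))"

definition zspan :: "('v, 'a) quiver_rep => int => cvec => 'v => cvec set" where
 "zspan M k y v = cv.span {zt M k y j |j. w (k - int j) = v}"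

lemma zt_mem: "is_rep Q M ==> y : spc M (w k) ==> zt M k y j : spc M (w (k - int j))"
proof (induction j)
 case (Suc j)
 have e1: "k - 1 - int j + 1 = k - int j" "k - int (Suc j) = k - 1 - int j" by simp_all
 show ?case
  unfolding e1(2) using act_mem_acw[OF Suc.prems(1), of "k - 1 - int j" "zt M k y j"] Suc
  by (simp add: e1 cv.subspace_0[OF rep_subspace])
qed simp

lemma zt_cw: "j > 0 ==> cw (k - int j) ==> zt M k y j = 0"
 by (cases j) (simp_all add: algebra_simps)

lemma zt_act:
 assumes "is_rep Q M" "act M (e k) y = 0" "cw (k - int j)" shows "act M (e (k - int j)) (zt M k y j) = 0"
 using assms zt_cw[OF _ assms(3)] rep_act_0[OF assms(1)] by (cases "j = 0") auto

lemma zt_pred: "~ cw (k - 1 - int j) ==> act M (e (k - 1 - int j)) (zt M k y j) = zt M k y (Suc j)"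
 by simp

lemma zspan_submodule:
 assumes M: "is_rep Q M" and y: "y : spc M (w k)" "act M (e k) y = 0"
 shows "submodule Q M (zspan M k y)"
proof (rule submoduleI)
 have sub: "{zt M k y j |j. w (k - int j) = v} <= spc M v" for v using zt_mem[OF M y(1)] by force
 show "cv.subspace (zspan M k y v)" for v by (simp add: zspan_def)
 show "x : spc M v" if "x : zspan M k y v" for v x
  using cv.span_minimal[OF sub rep_subspace[OF M]] that by (auto simp: zspan_def)
 show "act M a x : zspan M k y (tgt Q a)" if x: "x : zspan M k y (src Q a)" for a x
 proof -
  let ?F = "{zt M k y j |j. w (k - int j) = src Q a}"
  have "act M a ` zspan M k y (src Q a) = cv.span (act M a ` ?F)"
   unfolding zspan_def by (rule lft_span_image[OF rep_act[OF M] rep_subspace[OF M] rep_subspace[OF M] sub])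
  also have "... <= zspan M k y (tgt Q a)"
   unfolding zspan_def
  proof (rule cv.span_minimal[OF _ cv.subspace_span], rule image_subsetI)
   fix u assume "u : ?F"
   then obtain j where j: "u = zt M k y j" "w (k - int j) = src Q a" by blast
   obtain q' where "a = e q'" using e_surj by blast
   then obtain q where q: "a = e q" "spos q = k - int j" using e_position_src[of q' "k - int j"] j(2) by metis
   show "act M a u : cv.span {zt M k y j |j. w (k - int j) = tgt Q a}"
   proof (cases "cw q")
    case True
    hence "act M a u = 0" using zt_act[OF M y(2), of j] q j(1) by (simp add: spos_def)
    thus ?thesis using cv.span_zero by simp
   next
    case False
    hence q1: "q = k - 1 - int j" using q(2) by (simp add: spos_def)
    have "act M a u = zt M k y (Suc j)" using False unfolding j(1) q(1) q1 by simp
    moreover have "w (k - int (Suc j)) = tgt Q a"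
    using False arg_cong[of "k - int (Suc j)" q w] q1 q(1) by (simp add: tgt_e)
    ultimately show ?thesis by (intro cv.span_base) blast
   qed
  qed
  finally show ?thesis using x by blast
 qed
qed

lemma zspan_blk:
 assumes M: "is_rep Q M" and inj: "!!q. ~ cw q ==> inj_on (act M (e q)) (spc M (w (q + 1)))"
  and k: "cw k" and y: "y : spc M (w k)" "act M (e k) y = 0" "y ~= 0"
 shows "blk k (subrep M (zspan M k y))"
proof -
 let ?U = "zspan M k y"
 have U: "submodule Q M ?U" by (rule zspan_submodule[OF M y(1,2)])
 have at_cw: "?U (w q) = (if w q = w k then cv.span {y} else {0})" if q: "cw q" for q
 proof (cases "w q = w k")
  case True
  have "{zt M k y j |j. w (k - int j) = w k} <= {y, 0}"
  proof
   fix u assume "u : {zt M k y j |j. w (k - int j) = w k}"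
   then obtain j where j: "w (k - int j) = w k" "u = zt M k y j" by blast
   have "cw (k - int j)" using j(1) k cw_cong[of "k - int j" k] by (simp add: w_eq)
   thus "u : {y, 0}" using zt_cw[of j k M y] j(2) by (cases "j = 0") auto
  qed
  hence "?U (w k) <= cv.span {y, 0}" unfolding zspan_def by (rule cv.span_mono)
  moreover have "cv.span {y, 0} = cv.span {y}" using cv.span_insert_0[of "{y}"] by (simp add: insert_commute)
  moreover have "y : {zt M k y j |j. w (k - int j) = w k}" by (rule CollectI, rule exI[of _ 0]) simp
  hence "cv.span {y} <= ?U (w k)" unfolding zspan_def by (intro cv.span_mono) simp
  ultimately show ?thesis using True by auto
 next
  case False
  have "zt M k y j = 0" if "w (k - int j) = w q" for j
  proof -
   have "cw (k - int j)" using that q cw_cong[of "k - int j" q] by (simp add: w_eq)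
   moreover have "j ~= 0" by (rule notI) (use that False in simp)
   ultimately show ?thesis using zt_cw by blast
  qed
  hence "{zt M k y j |j. w (k - int j) = w q} <= {0}" by blast
  from cv.span_mono[OF this] have "?U (w q) <= {0}" by (simp add: zspan_def)
  thus ?thesis using False cv.subspace_0[OF submodule_subspace[OF U], of "w q"] by auto
 qed
 have surj: "x : act M (e q) ` ?U (w (q + 1))" if q: "~ cw q" and x: "x : ?U (w q)" for q x
 proof -
  have l: "linear_from_to (?U (w (q + 1))) (spc M (w q)) (act M (e q))"
   using lft_subset[OF rep_act[OF M, of "e q"] submodule_subset[OF U]] q by (simp add: src_e tgt_e)
  have "?U (w q) <= act M (e q) ` ?U (w (q + 1))"
   unfolding zspan_def[of M k y "w q"]
  proof (rule cv.span_minimal[OF _ lft_image_subspace[OF l submodule_subspace[OF U]]], rule subsetI)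
   fix u assume "u : {zt M k y j |j. w (k - int j) = w q}"
   then obtain j where j: "u = zt M k y j" "w (k - int j) = w q" by blast
   have nc: "~ cw (k - int j)" using j(2) q cw_cong[of "k - int j" q] by (simp add: w_eq)
   have "j ~= 0" by (rule notI) (use nc k in simp)
   then obtain i where i: "j = Suc i" by (cases j) auto
   have ki: "k - int j = k - 1 - int i" using i by simp
   have "e (k - 1 - int i) = e q" using j(2) ki by (simp add: e_eq w_eq)
   moreover have "~ cw (k - 1 - int i)" using nc unfolding ki .
   ultimately have "u = act M (e q) (zt M k y i)" unfolding j(1) i by simp
   moreover have "w (k - int i) = w (q + 1)" using w_add[OF j(2), of 1] i by (simp add: algebra_simps)
   hence "zt M k y i : ?U (w (q + 1))" unfolding zspan_def by (intro cv.span_base) blast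
   ultimately show "u : act M (e q) ` ?U (w (q + 1))" by blast
  qed
  thus ?thesis using x by blast
 qed
 have "bij_betw (act M (e q)) (?U (w (q + 1))) (?U (w q))" if q: "~ cw q" for q
 proof -
  have "inj_on (act M (e q)) (?U (w (q + 1)))" by (rule inj_on_subset[OF inj[OF q] submodule_subset[OF U]])
  moreover have "act M (e q) ` ?U (w (q + 1)) <= ?U (w q)"
   using submodule_act[OF U, of _ "e q"] q by (auto simp: src_e tgt_e)
  ultimately show ?thesis using surj[OF q] by (auto simp: bij_betw_def)
 qed
 hence "acwbij (subrep M ?U)" by (simp add: acwbij_def is_rep_subrep[OF M U])
 moreover have "act M (e q) x = 0" if q: "cw q" and x: "x : ?U (w q)" for q x
 proof (cases "w q = w k")
  case True
  hence "x : cv.span {y}" using x at_cw[OF q] by simp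
  then obtain c where "x = cscale c y" unfolding cv.span_singleton by blast
  moreover have "e q = e k" using True by (simp add: e_eq w_eq)
  ultimately show ?thesis using rep_act_scale[OF M, of y "e k" c] y k by (simp add: src_e)
 next
  case False thus ?thesis using x at_cw[OF q] rep_act_0[OF M] by simp
 qed
 moreover have "cv.dim (?U (w q)) = of_bool (w q = w k)" if q: "cw q" for q
  using at_cw[OF q] dim_zero cv.dim_eq_card_independent[of "{y}"] y(3) by simp
 ultimately show ?thesis using k by (simp add: blk_def)
qed

lemma blk_generated:
 assumes X: "blk k X" and x: "x : spc X (w k)" "x ~= 0" shows "spc X = zspan X k x"
proof -
 have Xr: "is_rep Q X" by (rule blk_rep[OF X])
 have k: "cw k" by (rule blk_cw[OF X])
 have a: "act X (e k) x = 0" by (rule blk_act[OF X k x(1)])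
 have U: "submodule Q X (zspan X k x)" by (rule zspan_submodule[OF Xr x(1) a])
 have b: "blk k (subrep X (zspan X k x))"
  by (rule zspan_blk[OF Xr _ k x(1) a x(2)]) (use blk_acwbij[OF X] in \<open>simp add: acwbij_def bij_betw_def\<close>)
 have "x : {zt X k x j |j. w (k - int j) = w k}" by (rule CollectI, rule exI[of _ 0]) simp
 hence "x : zspan X k x (w k)" unfolding zspan_def by (rule cv.span_base)
 hence "rep_surj (subrep X (zspan X k x)) X (%v x. x)"
  using blk_hom_iso(2)[OF b X rep_hom_incl[OF U], of x] x(2) by simp
 hence "zspan X k x v = spc X v" for v by (simp add: rep_surj_def)
 thus ?thesis by (simp add: fun_eq_iff)
qed

text \<open>The direct sum is formed as the extension with zero cocycle. In it, a pair of generators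
  generates a block, and both projections are nonzero on its generator; so this block is the graph
  of an isomorphism.\<close>

theorem blk_iso:
 assumes X: "blk k X" and Y: "blk k Y" shows "rep_iso Q X Y"
proof -
 let ?Z = "ext_rep X Y (%a x. 0)"
 have Xr: "is_rep Q X" and Yr: "is_rep Q Y" using blk_rep X Y by blast+
 have c: "cocycle Q Y X (%a x. 0)" by (simp add: cocycle_def lft_0[OF rep_subspace[OF Xr]])
 have Z: "is_rep Q ?Z" by (rule is_rep_ext_rep[OF Xr Yr c])
 have p2: "rep_hom Q ?Z Y (%v. csnd)" by (rule ext_rep_proj[OF Xr Yr c])
 have p1: "rep_hom Q ?Z X (%v. cfst)"
  by (rule rep_homI) (auto simp: linear_from_to_def spc_ext_rep cpair_add cpair_scale)
 obtain x y where x: "x : spc X (w k)" "x ~= 0" and y: "y : spc Y (w k)" "y ~= 0" using blk_element X Y by meson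
 let ?z = "cpair x y"
 have k: "cw k" by (rule blk_cw[OF X])
 have z: "?z : spc ?Z (w k)" "act ?Z (e k) ?z = 0" "?z ~= 0"
  using x y blk_act[OF X k x(1)] blk_act[OF Y k y(1)] by (auto simp: spc_ext_rep)
 have "inj_on (act ?Z (e q)) (spc ?Z (w (q + 1)))" if "~ cw q" for q
  using blk_acwbij[OF X] blk_acwbij[OF Y] that by (fastforce simp: acwbij_def bij_betw_def inj_on_def spc_ext_rep)
 hence b: "blk k (subrep ?Z (zspan ?Z k ?z))" by (intro zspan_blk[OF Z _ k z])
 have U: "submodule Q ?Z (zspan ?Z k ?z)" by (rule zspan_submodule[OF Z z(1,2)])
 have "?z : {zt ?Z k ?z j |j. w (k - int j) = w k}" by (rule CollectI, rule exI[of _ 0]) simp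
 hence zU: "?z : spc (subrep ?Z (zspan ?Z k ?z)) (w k)" unfolding spc_subrep zspan_def by (rule cv.span_base)
 note q1 = rep_hom_subrep[OF U p1] and q2 = rep_hom_subrep[OF U p2]
 have "rep_iso Q (subrep ?Z (zspan ?Z k ?z)) X" unfolding rep_iso_def
  using blk_hom_iso[OF b X q1 zU] x(2) q1 by auto
 moreover have "rep_iso Q (subrep ?Z (zspan ?Z k ?z)) Y" unfolding rep_iso_def
  using blk_hom_iso[OF b Y q2 zU] y(2) q2 by auto
 ultimately show ?thesis using rep_iso_trans rep_iso_sym blk_rep[OF b] Xr Yr by meson
qed

text \<open>Follow \<open>h\<close> along the vectors \<open>?z j\<close> of the block. By the
  preprojective relations it is zero on them, except across the clockwise edge
  \<open>k - 1 - m\<close>, which leads into the block from the left. The value \<open>y\<close>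
  found there is killed by that edge and generates \<open>N\<close>.\<close>

theorem blk_translate:
 assumes L: "blk k L" and N: "indecomposable Q N" "!!i. no_compat N i" and h: "connection Q L N h"
  and m: "cw (k - 1 - int m)" "!!i. i < m ==> ~ cw (k - 1 - int i)"
 shows "blk (k - 1 - int m) N"
proof -
 have Lr: "is_rep Q L" and Nr: "is_rep Q N" using blk_rep[OF L] indecomposable_rep[OF N(1)] .
 have k: "cw k" by (rule blk_cw[OF L])
 obtain x where x: "x : spc L (w k)" "x ~= 0" using blk_element[OF L] by blast
 have a: "act L (e k) x = 0" by (rule blk_act[OF L k x(1)])
 let ?z = "zt L k x" and ?k = "k - 1 - int m"
 have zm: "?z j : spc L (w (k - int j))" for j by (rule zt_mem[OF Lr x(1)])
 have h0: "h b 0 = 0" for b by (rule connection_0[OF Lr h])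
 have closed: "(if cw (k - int j) then 0 else act N (e (k - int j)) (h (e (k - int j)) (?z j))) +
   (if cw (k - int j - 1) then act N (e (k - int j - 1)) (h (e (k - int j - 1)) (?z j)) else 0) =
   (if cw (k - int j - 1) then 0 else h (e (k - int j - 1)) (?z (Suc j)))" for j
 proof -
  have e1: "k - 1 - int j = k - int j - 1" by simp
  have "(if cw (k - int j) then h (e (k - int j)) (act L (e (k - int j)) (?z j)) else 0) = 0"
   using zt_act[OF Lr a, of j] h0 by simp
  moreover have "~ cw (k - int j - 1) ==> act L (e (k - int j - 1)) (?z j) = ?z (Suc j)" using zt_pred[of k j L x] unfolding e1 .
  ultimately show ?thesis using connection_closed[OF h zm[of j]]
   by (cases "cw (k - int j - 1)") (simp_all del: zt.simps)
 qed
 have claim: "h (e (k - int j)) (?z j) = 0" if "j > 0" "j <= m" for j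
  using that
 proof (induction j)
  case (Suc j)
  have e1: "k - int (Suc j) = k - int j - 1" and e2: "k - int j - 1 = k - 1 - int j" by simp_all
  have "~ cw (k - int j - 1)" using m(2)[of j] Suc.prems unfolding e2 by simp
  moreover have "act N (e (k - int j)) (h (e (k - int j)) (?z j)) = 0" if "~ cw (k - int j)"
  proof -
   have "j > 0" using that k by (cases j) auto
   thus ?thesis using Suc rep_act_0[OF Nr] by simp
  qed
  ultimately show ?case using closed[of j] unfolding e1 by (auto simp del: zt.simps split: if_splits)
 qed simp
 define y where "y = h (e ?k) (?z m)"
 have e3: "k - int m - 1 = ?k" by simp
 have y1: "y : spc N (w ?k)"
  using connection_mem[OF h, of "?z m" ?k] zm[of m] m(1) by (simp add: y_def tpos_def spos_def)
 have y2: "act N (e ?k) y = 0"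
 proof -
  have "act N (e (k - int m)) (h (e (k - int m)) (?z m)) = 0" if "~ cw (k - int m)"
  proof -
   have "m > 0" using that k by (cases m) auto
   thus ?thesis using claim[of m] rep_act_0[OF Nr] by simp
  qed
  thus ?thesis using closed[of m] m(1) unfolding e3 y_def by (auto split: if_splits)
 qed
 have W: "submodule Q N (zspan N ?k y)" by (rule zspan_submodule[OF Nr y1 y2])
 have yW: "y : zspan N ?k y (w ?k)"
 proof -
  have "y : {zt N ?k y j |j. w (?k - int j) = w ?k}" by (rule CollectI, rule exI[of _ 0]) simp
  thus ?thesis unfolding zspan_def by (rule cv.span_base)
 qed
 have z0: "?z j = 0" if "j > m" for j
  using that
 proof (induction j)
  case (Suc j)
  show ?case
  proof (cases "j = m")
   case True thus ?thesis using m(1) by simp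
  next
   case False thus ?thesis using Suc rep_act_0[OF Lr] by simp
  qed
 qed simp
 have "h b l : zspan N ?k y (src Q b)" if l: "l : spc L (tgt Q b)" for b l
 proof -
  let ?F = "{?z j |j. w (k - int j) = tgt Q b}"
  have F: "spc L (tgt Q b) = cv.span ?F" using fun_cong[OF blk_generated[OF L x], of "tgt Q b"] by (simp add: zspan_def)
  have "?z j : spc L v" if "w (k - int j) = v" for j v using zm[of j] that by simp
  hence FL: "?F <= spc L (tgt Q b)" by blast
  have "h b ` spc L (tgt Q b) = cv.span (h b ` ?F)"
   using lft_span_image[OF connection_lin[OF h] rep_subspace[OF Lr] rep_subspace[OF Nr] FL] F by simp
  also have "... <= zspan N ?k y (src Q b)"
  proof (rule cv.span_minimal[OF _ submodule_subspace[OF W]], rule image_subsetI)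
   fix u assume "u : ?F"
   then obtain j where j: "u = ?z j" "w (k - int j) = tgt Q b" by blast
   obtain q' where "b = e q'" using e_surj by blast
   then obtain q where q: "b = e q" "tpos q = k - int j" using e_position_tgt[of q' "k - int j"] j(2) by metis
   have "h b u = 0 | (h b u = y & src Q b = w ?k)"
   proof (cases "j > m")
    case True thus ?thesis using z0 h0 j(1) by simp
   next
    case jm: False
    show ?thesis
    proof (cases "cw q")
     case True
     hence q1: "q = k - 1 - int j" using q(2) by (simp add: tpos_def)
     hence "j = m" using m(2)[of j] True jm by fastforce
     thus ?thesis using True q(1) q1 j(1) by (simp add: y_def src_e)
    next
     case False
     hence q1: "q = k - int j" using q(2) by (simp add: tpos_def)
     hence "j > 0" using False k by (cases j) auto
     thus ?thesis using claim[of j] jm q(1) q1 j(1) by simp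
    qed
   qed
   thus "h b u : zspan N ?k y (src Q b)" using yW cv.subspace_0[OF submodule_subspace[OF W]] by auto
  qed
  finally show ?thesis using l by blast
 qed
 from connection_generates[OF h W this] have full: "zspan N ?k y = spc N" by blast
 have y3: "y ~= 0"
 proof
  assume y0: "y = 0"
  have z: "zt N ?k y j = 0" for j using y0 rep_act_0[OF Nr] by (induction j) simp_all
  have "spc N v = {0}" for v
  proof -
   have "{zt N ?k y j |j. w (?k - int j) = v} <= {0}" using z by blast
   from cv.span_mono[OF this] have "zspan N ?k y v <= {0}" by (simp add: zspan_def)
   thus ?thesis unfolding full using cv.subspace_0[OF rep_subspace[OF Nr], of v] by blast
  qed
  hence "spc N = zero_fam" by (simp add: zero_fam_def fun_eq_iff)
  thus False using N(1) by (simp add: indecomposable_def)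
 qed
 have "acwbij N" using string_basis_exists[OF N m(1) y1 y2 y3] string_acwbij[OF Nr N(2)] by blast
 hence "blk ?k (subrep N (zspan N ?k y))"
  by (intro zspan_blk[OF Nr _ m(1) y1 y2 y3]) (simp add: acwbij_def bij_betw_def)
 thus ?thesis unfolding full subrep_spc .
qed

text \<open>Position \<open>q\<close> becomes \<open>- q\<close>, and the edge from
  \<open>- q - 1\<close> to \<open>- q\<close> gets the number \<open>q\<close>. This exchanges
  clockwise and anticlockwise, so all results about one orientation hold for the other.\<close>

lemma flip: "cyclic_quiver Q n (%q. w (- q)) (%q. e (- q - 1)) (%q. ~ cw (- q - 1))"
proof -
 have neg: "(- q) mod int n = (- q') mod int n \<longleftrightarrow> q mod int n = q' mod int n" for q q' :: int
  by (metis mod_minus_cong minus_minus)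
 have neg1: "(- q - 1) mod int n = (- q' - 1) mod int n \<longleftrightarrow> q mod int n = q' mod int n" for q q' :: int
  using mod_add1[of "- q - 1" "- q' - 1" 1] mod_add1[of "- q" "- q'" "- 1"] neg[of q q'] by auto
 have a: "- (q + 1) = - q - 1" "- q - 1 + 1 = - q" for q :: int by simp_all
 show ?thesis
 proof
  show "n >= 2" by (rule n2)
  show "w (- q) = w (- q') \<longleftrightarrow> q mod int n = q' mod int n" for q q' by (simp add: w_eq neg)
  show "e (- q - 1) = e (- q' - 1) \<longleftrightarrow> q mod int n = q' mod int n" for q q' by (simp add: e_eq neg1)
  show "EX q. v = w (- q)" for v using w_surj[of v] by (metis minus_minus)
  show "EX q. a = e (- q - 1)" for a
  proof -
   obtain q where "a = e q" using e_surj by blast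
   thus ?thesis by (intro exI[of _ "- q - 1"]) simp
  qed
  show "(~ cw (- q - 1)) = (~ cw (- q' - 1))" if "q mod int n = q' mod int n" for q q'
   using cw_cong[of "- q - 1" "- q' - 1"] neg1[of q q'] that by simp
  show "src Q (e (- q - 1)) = (if ~ cw (- q - 1) then w (- q) else w (- (q + 1)))" for q
   using src_e[of "- q - 1"] unfolding a by (cases "cw (- q - 1)") simp_all
  show "tgt Q (e (- q - 1)) = (if ~ cw (- q - 1) then w (- (q + 1)) else w (- q))" for q
   using tgt_e[of "- q - 1"] unfolding a by (cases "cw (- q - 1)") simp_all
  obtain q where "~ cw q" using ex_acw by blast
  thus "EX q. ~ cw (- q - 1)" by (intro exI[of _ "- q - 1"]) simp
  obtain q where "cw q" using ex_cw by blast
  thus "EX q. ~ ~ cw (- q - 1)" by (intro exI[of _ "- q - 1"]) simp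
 qed
qed

section \<open>Surjectivity of the arrows\<close>

lemma cfunctional_flin: "cfunctional ph ==> flin V ph"
 by (simp add: cfunctional_iff flin_def)

text \<open>Continue \<open>ph\<close> to the left by \<open>extend_all_left\<close> and to the
  right by zero; the latter is possible because \<open>ph\<close> kills the image of the
  anticlockwise arrow at \<open>q\<close>.\<close>

lemma no_dcompat_functional:
 assumes M: "is_rep Q M" and S: "!!k. no_dcompat M k" and q: "~ cw q"
  and ph: "cfunctional ph" "!!x. x : lc M k q ==> ph x = 0" "!!x. x : spc M (w (q + 1)) ==> ph (act M (e q) x) = 0"
  and x: "x : spc M (w q)"
 shows "ph x = 0"
proof -
 obtain Ph where Ph: "Ph q = ph" "ALL i<=q. cfunctional (Ph i)" "ALL i<q. drel M i (Ph i) (Ph (i + 1))"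
  "ALL i<=q - int k. ALL x:spc M (w i). Ph i x = 0"
  using extend_all_left[OF M ph(1), of k q] ph(2) by blast
 define Ps where "Ps i = (if i <= q then Ph i else (%x. 0))" for i
 have c0: "cfunctional (%x. 0)" by (simp add: cfunctional_iff)
 have "drel M i (Ps i) (Ps (i + 1))" for i
 proof -
  consider "i < q" | "i = q" | "i > q" by linarith
  thus ?thesis
  proof cases
   case 1 thus ?thesis using Ph(3) by (simp add: Ps_def)
  next
   case 2 thus ?thesis using ph(3) q Ph(1) by (simp add: Ps_def drel_def)
  next
   case 3 thus ?thesis by (simp add: Ps_def drel_def)
  qed
 qed
 moreover have "flin (spc M (w i)) (Ps i)" for i
  using Ph(2) c0 by (intro cfunctional_flin) (simp add: Ps_def)
 ultimately have "dcompat M Ps" unfolding dcompat_def drel_def by simp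
 moreover have "ALL x:spc M (w i). Ps i x = 0" if "i < q - int k | i >= q - int k + int (Suc k)" for i
  using that Ph(4) by (auto simp: Ps_def)
 ultimately have "ALL x:spc M (w q). Ps q x = 0" using S[of "Suc k"] unfolding no_dcompat_def by blast
 thus ?thesis using x Ph(1) by (simp add: Ps_def)
qed

lemma w_period: "w (q + int n) = w q"
 by (simp add: w_eq)

text \<open>Once the spaces \<open>lc\<close> are stable in \<open>k\<close>, their dimensions do
  not increase from left to right: a clockwise arrow maps one onto the next, an anticlockwise arrow
  embeds the next in it. Around the cycle they are equal, so the image of an anticlockwise arrow
  contains \<open>lc\<close>, and functionals that kill the image are zero by
  \<open>no_dcompat_functional\<close>.\<close>

theorem acw_surjective:
 assumes M: "is_rep Q M" and S: "!!k. no_dcompat M k" and inj: "!!a. inj_on (act M a) (spc M (src Q a))" and q: "~ cw q"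
 shows "act M (e q) ` spc M (w (q + 1)) = spc M (w q)"
proof -
 have fd: "fd_space (lc M k q)" for k q by (rule fd_sub(1)[OF rep_fd[OF M] lc_subspace[OF M] lc_sub])
 have dmono: "cv.dim (lc M (Suc k) q) <= cv.dim (lc M k q)" for k q
  by (rule fd_sub(2)[OF fd lc_subspace[OF M] lc_antimono])
 define F where "F k = (SUM q:{0..<int n}. cv.dim (lc M k q))" for k
 define k where "k = (ARG_MIN F k. True)"
 have "F k <= F (Suc k)" unfolding k_def by (rule arg_min_nat_le) simp
 hence eq0: "cv.dim (lc M k q) <= cv.dim (lc M (Suc k) q)" if "q : {0..<int n}" for q
  using sum_strict_mono_ex1[of "{0..<int n}" "%q. cv.dim (lc M (Suc k) q)" "%q. cv.dim (lc M k q)"] dmono that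
  unfolding F_def by (meson finite_atLeastLessThan_int leD not_le_imp_less)
 have stab: "lc M (Suc k) q = lc M k q" for q
 proof -
  have "q mod int n : {0..<int n}" using n2 by simp
  moreover have wq: "w (q mod int n) = w q" by (simp add: w_eq)
  ultimately have "cv.dim (lc M k q) <= cv.dim (lc M (Suc k) q)" using eq0 lc_cong[OF wq] by metis
  thus ?thesis by (rule fd_eq[OF fd lc_subspace[OF M] lc_antimono])
 qed
 have acwl: "linear_from_to (spc M (w (q + 1))) (spc M (w q)) (act M (e q))" "inj_on (act M (e q)) (spc M (w (q + 1)))" if "~ cw q" for q
  using rep_act[OF M, of "e q"] inj[of "e q"] that by (simp_all add: src_e tgt_e)
 have acw_img: "act M (e q) ` lc M k (q + 1) <= lc M k q" "cv.dim (act M (e q) ` lc M k (q + 1)) = cv.dim (lc M k (q + 1))" if "~ cw q" for q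
 proof -
  show "act M (e q) ` lc M k (q + 1) <= lc M k q"
   using stab[of "q + 1"] lc_Suc_acw[of "q + 1" M k] that by auto
  show "cv.dim (act M (e q) ` lc M k (q + 1)) = cv.dim (lc M k (q + 1))"
   by (rule fd_image_inj[OF fd lft_subset[OF acwl(1)[OF that] lc_sub] inj_on_subset[OF acwl(2)[OF that] lc_sub]])
 qed
 have dle: "cv.dim (lc M k (q + 1)) <= cv.dim (lc M k q)" for q
 proof (cases "cw q")
  case True
  have l: "linear_from_to (lc M k q) (spc M (w (q + 1))) (act M (e q))"
   using lft_subset[OF rep_act[OF M, of "e q"], of "lc M k q"] lc_sub[of M k q] True by (simp add: src_e tgt_e)
  have "lc M k (q + 1) = act M (e q) ` lc M k q" using lc_Suc_cw[OF M, of "q + 1" k] stab[of "q + 1"] True by simp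
  thus ?thesis using fd_image(2)[OF fd l] by simp
 next
  case False
  have "cv.subspace (act M (e q) ` lc M k (q + 1))"
   by (rule lft_image_subspace[OF lft_subset[OF acwl(1)[OF False] lc_sub] lc_subspace[OF M]])
  thus ?thesis using fd_sub(2)[OF fd _ acw_img(1)[OF False]] acw_img(2)[OF False] by simp
 qed
 have dle': "cv.dim (lc M k (q + int j)) <= cv.dim (lc M k q)" for q j
 proof (induction j)
  case (Suc j)
  thus ?case using dle[of "q + int j"] by (simp add: algebra_simps)
 qed simp
 have "cv.dim (lc M k q) = cv.dim (lc M k (q + 1 + int (n - 1)))"
  using lc_cong[OF w_period, of M k q] n2 by (simp add: algebra_simps of_nat_diff)
 also have "... <= cv.dim (lc M k (q + 1))" by (rule dle')
 finally have "act M (e q) ` lc M k (q + 1) = lc M k q"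
  using fd_eq[OF fd lft_image_subspace[OF lft_subset[OF acwl(1)[OF q] lc_sub] lc_subspace[OF M]] acw_img(1)[OF q]] acw_img(2)[OF q] by simp
 hence sub: "lc M k q <= act M (e q) ` spc M (w (q + 1))" using lc_sub[of M k "q + 1"] by blast
 have I: "cv.subspace (act M (e q) ` spc M (w (q + 1)))" by (rule lft_image_subspace[OF acwl(1)[OF q] rep_subspace[OF M]])
 have "x : act M (e q) ` spc M (w (q + 1))" if x: "x : spc M (w q)" for x
 proof (rule ccontr)
  assume "x ~: act M (e q) ` spc M (w (q + 1))"
  then obtain ph where ph: "cfunctional ph" "!!y. y : act M (e q) ` spc M (w (q + 1)) ==> ph y = 0" "ph x = 1"
   using separating_functional[OF I] by metis
  have "ph x = 0" by (rule no_dcompat_functional[OF M S q ph(1) _ _ x, of k]) (use ph(2) sub in blast)+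
  thus False using ph(3) by simp
 qed
 thus ?thesis using lft_mem[OF acwl(1)[OF q]] by blast
qed

lemma no_dcompat_iso:
 assumes X: "is_rep Q X" and Y: "is_rep Q Y" and iso: "rep_iso Q X Y" and k: "no_dcompat Y k"
 shows "no_dcompat X k"
 unfolding no_dcompat_def
proof (intro allI impI, elim conjE)
 fix ph l q assume ph: "dcompat X ph" and z: "ALL q. q < l | q >= l + int k --> (ALL x:spc X (w q). ph q x = 0)"
 obtain g where g: "rep_hom Q Y X g" "rep_surj Y X g"
  using rep_iso_sym[OF X iso] unfolding rep_iso_def by blast
 have "dcompat Y (%q x. ph q (g (w q) x))"
  unfolding dcompat_def
 proof (intro allI conjI)
  fix q
  show "flin (spc Y (w q)) (%x. ph q (g (w q) x))"
   using dcompat_flin[OF ph, of q] by (simp add: flin_def hom_mem[OF g(1)] hom_add[OF g(1)] hom_scale[OF g(1)])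
  show "if cw q then ALL x:spc Y (w q). ph q (g (w q) x) = ph (q + 1) (g (w (q + 1)) (act Y (e q) x))
    else ALL x:spc Y (w (q + 1)). ph (q + 1) (g (w (q + 1)) x) = ph q (g (w q) (act Y (e q) x))"
  proof (cases "cw q")
   case True
   have "g (w (q + 1)) (act Y (e q) x) = act X (e q) (g (w q) x)" if "x : spc Y (w q)" for x
    using hom_commute[OF g(1), of x "e q"] that True by (simp add: src_e tgt_e)
   thus ?thesis using dcompat_cw[OF ph True hom_mem[OF g(1)]] True by simp
  next
   case False
   have "g (w q) (act Y (e q) x) = act X (e q) (g (w (q + 1)) x)" if "x : spc Y (w (q + 1))" for x
    using hom_commute[OF g(1), of x "e q"] that False by (simp add: src_e tgt_e)
   thus ?thesis using dcompat_acw[OF ph False hom_mem[OF g(1)]] False by simp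
  qed
 qed
 moreover have "ALL x:spc Y (w q). ph q (g (w q) x) = 0" if "q < l | q >= l + int k" for q
  using z that hom_mem[OF g(1)] by blast
 ultimately have "ALL q. ALL x:spc Y (w q). ph q (g (w q) x) = 0" using k unfolding no_dcompat_def by blast
 thus "ALL x:spc X (w q). ph q x = 0" using g(2) unfolding rep_surj_def by (metis imageE)
qed

end

section \<open>Tubes\<close>

locale cyclic_tube = cyclic_quiver +
 fixes T p R
 assumes regular: "regular_component Q T" and p_pos: "p > 0"
  and R_mem: "R i j : T" and R_ex: "M : T ==> EX i j. rep_iso Q M (R i j)"
  and R_iso: "rep_iso Q (R i j) (R i' j') \<longleftrightarrow> i mod int p = i' mod int p & j = j'"
  and R_translate: "ar_translate Q (R i j) (R (i - 1) j)"
begin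

lemma flip_tube: "cyclic_tube Q n (%q. w (- q)) (%q. e (- q - 1)) (%q. ~ cw (- q - 1)) T p R"
 using cyclic_tube_axioms unfolding cyclic_tube_def by (blast intro: flip)

lemma T_indecomposable: "X : T ==> indecomposable Q X"
 using regular unfolding regular_component_def by (metis ar_component_indecomposable)

lemma T_rep: "X : T ==> is_rep Q X"
 using T_indecomposable indecomposable_rep by blast

lemma T_component: "X : T ==> ar_component Q X = T"
 using regular unfolding regular_component_def by (metis ar_component_cong)

lemma T_iso: "X : T ==> indecomposable Q Y ==> rep_iso Q X Y ==> Y : T"
 using ar_component_iso[OF ar_component_self[of X Q] T_indecomposable] T_component by metis

lemma T_no_compat: "X : T ==> no_compat X k"
 using regular_no_compat[OF T_indecomposable] regular T_component by metis

lemma R_sequence: "EX B f g. almost_split Q (R (i - 1) j) B (R i j) f g"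
 using R_translate[of i j] unfolding ar_translate_def almost_split_def by blast

lemma R_connection: "EX h. connection Q (R (i - 1) j) (R i j) h"
 using R_sequence[of i j] almost_split.connection_exists by blast

lemma T_no_dcompat: assumes "X : T" shows "no_dcompat X k"
proof -
 have R: "no_dcompat (R i j) (2 * m)" for i j m
 proof (induction m arbitrary: i)
  case 0 show ?case using no_dcompat_0 by simp
 next
  case (Suc m)
  obtain h where "connection Q (R (i - 1) j) (R i j) h" using R_connection by blast
  from no_dcompat_step[OF T_rep[OF R_mem] T_rep[OF R_mem] this Suc] show ?case by simp
 qed
 obtain i j where "rep_iso Q X (R i j)" using R_ex[OF assms] by blast
 hence "no_dcompat X (2 * k)" using no_dcompat_iso[OF T_rep[OF assms] T_rep[OF R_mem]] R by blast
 thus ?thesis by (rule no_dcompat_mono) simp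
qed

text \<open>Take a nonzero map from \<open>S\<close> to a member of least dimension. Unless it splits, it lifts along the
 almost split sequence that ends there.\<close>

theorem tube_member:
 assumes S: "indecomposable Q S" and L0: "L0 : T" and F0: "rep_hom Q S L0 F0" "EX v. EX x:spc S v. F0 v x ~= 0"
  and kill: "!!X L g F. X : T ==> L : T ==> rep_hom Q X L g ==> rep_surj X L g ==> ~ rep_inj X g ==> rep_hom Q S X F ==>
   ALL v. ALL x:spc S v. g v (F v x) = 0"
 shows "S : T"
proof -
 have Sr: "is_rep Q S" using S by (rule indecomposable_rep)
 let ?P = "%L. L : T & (EX F. rep_hom Q S L F & (EX v. EX x:spc S v. F v x ~= 0))"
 define L where "L = (ARG_MIN tdim L. ?P L)"
 have P0: "?P L0" using L0 F0 by blast
 have PL: "?P L" unfolding L_def by (rule arg_min_natI[where P = ?P, OF P0])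
 have Lmin: "tdim L <= tdim X" if "?P X" for X unfolding L_def by (rule arg_min_nat_le[where P = ?P, OF that])
 obtain F where F: "rep_hom Q S L F" "EX v. EX x:spc S v. F v x ~= 0" using PL by blast
 obtain i j where ij: "rep_iso Q L (R i j)" using R_ex PL by blast
 let ?N = "R i j"
 have LT: "L : T" using PL by blast
 note iN = T_indecomposable[OF R_mem[of i j]] and Nr = T_rep[OF R_mem[of i j]]
 obtain tt where tt: "rep_hom Q L ?N tt" "rep_inj L tt" using ij unfolding rep_iso_def by blast
 have dN: "tdim L = tdim ?N" by (rule rep_iso_tdim[OF T_rep[OF LT] Nr ij])
 define ph where "ph v x = tt v (F v x)" for v x
 have ph: "rep_hom Q S ?N ph" unfolding ph_def[abs_def] by (rule rep_hom_comp[OF F(1) tt(1)])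
 obtain v x where vx: "x : spc S v" "F v x ~= 0" using F(2) by blast
 have ne: "ph v x ~= 0"
  using rep_inj_iff[OF T_rep[OF LT] tt(1)] tt(2) hom_mem[OF F(1) vx(1)] vx(2) unfolding ph_def by blast
 obtain B f g where "almost_split Q (R (i - 1) j) B ?N f g" using R_sequence by blast
 then interpret almost_split Q "R (i - 1) j" B ?N f g .
 show ?thesis
 proof (cases "split_epi Q S ?N ph")
  case True
  then obtain s where s: "rep_hom Q ?N S s" "!!v x. x : spc ?N v ==> ph v (s v x) = x" unfolding split_epi_iff by blast
  have "spc ?N ~= zero_fam" using iN by (simp add: indecomposable_def)
  from retract_of_indecomposable(1,2)[OF Nr S s(1) ph s(2) this] have "rep_iso Q ?N S"
   unfolding rep_iso_def using s(1) by blast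
  thus ?thesis by (rule T_iso[OF R_mem S])
 next
  case False
  obtain k where k: "rep_hom Q S B k" "ALL v. ALL x:spc S v. g v (k v x) = ph v x"
   using lift[OF Sr ph False] by blast
  have "EX v. EX x:spc S v. g v (k v x) ~= 0" using k(2) vx(1) ne by auto
  from middle_summand[OF T_indecomposable[OF R_mem] iN k(1) g this] obtain U pr where
   U: "submodule Q B U" "indecomposable Q (subrep B U)" and pr: "rep_hom Q B (subrep B U) pr"
   and irr: "irreducible_hom Q (subrep B U) ?N g" and ne': "EX v. EX x:spc S v. g v (pr v (k v x)) ~= 0"
   by blast
  let ?X = "subrep B U"
  have gX: "rep_hom Q ?X ?N g" using irr by (simp add: irreducible_hom_def)
  have Xr: "is_rep Q ?X" using U(2) by (rule indecomposable_rep)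
  have FX: "rep_hom Q S ?X (%v x. pr v (k v x))" by (rule rep_hom_comp[OF k(1) pr])
  have XT: "?X : T"
  proof -
   have "(?N, ?X) : ar_rel Q" using ar_arrowI[OF U(2) iN irr] U(2) iN by (simp add: ar_rel_def)
   from ar_component_step[OF ar_component_self this] show ?thesis using T_component[OF R_mem] by simp
  qed
  have "EX v. EX x:spc S v. pr v (k v x) ~= 0"
  proof -
   obtain v x where "x : spc S v" "g v (pr v (k v x)) ~= 0" using ne' by blast
   thus ?thesis using hom_0[OF Xr gX, of v] by metis
  qed
  hence "tdim L <= tdim ?X" using XT FX by (intro Lmin) blast
  \<comment> \<open>\<open>?X\<close> is not smaller than \<open>?N\<close> by minimality, so an
    injective \<open>g\<close> would be bijective, which an irreducible map is not.\<close>
  hence "~ rep_inj ?X g" using rep_surj_of_tdim[OF Xr Nr gX] irreducible_not_bij[OF Xr irr] dN by auto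
  moreover have "rep_inj ?X g | rep_surj ?X ?N g" by (rule irreducible_inj_or_surj[OF Xr Nr irr])
  ultimately have "ALL v. ALL x:spc S v. g v (pr v (k v x)) = 0" using kill[OF XT R_mem gX _ _ FX] by blast
  thus ?thesis using ne' by blast
 qed
qed

lemma T_type:
 assumes X: "X : T" and q: "cw q" "x : spc X (w q)" "x ~= 0" "act X (e q) x = 0"
 shows "EX q0 q1 xi. string_basis X q0 q1 xi" "acwbij X" "y : spc X (w q') ==> EX j. sgp X q' j y = 0"
 using string_basis_exists[OF T_indecomposable[OF X] T_no_compat[OF X] q(1,2,4,3)]
  string_acwbij[OF T_rep[OF X] T_no_compat[OF X]] string_nilpotent[OF T_rep[OF X] T_no_compat[OF X]] by blast+

end

section \<open>Vectors killed by clockwise arrows, and the order of the clockwise positions\<close>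

context cyclic_quiver
begin

text \<open>Take the last nonzero vector in the orbit of \<open>x\<close> under transport. The next
  edge is clockwise, because transport across an anticlockwise edge inverts an arrow and kills
  nothing.\<close>

lemma nil_killed:
 assumes X: "acwbij X" and ex: "EX j. sgp X q j x = 0" and xm: "x : spc X (w q)" and x: "x ~= 0"
 shows "EX j. cw (q + int j) & sgp X q j x ~= 0 & act X (e (q + int j)) (sgp X q j x) = 0 & sg X (q + int j) (sgp X q j x) = 0"
proof -
 define m where "m = (LEAST j. sgp X q j x = 0)"
 have m: "sgp X q m x = 0" unfolding m_def by (rule LeastI_ex[OF ex])
 have "m ~= 0" using m x by (metis sgp.simps(1))
 then obtain j where j: "m = Suc j" by (cases m) auto
 have ne: "sgp X q j x ~= 0" using not_less_Least[of j "%j. sgp X q j x = 0"] j unfolding m_def by simp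
 have z: "sg X (q + int j) (sgp X q j x) = 0" using m unfolding j by simp
 have s: "step X (q + int j) (sgp X q j x) 0" using sg_step[OF X sgp_mem[OF X xm, of j]] z by simp
 have "cw (q + int j)"
 proof (rule ccontr)
  assume "~ cw (q + int j)"
  thus False using s ne rep_act_0[OF acwbij_rep[OF X]] by (simp add: step_def)
 qed
 thus ?thesis using ne z s by (auto simp: step_def)
qed

lemma acwbij_iso:
 assumes X: "acwbij X" and Y: "is_rep Q Y" and f: "rep_hom Q X Y f" "rep_inj X f" "rep_surj X Y f"
 shows "acwbij Y"
 unfolding acwbij_def
proof (intro conjI allI impI)
 show "is_rep Q Y" by (rule Y)
 fix q assume q: "~ cw q"
 have bf: "bij_betw (f v) (spc X v) (spc Y v)" for v using f(2,3) by (simp add: bij_betw_def rep_inj_def rep_surj_def)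
 have "bij_betw (act X (e q)) (spc X (w (q + 1))) (spc X (w q))" using X q by (simp add: acwbij_def)
 hence "bij_betw (f (w q) \<circ> act X (e q)) (spc X (w (q + 1))) (spc Y (w q))" by (rule bij_betw_trans[OF _ bf])
 hence "bij_betw (act Y (e q) \<circ> f (w (q + 1))) (spc X (w (q + 1))) (spc Y (w q))"
  by (rule bij_betw_cong[THEN iffD1, rotated]) (use hom_commute[OF f(1), of _ "e q"] q in \<open>simp add: src_e tgt_e\<close>)
 thus "bij_betw (act Y (e q)) (spc Y (w (q + 1))) (spc Y (w q))" using bij_betw_comp_iff[OF bf] by blast
qed

lemma blk_transfer:
 assumes X: "blk k X" and Y: "is_rep Q Y" and iso: "rep_iso Q X Y" shows "blk k Y"
proof -
 obtain f where f: "rep_hom Q X Y f" "rep_inj X f" "rep_surj X Y f" using iso unfolding rep_iso_def by blast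
 have "act Y (e q) y = 0" if q: "cw q" and y: "y : spc Y (w q)" for q y
 proof -
  obtain x where x: "x : spc X (w q)" "y = f (w q) x" using rep_surjD[OF f(3) y] by blast
  thus ?thesis using hom_commute[OF f(1), of x "e q"] blk_act[OF X q x(1)] q hom_0[OF blk_rep[OF X] f(1)]
   by (simp add: src_e tgt_e)
 qed
 moreover have "cv.dim (spc Y v) = cv.dim (spc X v)" for v
  using fd_image_inj[OF rep_fd[OF blk_rep[OF X]] hom_linear[OF f(1)], of v] f(2,3) by (simp add: rep_inj_def rep_surj_def)
 ultimately show ?thesis using acwbij_iso[OF blk_acwbij[OF X] Y f] blk_cw[OF X] blk_dim[OF X] by (simp add: blk_def)
qed

lemma blk_cong: "w k = w k' ==> blk k X ==> blk k' X"
proof -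
 assume a: "w k = w k'" "blk k X"
 have "cw k'" using blk_cw[OF a(2)] cw_cong[of k k'] a(1) by (simp add: w_eq)
 thus ?thesis using a(2) unfolding blk_def a(1) by blast
qed

text \<open>The clockwise positions from \<open>k\<close> to the left, in order; iterating the
  inverse translation on a block visits them one by one.\<close>

fun prev_cw :: "int => nat => int" where
 "prev_cw k 0 = k"
| "prev_cw k (Suc a) = prev_cw k a - 1 - int (LEAST m. cw (prev_cw k a - 1 - int m))"

lemma cw_prev: "cw k ==> cw (prev_cw k a)"
proof (induction a)
 case (Suc a)
 have "cw (prev_cw k a - 1 - int (n - 1))"
  using Suc cw_shift[of "prev_cw k a" "- 1"] n2 by (simp add: of_nat_diff algebra_simps)
 hence "cw (prev_cw k a - 1 - int (LEAST m. cw (prev_cw k a - 1 - int m)))" by (rule LeastI)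
 thus ?case by simp
qed simp

lemma prev_cw_le: "prev_cw k a <= k - int a"
 by (induction a) auto

lemma prev_cw_all:
 assumes q: "cw q" "q <= k" shows "EX a. prev_cw k a = q"
proof -
 have "prev_cw k a > q | (EX b<=a. prev_cw k b = q)" for a
 proof (induction a)
  case 0 thus ?case using q by force
 next
  case (Suc a)
  show ?case
  proof (cases "EX b<=a. prev_cw k b = q")
   case True
   then obtain b where b: "b <= a" "prev_cw k b = q" by blast
   hence "b <= Suc a" by simp
   thus ?thesis using b(2) by blast
  next
   case False
   hence gt: "prev_cw k a > q" using Suc by blast
   let ?m = "nat (prev_cw k a - 1 - q)"
   have "prev_cw k a - 1 - int ?m = q" using gt by simp
   hence "cw (prev_cw k a - 1 - int ?m)" using q(1) by simp
   hence "(LEAST m. cw (prev_cw k a - 1 - int m)) <= ?m" by (rule Least_le)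
   hence "prev_cw k (Suc a) >= q" using gt by simp
   thus ?thesis by (metis le_less order_refl)
  qed
 qed
 from this[of "nat (k - q) + 1"] prev_cw_le[of k "nat (k - q) + 1"] q(2) show ?thesis by auto
qed

end

section \<open>Blocks and quasi-simple modules in a tube of strings\<close>

context cyclic_tube
begin

text \<open>The generator of the block goes to a killed vector of \<open>X\<close>. If
  \<open>g\<close> did not annihilate it, \<open>X\<close> and \<open>L\<close> would be strings;
  the kernel of \<open>g\<close> is stable under transport and so contains a killed vector. In a
  string all killed vectors are proportional, so \<open>g\<close> does annihilate it.\<close>

theorem blk_in_tube:
 assumes S: "blk k S" and L0: "L0 : T" and F0: "rep_hom Q S L0 F0" "EX v. EX x:spc S v. F0 v x ~= 0"
 shows "S : T"
proof (rule tube_member[OF blk_indecomposable[OF S] L0 F0])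
 fix X L g F
 assume X: "X : T" and L: "L : T" and g: "rep_hom Q X L g" "rep_surj X L g" "~ rep_inj X g" and F: "rep_hom Q S X F"
 have k: "cw k" by (rule blk_cw[OF S])
 obtain x where x: "x : spc S (w k)" "x ~= 0" using blk_element[OF S] by blast
 have gF: "rep_hom Q S L (%v x. g v (F v x))" by (rule rep_hom_comp[OF F g(1)])
 have "g (w k) (F (w k) x) = 0"
 proof (rule ccontr)
  assume ne: "g (w k) (F (w k) x) ~= 0"
  let ?u = "F (w k) x"
  have u: "?u : spc X (w k)" "?u ~= 0" using hom_mem[OF F x(1)] ne hom_0[OF T_rep[OF X] g(1)] by metis+
  have a: "act X (e k) ?u = 0"
   using hom_commute[OF F, of x "e k"] blk_act[OF S k x(1)] x(1) k hom_0[OF blk_rep[OF S] F] by (simp add: src_e tgt_e)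
  have a': "act L (e k) (g (w k) ?u) = 0"
   using hom_commute[OF g(1), of ?u "e k"] a u(1) k hom_0[OF T_rep[OF X] g(1)] by (simp add: src_e tgt_e)
  note tX = T_type[OF X k u a] and tL = T_type[OF L k hom_mem[OF g(1) u(1)] ne a']
  obtain z v where z: "z : spc X v" "z ~= 0" "g v z = 0" using g(3) rep_inj_iff[OF T_rep[OF X] g(1)] by blast
  obtain q where q: "v = w q" using w_surj by blast
  have zq: "z : spc X (w q)" using z(1) q by simp
  obtain j where j: "cw (q + int j)" "sgp X q j z ~= 0" "act X (e (q + int j)) (sgp X q j z) = 0"
   using nil_killed[OF tX(2) tX(3)[OF zq] zq z(2)] by blast
  have zm: "sgp X q j z : spc X (w (q + int j))" by (rule sgp_mem[OF tX(2) zq])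
  have gz: "g (w (q + int j)) (sgp X q j z) = 0"
   using hom_sgp[OF tX(2) tL(2) g(1) zq, of j] z q sgp_0[OF tL(2)] by simp
  obtain q0 q1 xi where sb: "string_basis X q0 q1 xi" using tX(1) by blast
  note ker = string_kernel[OF T_rep[OF X] T_no_compat[OF X] sb]
  obtain c where c: "w (q + int j) = w q1" "sgp X q j z = cscale c (xi q1)" using ker[OF zm j(1,3,2)] by blast
  obtain c' where c': "w k = w q1" "?u = cscale c' (xi q1)" using ker[OF u(1) k a u(2)] by blast
  have c0: "c ~= 0" using c(2) j(2) by auto
  have "?u = cscale (c' / c) (sgp X q j z)" using c(2) c'(2) c0 by simp
  hence "g (w k) ?u = cscale (c' / c) (g (w k) (sgp X q j z))"
   using hom_scale[OF g(1), of "sgp X q j z" "w k"] zm c(1) c'(1) by simp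
  thus False using ne gz c(1) c'(1) by simp
 qed
 hence "ALL y:spc S (w q). g (w q) (F (w q) y) = 0" for q
  using blk_hom_zero[OF S T_rep[OF L] gF x] by blast
 thus "ALL v. ALL x:spc S v. g v (F v x) = 0" using w_surj by metis
qed

lemma blk_orbit:
 assumes "blk k (R i j)" shows "blk (prev_cw k a) (R (i + int a) j)"
proof (induction a)
 case 0 show ?case using assms by simp
next
 case (Suc a)
 obtain h where h: "connection Q (R (i + int a) j) (R (i + int (Suc a)) j) h"
  using R_connection[of "i + int (Suc a)" j] by (auto simp: algebra_simps)
 have cwk: "cw k" by (rule blk_cw[OF assms])
 show ?case
  unfolding prev_cw.simps
 proof (rule blk_translate[OF Suc T_indecomposable[OF R_mem] T_no_compat[OF R_mem] h])
  show "cw (prev_cw k a - 1 - int (LEAST m. cw (prev_cw k a - 1 - int m)))" using cw_prev[OF cwk, of "Suc a"] by simp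
  show "~ cw (prev_cw k a - 1 - int i)" if "i < (LEAST m. cw (prev_cw k a - 1 - int m))" for i
   using not_less_Least[OF that] .
 qed
qed

text \<open>Under the inverse translation a block passes to the next clockwise position on the left.
  Hence all blocks occur, and two of the modules are isomorphic exactly when their positions lie
  over the same vertex; the period is the rank.\<close>

theorem blk_tube:
 assumes S: "blk k S" "S : T"
 shows "blk k' X ==> X : T" "p = card (w ` {q. cw q})"
proof -
 obtain i j where ij: "rep_iso Q S (R i j)" using R_ex[OF S(2)] by blast
 have b0: "blk k (R i j)" by (rule blk_transfer[OF S(1) T_rep[OF R_mem] ij])
 note b = blk_orbit[OF b0]
 have k: "cw k" by (rule blk_cw[OF S(1)])
 have ex: "EX a. w (prev_cw k a) = w q" if q: "cw q" for q
 proof -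
  \<comment> \<open>Any multiple of \<open>n\<close> that moves \<open>q\<close> to the left of
    \<open>k\<close> would serve.\<close>
  let ?t = "\<bar>q - k\<bar>"
  have n1: "int n >= 1" using n2 by simp
  have "?t <= int n * ?t" using n1 mult_right_mono[of 1 "int n" ?t] by simp
  hence "q + int n * (- ?t) <= k" by simp
  moreover have "cw (q + int n * (- ?t))" using q cw_shift[of q "- ?t"] by blast
  ultimately obtain a where a: "prev_cw k a = q + int n * (- ?t)" using prev_cw_all by blast
  have "w (q + int n * (- ?t)) = w q" unfolding w_eq by (rule mod_mult_self2)
  thus ?thesis unfolding a[symmetric] by blast
 qed
 show "X : T" if X: "blk k' X"
 proof -
  obtain a where "w (prev_cw k a) = w k'" using ex[OF blk_cw[OF X]] by blast
  hence "blk k' (R (i + int a) j)" using blk_cong b by blast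
  thus ?thesis using T_iso[OF R_mem blk_indecomposable[OF X]] blk_iso X by blast
 qed
 have same: "w (prev_cw k a) = w (prev_cw k a') \<longleftrightarrow> a mod p = a' mod p" for a a'
 proof -
  have "w (prev_cw k a) = w (prev_cw k a') \<longleftrightarrow> rep_iso Q (R (i + int a) j) (R (i + int a') j)"
  proof
   assume "w (prev_cw k a) = w (prev_cw k a')"
   thus "rep_iso Q (R (i + int a) j) (R (i + int a') j)" using blk_iso[OF blk_cong b] b by blast
  next
   assume "rep_iso Q (R (i + int a) j) (R (i + int a') j)"
   hence "blk (prev_cw k a) (R (i + int a') j)" by (rule blk_transfer[OF b T_rep[OF R_mem]])
   from blk_dim[OF this cw_prev[OF k, of a]] blk_dim[OF b[of a'] cw_prev[OF k, of a]]
   show "w (prev_cw k a) = w (prev_cw k a')" by (cases "w (prev_cw k a) = w (prev_cw k a')") simp_all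
  qed
  also have "... \<longleftrightarrow> int a mod int p = int a' mod int p"
   unfolding R_iso by (simp add: mod_eq_dvd_iff)
  also have "... \<longleftrightarrow> a mod p = a' mod p" by (metis of_nat_eq_iff of_nat_mod)
  finally show ?thesis .
 qed
 have "bij_betw (%a. w (prev_cw k a)) {..<p} (w ` {q. cw q})"
  unfolding bij_betw_def
 proof
  show "inj_on (%a. w (prev_cw k a)) {..<p}" by (rule inj_onI) (simp add: same)
  show "(%a. w (prev_cw k a)) ` {..<p} = w ` {q. cw q}"
  proof
   show "(%a. w (prev_cw k a)) ` {..<p} <= w ` {q. cw q}" using cw_prev[OF k] by blast
   show "w ` {q. cw q} <= (%a. w (prev_cw k a)) ` {..<p}"
   proof
    fix v assume "v : w ` {q. cw q}"
    then obtain a where "v = w (prev_cw k a)" using ex by (metis (mono_tags, lifting) imageE mem_Collect_eq)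
    hence "v = w (prev_cw k (a mod p))" using same[of a "a mod p"] by simp
    thus "v : (%a. w (prev_cw k a)) ` {..<p}" using p_pos by (intro image_eqI[of _ _ "a mod p"]) simp_all
   qed
  qed
 qed
 thus "p = card (w ` {q. cw q})" using bij_betw_same_card by fastforce
qed

text \<open>A submodule that belongs to the tube is indecomposable, so its only nonzero direct
  summand is itself and it is a regular submodule.\<close>

lemma quasi_simple_tube_sub:
 assumes X: "quasi_simple Q X" and U: "submodule Q X U" "subrep X U : T" shows "U = spc X"
proof -
 let ?Y = "subrep X U"
 have ind: "indecomposable Q ?Y" by (rule T_indecomposable[OF U(2)])
 have "regular_module Q ?Y"
  unfolding regular_module_def
 proof (intro conjI allI impI)
  show "is_rep Q ?Y" by (rule T_rep[OF U(2)])
  fix V assume "direct_summand Q ?Y V & indecomposable Q (subrep ?Y V)"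
  hence V: "direct_summand Q ?Y V" "indecomposable Q (subrep ?Y V)" by blast+
  then obtain W where W: "submodule Q ?Y V" "submodule Q ?Y W" "complementary ?Y V W" unfolding direct_summand_def by blast
  have "V ~= zero_fam" using V(2) by (auto simp: indecomposable_def)
  hence W0: "W = zero_fam" using indecomposable_complementary[OF ind W] by blast
  have "V v = spc ?Y v" for v
  proof
   show "V v <= spc ?Y v" by (rule submodule_subset[OF W(1)])
   show "spc ?Y v <= V v" using complementary_split[OF W(3)] W0 by (fastforce simp: zero_fam_def)
  qed
  hence "V = spc ?Y" by (simp add: fun_eq_iff)
  thus "regular_component Q (ar_component Q (subrep ?Y V))" using T_component[OF U(2)] regular by simp
 qed
 hence "regular_submodule Q X U" using U(1) by (simp add: regular_submodule_def)
 hence "U = zero_fam | U = spc X" using X by (simp add: quasi_simple_def)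
 moreover have "U ~= zero_fam" using ind by (auto simp: indecomposable_def)
 ultimately show ?thesis by blast
qed

lemma quasi_simple_blk:
 assumes E: "quasi_simple Q E" and b: "acwbij E" and q: "cw q" "x : spc E (w q)" "x ~= 0" "act E (e q) x = 0"
  and T: "!!X F. blk q X ==> rep_hom Q X E F ==> rep_inj X F ==> X : T"
 shows "blk q E"
proof -
 have Er: "is_rep Q E" by (rule acwbij_rep[OF b])
 let ?U = "zspan E q x"
 have U: "submodule Q E ?U" by (rule zspan_submodule[OF Er q(2,4)])
 have bU: "blk q (subrep E ?U)" using b by (intro zspan_blk[OF Er _ q(1,2,4,3)]) (simp add: acwbij_def bij_betw_def)
 have "subrep E ?U : T" by (rule T[OF bU rep_hom_incl[OF U]]) (simp add: rep_inj_def)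
 hence "?U = spc E" by (rule quasi_simple_tube_sub[OF E U])
 thus ?thesis using bU by simp
qed

lemma tube_quasi_simple_blk:
 assumes E: "quasi_simple Q E" "E : T" and q: "cw q" "x : spc E (w q)" "x ~= 0" "act E (e q) x = 0"
 shows "blk q E"
proof (rule quasi_simple_blk[OF E(1) T_type(2)[OF E(2) q] q])
 fix X F assume X: "blk q X" "rep_hom Q X E F" "rep_inj X F"
 obtain y where y: "y : spc X (w q)" "y ~= 0" using blk_element[OF X(1)] by blast
 hence "F (w q) y ~= 0" using X(3) rep_inj_iff[OF blk_rep[OF X(1)] X(2)] by blast
 thus "X : T" using blk_in_tube[OF X(1) E(2) X(2)] y(1) by blast
qed

end

section \<open>Eigenvectors\<close>

definition peval :: "(cvec => cvec) => complex poly => cvec => cvec" where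
 "peval f p x = (SUM i<=degree p. cscale (coeff p i) ((f ^^ i) x))"

lemma peval_bound: "degree p <= n ==> peval f p x = (SUM i<=n. cscale (coeff p i) ((f ^^ i) x))"
 unfolding peval_def by (rule sum.mono_neutral_left) (auto simp: coeff_eq_0)

lemma peval_linear_factor:
 assumes f: "linear_from_to V V f" and V: "cv.subspace V" and x: "x : V"
 shows "peval f ([:- mu, 1:] * p) x = f (peval f p x) - cscale mu (peval f p x)"
proof -
 have m: "(f ^^ i) x : V" for i using lft_mem[OF lft_funpow[OF f] x] .
 let ?n = "Suc (degree p)"
 have e: "[:- mu, 1:] * p = smult (- mu) p + pCons 0 p" by simp
 have "degree ([:- mu, 1:] * p) <= ?n" using degree_mult_le[of "[:- mu, 1:]" p] by simp
 hence "peval f ([:- mu, 1:] * p) x = (SUM i<=?n. cscale (- mu * coeff p i) ((f ^^ i) x) + cscale (coeff (pCons 0 p) i) ((f ^^ i) x))"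
  unfolding e by (simp only: peval_bound coeff_add coeff_smult cv.scale_left_distrib)
 also have "... = (SUM i<=?n. cscale (- mu * coeff p i) ((f ^^ i) x)) + (SUM i<=?n. cscale (coeff (pCons 0 p) i) ((f ^^ i) x))"
  by (rule sum.distrib)
 also have "(SUM i<=?n. cscale (- mu * coeff p i) ((f ^^ i) x)) = cscale (- mu) (peval f p x)"
  unfolding peval_bound[of p ?n f x, OF le_SucI[OF order_refl]] by (simp only: cv.scale_sum_right cv.scale_scale)
 also have "(SUM i<=?n. cscale (coeff (pCons 0 p) i) ((f ^^ i) x)) = (SUM i<=degree p. cscale (coeff p i) (f ((f ^^ i) x)))"
  unfolding sum.atMost_Suc_shift by simp
 also have "... = (SUM i<=degree p. f (cscale (coeff p i) ((f ^^ i) x)))" using lft_scale[OF f m] by simp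
 also have "... = f (peval f p x)"
  unfolding peval_def by (rule lft_sum[OF f V, symmetric]) (simp add: cv.subspace_scale[OF V] m)
 finally have e': "peval f ([:- mu, 1:] * p) x = cscale (- mu) (peval f p x) + f (peval f p x)" .
 show ?thesis unfolding e' cv.scale_minus_left by (rule uminus_add_conv_diff)
qed

text \<open>Let \<open>p\<close> be a polynomial of least degree that annihilates \<open>x\<close>,
  and \<open>mu\<close> a root of it. The cofactor of the linear factor does not annihilate
  \<open>x\<close>; applied to \<open>x\<close> it gives an eigenvector.\<close>

theorem eigenvector_exists:
 assumes fd: "fd_space V" and f: "linear_from_to V V f" and ne: "V ~= {0}"
 shows "EX mu. EX x:V. x ~= 0 & f x = cscale mu x"
proof -
 have V: "cv.subspace V" by (rule fd_subspace[OF fd])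
 obtain x where x: "x : V" "x ~= 0" using ne cv.subspace_0[OF V] by blast
 have m: "(f ^^ i) x : V" for i using lft_mem[OF lft_funpow[OF f] x(1)] .
 let ?d = "cv.dim V"
 have "EX c. (SUM i:{..?d}. cscale (c i) ((f ^^ i) x)) = 0 & ~ (ALL i:{..?d}. c i = 0)"
 proof (rule ccontr)
  assume "~ ?thesis"
  hence "cv.dim (cv.span ((%i. (f ^^ i) x) ` {..?d})) = card {..?d}" by (intro dim_span_family) auto
  moreover have "cv.span ((%i. (f ^^ i) x) ` {..?d}) <= V" by (rule cv.span_minimal[OF _ V]) (use m in blast)
  ultimately show False using fd_sub(2)[OF fd cv.subspace_span] by fastforce
 qed
 then obtain c where c: "(SUM i<=?d. cscale (c i) ((f ^^ i) x)) = 0" "EX i<=?d. c i ~= 0" by auto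
 define p0 where "p0 = Abs_poly (%i. if i <= ?d then c i else 0)"
 have "coeff p0 = (%i. if i <= ?d then c i else 0)"
  unfolding p0_def by (rule coeff_Abs_poly[of ?d]) simp
 hence cp: "coeff p0 i = (if i <= ?d then c i else 0)" for i by simp
 have "degree p0 <= ?d" by (rule degree_le) (simp add: cp)
 hence "peval f p0 x = 0" using c(1) by (simp add: peval_bound cp)
 moreover have "p0 ~= 0" using c(2) cp by (metis coeff_0)
 ultimately have P0: "p0 ~= 0 & peval f p0 x = 0" by blast
 let ?P = "%p. p ~= 0 & peval f p x = 0"
 define p where "p = (ARG_MIN degree p. ?P p)"
 have p: "?P p" unfolding p_def by (rule arg_min_natI[where P = ?P, OF P0])
 have pmin: "degree p <= degree r" if "?P r" for r unfolding p_def by (rule arg_min_nat_le[where P = ?P, OF that])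
 have "degree p ~= 0"
 proof
  assume d0: "degree p = 0"
  hence "cscale (coeff p 0) x = 0" using p by (simp add: peval_def)
  hence "coeff p 0 = 0" using x(2) by simp
  thus False using p d0 by (metis leading_coeff_0_iff)
 qed
 then obtain mu where "poly p mu = 0"
  using fundamental_theorem_of_algebra[of p] by (metis constant_degree)
 then obtain r where r: "p = [:- mu, 1:] * r" using poly_eq_0_iff_dvd by (metis dvdE)
 have r0: "r ~= 0" using p r by auto
 have "degree p = Suc (degree r)" unfolding r using r0 by (subst degree_mult_eq) auto
 hence "peval f r x ~= 0" using pmin[of r] r0 by auto
 moreover have "peval f r x : V" unfolding peval_def
  by (intro cv.subspace_sum[OF V] cv.subspace_scale[OF V] m)
 moreover have "f (peval f r x) = cscale mu (peval f r x)" using peval_linear_factor[OF f V x(1), of mu r] p r by simp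
 ultimately show ?thesis by blast
qed

context cyclic_quiver
begin

section \<open>Representations with bijective arrows\<close>

definition allbij :: "('v, 'a) quiver_rep => bool" where
 "allbij M \<longleftrightarrow> is_rep Q M & (ALL a. bij_betw (act M a) (spc M (src Q a)) (spc M (tgt Q a)))"

lemma allbij_rep: "allbij M ==> is_rep Q M"
 by (simp add: allbij_def)

lemma allbij_step:
 assumes M: "allbij M"
 shows "x : spc M (w q) ==> EX! y. y : spc M (w (q + 1)) & step M q x y"
  and "y : spc M (w (q + 1)) ==> EX! x. x : spc M (w q) & step M q x y"
proof -
 have b: "bij_betw (act M (e q)) (spc M (if cw q then w q else w (q + 1))) (spc M (if cw q then w (q + 1) else w q))"
  using M by (simp add: allbij_def src_e[symmetric] tgt_e[symmetric])
 have inj: "x = y" if "act M (e q) x = act M (e q) y" "x : spc M (if cw q then w q else w (q + 1))"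
  "y : spc M (if cw q then w q else w (q + 1))" for x y
  using bij_betw_imp_inj_on[OF b] that by (meson inj_onD)
 have mem: "act M (e q) x : spc M (if cw q then w (q + 1) else w q)" if "x : spc M (if cw q then w q else w (q + 1))" for x
  using bij_betwE[OF b] that by blast
 have sur: "EX x. x : spc M (if cw q then w q else w (q + 1)) & act M (e q) x = y" if "y : spc M (if cw q then w (q + 1) else w q)" for y
  using bij_betw_imp_surj_on[OF b] that by (metis imageE)
 show "EX! y. y : spc M (w (q + 1)) & step M q x y" if x: "x : spc M (w q)"
 proof (cases "cw q")
  case True thus ?thesis using mem[of x] x by (auto simp: step_def)
 next
  case False
  obtain y where "y : spc M (w (q + 1))" "act M (e q) y = x" using sur[of x] x False by auto
  thus ?thesis using inj False by (auto simp: step_def)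
 qed
 show "EX! x. x : spc M (w q) & step M q x y" if y: "y : spc M (w (q + 1))"
 proof (cases "cw q")
  case False thus ?thesis using mem[of y] y by (auto simp: step_def)
 next
  case True
  obtain x where "x : spc M (w q)" "act M (e q) x = y" using sur[of y] y True by auto
  thus ?thesis using inj True by (auto simp: step_def)
 qed
qed

lemma compat_stepD: "compat M xi ==> step M q (xi q) (xi (q + 1))"
 by (simp add: compat_def)

lemma compat_exists:
 assumes M: "allbij M" and x: "x : spc M (w q)" shows "EX xi. compat M xi & xi q = x"
proof -
 define rt where "rt = rec_nat x (%j y. SOME z. z : spc M (w (q + int j + 1)) & step M (q + int j) y z)"
 have rt0: "rt 0 = x" and rtS: "rt (Suc j) = (SOME z. z : spc M (w (q + int j + 1)) & step M (q + int j) (rt j) z)" for j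
  by (simp_all add: rt_def)
 have rtm: "rt j : spc M (w (q + int j)) & (rt (Suc j) : spc M (w (q + int j + 1)) & step M (q + int j) (rt j) (rt (Suc j)))" for j
 proof (induction j)
  case 0
  have "EX z. z : spc M (w (q + 0 + 1)) & step M (q + 0) x z" using allbij_step(1)[OF M x] by auto
  from someI_ex[OF this] show ?case using x unfolding rtS[of 0] rt0 by simp
 next
  case (Suc j)
  have e1: "q + int j + 1 = q + int (Suc j)" by simp
  have m: "rt (Suc j) : spc M (w (q + int (Suc j)))" using Suc unfolding e1 by blast
  have "EX z. z : spc M (w (q + int (Suc j) + 1)) & step M (q + int (Suc j)) (rt (Suc j)) z" using allbij_step(1)[OF M m] by blast
  from someI_ex[OF this] show ?case using m unfolding rtS[of "Suc j"] by blast
 qed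
 define lf where "lf = rec_nat x (%j y. SOME z. z : spc M (w (q - 1 - int j)) & step M (q - 1 - int j) z y)"
 have lf0: "lf 0 = x" and lfS: "lf (Suc j) = (SOME z. z : spc M (w (q - 1 - int j)) & step M (q - 1 - int j) z (lf j))" for j
  by (simp_all add: lf_def)
 have lfm: "lf j : spc M (w (q - int j)) & (lf (Suc j) : spc M (w (q - 1 - int j)) & step M (q - 1 - int j) (lf (Suc j)) (lf j))" for j
 proof (induction j)
  case 0
  have "EX z. z : spc M (w (q - 1 - int 0)) & step M (q - 1 - int 0) z x" using allbij_step(2)[OF M, of x "q - 1"] x by auto
  from someI_ex[OF this] show ?case using x unfolding lfS[of 0] lf0 by simp
 next
  case (Suc j)
  have e1: "q - 1 - int j = q - int (Suc j)" and e2: "q - 1 - int (Suc j) + 1 = q - int (Suc j)" by simp_all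
  have m: "lf (Suc j) : spc M (w (q - int (Suc j)))" using Suc unfolding e1 by blast
  have "EX z. z : spc M (w (q - 1 - int (Suc j))) & step M (q - 1 - int (Suc j)) z (lf (Suc j))"
   using allbij_step(2)[OF M, of "lf (Suc j)" "q - 1 - int (Suc j)"] m unfolding e2 by blast
  from someI_ex[OF this] show ?case using m unfolding lfS[of "Suc j"] by blast
 qed
 define xi where "xi i = (if i >= q then rt (nat (i - q)) else lf (nat (q - i)))" for i
 have "xi i : spc M (w i) & step M i (xi i) (xi (i + 1))" for i
 proof (cases "i >= q")
  case True
  have i: "q + int (nat (i - q)) = i" "nat (i + 1 - q) = Suc (nat (i - q))" using True by auto
  show ?thesis using rtm[of "nat (i - q)"] True unfolding i by (simp add: xi_def i(2))
 next
  case False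
  let ?j = "nat (q - 1 - i)"
  have i: "q - 1 - int ?j = i" "nat (q - i) = Suc ?j" using False by auto
  have "xi (i + 1) = lf ?j"
  proof (cases "i + 1 = q")
   case True thus ?thesis by (simp add: xi_def rt0 lf0)
  next
   case ne: False
   have "nat (q - (i + 1)) = ?j" by simp
   thus ?thesis using False ne by (simp add: xi_def)
  qed
  thus ?thesis using lfm[of ?j] False unfolding i by (simp add: xi_def i(2))
 qed
 moreover have "xi q = x" by (simp add: xi_def rt0)
 ultimately show ?thesis unfolding compat_def by blast
qed

lemma compat_unique:
 assumes M: "allbij M" and xi: "compat M xi" and ze: "compat M ze" and q: "xi q = ze q" shows "xi i = ze i"
proof -
 have r: "xi (q + int j) = ze (q + int j)" for j
 proof (induction j)
  case (Suc j)
  have "xi (q + int j + 1) = ze (q + int j + 1)"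
   using allbij_step(1)[OF M compat_mem[OF xi, of "q + int j"]] compat_stepD[OF xi, of "q + int j"] compat_stepD[OF ze, of "q + int j"]
    compat_mem[OF xi] compat_mem[OF ze] Suc by metis
  thus ?case by (simp add: algebra_simps)
 qed (simp add: q)
 have l: "xi (q - int j) = ze (q - int j)" for j
 proof (induction j)
  case (Suc j)
  have e: "q - int (Suc j) + 1 = q - int j" by simp
  show ?case
   using allbij_step(2)[OF M compat_mem[OF xi, of "q - int (Suc j) + 1"]] compat_stepD[OF xi, of "q - int (Suc j)"]
    compat_stepD[OF ze, of "q - int (Suc j)"] compat_mem[OF xi] compat_mem[OF ze] Suc unfolding e by metis
 qed (simp add: q)
 show ?thesis using r[of "nat (i - q)"] l[of "nat (q - i)"] by (cases "i >= q") auto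
qed

lemma compat_zero: "is_rep Q M ==> compat M (%i. 0)"
 by (simp add: compat_def step_0 cv.subspace_0[OF rep_subspace])

lemma compat_add:
 "is_rep Q M ==> compat M xi ==> compat M ze ==> compat M (%i. xi i + ze i)"
 by (simp add: compat_def step_add cv.subspace_add[OF rep_subspace])

lemma compat_scale: "is_rep Q M ==> compat M xi ==> compat M (%i. cscale c (xi i))"
 by (simp add: compat_def step_scale cv.subspace_scale[OF rep_subspace])

lemma compat_shift: "compat M xi ==> compat M (%i. xi (i + int n * k))"
proof -
 assume xi: "compat M xi"
 have "w (i + int n * k) = w i" "step M (i + int n * k) = step M i" for i using step_cong[of "i + int n * k" i M] by (simp_all add: w_eq)
 thus ?thesis using compat_mem[OF xi] compat_stepD[OF xi] unfolding compat_def by (metis add.assoc add.commute)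
qed

lemma compat_hom: "compat M xi ==> rep_hom Q M N f ==> compat N (%i. f (w i) (xi i))"
proof -
 assume xi: "compat M xi" and f: "rep_hom Q M N f"
 have "step N i (f (w i) (xi i)) (f (w (i + 1)) (xi (i + 1)))" for i
  using compat_cw[OF xi, of i] compat_acw[OF xi, of i] hom_commute[OF f, of "xi i" "e i"] hom_commute[OF f, of "xi (i + 1)" "e i"]
   compat_mem[OF xi, of i] compat_mem[OF xi, of "i + 1"] by (cases "cw i") (simp_all add: step_def src_e tgt_e)
 thus ?thesis using hom_mem[OF f compat_mem[OF xi]] by (simp add: compat_def)
qed

text \<open>Every vector is an entry of exactly one matched sequence at its position. So a linear
  operation on sequences is a homomorphism on the universal cover, and commuting with the shift by
  the period makes it independent of the position chosen above a vertex.\<close>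

theorem hom_of_sequences:
 assumes L: "allbij L" and N: "is_rep Q N"
  and c: "!!xi. compat L xi ==> compat N (Ps xi)"
  and a: "!!xi ze i. compat L xi ==> compat L ze ==> Ps (%i. xi i + ze i) i = Ps xi i + Ps ze i"
  and s: "!!xi b i. compat L xi ==> Ps (%i. cscale b (xi i)) i = cscale b (Ps xi i)"
  and sh: "!!xi i. compat L xi ==> Ps (%i. xi (i + int n)) i = Ps xi (i + int n)"
 shows "EX f. rep_hom Q L N f & (ALL xi q. compat L xi --> f (w q) (xi q) = Ps xi q)"
proof -
 note Lr = allbij_rep[OF L]
 have shk: "Ps (%i. xi (i + int n * int k)) i = Ps xi (i + int n * int k)" if xi: "compat L xi" for xi i k
 proof (induction k arbitrary: i)
  case (Suc k)
  have "Ps (%i. xi (i + int n * int (Suc k))) i = Ps (%i. xi (i + int n * int k)) (i + int n)"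
   using sh[OF compat_shift[OF xi, of "int k"], of i] by (simp add: algebra_simps)
  also have "... = Ps xi (i + int n * int (Suc k))" unfolding Suc by (simp add: algebra_simps)
  finally show ?case .
 qed simp
 define seq where "seq q x = (SOME xi. compat L xi & xi q = x)" for q x
 have seq: "compat L (seq q x) & seq q x q = x" if "x : spc L (w q)" for q x
  unfolding seq_def by (rule someI_ex[OF compat_exists[OF L that]])
 have seq_eq: "seq q (xi q) = xi" if "compat L xi" for xi q
  using seq[OF compat_mem[OF that, of q]] compat_unique[OF L _ that, of "seq q (xi q)" q] by blast
 define g where "g q x = Ps (seq q x) q" for q x
 have g: "g q (xi q) = Ps xi q" if "compat L xi" for xi q using seq_eq[OF that] by (simp add: g_def)
 have main: "g q x = g (q + int n * int k) x" if x: "x : spc L (w q)" for q k x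
 proof -
  let ?q = "q + int n * int k"
  have "w ?q = w q" unfolding w_eq by (rule mod_mult_self2)
  hence x': "x : spc L (w ?q)" using x by simp
  let ?xi = "seq ?q x"
  have xi: "compat L ?xi" "?xi ?q = x" using seq[OF x'] by blast+
  have "g q ((%i. ?xi (i + int n * int k)) q) = Ps (%i. ?xi (i + int n * int k)) q" by (rule g[OF compat_shift[OF xi(1)]])
  also have "... = Ps ?xi ?q" by (rule shk[OF xi(1)])
  also have "... = g ?q x" by (simp add: g_def)
  finally show ?thesis using xi(2) by simp
 qed
 have gcong: "g q x = g q' x" if wq: "w q = w q'" and x: "x : spc L (w q)" for q q' x
 proof -
  have *: "g q x = g q' x" if wq: "w q = w q'" and x: "x : spc L (w q)" and le: "q <= q'" for q q'
  proof -
   have "int n dvd q' - q" using wq by (metis w_eq mod_eq_dvd_iff)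
   then obtain t where t: "q' - q = int n * t" by (auto simp: dvd_def)
   hence "t >= 0" using le n2 by (metis diff_ge_0_iff_ge of_nat_0_less_iff zero_le_mult_iff less_le_trans zero_less_numeral not_less)
   hence "q' = q + int n * int (nat t)" using t by simp
   thus ?thesis using main[OF x, of "nat t"] by simp
  qed
  show ?thesis
  proof (cases "q <= q'")
   case True thus ?thesis by (rule *[OF wq x])
  next
   case False
   hence le: "q' <= q" by simp
   show ?thesis by (rule *[OF wq[symmetric] x[unfolded wq] le, symmetric])
  qed
 qed
 define f where "f v x = g (SOME q. w q = v) x" for v x
 have fg: "f (w q) x = g q x" if x: "x : spc L (w q)" for q x
 proof -
  have ws: "w (SOME q'. w q' = w q) = w q" by (rule someI_ex) blast
  show ?thesis unfolding f_def using gcong[OF ws] x ws by simp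
 qed
 have f: "f (w q) (xi q) = Ps xi q" if "compat L xi" for xi q using fg[OF compat_mem[OF that]] g[OF that] by simp
 have "rep_hom Q L N f"
 proof (rule rep_homI)
  fix v obtain q where q: "v = w q" using w_surj by blast
  show "linear_from_to (spc L v) (spc N v) (f v)"
  proof (rule linear_from_toI)
   fix x assume x: "x : spc L v"
   let ?xi = "seq q x"
   have xi: "compat L ?xi" "?xi q = x" using seq x q by blast+
   show "f v x : spc N v" using f[OF xi(1), of q] xi(2) compat_mem[OF c[OF xi(1)], of q] q by simp
   show "f v (cscale b x) = cscale b (f v x)" for b
    using f[OF xi(1), of q] f[OF compat_scale[OF Lr xi(1)], of q b] xi(2) s[OF xi(1)] q by simp
   fix y assume y: "y : spc L v"
   have ze: "compat L (seq q y)" "seq q y q = y" using seq y q by blast+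
   show "f v (x + y) = f v x + f v y"
    using f[OF xi(1), of q] f[OF ze(1), of q] f[OF compat_add[OF Lr xi(1) ze(1)], of q] xi(2) ze(2) a[OF xi(1) ze(1)] q by simp
  qed
 next
  fix b x assume x: "x : spc L (src Q b)"
  obtain q where q: "b = e q" using e_surj by blast
  have x': "x : spc L (w (spos q))" using x q src_spos by simp
  let ?xi = "seq (spos q) x"
  have xi: "compat L ?xi" "?xi (spos q) = x" using seq[OF x'] by blast+
  have "act L b x = ?xi (tpos q)" using compat_act[OF xi(1), of q] xi(2) q by simp
  thus "f (tgt Q b) (act L b x) = act N b (f (src Q b) x)"
   using f[OF xi(1), of "tpos q"] f[OF xi(1), of "spos q"] xi(2) compat_act[OF c[OF xi(1)], of q]
   by (simp add: q src_spos tgt_tpos)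
 qed
 thus ?thesis using f by blast
qed

section \<open>The translate of a representation with bijective arrows\<close>

text \<open>Dimensions do not increase from one position to the next, so after a full turn they are
  equal, and the surjective clockwise arrows are injective.\<close>

lemma acwbij_cw_surj:
 assumes N: "acwbij N" and s: "!!q. cw q ==> act N (e q) ` spc N (w q) = spc N (w (q + 1))"
 shows "allbij N"
proof -
 note Nr = acwbij_rep[OF N]
 have cl: "linear_from_to (spc N (w q)) (spc N (w (q + 1))) (act N (e q))" if "cw q" for q
  using rep_act[OF Nr, of "e q"] that by (simp add: src_e tgt_e)
 have al: "linear_from_to (spc N (w (q + 1))) (spc N (w q)) (act N (e q))" if "~ cw q" for q
  using rep_act[OF Nr, of "e q"] that by (simp add: src_e tgt_e)
 have d: "cv.dim (spc N (w (q + 1))) <= cv.dim (spc N (w q))" for q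
 proof (cases "cw q")
  case True thus ?thesis using fd_image(2)[OF rep_fd[OF Nr] cl[OF True]] s[OF True] by simp
 next
  case False
  hence b: "bij_betw (act N (e q)) (spc N (w (q + 1))) (spc N (w q))" using N by (simp add: acwbij_def)
  thus ?thesis
   using fd_image_inj[OF rep_fd[OF Nr] al[OF False]] by (simp add: bij_betw_def)
 qed
 have d': "cv.dim (spc N (w (q + int j))) <= cv.dim (spc N (w q))" for q j
 proof (induction j)
  case (Suc j) thus ?case using d[of "q + int j"] by (simp add: algebra_simps)
 qed simp
 have "inj_on (act N (e q)) (spc N (w q))" if q: "cw q" for q
 proof (rule fd_surj_inj[OF rep_fd[OF Nr] cl[OF q]])
  have "cv.dim (spc N (w q)) = cv.dim (spc N (w (q + 1 + int (n - 1))))"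
   using w_period[of q] n2 by (simp add: algebra_simps of_nat_diff)
  also have "... <= cv.dim (spc N (w (q + 1)))" by (rule d')
  finally show "cv.dim (spc N (w q)) <= cv.dim (act N (e q) ` spc N (w q))" using s[OF q] by simp
 qed
 hence "bij_betw (act N (e q)) (spc N (src Q (e q))) (spc N (tgt Q (e q)))" for q
  using s[of q] N by (cases "cw q") (simp_all add: src_e tgt_e bij_betw_def acwbij_def)
 thus ?thesis using Nr e_surj unfolding allbij_def by metis
qed

lemma lam_additive:
 assumes L: "is_rep Q L" and N: "is_rep Q N" and h: "connection Q L N h" and xi: "compat L xi" "compat L ze"
 shows "lam N h (%i. xi i + ze i) q = lam N h xi q + lam N h ze q"
  "lam N h (%i. cscale b (xi i)) q = cscale b (lam N h xi q)"
proof -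
 have m: "xi (tpos q) : spc L (tgt Q (e q))" "ze (tpos q) : spc L (tgt Q (e q))"
  using compat_mem[OF xi(1)] compat_mem[OF xi(2)] by (simp_all add: tgt_tpos)
 note hl = connection_lin[OF h, of "e q"]
 note hm = lft_mem[OF hl m(1)] lft_mem[OF hl m(2)]
 show "lam N h (%i. xi i + ze i) q = lam N h xi q + lam N h ze q"
  using lft_add[OF hl m] rep_act_add[OF N hm] by (cases "cw q") (simp_all add: lam_def tpos_def)
 show "lam N h (%i. cscale b (xi i)) q = cscale b (lam N h xi q)"
  using lft_scale[OF hl m(1), of b] rep_act_scale[OF N hm(1), of b] by (cases "cw q") (simp_all add: lam_def tpos_def cv.scale_minus_right)
qed

text \<open>\<open>lam\<close> is linear and commutes with the period, so
  \<open>hom_of_sequences\<close> applies. By \<open>lam\<close> and \<open>rho\<close> the image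
  contains all values of \<open>h\<close> up to sign, and these generate \<open>N\<close>.\<close>

theorem translate_hom:
 assumes L: "allbij L" and N: "is_rep Q N" and h: "connection Q L N h"
 shows "EX f. rep_hom Q L N f & rep_surj L N f & (ALL xi q. compat L xi --> f (w q) (xi q) = lam N h xi q)"
proof -
 note Lr = allbij_rep[OF L]
 have sh: "lam N h (%i. xi (i + int n)) i = lam N h xi (i + int n)" for xi i
 proof -
  have "e (i + int n) = e i" "cw (i + int n) = cw i" using cw_shift[of i 1] by (simp_all add: e_eq)
  thus ?thesis by (simp add: lam_def algebra_simps)
 qed
 have "EX f. rep_hom Q L N f & (ALL xi q. compat L xi --> f (w q) (xi q) = lam N h xi q)"
  by (rule hom_of_sequences[where Ps = "lam N h", OF L N lam_compat(2)[OF N h] lam_additive(1)[OF Lr N h] lam_additive(2)[OF Lr N h] sh])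
 then obtain f where f: "rep_hom Q L N f" "ALL xi q. compat L xi --> f (w q) (xi q) = lam N h xi q" by blast
 have W: "submodule Q N (%v. f v ` spc L v)" by (rule submodule_image[OF Lr f(1) submodule_full[OF Lr]])
 have "h b l : f (src Q b) ` spc L (src Q b)" if l: "l : spc L (tgt Q b)" for b l
 proof -
  obtain q where q: "b = e q" using e_surj by blast
  have l': "l : spc L (w (tpos q))" using l q tgt_tpos by simp
  obtain xi where xi: "compat L xi" "xi (tpos q) = l" using compat_exists[OF L l'] by blast
  show ?thesis
  proof (cases "cw q")
   case True
   hence "h b l = f (w q) (xi q)" using f(2) xi q by (simp add: lam_def tpos_def)
   thus ?thesis using compat_mem[OF xi(1), of q] True q by (simp add: src_e)
  next
   case False
   have "h b l = - f (w (q + 1)) (xi (q + 1))"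
    using lam_compat(1)[OF N h xi(1), of q] f(2)[rule_format, OF xi(1), of "q + 1"] False xi(2) q by (simp add: rho_def tpos_def)
   moreover have "f (w (q + 1)) (xi (q + 1)) : f (src Q b) ` spc L (src Q b)"
    using compat_mem[OF xi(1), of "q + 1"] False q by (simp add: src_e)
   ultimately show ?thesis using cv.subspace_neg[OF submodule_subspace[OF W]] by simp
  qed
 qed
 from connection_generates[OF h W this] have "(%v. f v ` spc L v) = spc N" by blast
 thus ?thesis using f rep_surj_iff by blast
qed

text \<open>If one entry of the sequence \<open>lam\<close> is zero, all are, because the arrows of
  \<open>N\<close> are bijective; then \<open>lam_zero\<close> gives injectivity.\<close>

theorem translate_allbij_iso:
 assumes L: "allbij L" and N: "allbij N" and h: "connection Q L N h" shows "rep_iso Q L N"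
proof -
 note Lr = allbij_rep[OF L] and Nr = allbij_rep[OF N]
 obtain f where f: "rep_hom Q L N f" "rep_surj L N f" "ALL xi q. compat L xi --> f (w q) (xi q) = lam N h xi q"
  using translate_hom[OF L Nr h] by blast
 have ker: "x = 0" if x: "x : spc L v" "f v x = 0" for v x
 proof -
  obtain q where q: "v = w q" using w_surj by blast
  obtain xi where xi: "compat L xi" "xi q = x" using compat_exists[OF L] x(1) q by blast
  have "lam N h xi q = (%i. 0) q" using f(3)[rule_format, OF xi(1), of q] xi(2) x(2) q by simp
  hence "lam N h xi i = 0" for i
   using compat_unique[OF N lam_compat(2)[OF Nr h xi(1)] compat_zero[OF Nr], of q i] by simp
  thus ?thesis using lam_zero[OF Lr Nr h xi(1)] xi(2) by blast
 qed
 have "rep_inj L f" unfolding rep_inj_iff[OF Lr f(1)] using ker by simp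
 thus ?thesis using f(1,2) unfolding rep_iso_def by blast
qed

section \<open>Eigensequences\<close>

text \<open>An eigenvector of the monodromy around the cycle, spread out over the universal
  cover.\<close>

definition eigenseq :: "('v, 'a) quiver_rep => complex => (int => cvec) => bool" where
 "eigenseq M mu u \<longleftrightarrow> compat M u & mu ~= 0 & (ALL q. u (q + int n) = cscale mu (u q)) & (EX q. u q ~= 0)"

lemma eigenseq_compat: "eigenseq M mu u ==> compat M u"
 and eigenseq_shift: "eigenseq M mu u ==> u (q + int n) = cscale mu (u q)"
 and eigenseq_nonzero: "eigenseq M mu u ==> mu ~= 0"
 by (simp_all add: eigenseq_def)

lemma eigenseq_power: "eigenseq M mu u ==> u (q + int n * int k) = cscale (mu ^ k) (u q)"
proof (induction k)
 case (Suc k)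
 have "u (q + int n * int (Suc k)) = u ((q + int n * int k) + int n)" by (simp add: algebra_simps)
 thus ?case using eigenseq_shift[OF Suc.prems] Suc by simp
qed simp

lemma eigenseq_span:
 assumes u: "eigenseq M mu u" and w: "w q' = w q" shows "u q' : cv.span {u q}"
proof -
 have m: "mu ~= 0" by (rule eigenseq_nonzero[OF u])
 have "int n dvd q' - q" using w by (metis w_eq mod_eq_dvd_iff)
 then obtain t where t: "q' = q + int n * t" by (metis add_diff_cancel_left' dvd_def diff_eq_eq add.commute)
 show ?thesis
 proof (cases "t >= 0")
  case True
  hence "u q' = cscale (mu ^ nat t) (u q)" using eigenseq_power[OF u, of q "nat t"] t by simp
  thus ?thesis by (auto simp: cv.span_singleton)
 next
  case False
  hence "q = q' + int n * int (nat (- t))" using t by (simp add: algebra_simps)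
  hence "u q = cscale (mu ^ nat (- t)) (u q')" using eigenseq_power[OF u] by metis
  hence "u q' = cscale (inverse (mu ^ nat (- t))) (u q)" using m by simp
  thus ?thesis by (auto simp: cv.span_singleton)
 qed
qed

lemma eigenseq_exists:
 assumes L: "allbij L" and ne: "spc L ~= zero_fam" shows "EX mu u. eigenseq L mu u"
proof -
 note Lr = allbij_rep[OF L]
 obtain f where f: "rep_hom Q L L f" "ALL xi q. compat L xi --> f (w q) (xi q) = xi (q + int n)"
  using hom_of_sequences[where Ps = "%xi i. xi (i + int n)", OF L Lr] compat_shift[of L _ 1] by auto
 have ne0: "spc L (w 0) ~= {0}"
 proof
  assume z: "spc L (w 0) = {0}"
  have "spc L v = {0}" for v
  proof -
   obtain q where q: "v = w q" using w_surj by blast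
   have "x = 0" if x: "x : spc L (w q)" for x
   proof -
    obtain xi where xi: "compat L xi" "xi q = x" using compat_exists[OF L x] by blast
    have "xi 0 = (%i. 0) 0" using compat_mem[OF xi(1), of 0] z by simp
    from compat_unique[OF L xi(1) compat_zero[OF Lr] this, of q] show ?thesis using xi(2) by simp
   qed
   thus ?thesis using q cv.subspace_0[OF rep_subspace[OF Lr], of v] by blast
  qed
  thus False using ne by (simp add: zero_fam_def fun_eq_iff)
 qed
 obtain mu x where x: "x : spc L (w 0)" "x ~= 0" "f (w 0) x = cscale mu x"
  using eigenvector_exists[OF rep_fd[OF Lr] hom_linear[OF f(1)] ne0] by blast
 obtain xi where xi: "compat L xi" "xi 0 = x" using compat_exists[OF L x(1)] by blast
 have "xi (0 + int n) = cscale mu (xi 0)" using f(2)[rule_format, OF xi(1), of 0] xi(2) x(3) by simp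
 hence sh: "xi (q + int n) = cscale mu (xi q)" for q
  using compat_unique[OF L compat_shift[OF xi(1), of 1] compat_scale[OF Lr xi(1), of mu], of 0 q] by simp
 have "mu ~= 0"
 proof
  assume m: "mu = 0"
  have "xi (int n) = (%i. 0) (int n)" using sh[of 0] m by simp
  from compat_unique[OF L xi(1) compat_zero[OF Lr] this, of 0] show False using xi(2) x(2) by simp
 qed
 hence "eigenseq L mu xi" using xi sh x(2) unfolding eigenseq_def by blast
 thus ?thesis by blast
qed

lemma allbij_compat_zero: "allbij L ==> compat L xi ==> xi q = 0 ==> xi i = 0"
 using compat_unique[of L xi "%i. 0" q i] compat_zero[OF allbij_rep] by simp

lemma compat_sum:
 assumes M: "is_rep Q M" and c: "!!j. compat M (xi j)" shows "compat M (%i. SUM j<(k::nat). xi j i)"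
proof (induction k)
 case 0 show ?case using compat_zero[OF M] by simp
next
 case (Suc k) show ?case using compat_add[OF M Suc c] by simp
qed

lemma hom_funpow_0: "is_rep Q M ==> rep_hom Q M M u ==> (u v ^^ k) 0 = 0"
 using hom_0[of Q M M "%v. u v ^^ k" v] rep_hom_funpow[of Q M u k] by simp

text \<open>The point is that \<open>X\<close> has only one eigensequence up to scalars, so the kernel of \<open>g\<close> contains it.\<close>

theorem eigenseq_killed:
 assumes ind: "indecomposable Q X" and X: "allbij X" and L: "allbij L" and g: "rep_hom Q X L g" "~ rep_inj X g"
  and u: "eigenseq X mu u"
 shows "g (w q) (u q) = 0"
proof -
 note Xr = allbij_rep[OF X] and Lr = allbij_rep[OF L]
 note uc = eigenseq_compat[OF u]
 have lin: "xi (i + int n) + ze (i + int n) + cscale (- mu) (xi i + ze i) =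
   (xi (i + int n) + cscale (- mu) (xi i)) + (ze (i + int n) + cscale (- mu) (ze i))" for xi ze :: "int => cvec" and i
  unfolding cv.scale_right_distrib by (simp only: ac_simps)
 have sc: "cscale b (xi (i + int n)) + cscale (- mu) (cscale b (xi i)) = cscale b (xi (i + int n) + cscale (- mu) (xi i))"
  for xi :: "int => cvec" and i b
  unfolding cv.scale_right_distrib cv.scale_scale by (simp only: mult.commute)
 have cc: "compat X (%i. xi (i + int n) + cscale (- mu) (xi i))" if "compat X xi" for xi
  using compat_add[OF Xr compat_shift[OF that, of 1] compat_scale[OF Xr that, of "- mu"]] by simp
 \<comment> \<open>The monodromy minus \<open>mu\<close>, as an endomorphism of \<open>X\<close>. It
   kills the eigensequence, so it is not injective, and by Fitting's lemma it is nilpotent.\<close>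
 have "EX f. rep_hom Q X X f & (ALL xi q. compat X xi --> f (w q) (xi q) = xi (q + int n) + cscale (- mu) (xi q))"
  by (rule hom_of_sequences[where Ps = "%xi i. xi (i + int n) + cscale (- mu) (xi i)", OF X Xr cc lin sc refl])
 then obtain tt where tt: "rep_hom Q X X tt" and tts': "ALL xi q. compat X xi --> tt (w q) (xi q) = xi (q + int n) + cscale (- mu) (xi q)"
  by blast
 note tts = tts'[rule_format]
 have shift: "xi (q + int n) = tt (w q) (xi q) + cscale mu (xi q)" if "compat X xi" for xi q
  using tts[OF that, of q] by (simp add: cv.scale_minus_left add.assoc del: add_uminus_conv_diff)
 have ttu: "tt (w i) (u i) = 0" for i
  unfolding tts[OF uc] eigenseq_shift[OF u] cv.scale_minus_left by simp
 note ttk = rep_hom_funpow[OF tt]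
 have ttm: "(tt v ^^ k) x : spc X v" if "x : spc X v" for v k x using hom_mem[OF ttk] that by blast
 obtain q1 where q1: "u q1 ~= 0" using u by (auto simp: eigenseq_def)
 have "~ rep_inj X tt"
  using rep_inj_iff[OF Xr tt] ttu q1 compat_mem[OF uc] by blast
 hence ex: "EX k. ALL v. ALL x:spc X v. (tt v ^^ k) x = 0" using fitting[OF ind tt] by blast
 define H where "H = (LEAST k. ALL v. ALL x:spc X v. (tt v ^^ k) x = 0)"
 have H: "ALL v. ALL x:spc X v. (tt v ^^ H) x = 0" unfolding H_def by (rule LeastI_ex[OF ex])
 have "H ~= 0"
 proof
  assume "H = 0"
  hence "ALL v. ALL x:spc X v. x = 0" using H by simp
  thus False using q1 compat_mem[OF uc] by blast
 qed
 then obtain h where h: "H = Suc h" by (cases H) auto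
 have top: "(tt v ^^ k) x = 0" if "x : spc X v" "k > h" for v k x
 proof -
  have "k = (k - H) + H" using that(2) h by simp
  hence "(tt v ^^ k) x = (tt v ^^ (k - H)) ((tt v ^^ H) x)" by (metis comp_apply funpow_add)
  thus ?thesis using H that(1) hom_funpow_0[OF Xr tt] by simp
 qed
 obtain v0 x where x: "x : spc X v0" "(tt v0 ^^ h) x ~= 0"
  using not_less_Least[of h "%k. ALL v. ALL x:spc X v. (tt v ^^ k) x = 0"] h unfolding H_def by auto
 obtain q0 where q0: "v0 = w q0" using w_surj by blast
 obtain c where c: "compat X c" "c q0 = x" using compat_exists[OF X] x(1) q0 by blast
 obtain g0 where g0: "cfunctional g0" "g0 ((tt (w q0) ^^ h) x) = 1"
  using separating_functional[OF cv.subspace_single_0, of "(tt (w q0) ^^ h) x"] x(2) q0 by blast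
 have g00: "g0 0 = 0" by (rule cfunctional_0[OF g0(1)])
 \<comment> \<open>\<open>x\<close> is the top of a longest Jordan chain of \<open>tt\<close>, with
   end \<open>tt^h x\<close>, and \<open>g0\<close> is 1 on this end. The sum of the maps
   \<open>A j\<close> times \<open>B j\<close> commutes with the monodromy and fixes the end; so it
   is not nilpotent, hence injective, and it sends the kernel of \<open>tt\<close> into the line of
   \<open>B h\<close>.\<close>
 define A where "A j y = g0 ((tt (w q0) ^^ (h - j)) y)" for j y
 define B where "B j i = (tt (w i) ^^ j) (c i)" for j i
 have Bc: "compat X (B j)" for j unfolding B_def by (rule compat_hom[OF c(1) ttk])
 have Aadd: "A j (y + z) = A j y + A j z" and Asc: "A j (cscale b y) = b * A j y"
  if "y : spc X (w q0)" "z : spc X (w q0)" for j y z b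
  using g0(1) hom_add[OF ttk that] hom_scale[OF ttk that(1)] by (simp_all add: A_def cfunctional_iff)
 define Ps where "Ps et i = (SUM j<Suc h. cscale (A j (et q0)) (B j i))" for et i
 have Psc: "compat X (Ps et)" for et unfolding Ps_def[abs_def] by (rule compat_sum[OF Xr compat_scale[OF Xr Bc]])
 have Psa: "Ps (%i. xi i + ze i) i = Ps xi i + Ps ze i" if "compat X xi" "compat X ze" for xi ze i
  unfolding Ps_def Aadd[OF compat_mem[OF that(1), of q0] compat_mem[OF that(2), of q0]] cv.scale_left_distrib by (rule sum.distrib)
 have Pss: "Ps (%i. cscale b (xi i)) i = cscale b (Ps xi i)" if "compat X xi" for xi i b
  unfolding Ps_def Asc[OF compat_mem[OF that, of q0] compat_mem[OF that, of q0]] cv.scale_sum_right cv.scale_scale by (rule refl)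
 have Pssh: "Ps (%i. et (i + int n)) i = Ps et (i + int n)" if et: "compat X et" for et i
 proof -
  let ?y = "et q0"
  have y: "?y : spc X (w q0)" by (rule compat_mem[OF et])
  have A1: "A j (et (q0 + int n)) = A j (tt (w q0) ?y) + mu * A j ?y" for j
   unfolding shift[OF et] Aadd[OF hom_mem[OF tt y] cv.subspace_scale[OF rep_subspace[OF Xr] y]] Asc[OF y y] by (rule refl)
  have B1: "B j (i + int n) = B (Suc j) i + cscale mu (B j i)" for j
   unfolding shift[OF Bc] by (simp add: B_def)
  have A0: "A 0 (tt (w q0) ?y) = 0"
  proof -
   have "(tt (w q0) ^^ h) (tt (w q0) ?y) = (tt (w q0) ^^ Suc h) ?y" by (simp add: funpow_swap1)
   thus ?thesis using top[OF y, of "Suc h"] g00 by (simp add: A_def del: funpow.simps)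
  qed
  have AS: "A (Suc j) (tt (w q0) ?y) = A j ?y" if "j < h" for j
  proof -
   have "(tt (w q0) ^^ (h - Suc j)) (tt (w q0) ?y) = (tt (w q0) ^^ Suc (h - Suc j)) ?y" by (simp add: funpow_swap1)
   thus ?thesis using Suc_diff_Suc[OF that] by (simp add: A_def del: funpow.simps)
  qed
  have Bh: "B (Suc h) i = 0" unfolding B_def by (rule top[OF compat_mem[OF c(1)]]) simp
  have "(SUM j<Suc h. cscale (A j (tt (w q0) ?y)) (B j i)) = (SUM j<h. cscale (A j ?y) (B (Suc j) i))"
   unfolding sum.lessThan_Suc_shift A0 using AS by simp
  also have "... = (SUM j<Suc h. cscale (A j ?y) (B (Suc j) i))" using Bh by simp
  finally have tel: "(SUM j<Suc h. cscale (A j (tt (w q0) ?y)) (B j i)) = (SUM j<Suc h. cscale (A j ?y) (B (Suc j) i))" .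
  have "Ps (%i. et (i + int n)) i = (SUM j<Suc h. cscale (A j (tt (w q0) ?y)) (B j i)) + (SUM j<Suc h. cscale (mu * A j ?y) (B j i))"
   unfolding Ps_def A1 cv.scale_left_distrib by (rule sum.distrib)
  also have "... = (SUM j<Suc h. cscale (A j ?y) (B (Suc j) i)) + (SUM j<Suc h. cscale (A j ?y) (cscale mu (B j i)))"
   unfolding tel cv.scale_scale by (simp only: mult.commute)
  also have "... = Ps et (i + int n)"
   unfolding Ps_def B1 cv.scale_right_distrib by (rule sum.distrib[symmetric])
  finally show ?thesis .
 qed
 have "EX f. rep_hom Q X X f & (ALL xi q. compat X xi --> f (w q) (xi q) = Ps xi q)"
  by (rule hom_of_sequences[where Ps = Ps, OF X Xr Psc Psa Pss Pssh])
 then obtain pr where pr: "rep_hom Q X X pr" and prs': "ALL xi q. compat X xi --> pr (w q) (xi q) = Ps xi q" by blast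
 note prs = prs'[rule_format]
 let ?z = "(tt (w q0) ^^ h) x"
 have zm: "?z : spc X (w q0)" using ttm x(1) q0 by blast
 have prz: "pr (w q0) ?z = ?z"
 proof -
  have e: "B h q0 = ?z" by (simp add: B_def c(2))
  have "A j ?z = 0" if "j < h" for j
  proof -
   have "(tt (w q0) ^^ (h - j)) ?z = (tt (w q0) ^^ (h - j + h)) x" by (simp add: funpow_add)
   also have "... = 0" using that x(1) q0 by (intro top) auto
   finally show ?thesis using g00 by (simp add: A_def)
  qed
  moreover have "A h ?z = 1" using g0(2) by (simp add: A_def)
  ultimately have "Ps (B h) q0 = ?z" unfolding Ps_def e by (simp add: e)
  thus ?thesis using prs[OF Bc, of q0 h] e by simp
 qed
 have "~ (EX k. ALL v. ALL x:spc X v. (pr v ^^ k) x = 0)"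
 proof
  assume "EX k. ALL v. ALL x:spc X v. (pr v ^^ k) x = 0"
  then obtain k where "(pr (w q0) ^^ k) ?z = 0" using zm by blast
  moreover have "(pr (w q0) ^^ k) ?z = ?z" by (induction k) (simp_all add: prz)
  ultimately show False using x(2) q0 by simp
 qed
 hence prinj: "rep_inj X pr" using fitting[OF ind pr] by blast
 have ker: "pr (w i) (ze i) = cscale (g0 (ze q0)) (B h i)" if ze: "compat X ze" "tt (w q0) (ze q0) = 0" for ze i
 proof -
  have "A j (ze q0) = 0" if "j < h" for j
  proof -
   have "h - j = Suc (h - Suc j)" using that by simp
   hence "(tt (w q0) ^^ (h - j)) (ze q0) = (tt (w q0) ^^ (h - Suc j)) (tt (w q0) (ze q0))"
    by (simp add: funpow_swap1)
   thus ?thesis using ze(2) hom_funpow_0[OF Xr tt] g00 by (simp add: A_def)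
  qed
  moreover have "A h (ze q0) = g0 (ze q0)" by (simp add: A_def)
  ultimately show ?thesis unfolding prs[OF ze(1)] Ps_def by simp
 qed
 have Kseq: "g (w i) (et i) = 0" if et: "compat X et" "g (w j) (et j) = 0" for et i j
  by (rule allbij_compat_zero[OF L compat_hom[OF et(1) g(1)], of j i, OF et(2)])
 have Ktt: "g v (tt v y) = 0" if y: "y : spc X v" "g v y = 0" for v y
 proof -
  obtain j where j: "v = w j" using w_surj by blast
  obtain et where et: "compat X et" "et j = y" using compat_exists[OF X] y(1) j by blast
  have "compat X (%i. tt (w i) (et i))" by (rule compat_hom[OF et(1) tt])
  have "g (w (j + int n)) (et (j + int n)) = 0" by (rule Kseq[OF et(1), of j]) (use et(2) y(2) j in simp)
  hence "g v (et (j + int n)) = 0" using w_period[of j] j by simp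
  moreover have m: "et (j + int n) : spc X v" using compat_mem[OF et(1), of "j + int n"] w_period[of j] j by simp
  ultimately show ?thesis
   using tts[OF et(1), of j] et(2) y j hom_diff[OF Xr g(1) m cv.subspace_scale[OF rep_subspace[OF Xr] y(1)]] hom_scale[OF g(1) y(1)] by simp
 qed
 obtain v z0 where z0: "z0 : spc X v" "z0 ~= 0" "g v z0 = 0" using g(2) rep_inj_iff[OF Xr g(1)] by blast
 have gk: "g v ((tt v ^^ k) z0) = 0" for k by (induction k) (use z0 Ktt ttm in auto)
 have exm: "EX k. (tt v ^^ k) z0 = 0" using H z0(1) by blast
 \<comment> \<open>The kernel of \<open>g\<close> is stable under \<open>tt\<close>, so it contains
   a nonzero vector killed by \<open>tt\<close>. Since the kernel of \<open>tt\<close> injects into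
   a line at each vertex, the entry of \<open>u\<close> is a multiple of that vector.\<close>
 define m where "m = (LEAST k. (tt v ^^ k) z0 = 0)"
 have mz: "(tt v ^^ m) z0 = 0" unfolding m_def by (rule LeastI_ex[OF exm])
 have "m ~= 0" using mz z0(2) by (metis funpow_0)
 then obtain m' where m': "m = Suc m'" by (cases m) auto
 define z where "z = (tt v ^^ m') z0"
 have z: "z : spc X v" "z ~= 0" "tt v z = 0" "g v z = 0"
  using not_less_Least[of m' "%k. (tt v ^^ k) z0 = 0"] m' mz ttm[OF z0(1)] gk unfolding m_def[symmetric] by (auto simp: z_def)
 obtain i where i: "v = w i" using w_surj by blast
 obtain ze where ze: "compat X ze" "ze i = z" using compat_exists[OF X] z(1) i by blast
 have "tt (w q0) (ze q0) = 0"
  by (rule allbij_compat_zero[OF X compat_hom[OF ze(1) tt], of i q0]) (use ze(2) z(3) i in simp)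
 from ker[OF ze(1) this, of i] have pr1: "pr (w i) z = cscale (g0 (ze q0)) (B h i)" using ze(2) by simp
 have pr2: "pr (w i) (u i) = cscale (g0 (u q0)) (B h i)" by (rule ker[OF uc ttu])
 have ui: "u i : spc X (w i)" by (rule compat_mem[OF uc])
 have zi: "z : spc X (w i)" using z(1) i by simp
 have inj0: "y = 0" if "y : spc X (w i)" "pr (w i) y = 0" for y using prinj rep_inj_iff[OF Xr pr] that by blast
 have a0: "g0 (ze q0) ~= 0" using inj0[OF zi] pr1 z(2) by auto
 let ?r = "g0 (u q0) / g0 (ze q0)"
 have "pr (w i) (u i - cscale ?r z) = 0"
  using hom_diff[OF Xr pr ui cv.subspace_scale[OF rep_subspace[OF Xr] zi]] hom_scale[OF pr zi, of ?r] pr1 pr2 a0 by simp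
 hence "u i - cscale ?r z = 0" by (rule inj0[OF cv.subspace_diff[OF rep_subspace[OF Xr] ui cv.subspace_scale[OF rep_subspace[OF Xr] zi]]])
 hence "u i = cscale ?r z" by simp
 hence "g (w i) (u i) = 0" using hom_scale[OF g(1) zi, of ?r] z(4) i by simp
 thus ?thesis by (rule Kseq[OF uc])
qed

lemma allbij_iso:
 assumes X: "allbij X" and Y: "is_rep Q Y" and iso: "rep_iso Q X Y" shows "allbij Y"
 unfolding allbij_def
proof (intro conjI allI)
 show "is_rep Q Y" by (rule Y)
 fix a
 obtain f where f: "rep_hom Q X Y f" "rep_inj X f" "rep_surj X Y f" using iso unfolding rep_iso_def by blast
 have bf: "bij_betw (f v) (spc X v) (spc Y v)" for v using f(2,3) by (simp add: bij_betw_def rep_inj_def rep_surj_def)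
 have "bij_betw (act X a) (spc X (src Q a)) (spc X (tgt Q a))" using X by (simp add: allbij_def)
 hence "bij_betw (f (tgt Q a) \<circ> act X a) (spc X (src Q a)) (spc Y (tgt Q a))" by (rule bij_betw_trans[OF _ bf])
 hence "bij_betw (act Y a \<circ> f (src Q a)) (spc X (src Q a)) (spc Y (tgt Q a))"
  by (rule bij_betw_cong[THEN iffD1, rotated]) (simp add: hom_commute[OF f(1)])
 thus "bij_betw (act Y a) (spc Y (src Q a)) (spc Y (tgt Q a))" using bij_betw_comp_iff[OF bf] by blast
qed

end

section \<open>Tubes whose members have bijective arrows\<close>

context cyclic_tube
begin

text \<open>\<open>acw_surjective\<close> takes care of the anticlockwise arrows and, after reversal
  of the cycle, of the clockwise ones.\<close>

lemma T_inj_allbij: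
 assumes X: "X : T" and inj: "!!a. inj_on (act X a) (spc X (src Q a))"
 shows "allbij X"
proof -
 interpret F: cyclic_tube Q n "%q. w (- q)" "%q. e (- q - 1)" "%q. ~ cw (- q - 1)" T p R by (rule flip_tube)
 have "act X (e q) ` spc X (src Q (e q)) = spc X (tgt Q (e q))" for q
 proof (cases "cw q")
  case False thus ?thesis using acw_surjective[OF T_rep[OF X] T_no_dcompat[OF X] inj False] by (simp add: src_e tgt_e)
 next
  case True
  thus ?thesis using F.acw_surjective[OF T_rep[OF X] F.T_no_dcompat[OF X] inj, of "- q - 1"] by (simp add: src_e tgt_e add.commute)
 qed
 thus ?thesis using T_rep[OF X] inj e_surj unfolding allbij_def bij_betw_def by metis
qed

text \<open>A killed vector would make transport nilpotent, whereas the entries of an eigensequence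
  come back after each turn up to a nonzero factor.\<close>

lemma eigenseq_cw_inj:
 assumes X: "X : T" and u: "eigenseq X mu u" and q: "cw q" shows "inj_on (act X (e q)) (spc X (w q))"
proof (rule ccontr)
 assume a: "~ ?thesis"
 have l: "linear_from_to (spc X (w q)) (spc X (w (q + 1))) (act X (e q))"
  using rep_act[OF T_rep[OF X], of "e q"] q by (simp add: src_e tgt_e)
 obtain x where x: "x : spc X (w q)" "act X (e q) x = 0" "x ~= 0"
  using a lft_inj_on_iff[OF l rep_subspace[OF T_rep[OF X]]] by blast
 note tX = T_type[OF X q x(1,3,2)]
 note uc = eigenseq_compat[OF u]
 obtain q1 where q1: "u q1 ~= 0" using u by (auto simp: eigenseq_def)
 obtain j where j: "sgp X q1 j (u q1) = 0" using tX(3)[OF compat_mem[OF uc]] by blast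
 have s: "sgp X q1 k (u q1) = u (q1 + int k)" for k
 proof (induction k)
  case (Suc k)
  have "u (q1 + int k + 1) = sg X (q1 + int k) (u (q1 + int k))"
   by (rule step_sg[OF tX(2) compat_mem[OF uc] compat_mem[OF uc] compat_stepD[OF uc]])
  thus ?case using Suc by (simp add: algebra_simps)
 qed simp
 have "j <= n * j" using n2 by simp
 hence "u (q1 + int (n * j)) = 0" using sgp_zero_mono[OF tX(2) j] s by metis
 hence "cscale (mu ^ j) (u q1) = 0" using eigenseq_power[OF u, of q1 j] by simp
 thus False using q1 eigenseq_nonzero[OF u] by simp
qed

lemma eigenseq_allbij:
 assumes X: "X : T" and u: "eigenseq X mu u" shows "allbij X"
proof (rule T_inj_allbij[OF X])
 interpret F: cyclic_tube Q n "%q. w (- q)" "%q. e (- q - 1)" "%q. ~ cw (- q - 1)" T p R by (rule flip_tube)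
 note uc = eigenseq_compat[OF u]
 have "F.compat X (%q. u (- q))"
  unfolding F.compat_def F.step_def
 proof (intro allI conjI)
  fix q
  show "u (- q) : spc X (w (- q))" by (rule compat_mem[OF uc])
  have e1: "- q - 1 + 1 = - q" "- (q + 1) = - q - 1" by simp_all
  show "if ~ cw (- q - 1) then act X (e (- q - 1)) (u (- q)) = u (- (q + 1)) else act X (e (- q - 1)) (u (- (q + 1))) = u (- q)"
   using compat_cw[OF uc, of "- q - 1"] compat_acw[OF uc, of "- q - 1"] unfolding e1 by simp
 qed
 moreover have "u (- (q + int n)) = cscale (inverse mu) (u (- q))" for q
 proof -
  have "u (- q) = cscale mu (u (- (q + int n)))" using eigenseq_shift[OF u, of "- (q + int n)"] by simp
  thus ?thesis using eigenseq_nonzero[OF u] by simp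
 qed
 moreover have "EX q. u (- q) ~= 0" using u unfolding eigenseq_def by (metis minus_minus)
 ultimately have u': "F.eigenseq X (inverse mu) (%q. u (- q))" using eigenseq_nonzero[OF u] unfolding F.eigenseq_def by simp
 fix a obtain q where q: "a = e q" using e_surj by blast
 show "inj_on (act X a) (spc X (src Q a))"
 proof (cases "cw q")
  case True thus ?thesis using eigenseq_cw_inj[OF X u True] q by (simp add: src_e)
 next
  case False thus ?thesis using F.eigenseq_cw_inj[OF X u', of "- q - 1"] q by (simp add: src_e add.commute)
 qed
qed

theorem allbij_rank_one:
 assumes X: "X : T" "allbij X" shows "p = 1"
proof -
 interpret F: cyclic_tube Q n "%q. w (- q)" "%q. e (- q - 1)" "%q. ~ cw (- q - 1)" T p R by (rule flip_tube)
 obtain i j where ij: "rep_iso Q X (R i j)" using R_ex[OF X(1)] by blast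
 let ?L = "R i j" and ?N = "R (i + 1) j"
 have L: "allbij ?L" by (rule allbij_iso[OF X(2) T_rep[OF R_mem] ij])
 have Nr: "is_rep Q ?N" by (rule T_rep[OF R_mem])
 obtain h where h: "connection Q ?L ?N h" using R_connection[of "i + 1" j] by auto
 obtain f where f: "rep_hom Q ?L ?N f" "rep_surj ?L ?N f" using translate_hom[OF L Nr h] by blast
 have surj: "act ?N a ` spc ?N (src Q a) = spc ?N (tgt Q a)" for a
 proof
  show "act ?N a ` spc ?N (src Q a) <= spc ?N (tgt Q a)" using rep_act_mem[OF Nr] by blast
  show "spc ?N (tgt Q a) <= act ?N a ` spc ?N (src Q a)"
  proof
   fix y assume "y : spc ?N (tgt Q a)"
   then obtain x where x: "x : spc ?L (tgt Q a)" "y = f (tgt Q a) x" using rep_surjD[OF f(2)] by blast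
   have "x : act ?L a ` spc ?L (src Q a)" using L x(1) by (simp add: allbij_def bij_betw_def)
   then obtain x' where x': "x' : spc ?L (src Q a)" "x = act ?L a x'" by blast
   thus "y : act ?N a ` spc ?N (src Q a)" using x(2) hom_commute[OF f(1) x'(1)] hom_mem[OF f(1) x'(1)] by simp
  qed
 qed
 \<comment> \<open>\<open>acwbij_cw_surj\<close> needs one orientation to be bijective already.
   Either a clockwise arrow kills a vector, and then the anticlockwise ones are bijective, or the
   clockwise ones are injective and the reversed cycle is used.\<close>
 have N: "allbij ?N"
 proof (cases "EX q x. cw q & x : spc ?N (w q) & x ~= 0 & act ?N (e q) x = 0")
  case True
  then obtain q x where "cw q" "x : spc ?N (w q)" "x ~= 0" "act ?N (e q) x = 0" by blast
  from T_type(2)[OF R_mem this] have b: "acwbij ?N" .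
  show ?thesis
  proof (rule acwbij_cw_surj[OF b])
   fix q assume "cw q" thus "act ?N (e q) ` spc ?N (w q) = spc ?N (w (q + 1))" using surj[of "e q"] by (simp add: src_e tgt_e)
  qed
 next
  case False
  have "F.acwbij ?N"
   unfolding F.acwbij_def
  proof (intro conjI allI impI)
   show "is_rep Q ?N" by (rule Nr)
   fix q assume "~ ~ cw (- q - 1)"
   hence q: "cw (- q - 1)" by simp
   have l: "linear_from_to (spc ?N (w (- q - 1))) (spc ?N (w (- q - 1 + 1))) (act ?N (e (- q - 1)))"
    using rep_act[OF Nr, of "e (- q - 1)"] q by (simp add: src_e tgt_e)
   have "inj_on (act ?N (e (- q - 1))) (spc ?N (w (- q - 1)))"
    unfolding lft_inj_on_iff[OF l rep_subspace[OF Nr]] using False q by blast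
   moreover have "- (q + 1) = - q - 1" "- q - 1 + 1 = - q" by simp_all
   ultimately show "bij_betw (act ?N (e (- q - 1))) (spc ?N (w (- (q + 1)))) (spc ?N (w (- q)))"
    using surj[of "e (- q - 1)"] q src_e[of "- q - 1"] tgt_e[of "- q - 1"] by (simp add: bij_betw_def)
  qed
  thus ?thesis
  proof (rule F.acwbij_cw_surj)
   fix q assume q: "~ cw (- q - 1)"
   have "- (q + 1) = - q - 1" "- q - 1 + 1 = - q" by simp_all
   thus "act ?N (e (- q - 1)) ` spc ?N (w (- q)) = spc ?N (w (- (q + 1)))"
    using surj[of "e (- q - 1)"] q src_e[of "- q - 1"] tgt_e[of "- q - 1"] by simp
  qed
 qed
 have "rep_iso Q ?L ?N" by (rule translate_allbij_iso[OF L N h])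
 hence "i mod int p = (i + 1) mod int p" unfolding R_iso by blast
 hence "int p dvd (i + 1) - i" by (metis mod_eq_dvd_iff)
 hence "int p dvd 1" by simp
 thus ?thesis by simp
qed

text \<open>The entries of an eigensequence span a submodule with a line at each vertex. It is
  indecomposable and lies in the tube by \<open>tube_member\<close>, where
  \<open>eigenseq_killed\<close> provides the vanishing composites; so it is all of
  \<open>L\<close>.\<close>

theorem allbij_quasi_simple:
 assumes L: "quasi_simple Q L" "L : T" "allbij L"
 shows "cv.dim (spc L v) = 1"
proof -
 note Lr = allbij_rep[OF L(3)]
 have "spc L ~= zero_fam" using L(1) by (simp add: quasi_simple_def indecomposable_def)
 then obtain mu u where u: "eigenseq L mu u" using eigenseq_exists[OF L(3)] by blast
 note uc = eigenseq_compat[OF u]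
 obtain q1 where q1: "u q1 ~= 0" using u by (auto simp: eigenseq_def)
 have u0: "u q ~= 0" for q using allbij_compat_zero[OF L(3) uc] q1 by blast
 define U where "U = (%v. cv.span {u q |q. w q = v})"
 have U: "submodule Q L U" unfolding U_def by (rule span_compat_submodule[OF Lr uc])
 let ?S = "subrep L U"
 have Sr: "is_rep Q ?S" by (rule is_rep_subrep[OF Lr U])
 have Uq: "U (w q) = cv.span {u q}" for q
 proof
  show "U (w q) <= cv.span {u q}" unfolding U_def
   by (rule cv.span_minimal[OF _ cv.subspace_span]) (use eigenseq_span[OF u] in blast)
  show "cv.span {u q} <= U (w q)" unfolding U_def by (rule cv.span_mono) blast
 qed
 have uU: "u q : U (w q)" for q unfolding Uq by (rule cv.span_base) simp
 have dU: "cv.dim (U v) = 1" for v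
 proof -
  obtain q where "v = w q" using w_surj by blast
  thus ?thesis using Uq[of q] cv.dim_eq_card_independent[of "{u q}"] u0 by simp
 qed
 have Sc: "compat ?S u" using uc uU by (simp add: compat_def step_def)
 have Su: "eigenseq ?S mu u" using u Sc by (simp add: eigenseq_def)
 have ind: "indecomposable Q ?S"
 proof (rule indecomposable_if_no_idempotents[OF Sr])
  show "spc ?S ~= zero_fam"
  proof
   assume "spc ?S = zero_fam"
   hence "U (w q1) = {0}" by (simp add: zero_fam_def)
   thus False using uU[of q1] q1 by simp
  qed
  fix p q assume p: "rep_hom Q ?S ?S p" and q: "rep_hom Q ?S ?S q"
   and pq: "!!v x. x : spc ?S v ==> x = p v x + q v x" "!!v x. x : spc ?S v ==> p v (p v x) = p v x"
  have all: "ALL v. ALL x:spc ?S v. f v x = 0" if f: "rep_hom Q ?S ?S f" "f (w 0) (u 0) = 0" for f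
  proof (intro allI ballI)
   fix v x assume x: "x : spc ?S v"
   obtain i where i: "v = w i" using w_surj by blast
   have "compat L (%q. f (w q) (u q))"
    using compat_hom[OF compat_hom[OF Sc f(1)] rep_hom_incl[OF U]] by simp
   hence "f (w i) (u i) = 0" by (rule allbij_compat_zero[where xi = "%q. f (w q) (u q)" and q = 0, OF L(3) _ f(2)])
   moreover obtain b where "x = cscale b (u i)" using x Uq[of i] i by (auto simp: cv.span_singleton)
   ultimately show "f v x = 0" using hom_scale[OF f(1), of "u i" "w i" b] uU[of i] i by simp
  qed
  show "(ALL v. ALL x:spc ?S v. p v x = 0) | (ALL v. ALL x:spc ?S v. q v x = 0)"
  proof (cases "p (w 0) (u 0) = 0")
   case True thus ?thesis using all[OF p] by blast
  next
   case False
   have u0S: "u 0 : spc ?S (w 0)" using uU by simp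
   have pm: "p (w 0) (u 0) : spc ?S (w 0)" by (rule hom_mem[OF p u0S])
   obtain b where b: "p (w 0) (u 0) = cscale b (u 0)" using pm Uq[of 0] by (auto simp: cv.span_singleton)
   have "cscale b (q (w 0) (u 0)) = q (w 0) (p (w 0) (u 0))" unfolding b by (rule hom_scale[OF q u0S, symmetric])
   also have "... = 0" using pq(1)[OF pm] pq(2)[OF u0S] by simp
   finally have "q (w 0) (u 0) = 0" using False b by auto
   thus ?thesis using all[OF q] by blast
  qed
 qed
 have "?S : T"
 proof (rule tube_member[OF ind L(2) rep_hom_incl[OF U]])
  show "EX v. EX x:spc ?S v. x ~= 0" using uU[of q1] q1 by auto
  fix X Y g F
  assume X: "X : T" and Y: "Y : T" and g: "rep_hom Q X Y g" "rep_surj X Y g" "~ rep_inj X g" and F: "rep_hom Q ?S X F"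
  have gF: "rep_hom Q ?S Y (%v x. g v (F v x))" by (rule rep_hom_comp[OF F g(1)])
  have img: "eigenseq Z mu (%q. G (w q) (u q))" if G: "rep_hom Q ?S Z G" and ne: "EX q. G (w q) (u q) ~= 0" for Z G
  proof -
   have "G (w (q + int n)) (u (q + int n)) = cscale mu (G (w q) (u q))" for q
    unfolding w_period eigenseq_shift[OF u] by (rule hom_scale[OF G]) (simp add: uU)
   thus ?thesis using compat_hom[OF Sc G] ne eigenseq_nonzero[OF u] unfolding eigenseq_def by blast
  qed
  have z: "g (w q) (F (w q) (u q)) = 0" for q
  proof (rule ccontr)
   assume ne: "g (w q) (F (w q) (u q)) ~= 0"
   hence "F (w q) (u q) ~= 0" using hom_0[OF T_rep[OF X] g(1), of "w q"] by metis
   hence uX: "eigenseq X mu (%q. F (w q) (u q))" using img[OF F] by blast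
   have uY: "eigenseq Y mu (%q. g (w q) (F (w q) (u q)))" using img[OF gF] ne by blast
   from eigenseq_killed[OF T_indecomposable[OF X] eigenseq_allbij[OF X uX] eigenseq_allbij[OF Y uY] g(1,3) uX, of q]
   show False using ne by simp
  qed
  show "ALL v. ALL x:spc ?S v. g v (F v x) = 0"
  proof (intro allI ballI)
   fix v x assume x: "x : spc ?S v"
   obtain q where q: "v = w q" using w_surj by blast
   obtain b where b: "x = cscale b (u q)" using x Uq[of q] q by (auto simp: cv.span_singleton)
   show "g v (F v x) = 0" using hom_scale[OF gF, of "u q" "w q" b] uU[of q] z[of q] q b by simp
  qed
 qed
 from quasi_simple_tube_sub[OF L(1) U this] have "U = spc L" .
 thus ?thesis using dU[of v] by simp
qed

end

section \<open>Preparations for the chain of regular submodules\<close>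

lemma fd_rank_nullity:
 assumes V: "fd_space V" and f: "linear_from_to V W f"
 shows "cv.dim V = cv.dim {x : V. f x = 0} + cv.dim (f ` V)"
proof -
 let ?K = "{x : V. f x = 0}" and ?I = "f ` V"
 have sV: "cv.subspace V" by (rule fd_subspace[OF V])
 have sK: "cv.subspace ?K" using lft_kernel_subspace[OF f sV cv.subspace_single_0] by simp
 have fK: "fd_space ?K" by (rule fd_sub(1)[OF V sK]) blast
 have fI: "fd_space ?I" by (rule fd_image(1)[OF V f])
 obtain K where K: "finite K" "K <= ?K" "cv.independent K" "cv.span K = ?K" "card K = cv.dim ?K" by (rule fd_basis[OF fK])
 obtain I where I: "finite I" "I <= ?I" "cv.independent I" "cv.span I = ?I" "card I = cv.dim ?I" by (rule fd_basis[OF fI])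
 have "ALL y:I. EX x:V. f x = y" using I(2) by blast
 then obtain s where s: "ALL y:I. s y : V & f (s y) = y" by metis
 have sm: "cscale c (s y) : V" if "y : I" for c y using s that cv.subspace_scale[OF sV] by blast
 have fs: "f (SUM y:I. cscale (d y) (s y)) = (SUM y:I. cscale (d y) y)" for d
 proof -
  have "f (SUM y:I. cscale (d y) (s y)) = (SUM y:I. f (cscale (d y) (s y)))" by (rule lft_sum[OF f sV sm])
  also have "... = (SUM y:I. cscale (d y) y)" by (rule sum.cong[OF refl]) (use s lft_scale[OF f] in simp)
  finally show ?thesis .
 qed
 define b where "b = case_sum (%x. x) s"
 have split: "(SUM j:K <+> I. cscale (c j) (b j)) = (SUM x:K. cscale (c (Inl x)) x) + (SUM y:I. cscale (c (Inr y)) (s y))" for c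
  by (simp add: sum.Plus K(1) I(1) b_def)
 have Kz: "(SUM x:K. cscale (d x) x) : ?K" for d
  by (rule cv.subspace_sum[OF sK], rule cv.subspace_scale[OF sK]) (use K(2) in blast)
 have Is: "(SUM y:I. cscale (d y) (s y)) : V" for d by (rule cv.subspace_sum[OF sV sm])
 have "cv.dim (cv.span (b ` (K <+> I))) = card (K <+> I)"
 proof (rule dim_span_family)
  show "finite (K <+> I)" using K(1) I(1) by simp
  fix c assume z: "(SUM j:K <+> I. cscale (c j) (b j)) = 0"
  have "f (SUM x:K. cscale (c (Inl x)) x) = 0" "(SUM x:K. cscale (c (Inl x)) x) : V" using Kz[of "%x. c (Inl x)"] by auto
  hence "f ((SUM x:K. cscale (c (Inl x)) x) + (SUM y:I. cscale (c (Inr y)) (s y))) = (SUM y:I. cscale (c (Inr y)) y)"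
   using lft_add[OF f _ Is] fs by simp
  hence "(SUM y:I. cscale (c (Inr y)) y) = 0" using z lft_zero[OF f sV] unfolding split by simp
  hence i: "c (Inr y) = 0" if "y : I" for y using cv.independentD[OF I(3,1) order_refl, of "%y. c (Inr y)"] that by blast
  hence "(SUM x:K. cscale (c (Inl x)) x) = 0" using z unfolding split by simp
  hence "c (Inl x) = 0" if "x : K" for x using cv.independentD[OF K(3,1) order_refl, of "%x. c (Inl x)"] that by blast
  thus "ALL j:K <+> I. c j = 0" using i by auto
 qed
 moreover have "cv.span (b ` (K <+> I)) = V"
 proof
  have "b j : V" if "j : K <+> I" for j using that K(2) s by (auto simp: b_def)
  thus "cv.span (b ` (K <+> I)) <= V" by (intro cv.span_minimal[OF _ sV]) blast
  have Kb: "K <= b ` (K <+> I)"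
  proof
   fix x assume "x : K"
   hence "b (Inl x) : b ` (K <+> I)" by (intro imageI InlI)
   thus "x : b ` (K <+> I)" by (simp add: b_def)
  qed
  have Ib: "s y : b ` (K <+> I)" if "y : I" for y
  proof -
   have "b (Inr y) : b ` (K <+> I)" using that by (intro imageI InrI)
   thus ?thesis by (simp add: b_def)
  qed
  show "V <= cv.span (b ` (K <+> I))"
  proof
   fix x assume x: "x : V"
   hence "f x : cv.span I" unfolding I(4) by blast
   then obtain d where "f x = (SUM y:I. cscale (d y) y)" unfolding cv.span_finite[OF I(1)] by blast
   hence "f (x - (SUM y:I. cscale (d y) (s y))) = 0" using lft_diff[OF f sV x Is] fs by simp
   hence "x - (SUM y:I. cscale (d y) (s y)) : cv.span K" unfolding K(4) using cv.subspace_diff[OF sV x Is] by blast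
   hence "x - (SUM y:I. cscale (d y) (s y)) : cv.span (b ` (K <+> I))" using cv.span_mono[OF Kb] by blast
   moreover have "(SUM y:I. cscale (d y) (s y)) : cv.span (b ` (K <+> I))"
    by (intro cv.span_sum cv.span_scale cv.span_base Ib)
   ultimately show "x : cv.span (b ` (K <+> I))" using cv.span_add by fastforce
  qed
 qed
 ultimately show ?thesis using K(1,5) I(1,5) by (simp add: card_Plus)
qed

lemma regular_indecomposable_component:
 assumes "indecomposable Q M" "regular_module Q M" shows "regular_component Q (ar_component Q M)"
proof -
 have M: "is_rep Q M" by (rule indecomposable_rep[OF assms(1)])
 have "complementary M (spc M) zero_fam"
  unfolding complementary_def zero_fam_def using cv.subspace_0[OF rep_subspace[OF M]] by auto
 hence "direct_summand Q M (spc M)"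
  unfolding direct_summand_def using submodule_full[OF M] submodule_zero[OF M] by blast
 thus ?thesis using assms unfolding regular_module_def by (metis subrep_spc)
qed

context cyclic_quiver
begin

section \<open>The structure of \<open>M\<^sub>E\<close>\<close>

lemma regular_no_compat': "indecomposable Q M ==> regular_module Q M ==> no_compat M k"
 by (rule regular_no_compat[OF _ regular_indecomposable_component])

lemma w_reach_left: "EX j::nat. w (t - int j) = w q"
proof -
 have "0 <= (t - q) mod int n" using n2 by simp
 hence "t - int (nat ((t - q) mod int n)) = q + int n * ((t - q) div int n)"
  using minus_mod_eq_mult_div[of "t - q" "int n"] by simp
 thus ?thesis by (metis w_eq mod_mult_self2)
qed

lemma w_reach_right: "EX j::nat. w (t + int j) = w q"
proof -
 have "0 <= (q - t) mod int n" using n2 by simp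
 hence "t + int (nat ((q - t) mod int n)) = q + int n * (- ((q - t) div int n))"
  using minus_mod_eq_mult_div[of "q - t" "int n"] by (simp add: algebra_simps)
 thus ?thesis by (metis w_eq mod_mult_self2)
qed

text \<open>Follow the images under \<open>f\<close> of the transported vectors to the last nonzero
  one. The edge after it is clockwise, since otherwise this vector would be the image of zero under
  an arrow of \<open>S\<close>.\<close>

lemma nilpotent_image_killed:
 assumes Y: "acwbij Y" and nil: "EX j. sgp Y q j y = 0" and S: "is_rep Q S" and f: "rep_hom Q Y S f"
  and y: "y : spc Y (w q)" "f (w q) y ~= 0"
 shows "EX q x. cw q & x : spc S (w q) & x ~= 0 & act S (e q) x = 0"
proof -
 note f0 = hom_0[OF acwbij_rep[OF Y] f]
 let ?y = "%i. sgp Y q i y"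
 let ?P = "%i. f (w (q + int i)) (?y i) = 0"
 obtain m where "?y m = 0" using nil by blast
 hence ex: "?P m" using f0 by simp
 have "(LEAST i. ?P i) ~= 0" using LeastI[of ?P, OF ex] y(2) by (intro notI) simp
 then obtain i where i: "(LEAST i. ?P i) = Suc i" using not0_implies_Suc by blast
 let ?q = "q + int i"
 have wq: "w (q + int (Suc i)) = w (?q + 1)" by (simp add: algebra_simps)
 have z: "f (w (?q + 1)) (sg Y ?q (?y i)) = 0" using LeastI[of ?P, OF ex] unfolding i wq by simp
 have ne: "f (w ?q) (?y i) ~= 0" using not_less_Least[of i ?P] i by simp
 have ym: "?y i : spc Y (w ?q)" by (rule sgp_mem[OF Y y(1)])
 note sm = sg_mem[OF Y ym] and st = sg_step[OF Y ym]
 have "cw ?q"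
 proof (rule ccontr)
  assume c: "~ cw ?q"
  hence "act Y (e ?q) (sg Y ?q (?y i)) = ?y i" using st by (simp add: step_def)
  hence "f (w ?q) (?y i) = act S (e ?q) 0" using hom_commute[OF f, of "sg Y ?q (?y i)" "e ?q"] sm c z by (simp add: src_e tgt_e)
  thus False using ne rep_act_0[OF S] by simp
 qed
 moreover from this have "act S (e ?q) (f (w ?q) (?y i)) = 0"
  using hom_commute[OF f, of "?y i" "e ?q"] ym st z by (simp add: src_e tgt_e step_def)
 ultimately show ?thesis using ne hom_mem[OF f ym] by blast
qed

text \<open>A vector of the kernel has a preimage in \<open>U\<close>; its image in \<open>S\<close>
  is killed by an arrow that is injective there, so the preimage lies in the kernel as well.\<close>

lemma acwbij_kernel:
 assumes Y: "acwbij (subrep M U)" and S: "acwbij S" and f: "rep_hom Q (subrep M U) S f"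
  and V: "submodule Q M V" "!!v. {x : U v. f v x = 0} = V v"
 shows "acwbij (subrep M V)"
 unfolding acwbij_def
proof (intro conjI allI impI)
 have Sr: "is_rep Q S" by (rule acwbij_rep[OF S])
 have VU: "V v <= U v" for v using V(2) by blast
 have U0: "0 : U v" for v using cv.subspace_0[OF rep_subspace[OF acwbij_rep[OF Y], of v]] by simp
 have "fd_space (V v)" for v
  using fd_sub(1)[OF rep_fd[OF acwbij_rep[OF Y], of v] submodule_subspace[OF V(1)]] VU by simp
 moreover have "linear_from_to (V (src Q a)) (V (tgt Q a)) (act M a)" for a
  using rep_act[OF acwbij_rep[OF Y], of a] submodule_act[OF V(1)] VU[of "src Q a"]
  by (simp add: linear_from_to_def subset_iff)
 ultimately show "is_rep Q (subrep M V)" by (simp add: is_rep_def)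
 fix q assume q: "~ cw q"
 have bY: "bij_betw (act M (e q)) (U (w (q + 1))) (U (w q))" using Y q by (simp add: acwbij_def)
 have bS: "inj_on (act S (e q)) (spc S (w (q + 1)))" using S q by (simp add: acwbij_def bij_betw_def)
 have "x : act M (e q) ` V (w (q + 1))" if x: "x : V (w q)" for x
 proof -
  have "x : act M (e q) ` U (w (q + 1))" using x VU bij_betw_imp_surj_on[OF bY] by blast
  then obtain y where y: "y : U (w (q + 1))" "x = act M (e q) y" by blast
  have "act S (e q) (f (w (q + 1)) y) = f (w q) x" using hom_commute[OF f, of y "e q"] y q by (simp add: src_e tgt_e)
  also have "... = act S (e q) 0" using x V(2)[of "w q"] rep_act_0[OF Sr] by auto
  finally have "f (w (q + 1)) y = 0"
   using inj_onD[OF bS] hom_mem[OF f, of y "w (q + 1)"] y(1) cv.subspace_0[OF rep_subspace[OF Sr]] by simp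
  hence "y : V (w (q + 1))" using V(2)[of "w (q + 1)"] y(1) by blast
  thus ?thesis using y(2) by blast
 qed
 moreover have "act M (e q) ` V (w (q + 1)) <= V (w q)" using submodule_act[OF V(1), of _ "e q"] q by (auto simp: src_e tgt_e)
 ultimately show "bij_betw (act (subrep M V) (e q)) (spc (subrep M V) (w (q + 1))) (spc (subrep M V) (w q))"
  using inj_on_subset[OF bij_betw_imp_inj_on[OF bY] VU] by (auto simp: bij_betw_def)
qed

lemma acwbij_dim: "acwbij M ==> ~ cw q ==> cv.dim (spc M (w q)) = cv.dim (spc M (w (q + 1)))"
 using fd_image_inj[OF rep_fd[OF acwbij_rep], of M "w (q + 1)" "spc M (w q)" "act M (e q)"] rep_act[OF acwbij_rep, of M "e q"]
 by (auto simp: acwbij_def bij_betw_def src_e tgt_e)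

lemma card_cw_period: "card {i. a <= i & i < a + int n & cw i} = card (w ` {q. cw q})"
proof (rule bij_betw_same_card[of w], rule bij_betw_imageI)
 show "inj_on w {i. a <= i & i < a + int n & cw i}"
 proof (rule inj_onI)
  fix i j assume ij: "i : {i. a <= i & i < a + int n & cw i}" "j : {i. a <= i & i < a + int n & cw i}" "w i = w j"
  have "int n dvd i - j" using ij(3) by (simp add: w_eq mod_eq_dvd_iff)
  moreover have "\<bar>i - j\<bar> < int n" using ij(1,2) by auto
  ultimately show "i = j" using dvd_imp_le_int[of "i - j" "int n"] by (cases "i = j") auto
 qed
 show "w ` {i. a <= i & i < a + int n & cw i} = w ` {q. cw q}"
 proof (intro equalityI subsetI)
  fix v assume "v : w ` {q. cw q}"
  then obtain q where q: "v = w q" "cw q" by blast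
  let ?i = "a + (q - a) mod int n"
  have "?i mod int n = q mod int n" by (simp add: mod_simps)
  hence "w ?i = w q" "cw ?i" using cw_cong[of ?i q] q(2) by (simp_all add: w_eq)
  moreover have "a <= ?i" "?i < a + int n" using n2 by simp_all
  ultimately show "v : w ` {i. a <= i & i < a + int n & cw i}" using q(1) by (intro image_eqI[of _ _ ?i]) auto
 qed auto
qed

text \<open>By \<open>d\<close> the string contains as many clockwise positions as one period. It
  begins right after a clockwise position and ends at one, so its length is exactly one
  period.\<close>

lemma string_period:
 assumes M: "is_rep Q M" and S: "!!k. no_compat M k" and sb: "string_basis M q0 q1 xi"
  and d: "(SUM v:w ` {q. cw q}. cv.dim (spc M v)) = card (w ` {q. cw q})"
 shows "w (q1 + 1) = w q0" "cv.dim (spc M v) = 1"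
proof -
 have c: "cw (q0 - 1)" "cw q1" "q0 <= q1" using sb by (auto simp: string_basis_def null_chain_def)
 let ?C = "%b. {i. q0 <= i & i <= b & cw i}"
 have fin: "finite (?C b)" for b by (rule finite_subset[of _ "{q0..b}"]) auto
 have "card (?C q1) = (SUM v:w ` {q. cw q}. card {i : ?C q1. w i = v})"
  by (rule card_eq_sum[THEN trans], subst sum.group[symmetric, of _ "w ` {q. cw q}" w]) (auto simp: fin)
 also have "... = (SUM v:w ` {q. cw q}. cv.dim (spc M v))"
 proof (rule sum.cong[OF refl])
  fix v assume "v : w ` {q. cw q}"
  then obtain q where q: "v = w q" "cw q" by blast
  have "cw i" if "w i = w q" for i using that q(2) cw_cong[of i q] by (simp add: w_eq)
  hence "{i : ?C q1. w i = v} = {i. q0 <= i & i <= q1 & w i = w q}" using q(1) by auto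
  thus "card {i : ?C q1. w i = v} = cv.dim (spc M v)" using string_dim[OF M S sb, of q] q(1) by simp
 qed
 finally have card1: "card (?C q1) = card (w ` {q. cw q})" using d by simp
 let ?b = "q0 + int n - 1"
 have "?C ?b = {i. q0 <= i & i < q0 + int n & cw i}" by auto
 hence card2: "card (?C ?b) = card (w ` {q. cw q})" using card_cw_period[of q0] by simp
 have "w ?b = w (q0 - 1)" using w_period[of "q0 - 1"] by (simp add: algebra_simps)
 hence cb: "cw ?b" using c(1) cw_cong[of ?b "q0 - 1"] by (simp add: w_eq)
 have less: "card (?C b) < card (?C b')" if "b < b'" "cw b'" "q0 <= b'" for b b'
 proof (rule psubset_card_mono[OF fin])
  have "b' : ?C b'" "b' ~: ?C b" "?C b <= ?C b'" using that by auto
  thus "?C b < ?C b'" by blast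
 qed
 have "q1 = ?b"
 proof (rule ccontr)
  assume "q1 ~= ?b"
  then consider "q1 < ?b" | "?b < q1" by linarith
  thus False
  proof cases
   case 1
   thus False using less[of q1 ?b] cb c(3) card1 card2 by linarith
  next
   case 2
   thus False using less[of ?b q1] c(2,3) card1 card2 by linarith
  qed
 qed
 thus "w (q1 + 1) = w q0" using w_period[of q0] by (simp add: algebra_simps)
 obtain q where q: "v = w q" using w_surj by blast
 let ?i = "q0 + (q - q0) mod int n"
 have "{i. q0 <= i & i <= q1 & w i = w q} = {?i}"
 proof (intro equalityI subsetI)
  fix i assume i: "i : {i. q0 <= i & i <= q1 & w i = w q}"
  have "(i - q0) mod int n = (q - q0) mod int n" using i by (auto simp: w_eq intro: mod_diff_cong)
  thus "i : {?i}" using i \<open>q1 = ?b\<close> by simp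
 next
  fix i assume "i : {?i}"
  moreover have "?i mod int n = q mod int n" by (simp add: mod_simps)
  ultimately show "i : {i. q0 <= i & i <= q1 & w i = w q}" using n2 \<open>q1 = ?b\<close> by (auto simp: w_eq)
 qed
 thus "cv.dim (spc M v) = 1" using string_dim[OF M S sb, of q] q by simp
qed

end

definition vanishing :: "('v, 'a) quiver => ('v, 'a) quiver_rep => 'a => bool" where
 "vanishing Q M a \<longleftrightarrow> (ALL x:spc M (src Q a). act M a x = 0)"

lemma one_dim_not_vanishing:
 assumes M: "is_rep Q M" and d: "cv.dim (spc M (src Q a)) = 1" and a: "~ vanishing Q M a"
  and x: "x : spc M (src Q a)" "x ~= 0"
 shows "act M a x ~= 0"
proof
 assume z: "act M a x = 0"
 obtain y where y: "y : spc M (src Q a)" "act M a y ~= 0" using a by (auto simp: vanishing_def)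
 obtain c where "y = cscale c x"
  using y(1) unfolding dim_1_span[OF rep_fd[OF M] d x] by (auto simp: cv.span_singleton)
 thus False using y(2) z rep_act_scale[OF M x(1)] by simp
qed

context cyclic_quiver
begin

lemma acwbij_not_vanishing: "acwbij M ==> ~ cw q ==> cv.dim (spc M (w q)) = 1 ==> ~ vanishing Q M (e q)"
proof
 assume M: "acwbij M" and q: "~ cw q" "cv.dim (spc M (w q)) = 1" and v: "vanishing Q M (e q)"
 have "spc M (w q) = act M (e q) ` spc M (w (q + 1))" using M q(1) by (simp add: acwbij_def bij_betw_def)
 also have "... <= {0}" using v q(1) by (auto simp: vanishing_def src_e)
 finally have "spc M (w q) = {0}" using cv.subspace_0[OF rep_subspace[OF acwbij_rep[OF M]], of "w q"] by blast
 thus False using q(2) by (simp add: dim_zero)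
qed

text \<open>The first block of the string \<open>M\<close> is \<open>F1\<close>, the last one is \<open>F2\<close>; the only arrow acting as
 zero on \<open>M\<close> leads from the end of \<open>F2\<close> to the beginning of \<open>F1\<close>.\<close>

definition end_blocks :: "int => 'v set => 'v set => bool" where
 "end_blocks k F1 F2 \<longleftrightarrow> cw k & F1 \<inter> F2 = {} &
   (ALL q. ~ cw q --> (w q : F1 \<longleftrightarrow> w (q + 1) : F1)) & (ALL q. cw q --> (w (q + 1) : F1 \<longleftrightarrow> w q = w k)) &
   (ALL q. ~ cw q --> (w q : F2 \<longleftrightarrow> w (q + 1) : F2)) & (ALL q. cw q --> (w q : F2 \<longleftrightarrow> w q = w k))"

end

context cyclic_tube
begin

text \<open>Descending from \<open>M\<close>, the members of the chain keep bijective anticlockwise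
  arrows and nilpotent transport. So the next quotient contains a killed vector and is a string, and
  by quasi-simplicity a block, with one clockwise vertex. The sum of the dimensions at the clockwise
  vertices thus measures the quasi-length.\<close>

lemma chain_blocks:
 assumes B: "blk k0 B" "B : T" and M: "acwbij M" and nil: "!!q y. y : spc M (w q) ==> EX j. sgp M q j y = 0"
  and C: "quasi_chain Q M r C" and j: "j <= r"
 shows "acwbij (subrep M (C j)) & (SUM v:w ` {q. cw q}. cv.dim (spc M v)) = (SUM v:w ` {q. cw q}. cv.dim (C j v)) + (r - j) &
  (ALL i<r. j <= i --> (EX S f k. blk k S & rep_hom Q (subrep M (C (Suc i))) S f & rep_surj (subrep M (C (Suc i))) S f &
   (ALL v. {x : C (Suc i) v. f v x = 0} = C i v)))"
 using j
proof (induction "r - j" arbitrary: j)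
 case 0 thus ?case using C M by (simp add: quasi_chain_def)
next
 case (Suc d)
 let ?W = "w ` {q. cw q}" and ?Y = "subrep M (C (Suc j))"
 have j: "j < r" using Suc(2) by simp
 have IH: "acwbij ?Y" "(SUM v:?W. cv.dim (spc M v)) = (SUM v:?W. cv.dim (C (Suc j) v)) + (r - Suc j)"
  "ALL i<r. Suc j <= i --> (EX S f k. blk k S & rep_hom Q (subrep M (C (Suc i))) S f & rep_surj (subrep M (C (Suc i))) S f &
   (ALL v. {x : C (Suc i) v. f v x = 0} = C i v))"
  using Suc.hyps(1)[of "Suc j"] Suc.hyps(2) j by auto
 have sub: "submodule Q M (C i)" if "i <= r" for i using C that by (simp add: quasi_chain_def regular_submodule_def)
 obtain S where S: "is_quotient Q ?Y (C j) S" "quasi_simple Q S" using C j unfolding quasi_chain_def by blast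
 obtain f where f: "rep_hom Q ?Y S f" "rep_surj ?Y S f" "!!v. {x : C (Suc j) v. f v x = 0} = C j v"
  using S(1) unfolding is_quotient_def by auto
 have Si: "indecomposable Q S" "regular_module Q S" using S(2) by (simp_all add: quasi_simple_def)
 have Sr: "is_rep Q S" by (rule indecomposable_rep[OF Si(1)])
 obtain v s where "s : spc S v" "s ~= 0"
  using Si(1) cv.subspace_0[OF rep_subspace[OF Sr]] by (auto simp: indecomposable_def zero_fam_def fun_eq_iff)
 moreover obtain q where q: "v = w q" using w_surj by blast
 ultimately have s: "s : f (w q) ` C (Suc j) (w q)" "s ~= 0" using f(2) by (simp_all add: rep_surj_def)
 then obtain y where y: "y : C (Suc j) (w q)" "f (w q) y ~= 0" by (metis imageE)
 have Cj: "submodule Q M (C (Suc j))" by (rule sub) (use j in simp)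
 have "sgp ?Y q i y = sgp M q i y" for i using hom_sgp[OF IH(1) M rep_hom_incl[OF Cj], of y q i] y(1) by simp
 hence "EX i. sgp ?Y q i y = 0" using nil[OF submodule_mem[OF Cj y(1)]] by simp
 from nilpotent_image_killed[OF IH(1) this Sr f(1)] y
 obtain k x where x: "cw k" "x : spc S (w k)" "x ~= 0" "act S (e k) x = 0" by auto
 note Snc = regular_no_compat'[OF Si]
 obtain q0 q1 xi where "string_basis S q0 q1 xi" using string_basis_exists[OF Si(1) Snc x(1,2,4,3)] by blast
 hence Sb: "acwbij S" by (rule string_acwbij[OF Sr Snc])
 have blkS: "blk k S" by (rule quasi_simple_blk[OF S(2) Sb x]) (rule blk_tube(1)[OF B])
 have "cv.dim (C (Suc j) v) = cv.dim (C j v) + cv.dim (spc S v)" for v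
  using fd_rank_nullity[OF rep_fd[OF acwbij_rep[OF IH(1)]] hom_linear[OF f(1)], of v] f(2,3) by (simp add: rep_surj_def)
 moreover have "(SUM v:?W. cv.dim (spc S v)) = (SUM v:?W. if v = w k then 1 else 0)"
  by (rule sum.cong[OF refl]) (auto simp: blk_dim[OF blkS] x(1))
 ultimately have "(SUM v:?W. cv.dim (C (Suc j) v)) = (SUM v:?W. cv.dim (C j v)) + 1" using x(1) by (simp add: sum.distrib)
 moreover have "acwbij (subrep M (C j))" by (rule acwbij_kernel[OF IH(1) Sb f(1) sub f(3)]) (use j in simp)
 moreover have "EX S f k. blk k S & rep_hom Q (subrep M (C (Suc i))) S f & rep_surj (subrep M (C (Suc i))) S f &
   (ALL v. {x : C (Suc i) v. f v x = 0} = C i v)" if "i < r" "j <= i" for i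
  using IH(3) that blkS f by (cases "i = j") auto
 ultimately show ?case using IH(2) j by auto
qed

theorem M_E_structure:
 assumes E: "quasi_simple Q E" "E : T" "cw k0" "y0 : spc E (w k0)" "y0 ~= 0" "act E (e k0) y0 = 0"
  and ME: "is_M_E Q E p M C" and p: "p > 1" and N: "is_quotient Q (subrep M (C (p - 1))) (C 1) N"
 shows "EX k F1 F2. end_blocks k F1 F2 & (ALL v. cv.dim (spc M v) = 1) & (ALL a. vanishing Q M a \<longleftrightarrow> a = e k) &
  (ALL v. cv.dim (spc N v) = of_bool (v ~: F1 \<union> F2)) &
  (ALL a. src Q a ~: F1 \<union> F2 --> tgt Q a ~: F1 \<union> F2 --> ~ vanishing Q N a)"
proof -
 have blkE: "blk k0 E" by (rule tube_quasi_simple_blk[OF E])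
 have Mi: "indecomposable Q M" "regular_module Q M" and C: "quasi_chain Q M p C" and isoE: "rep_iso Q (subrep M (C 1)) E"
  using ME by (simp_all add: is_M_E_def)
 have M: "is_rep Q M" by (rule indecomposable_rep[OF Mi(1)])
 note nc = regular_no_compat'[OF Mi]
 have sub: "submodule Q M (C i)" if "i <= p" for i using C that by (simp add: quasi_chain_def regular_submodule_def)
 have C1: "submodule Q M (C 1)" and Cp: "submodule Q M (C (p - 1))" using sub p by simp_all
 have C1r: "is_rep Q (subrep M (C 1))" by (rule is_rep_subrep[OF M C1])
 have blk1: "blk k0 (subrep M (C 1))" by (rule blk_transfer[OF blkE C1r rep_iso_sym[OF C1r isoE]])
 obtain y where y: "y : C 1 (w k0)" "y ~= 0" using blk_element[OF blk1] by auto
 have ay: "act M (e k0) y = 0" using blk_act[OF blk1 E(3), of y] y(1) by simp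
 have yM: "y : spc M (w k0)" by (rule submodule_mem[OF C1 y(1)])
 obtain q0 q1 xi where sb: "string_basis M q0 q1 xi" using string_basis_exists[OF Mi(1) nc E(3) yM ay y(2)] by blast
 have xi: "cw q1" "!!i. xi i : spc M (w i)" "!!i. i >= q0 ==> step M i (xi i) (xi (i + 1))" "xi q1 ~= 0" "xi (q1 + 1) = 0" "q0 <= q1"
  using sb by (auto simp: string_basis_def null_chain_def)
 have Mb: "acwbij M" by (rule string_acwbij[OF M nc sb])
 have nil: "EX j. sgp M q j z = 0" if "z : spc M (w q)" for q z using string_nilpotent[OF M nc sb that] by blast
 note ch = chain_blocks[OF blkE E(2) Mb nil C]
 \<comment> \<open>The quasi-length \<open>p\<close> is the number of clockwise arrows by
   \<open>blk_tube\<close>, so the string makes exactly one turn.\<close>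
 have "(SUM v:w ` {q. cw q}. cv.dim (spc M v)) = card (w ` {q. cw q})"
  using ch[of 0] C blk_tube(2)[OF blkE E(2)] by (simp add: quasi_chain_def zero_fam_def dim_zero)
 note per = string_period[OF M nc sb this]
 have dM: "cv.dim (spc M v) = 1" for v by (rule per(2))
 have C1p: "C 1 v <= C (p - 1) v" for v using N submodule_subset unfolding is_quotient_def by fastforce
 define F1 F2 where "F1 = {v. C (p - 1) v = {0}}" and "F2 = {v. C 1 v ~= {0}}"
 have U0: "0 : U v" if "submodule Q M U" for U v by (rule cv.subspace_0[OF submodule_subspace[OF that]])
 have full: "U v = spc M v" if U: "submodule Q M U" and ne: "U v ~= {0}" for U v
 proof -
  obtain x where x: "x : U v" "x ~= 0" using ne U0[OF U, of v] by blast
  have "spc M v <= U v"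
   unfolding dim_1_span[OF rep_fd[OF M] dM submodule_mem[OF U x(1)] x(2)]
   using x(1) by (intro cv.span_minimal submodule_subspace[OF U]) simp
  thus ?thesis using submodule_subset[OF U, of v] by blast
 qed
 have Mne: "spc M v ~= {0}" for v
 proof
  assume "spc M v = {0}"
  thus False using dM[of v] by (simp add: dim_zero)
 qed
 have ziff: "U v = {0} \<longleftrightarrow> cv.dim (U v) = 0" if U: "submodule Q M U" for U v
 proof
  assume d: "cv.dim (U v) = 0"
  show "U v = {0}"
  proof (rule ccontr)
   assume "U v ~= {0}"
   from full[OF U this] d dM[of v] show False by simp
  qed
 qed (simp add: dim_zero)
 have acw: "U (w q) = {0} \<longleftrightarrow> U (w (q + 1)) = {0}" if U: "submodule Q M U" and b: "acwbij (subrep M U)" and q: "~ cw q" for U q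
  using acwbij_dim[OF b q] unfolding ziff[OF U] by simp
 have vM: "vanishing Q M a \<longleftrightarrow> a = e q1" for a
 proof -
  obtain q where q: "a = e q" using e_surj by blast
  show ?thesis
  proof (cases "cw q")
   case False
   thus ?thesis using acwbij_not_vanishing[OF Mb False dM] xi(1) cw_cong[of q q1] by (auto simp: q e_eq)
  next
   case True
   have "spc M (w q1) = cv.span {xi q1}" by (rule dim_1_span[OF rep_fd[OF M] dM xi(2,4)])
   hence "vanishing Q M (e q1)"
    using xi(3)[of q1] xi(1,5,6) rep_act_scale[OF M, of "xi q1" "e q1"] xi(2)[of q1]
    by (auto simp: vanishing_def src_e step_def cv.span_singleton)
   moreover have "w q = w q1" if v: "vanishing Q M (e q)"
   proof -
    obtain x where x: "x : spc M (w q)" "x ~= 0" using Mne[of "w q"] U0[OF submodule_full[OF M], of "w q"] by blast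
    thus ?thesis using string_kernel[OF M nc sb x(1) True _ x(2)] v True by (simp add: vanishing_def src_e)
   qed
   moreover have "e q = e q1 \<longleftrightarrow> w q = w q1" by (simp add: e_eq w_eq)
   ultimately show ?thesis unfolding q by metis
  qed
 qed
 have arrow: "U (tgt Q a) ~= {0}" if U: "submodule Q M U" and a: "a ~= e q1" "U (src Q a) ~= {0}" for U a
 proof -
  obtain x where x: "x : U (src Q a)" "x ~= 0" using a(2) U0[OF U, of "src Q a"] by blast
  have "act M a x ~= 0" using vM[of a] a(1) by (intro one_dim_not_vanishing[OF M dM _ submodule_mem[OF U x(1)] x(2)]) simp
  thus ?thesis using submodule_act[OF U x(1)] by auto
 qed
 have k01: "w k0 = w q1" using string_kernel[OF M nc sb yM E(3) ay y(2)] by blast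
 have f2: "w q : F2 \<longleftrightarrow> w q = w q1" if "cw q" for q
  using blk_dim[OF blk1 that] k01 unfolding F2_def mem_Collect_eq ziff[OF C1] by simp
 have Cpb: "acwbij (subrep M (C (p - 1)))" using ch[of "p - 1"] p by simp
 have "EX S f k. blk k S & rep_hom Q M S f & rep_surj M S f & (ALL v. {x : spc M v. f v x = 0} = C (p - 1) v)"
 proof -
  have "ALL i<p. p - 1 <= i --> (EX S f k. blk k S & rep_hom Q (subrep M (C (Suc i))) S f & rep_surj (subrep M (C (Suc i))) S f &
   (ALL v. {x : C (Suc i) v. f v x = 0} = C i v))" using ch[of "p - 1"] by simp
  then obtain S f k where "blk k S & rep_hom Q (subrep M (C (Suc (p - 1)))) S f & rep_surj (subrep M (C (Suc (p - 1)))) S f &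
   (ALL v. {x : C (Suc (p - 1)) v. f v x = 0} = C (p - 1) v)" using p by (meson diff_less order_refl zero_less_one order_less_trans)
  moreover have "C (Suc (p - 1)) = spc M" using C p by (simp add: quasi_chain_def)
  ultimately show ?thesis by auto
 qed
 then obtain S f k1 where S: "blk k1 S" "rep_hom Q M S f" "rep_surj M S f" "!!v. {x : spc M v. f v x = 0} = C (p - 1) v" by blast
 have dS: "v : F1 \<longleftrightarrow> cv.dim (spc S v) = 1" for v
 proof -
  have "cv.dim (spc M v) = cv.dim (C (p - 1) v) + cv.dim (spc S v)"
   using fd_rank_nullity[OF rep_fd[OF M] hom_linear[OF S(2)], of v] S(3,4) by (simp add: rep_surj_def)
  thus ?thesis using dM[of v] unfolding F1_def mem_Collect_eq ziff[OF Cp] by auto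
 qed
 have F1cw: "w q = w k1" if "cw q" "w q : F1" for q
  using blk_dim[OF S(1) that(1)] that(2) unfolding dS by (cases "w q = w k1") simp_all
 have F12: "F1 \<inter> F2 = {}" using C1p U0[OF C1] by (fastforce simp: F1_def F2_def)
 have acw1: "w q : F1 \<longleftrightarrow> w (q + 1) : F1" if "~ cw q" for q using acw[OF Cp Cpb that] by (simp add: F1_def)
 have acw2: "w q : F2 \<longleftrightarrow> w (q + 1) : F2" if "~ cw q" for q using acw[OF C1 blk_acwbij[OF blk1] that] by (simp add: F2_def)
 have q1F: "w q1 : F2" "w q1 ~: F1" using f2[OF xi(1)] F12 by auto
 have f1: "w (q + 1) : F1 \<longleftrightarrow> w q = w q1" if q: "cw q" for q
 proof
  assume a: "w (q + 1) : F1"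
  show "w q = w q1"
  proof (rule ccontr)
   assume ne: "w q ~= w q1"
   have "w q : F1"
   proof (rule ccontr)
    assume "w q ~: F1"
    hence "C (p - 1) (w (q + 1)) ~= {0}" using arrow[OF Cp, of "e q"] ne q by (simp add: F1_def e_eq w_eq src_e tgt_e)
    thus False using a by (simp add: F1_def)
   qed
   hence qk: "w q = w k1" by (rule F1cw[OF q])
   \<comment> \<open>\<open>F1\<close> would be entered through the edge at its own end, continue
     around the whole cycle and contain \<open>w q1\<close>.\<close>
   have "w (q + 1 + int j) : F1" for j
   proof (induction j)
    case 0 thus ?case using a by simp
   next
    case (Suc j)
    let ?t = "q + 1 + int j"
    have "w (?t + 1) : F1"
    proof (cases "cw ?t")
     case False thus ?thesis using acw1[OF False] Suc by simp
    next
     case True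
     hence "w ?t = w q" using F1cw[OF True Suc] qk by simp
     thus ?thesis using w_add[of ?t q 1] a by simp
    qed
    thus ?case by (simp add: algebra_simps)
   qed
   thus False using w_reach_right[of "q + 1" q1] q1F(2) by metis
  qed
 next
  assume q: "w q = w q1"
  show "w (q + 1) : F1"
  proof (rule ccontr)
   assume "w (q + 1) ~: F1"
   hence 0: "w (q1 + 1) ~: F1" using w_add[OF q, of 1] by simp
   \<comment> \<open>Starting outside \<open>F1\<close> one never enters it: the clockwise arrows
     other than \<open>e q1\<close> are injective, so \<open>C (p - 1)\<close> stays nonzero across
     them. Then \<open>F1\<close> would be empty, although the top of the chain is a block.\<close>
   have "w (q1 + 1 + int j) ~: F1" for j
   proof (induction j)
    case (Suc j)
    let ?t = "q1 + 1 + int j"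
    have "w (?t + 1) ~: F1"
    proof (cases "cw ?t")
     case False thus ?thesis using acw1[OF False] Suc by simp
    next
     case True
     show ?thesis
     proof (cases "w ?t = w q1")
      case True thus ?thesis using 0 w_add[OF True, of 1] by simp
     next
      case False
      thus ?thesis using arrow[OF Cp, of "e ?t"] Suc True by (simp add: F1_def e_eq w_eq src_e tgt_e)
     qed
    qed
    thus ?case by (simp add: algebra_simps)
   qed (simp add: 0)
   hence none: "w q ~: F1" for q using w_reach_right[of "q1 + 1" q] by metis
   have "cv.dim (spc S (w k1)) = 1" using blk_dim[OF S(1) blk_cw[OF S(1)]] by simp
   thus False using none dS by blast
  qed
 qed
 have eb: "end_blocks q1 F1 F2" unfolding end_blocks_def using xi(1) F12 acw1 f1 acw2 f2 by blast
 obtain g where g: "rep_hom Q (subrep M (C (p - 1))) N g" "rep_surj (subrep M (C (p - 1))) N g"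
   "!!v. {x : C (p - 1) v. g v x = 0} = C 1 v" and Nr: "is_rep Q N"
  using N unfolding is_quotient_def by auto
 have dN: "cv.dim (spc N v) = of_bool (v ~: F1 \<union> F2)" for v
 proof -
  have "cv.dim (C (p - 1) v) = cv.dim (C 1 v) + cv.dim (spc N v)"
   using fd_rank_nullity[OF rep_fd[OF is_rep_subrep[OF M Cp]] hom_linear[OF g(1)], of v] g(2,3) by (simp add: rep_surj_def)
  moreover have "cv.dim (C (p - 1) v) = of_bool (v ~: F1)" using full[OF Cp, of v] dM[of v] by (cases "C (p - 1) v = {0}") (simp_all add: F1_def dim_zero)
  moreover have "cv.dim (C 1 v) = of_bool (v : F2)" using full[OF C1, of v] dM[of v] by (cases "C 1 v = {0}") (simp_all add: F2_def dim_zero)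
  ultimately show ?thesis using F12 by (cases "v : F1"; cases "v : F2") auto
 qed
 have vN: "~ vanishing Q N a" if a: "src Q a ~: F1 \<union> F2" "tgt Q a ~: F1 \<union> F2" for a
 proof
  assume v: "vanishing Q N a"
  have "C (p - 1) (src Q a) ~= {0}" using a by (simp add: F1_def)
  then obtain x where x: "x : C (p - 1) (src Q a)" "x ~= 0" using U0[OF Cp, of "src Q a"] by blast
  have "a ~= e q1" using a(1) q1F(1) xi(1) by (auto simp: src_e)
  hence "act M a x ~= 0" using vM[of a] by (intro one_dim_not_vanishing[OF M dM _ submodule_mem[OF Cp x(1)] x(2)]) simp
  moreover have "g (tgt Q a) (act M a x) = 0"
   using hom_commute[OF g(1), of x a] hom_mem[OF g(1), of x "src Q a"] x(1) v by (simp add: vanishing_def)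
  hence "act M a x : C 1 (tgt Q a)" using g(3)[of "tgt Q a"] submodule_act[OF Cp x(1)] by blast
  ultimately show False using a(2) by (auto simp: F2_def)
 qed
 show ?thesis by (intro exI[of _ q1] exI[of _ F1] exI[of _ F2] conjI eb allI impI dM vM dN vN)
qed

end

section \<open>Euler characteristics of points\<close>

lemma group_rank_trivial:
 assumes "comm_group G" "trivial_group G" shows "group_rank G = 0"
proof -
 interpret comm_group G by fact
 let ?P = "%B. finite B & B <= carrier G &
   (ALL c :: 'a => int. finprod G (%b. b [^]\<^bsub>G\<^esub> c b) B = \<one>\<^bsub>G\<^esub> --> (ALL b:B. c b = 0))"
 have emp: "B = {}" if B: "?P B" for B
 proof -
  have ind: "finprod G (%b. b [^]\<^bsub>G\<^esub> c b) B = \<one>\<^bsub>G\<^esub> --> (ALL b:B. c b = 0)" for c :: "'a => int"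
   by (rule spec[OF conjunct2[OF conjunct2[OF B]]])
  have "B <= {\<one>\<^bsub>G\<^esub>}" using B assms(2) by (simp add: trivial_group_def)
  hence "finprod G (%b. b [^]\<^bsub>G\<^esub> (1::int)) B = \<one>\<^bsub>G\<^esub>" by (intro finprod_one_eqI) (auto simp: int_pow_one)
  hence "ALL b:B. (1::int) = 0" using ind[of "%_. 1"] by simp
  thus ?thesis by auto
 qed
 have "{card B |B. ?P B} = {0}"
 proof (intro equalityI subsetI)
  fix k assume "k : {card B |B. ?P B}"
  then obtain B where "k = card B" "?P B" by (elim CollectE exE conjE) (rule that, assumption, intro conjI)
  thus "k : {0}" using emp[of B] by simp
 next
  fix k :: nat assume "k : {0}"
  thus "k : {card B |B. ?P B}" by (intro CollectI exI[of _ "{}"]) simp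
 qed
 thus ?thesis by (simp add: group_rank_def)
qed

lemma group_rank_infinite_cyclic:
 assumes "comm_group G" and iso: "(%k::int. g [^]\<^bsub>G\<^esub> k) : iso integer_group G" and g: "g : carrier G"
 shows "group_rank G = 1"
proof -
 interpret comm_group G by fact
 let ?P = "%B. finite B & B <= carrier G &
   (ALL c :: 'a => int. finprod G (%b. b [^]\<^bsub>G\<^esub> c b) B = \<one>\<^bsub>G\<^esub> --> (ALL b:B. c b = 0))"
 have inj: "inj (%k::int. g [^]\<^bsub>G\<^esub> k)" and surj: "carrier G = range (%k::int. g [^]\<^bsub>G\<^esub> k)"
  using iso by (auto simp: iso_def bij_betw_def)
 have z: "k = 0" if "g [^]\<^bsub>G\<^esub> (k::int) = \<one>\<^bsub>G\<^esub>" for k using injD[OF inj, of k 0] that by simp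
 have le: "card B <= 1" if B: "?P B" for B
 proof (rule ccontr)
  have ind: "finprod G (%b. b [^]\<^bsub>G\<^esub> c b) B = \<one>\<^bsub>G\<^esub> --> (ALL b:B. c b = 0)" for c :: "'a => int"
   by (rule spec[OF conjunct2[OF conjunct2[OF B]]])
  assume "~ card B <= 1"
  hence "~ (ALL x:B. ALL y:B. x = y)" using B card_le_Suc0_iff_eq[of B] by simp
  then obtain x y where xy: "x : B" "y : B" "x ~= y" by blast
  have xc: "x : carrier G" "y : carrier G" using B xy by auto
  obtain m k :: int where mk: "x = g [^]\<^bsub>G\<^esub> m" "y = g [^]\<^bsub>G\<^esub> k" using xc unfolding surj by blast
  \<comment> \<open>With \<open>x\<close> the \<open>m\<close>-th and \<open>y\<close> the
    \<open>k\<close>-th power of \<open>g\<close>, the \<open>k\<close>-th power of \<open>x\<close>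
    times the \<open>- m\<close>-th power of \<open>y\<close> is 1: a nontrivial relation.\<close>
  define c where "c b = (if b = x then k else if b = y then - m else 0)" for b
  have Bxy: "B = insert x (insert y (B - {x, y}))" using xy by blast
  have fB: "finite (B - {x, y})" "B - {x, y} <= carrier G" using B by auto
  have one: "finprod G (%b. b [^]\<^bsub>G\<^esub> c b) (B - {x, y}) = \<one>\<^bsub>G\<^esub>" by (rule finprod_one_eqI) (auto simp: c_def)
  have cl: "(%b. b [^]\<^bsub>G\<^esub> c b) : B - {x, y} \<rightarrow> carrier G" using fB(2) by auto
  have "finprod G (%b. b [^]\<^bsub>G\<^esub> c b) (insert y (B - {x, y})) = y [^]\<^bsub>G\<^esub> (- m)"
   using finprod_insert[OF fB(1) _ cl, of y] xc xy(3) one by (simp add: c_def)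
  moreover have "finprod G (%b. b [^]\<^bsub>G\<^esub> c b) (insert x (insert y (B - {x, y}))) =
    x [^]\<^bsub>G\<^esub> k \<otimes>\<^bsub>G\<^esub> finprod G (%b. b [^]\<^bsub>G\<^esub> c b) (insert y (B - {x, y}))"
   using finprod_insert[of "insert y (B - {x, y})" x "%b. b [^]\<^bsub>G\<^esub> c b"] fB cl xc xy(3) by (simp add: c_def Pi_def)
  ultimately have "finprod G (%b. b [^]\<^bsub>G\<^esub> c b) B = x [^]\<^bsub>G\<^esub> k \<otimes>\<^bsub>G\<^esub> y [^]\<^bsub>G\<^esub> (- m)"
   using arg_cong[OF Bxy, of "finprod G (%b. b [^]\<^bsub>G\<^esub> c b)"] by simp
  also have "... = g [^]\<^bsub>G\<^esub> (m * k) \<otimes>\<^bsub>G\<^esub> g [^]\<^bsub>G\<^esub> (k * - m)" unfolding mk using g by (simp only: int_pow_pow)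
  also have "... = \<one>\<^bsub>G\<^esub>" using int_pow_mult[OF g, of "m * k" "k * - m", symmetric] by simp
  finally have "ALL b:B. c b = 0" by (rule mp[OF ind])
  hence "k = 0" "m = 0" using xy by (auto simp: c_def)
  thus False using mk xy(3) by simp
 qed
 have "Sup {card B |B. ?P B} = 1"
 proof (rule cSup_eq_maximum)
  have "?P {g}" using g z by simp
  thus "1 : {card B |B. ?P B}" by (intro CollectI exI[of _ "{g}"] conjI) auto
  show "k <= 1" if k: "k : {card B |B. ?P B}" for k
  proof -
   obtain B where "k = card B" "?P B" using k by (elim CollectE exE conjE) (rule that, assumption, intro conjI)
   thus ?thesis using le[of B] by simp
  qed
 qed
 thus ?thesis by (simp add: group_rank_def)
qed

lemma euler_char_empty:
 assumes "topspace X = {}" shows "euler_char X = 0"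
proof -
 have "betti k X = 0" for k
  unfolding betti_def by (rule group_rank_trivial[OF abelian_homology_group trivial_homology_group_empty[OF assms]])
 thus ?thesis by (simp add: euler_char_def)
qed

lemma euler_char_point:
 assumes X: "topspace X = {a}" shows "euler_char X = 1"
proof -
 let ?f = "restrict (%x. a) (standard_simplex 0)"
 have f: "singular_simplex 0 X ?f" using singular_simplex_singleton[OF X, of 0 ?f] by simp
 have "path_connected_space X" using X by (auto simp: path_connected_space_def pathin_def intro!: exI[of _ "%t. a"])
 from iso_integer_zeroth_homology_group[OF this f]
 have "group_rank (homology_group 0 X) = 1"
 proof (rule group_rank_infinite_cyclic[OF abelian_homology_group])
  have "singular_relcycle 0 X {} (frag_of ?f)" by (simp add: chain_boundary_def f singular_chain_of singular_cycle)
  thus "homologous_rel_set 0 X {} (frag_of ?f) : carrier (homology_group 0 X)" by (simp add: carrier_relative_homology_group_0)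
 qed
 hence "betti k X = of_bool (k = 0)" for k
  using group_rank_trivial[OF abelian_homology_group homology_dimension_axiom[OF X], of "int k"] by (cases "k = 0") (simp_all add: betti_def)
 thus ?thesis by (simp add: euler_char_def)
qed

section \<open>Quiver Grassmannians of thin representations\<close>

lemma topspace_grassmannian:
 assumes V: "fd_space V"
 shows "topspace (grassmannian n V) = {U. cv.subspace U & U <= V & cv.dim U = n}"
proof -
 have fr: "topspace (frames n V) = {b : {..<n} \<rightarrow>\<^sub>E V. cv.dim (b ` {..<n}) = n}" by (auto simp: frames_def)
 have "topspace (grassmannian n V) = frame_span n ` topspace (frames n V)"
  using quotient_imp_surjective_map[OF quotient_map_frame_span] by metis
 also have "... = {U. cv.subspace U & U <= V & cv.dim U = n}"
 proof (intro equalityI subsetI)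
  fix U assume "U : frame_span n ` topspace (frames n V)"
  then obtain b where b: "b : {..<n} \<rightarrow>\<^sub>E V" "cv.dim (b ` {..<n}) = n" "U = cv.span (b ` {..<n})"
   unfolding fr frame_span_def by blast
  have "b ` {..<n} <= V" using b(1) by auto
  hence "U <= V" unfolding b(3) by (rule cv.span_minimal[OF _ fd_subspace[OF V]])
  thus "U : {U. cv.subspace U & U <= V & cv.dim U = n}" using b(2,3) by simp
 next
  fix U assume U: "U : {U. cv.subspace U & U <= V & cv.dim U = n}"
  hence "fd_space U" using fd_sub(1)[OF V] by blast
  then obtain B where B: "finite B" "B <= U" "cv.independent B" "cv.span B = U" "card B = cv.dim U" by (rule fd_basis)
  obtain h where "bij_betw h {0..<card B} B" using ex_bij_betw_nat_finite[OF B(1)] by blast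
  hence h: "h ` {..<n} = B" using B(5) U by (simp add: bij_betw_def atLeast0LessThan)
  have i: "restrict h {..<n} ` {..<n} = B" using h by simp
  moreover have "restrict h {..<n} : {..<n} \<rightarrow>\<^sub>E V" using h B(2) U by auto
  moreover have "cv.dim B = n" using B(3,5) U by (simp add: cv.dim_eq_card_independent)
  ultimately have "restrict h {..<n} : topspace (frames n V)" unfolding fr by simp
  moreover have "U = frame_span n (restrict h {..<n})" unfolding frame_span_def i using B(4) by simp
  ultimately show "U : frame_span n ` topspace (frames n V)" by blast
 qed
 finally show ?thesis .
qed

definition closed_set :: "('v, 'a) quiver => ('v, 'a) quiver_rep => 'v set => bool" where
 "closed_set Q M A \<longleftrightarrow> (ALL a. ~ vanishing Q M a --> src Q a : A --> tgt Q a : A)"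

lemma euler_char_thin:
 fixes Q :: "('v::finite, 'a) quiver"
 assumes M: "is_rep Q M" and d: "!!v. cv.dim (spc M v) = of_bool (v : S)" and A: "A <= S"
 shows "euler_char (quiver_grassmannian Q (%v. of_bool (v : A)) M) = of_bool (closed_set Q M A)"
proof -
 define U where "U v = (if v : A then spc M v else {0})" for v
 let ?G = "quiver_grassmannian Q (%v. of_bool (v : A)) M"
 have M0: "0 : spc M v" for v by (rule cv.subspace_0[OF rep_subspace[OF M]])
 have dU: "W v = U v" if "cv.subspace (W v)" "W v <= spc M v" "cv.dim (W v) = of_bool (v : A)" for W v
 proof (cases "v : A")
  case True
  hence "cv.dim (spc M v) <= cv.dim (W v)" using that(3) A d[of v] by auto
  thus ?thesis using fd_eq[OF rep_fd[OF M] that(1,2)] True by (simp add: U_def)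
 next
  case False
  thus ?thesis using fd_dim_0[OF fd_sub(1)[OF rep_fd[OF M] that(1,2)]] that(3) by (simp add: U_def)
 qed
 have top: "topspace ?G = {W. (ALL v. cv.subspace (W v) & W v <= spc M v & cv.dim (W v) = of_bool (v : A)) & submodule Q M W}"
  by (auto simp: quiver_grassmannian_def topspace_grassmannian[OF rep_fd[OF M]] PiE_iff)
 have Ud: "cv.dim (U v) = of_bool (v : A)" for v using d[of v] A by (auto simp: U_def dim_zero)
 have sub: "submodule Q M U \<longleftrightarrow> closed_set Q M A"
 proof
  assume U: "submodule Q M U"
  show "closed_set Q M A"
   unfolding closed_set_def
  proof (intro allI impI)
   fix a assume a: "~ vanishing Q M a" "src Q a : A"
   then obtain x where x: "x : spc M (src Q a)" "act M a x ~= 0" by (auto simp: vanishing_def)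
   have "act M a x : U (tgt Q a)" by (rule submodule_act[OF U]) (simp add: U_def a(2) x(1))
   thus "tgt Q a : A" using x(2) by (auto simp: U_def split: if_splits)
  qed
 next
  assume c: "closed_set Q M A"
  show "submodule Q M U"
  proof (rule submoduleI)
   show "cv.subspace (U v)" for v using rep_subspace[OF M] by (simp add: U_def)
   show "x : spc M v" if "x : U v" for v x using that M0 by (auto simp: U_def split: if_splits)
   show "act M a x : U (tgt Q a)" if x: "x : U (src Q a)" for a x
   proof (cases "src Q a : A & ~ vanishing Q M a")
    case True
    thus ?thesis using c x rep_act_mem[OF M, of x a] by (simp add: U_def closed_set_def)
   next
    case False
    hence "act M a x = 0" using x rep_act_0[OF M] by (cases "src Q a : A") (auto simp: U_def vanishing_def)
    thus ?thesis using M0 by (simp add: U_def)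
   qed
  qed
 qed
 have "topspace ?G = (if closed_set Q M A then {U} else {})"
 proof -
  have 1: "W = U" if "W : topspace ?G" for W using that dU[of W] unfolding top by (auto simp: fun_eq_iff)
  have "cv.subspace (U v)" "U v <= spc M v" for v using M0 by (simp_all add: U_def rep_subspace[OF M])
  hence 2: "U : topspace ?G \<longleftrightarrow> closed_set Q M A" unfolding top using Ud sub by simp
  have "W : topspace ?G \<longleftrightarrow> W : (if closed_set Q M A then {U} else {})" for W using 1[of W] 2 by auto
  thus ?thesis by (rule Set.set_eqI)
 qed
 thus ?thesis using euler_char_point[of ?G U] euler_char_empty[of ?G] by (auto split: if_splits)
qed

definition CC_monomial :: "('v::finite, 'a::finite) quiver => 'v set => 'v set => 'v laurent" where
 "CC_monomial Q A S = (PROD i:UNIV. u_pow i (- euler_form Q (%v. of_bool (v : A)) (basis_vec i)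
   - euler_form Q (basis_vec i) (%v. of_bool (v : S) - of_bool (v : A))))"

lemma CC_thin:
 fixes Q :: "('v::finite, 'a::finite) quiver"
 assumes M: "is_rep Q M" and d: "!!v. cv.dim (spc M v) = of_bool (v : S)"
 shows "CC Q M = (SUM A | A <= S & closed_set Q M A. CC_monomial Q A S)"
proof -
 let ?e = "%A v. of_bool (v : A) :: nat"
 let ?t = "%e. of_int (euler_char (quiver_grassmannian Q e M)) *
   (PROD i:UNIV. u_pow i (- euler_form Q (%v. int (e v)) (basis_vec i)
     - euler_form Q (basis_vec i) (%v. int (dim_vec M v) - int (e v))))"
 have inj: "inj_on ?e {A. A <= S}" by (rule inj_onI) (auto simp: fun_eq_iff of_bool_def split: if_splits)
 have "{e. ALL v. e v <= dim_vec M v} = ?e ` {A. A <= S}"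
 proof (intro equalityI subsetI)
  fix e assume "e : {e. ALL v. e v <= dim_vec M v}"
  hence e: "e v <= of_bool (v : S)" for v by (simp add: dim_vec_def d)
  have e1: "e v = of_bool (e v = 1)" and "e v = 1 ==> v : S" for v using e[of v] by (cases "v : S"; simp)+
  hence "e = ?e {v. e v = 1}" "{v. e v = 1} <= S" by (auto simp: fun_eq_iff)
  thus "e : ?e ` {A. A <= S}" by blast
 qed (auto simp: dim_vec_def d)
 hence "CC Q M = (SUM A | A <= S. ?t (?e A))" unfolding CC_def by (simp add: sum.reindex[OF inj])
 also have "... = (SUM A | A <= S. if closed_set Q M A then CC_monomial Q A S else 0)"
  by (rule sum.cong[OF refl]) (simp add: euler_char_thin[OF M d] CC_monomial_def dim_vec_def d)
 also have "... = (SUM A | A <= S & closed_set Q M A. CC_monomial Q A S)"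
  using sum.inter_filter[of "{A. A <= S}" "%A. CC_monomial Q A S" "closed_set Q M"] by simp
 finally show ?thesis .
qed

section \<open>The difference property\<close>

lemma euler_form_basis_right: "euler_form Q x (basis_vec i) = x i - (SUM a | tgt Q a = i. x (src Q a))"
proof -
 have "(SUM a:UNIV. x (src Q a) * basis_vec i (tgt Q a)) = (SUM a:UNIV. if tgt Q a = i then x (src Q a) else 0)"
  by (rule sum.cong) (auto simp: basis_vec_def)
 thus ?thesis by (simp add: euler_form_def basis_vec_def sum.If_cases)
qed

lemma euler_form_basis_left: "euler_form Q (basis_vec i) x = x i - (SUM a | src Q a = i. x (tgt Q a))"
proof -
 have "(SUM a:UNIV. basis_vec i (src Q a) * x (tgt Q a)) = (SUM a:UNIV. if src Q a = i then x (tgt Q a) else 0)"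
  by (rule sum.cong) (auto simp: basis_vec_def)
 thus ?thesis by (simp add: euler_form_def basis_vec_def sum.If_cases)
qed

context cyclic_quiver
begin

text \<open>An instance of the Auslander-Reiten formula <x, y> = - <y, tau x>: the last block is the
  quasi-socle \<open>E\<close>, and the top of a module of quasi-length \<open>p\<close> over it is
  its translate. Here it is read off from the two edges at each vertex.\<close>

lemma end_blocks_euler_form:
 assumes b: "end_blocks k F1 F2"
 shows "euler_form Q (%v. of_bool (v : F2)) (basis_vec i) + euler_form Q (basis_vec i) (%v. of_bool (v : F1)) = 0"
proof -
 obtain q where q: "i = w q" using w_surj by blast
 have k: "cw k" using b by (simp add: end_blocks_def)
 have f1: "cw q ==> w (q + 1) : F1 \<longleftrightarrow> w q = w k" "~ cw q ==> w (q + 1) : F1 \<longleftrightarrow> w q : F1"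
  and f2: "cw q ==> w q : F2 \<longleftrightarrow> w q = w k" "~ cw q ==> w (q + 1) : F2 \<longleftrightarrow> w q : F2" for q
  using b by (auto simp: end_blocks_def)
 have wk: "w q = w k ==> cw q" for q using k cw_cong[of q k] by (simp add: w_eq)
 show ?thesis
  unfolding q euler_form_basis_right euler_form_basis_left sum_arrows_from sum_arrows_to
  using f1[of q] f2[of q] f1[of "q - 1"] f2[of "q - 1"] wk[of q] wk[of "q - 1"]
  by (cases "cw q"; cases "cw (q - 1)") (auto simp: src_e tgt_e)
qed

lemma CC_monomial_shift:
 assumes b: "end_blocks k F1 F2" and B: "B \<inter> (F1 \<union> F2) = {}"
 shows "CC_monomial Q (B \<union> F2) UNIV = CC_monomial Q B (- (F1 \<union> F2))"
proof -
 have F12: "F1 \<inter> F2 = {}" using b by (simp add: end_blocks_def)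
 have 1: "(%v. of_bool (v : B \<union> F2)) = (%v. of_bool (v : B) + of_bool (v : F2) :: int)" using B by (auto simp: fun_eq_iff)
 have 2: "(%v. of_bool (v : UNIV) - of_bool (v : B \<union> F2)) =
   (%v. (of_bool (v : - (F1 \<union> F2)) - of_bool (v : B)) + of_bool (v : F1) :: int)"
  using B F12 by (auto simp: fun_eq_iff)
 have "- euler_form Q (%v. of_bool (v : B \<union> F2)) (basis_vec i) - euler_form Q (basis_vec i) (%v. of_bool (v : UNIV) - of_bool (v : B \<union> F2)) =
  - euler_form Q (%v. of_bool (v : B)) (basis_vec i) - euler_form Q (basis_vec i) (%v. of_bool (v : - (F1 \<union> F2)) - of_bool (v : B))" for i
  unfolding 1 2 using end_blocks_euler_form[OF b, of i]
  by (simp add: euler_form_basis_right euler_form_basis_left sum.distrib)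
 thus ?thesis by (simp only: CC_monomial_def)
qed

theorem CC_difference:
 assumes b: "end_blocks k F1 F2"
  and M: "is_rep Q M" "!!v. cv.dim (spc M v) = 1" "!!a. vanishing Q M a \<longleftrightarrow> a = e k"
  and N: "is_rep Q N" "!!v. cv.dim (spc N v) = of_bool (v ~: F1 \<union> F2)"
   "!!a. src Q a ~: F1 \<union> F2 ==> tgt Q a ~: F1 \<union> F2 ==> ~ vanishing Q N a"
  and L: "is_rep Q L" "!!v. cv.dim (spc L v) = 1" "!!A. closed_set Q L A \<longleftrightarrow> (ALL a. src Q a : A --> tgt Q a : A)"
 shows "CC Q M = CC Q L + CC Q N"
proof -
 have k: "cw k" and F12: "F1 \<inter> F2 = {}" using b by (simp_all add: end_blocks_def)
 have f1: "cw q ==> w (q + 1) : F1 \<longleftrightarrow> w q = w k" "~ cw q ==> w q : F1 \<longleftrightarrow> w (q + 1) : F1"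
  and f2: "cw q ==> w q : F2 \<longleftrightarrow> w q = w k" "~ cw q ==> w q : F2 \<longleftrightarrow> w (q + 1) : F2" for q
  using b by (auto simp: end_blocks_def)
 let ?S = "- (F1 \<union> F2)"
 let ?X = "{A. closed_set Q L A}" and ?Y = "{B. B <= ?S & closed_set Q N B}"
 have kF: "w k : F2" "w k ~: F1" "w (k + 1) : F1" "w (k + 1) ~: F2" using f1(1)[OF k] f2(1)[OF k] F12 by auto
 have cM: "closed_set Q M A \<longleftrightarrow> (ALL a. a ~= e k --> src Q a : A --> tgt Q a : A)" for A by (simp add: closed_set_def M(3))
 have sp: "{A. closed_set Q M A} = ?X \<union> (%B. B \<union> F2) ` ?Y"
 proof (intro equalityI subsetI)
  fix A assume "A : {A. closed_set Q M A}"
  hence A: "!!a. a ~= e k ==> src Q a : A ==> tgt Q a : A" by (simp add: cM)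
  show "A : ?X \<union> (%B. B \<union> F2) ` ?Y"
  proof (cases "w k : A --> w (k + 1) : A")
   case True
   have "tgt Q a : A" if "src Q a : A" for a using A[of a] that True k by (cases "a = e k") (simp_all add: src_e tgt_e)
   thus ?thesis by (simp add: L(3))
  next
   case False
   have acw: "w q : A" if "~ cw q" "w (q + 1) : A" for q
   proof -
    have "e q ~= e k" using that(1) k cw_cong[of q k] by (auto simp: e_eq)
    thus ?thesis using A[of "e q"] that by (simp add: src_e tgt_e)
   qed
   have "w q : F2 --> w q : A" for q
   proof (induction q rule: acw_induct)
    case (1 q) thus ?case using False f2(1)[OF 1] by simp
   next
    case (2 q) thus ?case using f2(2)[OF 2(1)] acw[OF 2(1)] by simp
   qed
   hence "v : F2 ==> v : A" for v using w_surj[of v] by auto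
   hence F2A: "F2 <= A" by blast
   have "w q ~: F1 \<inter> A" for q
   proof
    assume q: "w q : F1 \<inter> A"
    \<comment> \<open>The only clockwise edge into \<open>F1\<close> starts at \<open>w k\<close>
      and ends at \<open>w (k + 1)\<close>, which is outside \<open>A\<close>. So the walk to the
      left would stay in \<open>F1\<close> for ever, although it must pass over
      \<open>w k\<close>.\<close>
    have "w (q - int j) : F1 \<inter> A" for j
    proof (induction j)
     case 0 thus ?case using q by simp
    next
     case (Suc j)
     let ?t = "q - int (Suc j)"
     have t: "?t + 1 = q - int j" by simp
     have "~ cw ?t"
     proof
      assume c: "cw ?t"
      hence "w ?t = w k" using f1(1)[OF c] Suc unfolding t by simp
      thus False using w_add[of ?t k 1] Suc False unfolding t by simp
     qed
     thus ?case using f1(2)[of ?t] acw[of ?t] Suc unfolding t by simp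
    qed
    thus False using w_reach_left[of q k] kF(2) by (metis IntD1)
   qed
   hence "v ~: F1 \<inter> A" for v using w_surj[of v] by auto
   hence F1A: "F1 \<inter> A = {}" by blast
   have "tgt Q a : A - F2" if a: "~ vanishing Q N a" "src Q a : A - F2" for a
   proof -
    have "a ~= e k" using a(2) k kF(1) by (auto simp: src_e)
    hence "tgt Q a : A" using A a(2) by blast
    moreover have "tgt Q a ~: F2"
    proof
     assume "tgt Q a : F2"
     hence "spc N (tgt Q a) = {0}" using N(2)[of "tgt Q a"] fd_dim_0[OF rep_fd[OF N(1)]] by simp
     thus False using a(1) rep_act_mem[OF N(1)] by (auto simp: vanishing_def)
    qed
    ultimately show ?thesis by blast
   qed
   hence "A - F2 : ?Y" using F1A by (auto simp: closed_set_def)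
   moreover have "A = (A - F2) \<union> F2" using F2A by blast
   ultimately show ?thesis by blast
  qed
 next
  fix A assume "A : ?X \<union> (%B. B \<union> F2) ` ?Y"
  then consider "A : ?X" | B where "B : ?Y" "A = B \<union> F2" by blast
  thus "A : {A. closed_set Q M A}"
  proof cases
   case 1 thus ?thesis by (simp add: L(3) cM)
  next
   case 2
   have "tgt Q a : B \<union> F2" if a: "a ~= e k" "src Q a : B \<union> F2" for a
   proof -
    obtain q where q: "a = e q" using e_surj by blast
    have ne: "w q ~= w k" using a(1) by (simp add: q e_eq w_eq)
    show ?thesis
    proof (cases "src Q a : F2")
     case True
     thus ?thesis using f2[of q] ne by (cases "cw q") (simp_all add: q src_e tgt_e)
    next
     case False
     hence s: "src Q a : B" "src Q a ~: F1 \<union> F2" using a(2) 2(1) by auto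
     hence "tgt Q a ~: F1" using f1[of q] ne by (cases "cw q") (auto simp: q src_e tgt_e)
     thus ?thesis using N(3)[OF s(2)] 2(1) s(1) by (auto simp: closed_set_def)
    qed
   qed
   thus ?thesis using 2(2) by (simp add: cM)
  qed
 qed
 have disj: "?X \<inter> (%B. B \<union> F2) ` ?Y = {}"
 proof -
  have False if B: "B <= ?S" and c: "closed_set Q L (B \<union> F2)" for B
  proof -
   have "tgt Q (e k) : B \<union> F2" using c kF(1) k unfolding L(3) by (simp add: src_e)
   thus False using B kF(3,4) k by (auto simp: tgt_e)
  qed
  thus ?thesis by blast
 qed
 have inj: "inj_on (%B. B \<union> F2) ?Y" by (rule inj_onI) blast
 have "CC Q M = (SUM A:?X \<union> (%B. B \<union> F2) ` ?Y. CC_monomial Q A UNIV)"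
  using CC_thin[OF M(1), of UNIV] M(2) sp by simp
 also have "... = (SUM A:?X. CC_monomial Q A UNIV) + (SUM A:(%B. B \<union> F2) ` ?Y. CC_monomial Q A UNIV)"
  by (rule sum.union_disjoint[OF _ _ disj]) simp_all
 also have "(SUM A:?X. CC_monomial Q A UNIV) = CC Q L" using CC_thin[OF L(1), of UNIV] L(2) by simp
 also have "(SUM A:(%B. B \<union> F2) ` ?Y. CC_monomial Q A UNIV) = (SUM B:?Y. CC_monomial Q (B \<union> F2) UNIV)"
  by (rule sum.reindex_cong[OF inj refl refl])
 also have "... = (SUM B:?Y. CC_monomial Q B ?S)"
  by (rule sum.cong[OF refl CC_monomial_shift[OF b]]) blast
 also have "... = CC Q N" using CC_thin[OF N(1), of ?S] N(2) by simp
 finally show ?thesis .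
qed

end

section \<open>Homogeneous tubes, and the difference property in a tube of strings\<close>

context cyclic_tube
begin

text \<open>For \<open>p = 1\<close> there is a single clockwise arrow, and it acts as zero. A
  closed set respects it nevertheless: walking left from its source along the anticlockwise arrows,
  once around the cycle, one arrives at its target.\<close>

lemma blk_homogeneous:
 assumes L: "quasi_simple Q L" "L : T" and q: "cw q" "x : spc L (w q)" "x ~= 0" "act L (e q) x = 0" and p: "p = 1"
 shows "cv.dim (spc L v) = 1 & (closed_set Q L A \<longleftrightarrow> (ALL a. src Q a : A --> tgt Q a : A))"
proof -
 have b: "blk q L" by (rule tube_quasi_simple_blk[OF L q])
 have "card (w ` {q. cw q}) = 1" using blk_tube(2)[OF b L(2)] p by simp
 then obtain v0 where "w ` {q. cw q} = {v0}" by (rule card_1_singletonE)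
 hence one: "w t = w t'" if "cw t" "cw t'" for t t' using that by (metis imageI mem_Collect_eq singletonD)
 have "cv.dim (spc L (w t)) = 1" for t
 proof (induction t rule: acw_induct)
  case (1 t) thus ?case using blk_dim[OF b 1] one[OF 1 q(1)] by simp
 next
  case (2 t) thus ?case using acwbij_dim[OF blk_acwbij[OF b] 2(1)] by simp
 qed
 hence d: "cv.dim (spc L v) = 1" for v using w_surj by metis
 have "tgt Q a : A" if c: "closed_set Q L A" and s: "src Q a : A" for a
 proof -
  have acw: "w t : A" if "~ cw t" "w (t + 1) : A" for t
   using c acwbij_not_vanishing[OF blk_acwbij[OF b] that(1) d] that by (auto simp: closed_set_def src_e tgt_e)
  obtain t where t: "a = e t" using e_surj by blast
  show ?thesis
  proof (cases "cw t")
   case False thus ?thesis using s acw by (simp add: t src_e tgt_e)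
  next
   case True
   have "w (t - int j) : A" for j
   proof (induction j)
    case 0 thus ?case using s True by (simp add: t src_e)
   next
    case (Suc j)
    let ?t = "t - int (Suc j)"
    show ?case
    proof (cases "cw ?t")
     case cw: True thus ?thesis using one[OF cw True] s True by (simp add: t src_e)
    next
     case False thus ?thesis using acw[OF False] Suc by simp
    qed
   qed
   thus ?thesis using w_reach_left[of t "t + 1"] True by (metis t tgt_e)
  qed
 qed
 thus ?thesis using d by (auto simp: closed_set_def)
qed

theorem killed_arrow:
 assumes "X : T"
 obtains "allbij X" | q x where "cw q" "x : spc X (w q)" "x ~= 0" "act X (e q) x = 0"
 | q x where "~ cw q" "x : spc X (w (q + 1))" "x ~= 0" "act X (e q) x = 0"
proof (cases "ALL a. inj_on (act X a) (spc X (src Q a))")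
 case True thus ?thesis using that(1) T_inj_allbij[OF assms] by blast
next
 case False
 then obtain a where a: "~ inj_on (act X a) (spc X (src Q a))" by blast
 obtain q where q: "a = e q" using e_surj by blast
 have X: "is_rep Q X" by (rule T_rep[OF assms])
 obtain x where "x : spc X (src Q a)" "act X a x = 0" "x ~= 0"
  using a lft_inj_on_iff[OF rep_act[OF X] rep_subspace[OF X]] by blast
 thus ?thesis using that(2,3)[of q x] q by (cases "cw q") (simp_all add: src_e)
qed

theorem homogeneous_structure:
 assumes L: "quasi_simple Q L" "L : T" and p: "p = 1"
 shows "cv.dim (spc L v) = 1 & (closed_set Q L A \<longleftrightarrow> (ALL a. src Q a : A --> tgt Q a : A))"
proof (rule killed_arrow[OF L(2)])
 assume b: "allbij L"
 have d: "cv.dim (spc L v) = 1" for v by (rule allbij_quasi_simple[OF L b])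
 have "~ vanishing Q L a" for a
 proof
  assume v: "vanishing Q L a"
  have "spc L (tgt Q a) = act L a ` spc L (src Q a)" using b by (simp add: allbij_def bij_betw_def)
  also have "... <= {0}" using v by (auto simp: vanishing_def)
  finally have "spc L (tgt Q a) = {0}" using cv.subspace_0[OF rep_subspace[OF allbij_rep[OF b]], of "tgt Q a"] by blast
  thus False using d[of "tgt Q a"] by (simp add: dim_zero)
 qed
 thus ?thesis using d by (simp add: closed_set_def)
next
 fix q x assume "cw q" "x : spc L (w q)" "x ~= 0" "act L (e q) x = 0"
 from blk_homogeneous[OF L this p] show ?thesis .
next
 interpret F: cyclic_tube Q n "%q. w (- q)" "%q. e (- q - 1)" "%q. ~ cw (- q - 1)" T p R by (rule flip_tube)
 fix q x assume "~ cw q" "x : spc L (w (q + 1))" "x ~= 0" "act L (e q) x = 0"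
 thus ?thesis using F.blk_homogeneous[OF L _ _ _ _ p, of "- q - 1" x] by (simp add: add.commute)
qed

lemma difference_of_killed:
 assumes E: "quasi_simple Q E" "E : T" "cw k0" "y0 : spc E (w k0)" "y0 ~= 0" "act E (e k0) y0 = 0"
  and ME: "is_M_E Q E p M C" and p: "p > 1" and N: "is_quotient Q (subrep M (C (p - 1))) (C 1) N"
  and L: "is_rep Q L" "!!v. cv.dim (spc L v) = 1" "!!A. closed_set Q L A \<longleftrightarrow> (ALL a. src Q a : A --> tgt Q a : A)"
 shows "CC Q M = CC Q L + CC Q N"
proof -
 obtain k F1 F2 where *: "end_blocks k F1 F2" "ALL v. cv.dim (spc M v) = 1" "ALL a. vanishing Q M a \<longleftrightarrow> a = e k"
  "ALL v. cv.dim (spc N v) = of_bool (v ~: F1 \<union> F2)"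
  "ALL a. src Q a ~: F1 \<union> F2 --> tgt Q a ~: F1 \<union> F2 --> ~ vanishing Q N a"
  using M_E_structure[OF E ME p N] by blast
 have "is_rep Q M" using ME indecomposable_rep by (auto simp: is_M_E_def)
 moreover have "is_rep Q N" using N by (simp add: is_quotient_def)
 ultimately show ?thesis using * by (intro CC_difference[OF *(1) _ _ _ _ _ _ L]) auto
qed

end

section \<open>From the definitions to the cyclic indexing, and the conclusion\<close>

lemma (in cyclic_quiver) tube_cyclic_tube: "tube Q p T ==> EX R :: int => nat => ('v, 'a) quiver_rep. cyclic_tube Q n w e cw T p R"
proof -
 assume t: "tube Q p T"
 then obtain R :: "int => nat => ('v, 'a) quiver_rep" where
  R: "ALL i j. R i j : T" "ALL M:T. EX i j. rep_iso Q M (R i j)"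
   "ALL i j i' j'. rep_iso Q (R i j) (R i' j') \<longleftrightarrow> i mod int p = i' mod int p & j = j'"
   "ALL i j i' j'. ar_arrow Q (R i j) (R i' j') \<longleftrightarrow>
      i' mod int p = i mod int p & j' = Suc j | i' mod int p = (i + 1) mod int p & j = Suc j'"
   "ALL i j. ar_translate Q (R i j) (R (i - 1) j)"
  unfolding tube_def by (elim conjE exE) (rule that, assumption+)
 have "cyclic_tube Q n w e cw T p R"
 proof unfold_locales
  show "regular_component Q T" "p > 0" using t by (simp_all add: tube_def)
  show "R i j : T" "ar_translate Q (R i j) (R (i - 1) j)" for i j using R(1,5) by simp_all
  show "EX i j. rep_iso Q M (R i j)" if "M : T" for M using R(2) that by simp
  show "rep_iso Q (R i j) (R i' j') \<longleftrightarrow> i mod int p = i' mod int p & j = j'" for i j i' j' by (rule R(3)[rule_format])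
 qed
 thus ?thesis by blast
qed

lemma affine_A_cyclic_quiver:
 fixes Q :: "('v::finite, 'a::finite) quiver"
 assumes "affine_A Q" shows "EX n w e cw. cyclic_quiver Q n w e cw"
proof -
 obtain r s v a where rs: "r > 0" "s > 0" and v: "bij_betw v {..<r + s} (UNIV :: 'v set)" and a: "bij_betw a {..<r + s} (UNIV :: 'a set)"
  and or: "ALL i<r + s. src Q (a i) = v i & tgt Q (a i) = v (Suc i mod (r + s)) | src Q (a i) = v (Suc i mod (r + s)) & tgt Q (a i) = v i"
  and r: "card {i. i < r + s & src Q (a i) = v i & tgt Q (a i) = v (Suc i mod (r + s))} = r"
  and s: "card {i. i < r + s & src Q (a i) = v (Suc i mod (r + s)) & tgt Q (a i) = v i} = s"
  using assms unfolding affine_A_def Let_def by blast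
 define n where "n = r + s"
 note or = or[folded n_def] and v = v[folded n_def] and a = a[folded n_def] and r = r[folded n_def] and s = s[folded n_def]
 have n2: "n >= 2" using rs by (simp add: n_def)
 define ix where "ix q = nat (q mod int n)" for q
 have ix: "ix q < n" "int (ix q) = q mod int n" for q using n2 by (simp_all add: ix_def nat_less_iff)
 have ix_eq: "ix q = ix q' \<longleftrightarrow> q mod int n = q' mod int n" for q q' using ix(2) by (metis of_nat_eq_iff)
 have ix_Suc: "ix (q + 1) = Suc (ix q) mod n" for q
 proof -
  have "int (Suc (ix q) mod n) = (q + 1) mod int n" by (simp add: zmod_int ix(2) mod_simps add.commute)
  thus ?thesis using ix(2)[of "q + 1"] by simp
 qed
 have ix_nat: "i < n ==> ix (int i) = i" for i by (simp add: ix_def)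
 \<comment> \<open>The source alone decides the orientation: the two ends of an edge are distinct
   since \<open>n\<close> is at least 2, see \<open>ends\<close>.\<close>
 define cw where "cw q \<longleftrightarrow> src Q (a (ix q)) = v (ix q)" for q
 have inj: "v i = v j \<longleftrightarrow> i = j" "a i = a j \<longleftrightarrow> i = j" if "i < n" "j < n" for i j
  using v a that by (auto simp: bij_betw_def inj_on_eq_iff)
 have Suc_ne: "Suc i mod n ~= i" if "i < n" for i
  using that n2 by (cases "Suc i = n") auto
 have sm: "Suc i mod n < n" for i using n2 by simp
 have ends: "src Q (a i) = v i ==> tgt Q (a i) = v (Suc i mod n)"
  "src Q (a i) ~= v i ==> src Q (a i) = v (Suc i mod n) & tgt Q (a i) = v i" if i: "i < n" for i
  using or i inj(1)[OF sm i, of i] Suc_ne[OF i] by auto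
 have "cyclic_quiver Q n (%q. v (ix q)) (%q. a (ix q)) cw"
 proof
  show "n >= 2" by (rule n2)
  show "v (ix q) = v (ix q') \<longleftrightarrow> q mod int n = q' mod int n" "a (ix q) = a (ix q') \<longleftrightarrow> q mod int n = q' mod int n" for q q'
   using inj[OF ix(1) ix(1)] ix_eq by simp_all
  show "EX q. u = v (ix q)" for u
  proof -
   have "u : v ` {..<n}" using v by (simp add: bij_betw_def)
   then obtain i where "i < n" "u = v i" by blast
   thus ?thesis using ix_nat by metis
  qed
  show "EX q. b = a (ix q)" for b
  proof -
   have "b : a ` {..<n}" using a by (simp add: bij_betw_def)
   then obtain i where "i < n" "b = a i" by blast
   thus ?thesis using ix_nat by metis
  qed
  show "cw q = cw q'" if "q mod int n = q' mod int n" for q q'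
  proof -
   have "ix q = ix q'" using that ix_eq by blast
   thus ?thesis by (simp add: cw_def)
  qed
  show "src Q (a (ix q)) = (if cw q then v (ix q) else v (ix (q + 1)))" for q using ends[OF ix(1), of q] by (auto simp: cw_def ix_Suc)
  show "tgt Q (a (ix q)) = (if cw q then v (ix (q + 1)) else v (ix q))" for q using ends[OF ix(1), of q] by (auto simp: cw_def ix_Suc)
  have "{i. i < n & src Q (a i) = v i & tgt Q (a i) = v (Suc i mod n)} ~= {}" using r rs(1) by (metis card.empty less_irrefl)
  then obtain i where "i < n" "src Q (a i) = v i" by blast
  thus "EX q. cw q" using ix_nat by (intro exI[of _ "int i"]) (simp add: cw_def)
  have "{i. i < n & src Q (a i) = v (Suc i mod n) & tgt Q (a i) = v i} ~= {}" using s rs(2) by (metis card.empty less_irrefl)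
  then obtain j where j: "j < n" "src Q (a j) = v (Suc j mod n)" by blast
  hence "src Q (a j) ~= v j" using inj(1)[OF sm j(1), of j] Suc_ne[OF j(1)] by simp
  thus "EX q. ~ cw q" using ix_nat[OF j(1)] by (intro exI[of _ "int j"]) (simp add: cw_def)
 qed
 thus ?thesis by blast
qed

theorem theorem3p25:
 fixes Q :: "('v::finite, 'a::finite) quiver"
 assumes "affine_A Q"
 shows "difference_property Q"
proof -
 obtain n w e cw where "cyclic_quiver Q n w e cw" using affine_A_cyclic_quiver[OF assms] by blast
 then interpret cyclic_quiver Q n w e cw .
 show ?thesis
  unfolding difference_property_def
 proof (intro allI impI, elim conjE)
  fix T p E M C N H L
  assume T: "tube Q p T" "1 < p" and E: "E : T" "quasi_simple Q E" and ME: "is_M_E Q E p M C"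
   and N: "is_quotient Q (subrep M (C (p - 1))) (C 1) N" and H: "homogeneous_tube Q H" and L: "L : H" "quasi_simple Q L"
  obtain R :: "int => nat => ('v, 'a) quiver_rep" where R: "cyclic_tube Q n w e cw T p R"
   using tube_cyclic_tube[OF T(1)] by blast
  obtain R' :: "int => nat => ('v, 'a) quiver_rep" where R': "cyclic_tube Q n w e cw H 1 R'"
   using tube_cyclic_tube[of 1 H] H unfolding homogeneous_tube_def by blast
  interpret H: cyclic_tube Q n w e cw H 1 R' by (rule R')
  note Lr = H.T_rep[OF L(1)]
  have Ls: "cv.dim (spc L v) = 1" "closed_set Q L A \<longleftrightarrow> (ALL a. src Q a : A --> tgt Q a : A)" for v A
   using H.homogeneous_structure[OF L(2,1) refl] by blast+
  interpret T: cyclic_tube Q n w e cw T p R by (rule R)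
  show "CC Q M = CC Q L + CC Q N"
  proof (rule T.killed_arrow[OF E(1)])
   assume "allbij E"
   thus ?thesis using T.allbij_rank_one[OF E(1)] T(2) by simp
  next
   fix q x assume "cw q" "x : spc E (w q)" "x ~= 0" "act E (e q) x = 0"
   from T.difference_of_killed[OF E(2,1) this ME T(2) N Lr Ls] show ?thesis .
  next
   \<comment> \<open>The mirror image of the previous case; neither the assumptions on
     \<open>M\<close>, \<open>N\<close>, \<open>L\<close> nor the claim refer to the indexing of the
     cycle.\<close>
   interpret F: cyclic_tube Q n "%q. w (- q)" "%q. e (- q - 1)" "%q. ~ cw (- q - 1)" T p R by (rule T.flip_tube)
   fix q x assume "~ cw q" "x : spc E (w (q + 1))" "x ~= 0" "act E (e q) x = 0"
   thus ?thesis
    using F.difference_of_killed[OF E(2,1) _ _ _ _ ME T(2) N Lr Ls, of "- q - 1" x] by (simp add: add.commute)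
  qed
 qed
qed

end
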